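(* For each $(p,q)\in\mathbb{Z}^2$ such that $q\neq 0$, if $M$ is obtained from $\mathbb{S}^3\setminus 6^2_2$ by $(p,q)$-hyperbolic filling of one cusp then the invariant trace field of $M$ equals its cusp field.
   Context: $6^2_2$ is the link so named in Rolfsen's table: a hyperbolic two-component two-bridge link (type $3/10$) with an involution of $\mathbb{S}^3$ exchanging its components. Give the filled cusp the standard homological framing $\{[\mu],[\lambda]\}$ ($\mu$ the meridian of the link component, $\lambda$ its null-homologous longitude). With $k=\gcd(p,q)$, the $(p,q)$-filling replaces the cusp by a solid torus whose meridian is glued to $\frac{p}{k}[\mu]+\frac{q}{k}[\lambda]$ and whose core is a cone singularity of order $k$ (non-singular if $k=1$); the other cusp stays unfilled. It is a hyperbolic filling if the resulting orbifold is hyperbolic. The invariant trace field of $M=\mathbb{H}^3/\Gamma$ is the field generated over $\mathbb{Q}$ by traces of elements of the subgroup of $\Gamma$ generated by squares. The cusp field of $M$ (which has a single, torus, cusp) is $\mathbb{Q}(\tau)$, where $\tau$ is the cusp parameter: the ratio of the complex translations of two generators of the peripheral $\mathbb{Z}^2$ subgroup, normalized to fix $\infty$. *)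

theory Defs
  imports
    "HOL-Analysis.Analysis"
    "HOL-Homology.Homology"
    "HOL-Algebra.Algebraic_Closure_Type"
    "HOL-Algebra.Generated_Fields"
begin

section \<open>The link in the three-sphere\<close>

text \<open>\<open>\<real>\<^sup>3\<close> is \<^typ>\<open>complex \<times> real\<close>, and the three-sphere is its one-point compactification.\<close>

definition S3 :: "(complex \<times> real) option topology" where
  "S3 = Alexandroff_compactification euclidean"

definition closed_polygon :: "'a::real_vector list \<Rightarrow> 'a set" where
  "closed_polygon vs =
     (\<Union>i<length vs. closed_segment (vs ! i) (vs ! (Suc i mod length vs)))"

text \<open>A link diagram with axis-parallel edges in which vertical edges always pass over
  horizontal ones. The argument lists the successive corners of a component, starting with a
  vertical edge; vertical edges are put at height 1, horizontal edges at height 0, joined at the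
  corners by unit segments.\<close>

fun lift_corners :: "complex list \<Rightarrow> (complex \<times> real) list" where
  "lift_corners (a # b # cs) = (a, 0) # (a, 1) # (b, 1) # (b, 0) # lift_corners cs"
| "lift_corners _ = []"

text \<open>The two components of the link. The diagram, in which \<open>#\<close> marks the first component,
  \<open>o\<close> the second one, and each crossing shows the over-strand:

  \<^verbatim>\<open>
    7      o o o o o o o o o o o o o
           o                       o
    6  # # o # #                   o
       #   o   #                   o
    5  #   o o # o o               o
       #       #   o               o
    4  #       # # o # # # # # #   o
       #           o           #   o
    3  #           o       o o # o o
       #           o       o   #
    2  #           o   # # o # #
       #           o   #   o
    1  #           o o # o o
       #               #
    0  # # # # # # # # #
       0   1   2   3   4   5   6   7
  \<close>

  It is alternating with six crossings, all of them between the two components, so it is reduced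
  and prime. The linking number is 3 up to sign and the determinant is 10; among the prime
  alternating two-component six-crossing links \<open>6\<^sup>2\<^sub>1\<close>, \<open>6\<^sup>2\<^sub>2\<close>, \<open>6\<^sup>2\<^sub>3\<close> the determinants are 6, 10
  and 12. The half turn \<open>(x, y, z) \<mapsto> (7 - y, 7 - x, 1 - z)\<close> exchanges the components.\<close>

definition link_component1 :: "(complex \<times> real) set" where
  "link_component1 = closed_polygon (lift_corners
     [Complex 0 0, Complex 0 6, Complex 2 6, Complex 2 4,
      Complex 6 4, Complex 6 2, Complex 4 2, Complex 4 0])"

definition link_component2 :: "(complex \<times> real) set" where
  "link_component2 = closed_polygon (lift_corners
     [Complex 1 7, Complex 1 5, Complex 3 5, Complex 3 1,
      Complex 5 1, Complex 5 3, Complex 7 3, Complex 7 7])"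

section \<open>Orbifold Dehn filling of one cusp of a two-component link\<close>

abbreviation circle :: "complex set" where
  "circle \<equiv> sphere 0 1"

text \<open>A tubular neighbourhood \<open>e\<close> of \<open>K\<close>, parametrised by \<open>S\<^sup>1 \<times> \<complex>\<close> with \<open>S\<^sup>1 \<times> {0}\<close> mapped onto
  \<open>K\<close>, inducing the homological framing: the meridian is \<open>u \<mapsto> e (1, u)\<close> and the longitude
  \<open>u \<mapsto> e (u, 1)\<close>, which has to bound in the complement of \<open>K\<close>. The orientation of the pair
  (meridian, longitude) is left open; reversing it changes the slope \<open>(p, q)\<close> into \<open>(p, -q)\<close>.\<close>

definition homologically_framed_nbhd ::
    "(complex \<times> real) set \<Rightarrow> (complex \<times> real) set \<Rightarrow>
     (complex \<times> complex \<Rightarrow> (complex \<times> real) option) \<Rightarrow> bool" where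
  "homologically_framed_nbhd K K' e \<longleftrightarrow>
     embedding_map (top_of_set (circle \<times> UNIV)) S3 e \<and>
     openin S3 (e ` (circle \<times> UNIV)) \<and>
     e ` (circle \<times> {0}) = Some ` K \<and>
     e ` (circle \<times> UNIV) \<inter> Some ` K' = {} \<and>
     singular_relboundary 1 (subtopology S3 (- Some ` K)) {}
       (frag_of (restrict (\<lambda>x. e (cis (2 * pi * x 0), 1)) (standard_simplex 1)))"

text \<open>\<open>M\<close> is the union of the open subset \<open>f (S\<^sup>3 - K - K')\<close> and the open solid torus
  \<open>g (\<complex> \<times> S\<^sup>1)\<close>, whose punctured part \<open>(\<complex> - {0}) \<times> S\<^sup>1\<close> is identified with the end
  \<open>e (S\<^sup>1 \<times> (\<complex> - {0}))\<close> of the cusp by the matrix, in the basis (meridian, longitude) and with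
  \<open>k = gcd p q\<close>, whose columns are \<open>(p / k, q / k)\<close> and \<open>(r, s)\<close>. So the
  meridian \<open>u \<mapsto> (u, 1)\<close> of the solid torus represents \<open>p / k\<close> times the meridian plus \<open>q / k\<close> times
  the longitude; the choice of \<open>r\<close> and \<open>s\<close> does not affect the result.\<close>

definition dehn_filling ::
    "(complex \<times> real) set \<Rightarrow> (complex \<times> real) set \<Rightarrow> int \<Rightarrow> int \<Rightarrow>
     'a topology \<Rightarrow> 'a set \<Rightarrow> bool" where
  "dehn_filling K K' p q M core \<longleftrightarrow>
     (\<exists>e f g r s.
        homologically_framed_nbhd K K' e \<and>
        embedding_map (subtopology S3 (- (Some ` K \<union> Some ` K'))) M f \<and>
        openin M (f ` (- (Some ` K \<union> Some ` K'))) \<and>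
        embedding_map (top_of_set (UNIV \<times> circle)) M g \<and>
        openin M (g ` (UNIV \<times> circle)) \<and>
        topspace M = f ` (- (Some ` K \<union> Some ` K')) \<union> g ` (UNIV \<times> circle) \<and>
        core = g ` ({0} \<times> circle) \<and>
        core \<inter> f ` (- (Some ` K \<union> Some ` K')) = {} \<and>
        (p div gcd p q) * s - (q div gcd p q) * r = 1 \<and>
        (\<forall>z v. z \<noteq> 0 \<longrightarrow> v \<in> circle \<longrightarrow>
           g (z, v) =
             f (e (sgn z powi (q div gcd p q) * v powi s,
                   of_real (cmod z) * sgn z powi (p div gcd p q) * v powi r))))"

section \<open>Hyperbolic orbifolds\<close>

definition SL2C :: "(complex^2^2) monoid" where
  "SL2C = \<lparr>carrier = {A. det A = 1}, mult = (**), one = mat 1\<rparr>"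

definition H3 :: "(complex \<times> real) set" where
  "H3 = {x. snd x > 0}"

text \<open>The Poincare extension of a Moebius transformation to upper half-space.\<close>

definition act :: "complex^2^2 \<Rightarrow> complex \<times> real \<Rightarrow> complex \<times> real" where
  "act A x =
     (let a = A$1$1; b = A$1$2; c = A$2$1; d = A$2$2; z = fst x; t = snd x;
          n = (cmod (c * z + d))\<^sup>2 + (cmod c)\<^sup>2 * t\<^sup>2
      in (((a * z + b) * cnj (c * z + d) + a * cnj c * of_real (t\<^sup>2)) / of_real n, t / n))"

definition orbit :: "(complex^2^2) set \<Rightarrow> complex \<times> real \<Rightarrow> (complex \<times> real) set" where
  "orbit \<Gamma> x = (\<lambda>A. act A x) ` \<Gamma>"

definition orbit_space :: "(complex^2^2) set \<Rightarrow> (complex \<times> real) set topology" where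
  "orbit_space \<Gamma> =
     topology (\<lambda>U. U \<subseteq> orbit \<Gamma> ` H3 \<and> openin (top_of_set H3) {x \<in> H3. orbit \<Gamma> x \<in> U})"

lemma openin_orbit_space:
  "openin (orbit_space \<Gamma>) U \<longleftrightarrow>
     U \<subseteq> orbit \<Gamma> ` H3 \<and> openin (top_of_set H3) {x \<in> H3. orbit \<Gamma> x \<in> U}"
proof -
  have "istopology
     (\<lambda>U. U \<subseteq> orbit \<Gamma> ` H3 \<and> openin (top_of_set H3) {x \<in> H3. orbit \<Gamma> x \<in> U})"
    unfolding istopology_def
  proof (intro conjI allI impI; (elim conjE)?)
    fix S T
    assume "S \<subseteq> orbit \<Gamma> ` H3" "openin (top_of_set H3) {x \<in> H3. orbit \<Gamma> x \<in> S}"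
      "openin (top_of_set H3) {x \<in> H3. orbit \<Gamma> x \<in> T}"
    moreover have "{x \<in> H3. orbit \<Gamma> x \<in> S \<inter> T} =
        {x \<in> H3. orbit \<Gamma> x \<in> S} \<inter> {x \<in> H3. orbit \<Gamma> x \<in> T}"
      by blast
    ultimately show "S \<inter> T \<subseteq> orbit \<Gamma> ` H3"
      "openin (top_of_set H3) {x \<in> H3. orbit \<Gamma> x \<in> S \<inter> T}"
      by (auto simp del: Int_Collect)
  next
    fix \<K> :: "(complex \<times> real) set set set"
    assume *: "\<forall>K\<in>\<K>. K \<subseteq> orbit \<Gamma> ` H3 \<and>
      openin (top_of_set H3) {x \<in> H3. orbit \<Gamma> x \<in> K}"
    then show "\<Union>\<K> \<subseteq> orbit \<Gamma> ` H3"
      by blast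
    have "{x \<in> H3. orbit \<Gamma> x \<in> \<Union>\<K>} = (\<Union>K\<in>\<K>. {x \<in> H3. orbit \<Gamma> x \<in> K})"
      by blast
    then show "openin (top_of_set H3) {x \<in> H3. orbit \<Gamma> x \<in> \<Union>\<K>}"
      using * by auto
  qed
  then show ?thesis
    by (simp add: orbit_space_def)
qed

lemma topspace_orbit_space: "topspace (orbit_space \<Gamma>) = orbit \<Gamma> ` H3"
proof -
  have "{x \<in> H3. orbit \<Gamma> x \<in> orbit \<Gamma> ` H3} = H3"
    by blast
  then have "openin (orbit_space \<Gamma>) (orbit \<Gamma> ` H3)"
    by (simp add: openin_orbit_space)
  then show ?thesis
    unfolding topspace_def using openin_orbit_space by blast
qed

text \<open>A subgroup of \<open>PSL\<^sub>2(\<complex>)\<close> is represented by its full preimage in \<open>SL\<^sub>2(\<complex>)\<close>, which contains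
  \<open>-1\<close>.\<close>

definition finite_covolume :: "(complex^2^2) set \<Rightarrow> bool" where
  "finite_covolume \<Gamma> \<longleftrightarrow>
     (\<exists>F \<in> sets borel. F \<subseteq> H3 \<and> H3 \<subseteq> (\<Union>A\<in>\<Gamma>. act A ` F) \<and>
        (\<integral>\<^sup>+x\<in>F. ennreal (1 / snd x ^ 3) \<partial>lborel) < \<infinity>)"

definition hyperbolic_orbifold_group :: "(complex^2^2) set \<Rightarrow> bool" where
  "hyperbolic_orbifold_group \<Gamma> \<longleftrightarrow>
     subgroup \<Gamma> SL2C \<and> - mat 1 \<in> \<Gamma> \<and> discrete \<Gamma> \<and> finite_covolume \<Gamma>"

definition isotropy :: "(complex^2^2) set \<Rightarrow> complex \<times> real \<Rightarrow> (complex^2^2) set" where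
  "isotropy \<Gamma> x = {A \<in> \<Gamma>. act A x = x}"

text \<open>The preimage in \<open>SL\<^sub>2(\<complex>)\<close> of a finite cyclic subgroup of \<open>PSL\<^sub>2(\<complex>)\<close> of order \<open>k\<close> is cyclic
  of order \<open>2 k\<close>.\<close>

definition cyclic_isotropy :: "(complex^2^2) set \<Rightarrow> complex \<times> real \<Rightarrow> nat \<Rightarrow> bool" where
  "cyclic_isotropy \<Gamma> x k \<longleftrightarrow>
     (\<exists>A\<in>\<Gamma>. isotropy \<Gamma> x = generate SL2C {A}) \<and> card (isotropy \<Gamma> x) = 2 * k"

text \<open>\<open>\<H>\<^sup>3 / \<Gamma>\<close> is, as an orbifold, the \<open>(p, q)\<close>-filling of the cusp \<open>K\<close> of \<open>S\<^sup>3 - (K \<union> K')\<close>: the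
  underlying space is the Dehn filling, and the singular locus is the core, with cone order
  \<open>gcd p q\<close> (no singular locus if this is 1).\<close>

definition hyperbolic_filling ::
    "(complex \<times> real) set \<Rightarrow> (complex \<times> real) set \<Rightarrow> int \<Rightarrow> int \<Rightarrow>
     (complex^2^2) set \<Rightarrow> bool" where
  "hyperbolic_filling K K' p q \<Gamma> \<longleftrightarrow>
     hyperbolic_orbifold_group \<Gamma> \<and>
     (\<exists>core. dehn_filling K K' p q (orbit_space \<Gamma>) core \<and>
        (\<forall>x\<in>H3. cyclic_isotropy \<Gamma> x (if orbit \<Gamma> x \<in> core then nat (gcd p q) else 1)))"

section \<open>Invariant trace field and cusp field\<close>

abbreviation generated_subfield :: "complex set \<Rightarrow> complex set" where
  "generated_subfield S \<equiv> generate_field ring_of_type_algebra S"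

definition invariant_trace_field :: "(complex^2^2) set \<Rightarrow> complex set" where
  "invariant_trace_field \<Gamma> =
     generated_subfield (trace ` generate SL2C {A ** A | A. A \<in> \<Gamma>})"

definition translation :: "complex \<Rightarrow> complex^2^2" where
  "translation w = vector [vector [1, w], vector [0, 1]]"

text \<open>After conjugating a parabolic fixed point of \<open>\<Gamma>\<close> to \<open>\<infinity>\<close>, the stabiliser of \<open>\<infinity>\<close> is a lattice
  of translations (up to sign, as matrices), and \<open>\<tau>\<close> is the ratio of two generators.\<close>

definition cusp_parameter :: "(complex^2^2) set \<Rightarrow> complex \<Rightarrow> bool" where
  "cusp_parameter \<Gamma> \<tau> \<longleftrightarrow>
     (\<exists>C \<in> carrier SL2C. \<exists>w1 w2.
        w1 \<noteq> 0 \<and> Im (w2 / w1) \<noteq> 0 \<and>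
        {B. (\<exists>A\<in>\<Gamma>. B = C ** A ** matrix_inv C) \<and> B$2$1 = 0} =
          (\<Union>m n :: int. {translation (of_int m * w1 + of_int n * w2),
                          - translation (of_int m * w1 + of_int n * w2)}) \<and>
        \<tau> = w2 / w1)"

definition cusp_field :: "complex \<Rightarrow> complex set" where
  "cusp_field \<tau> = generated_subfield {\<tau>}"

end

theory Submission
  imports Defs
begin

text \<open>Upper half-space without the preimage of the core covers the link complement, so the Dehn
  presentation of the diagram gives two meridians \<open>u\<close> and \<open>v\<close> generating the group and satisfying
  the two-bridge relation. The unfilled end lifts to a horoball, so \<open>v\<close> and its longitude \<open>l\<close> are
  translations at \<open>\<infinity>\<close>; the filled end gives \<open>u\<^sup>p l'\<^sup>q = \<plusminus>1\<close> up to the cone order, \<open>l'\<close> being the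
  longitude of \<open>u\<close>. After normalisation the cusp field lies in the trace field, and the traces are
  polynomials in a root of a quadratic over the cusp field. If that root were not in the cusp field,
  its conjugate would give a second solution of the filling equation, which an estimate of the
  eigenvalues rules out for \<open>q \<noteq> 0\<close>.\<close>

text \<open>The conjugation over the cusp field is an algebraic map, not a continuous one: it yields
  no second orbifold, only a second matrix solution of the same relation. With \<beta> = q + e one
  has q^2 = (\<beta> + 2) q - \<beta>, so it fixes \<beta> and replaces the meridian trace x = 1 + e
  - q by -2 - x. The two solutions become comparable through absolute values: P log|m| + Q log|L| =
  0 with Q \<noteq> 0 fixes the ratio of the logarithms, so the products log|m| log|L| of the two
  cannot have opposite signs. But reflecting -2 - x back into the upper half-plane flips the branch
  of \<beta>, and that sign with it. Real x is a degenerate case of its own. On the geometric side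
  the filling is only a gluing of spaces, with no fundamental group at hand. Its role is played by
  transition elements between sections of the covering over the parts of space above and below the
  diagram. The framing is given through a longitude that bounds, so matching it with a word read off
  the diagram takes a winding number around the filled component.\<close>

no_notation fps_nth (infixl \<open>$\<close> 75)

type_synonym point = "complex \<times> real"

section \<open>Algebra: SL2 up to sign and subfields of the complex numbers\<close>

section \<open>Two by two matrices\<close>

definition mat2 :: "complex \<Rightarrow> complex \<Rightarrow> complex \<Rightarrow> complex \<Rightarrow> complex^2^2" where
  "mat2 a b c d = vector [vector [a, b], vector [c, d]]"

lemma mat2_nth [simp]:
  "mat2 a b c d $ 1 $ 1 = a" "mat2 a b c d $ 1 $ 2 = b"
  "mat2 a b c d $ 2 $ 1 = c" "mat2 a b c d $ 2 $ 2 = d"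
  by (simp_all add: mat2_def)

lemma mat_eq_iff:
  "A = B \<longleftrightarrow> A$1$1 = B$1$1 \<and> A$1$2 = B$1$2 \<and> A$2$1 = B$2$1 \<and> A$2$2 = B$2$2"
  for A B :: "complex^2^2"
  by (simp add: vec_eq_iff forall_2)

lemma matrix_mult_nth: "(A ** B) $ i $ j = A$i$1 * B$1$j + A$i$2 * B$2$j"
  for A B :: "complex^2^2"
  by (simp add: matrix_matrix_mult_def sum_2)

lemma mat1_nth [simp]:
  "(mat 1 :: complex^2^2) $ 1 $ 1 = 1" "(mat 1 :: complex^2^2) $ 1 $ 2 = 0"
  "(mat 1 :: complex^2^2) $ 2 $ 1 = 0" "(mat 1 :: complex^2^2) $ 2 $ 2 = 1"
  by (simp_all add: mat_def)

lemma translation_nth [simp]: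
  "translation w $ 1 $ 1 = 1" "translation w $ 1 $ 2 = w"
  "translation w $ 2 $ 1 = 0" "translation w $ 2 $ 2 = 1"
  by (simp_all add: translation_def)

lemma trace2: "trace A = A$1$1 + A$2$2" for A :: "complex^2^2"
  by (simp add: trace_def sum_2)

text \<open>The adjugate. On determinant 1 it is the inverse, and its entries are linear in those of
  the matrix, so identities about inverses stay polynomial and laws such as \<open>minv_mult\<close>
  hold for all matrices.\<close>

definition minv :: "complex^2^2 \<Rightarrow> complex^2^2" where
  "minv A = mat2 (A$2$2) (- A$1$2) (- A$2$1) (A$1$1)"

lemma minv_nth [simp]:
  "minv A $ 1 $ 1 = A$2$2" "minv A $ 1 $ 2 = - A$1$2"
  "minv A $ 2 $ 1 = - A$2$1" "minv A $ 2 $ 2 = A$1$1"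
  by (simp_all add: minv_def)

lemma minv_mult: "minv (A ** B) = minv B ** minv A"
  by (simp add: mat_eq_iff matrix_mult_nth algebra_simps)

lemma minv_minv [simp]: "minv (minv A) = A"
  by (simp add: mat_eq_iff)

lemma minv_mat1 [simp]: "minv (mat 1) = mat 1"
  by (simp add: mat_eq_iff)

lemma minv_uminus: "minv (- A) = - minv A"
  by (simp add: mat_eq_iff)

lemma det_minv [simp]: "det (minv A) = det A"
  by (simp add: det_2 algebra_simps)

lemma minv_left: "det A = 1 \<Longrightarrow> minv A ** A = mat 1"
  by (auto simp: mat_eq_iff matrix_mult_nth det_2 algebra_simps)

lemma minv_right: "det A = 1 \<Longrightarrow> A ** minv A = mat 1"
  by (auto simp: mat_eq_iff matrix_mult_nth det_2 algebra_simps)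

lemma minv_cancel:
  assumes "det A = 1"
  shows "minv A ** (A ** B) = B" "A ** (minv A ** B) = B"
  using assms by (simp_all add: matrix_mul_assoc minv_left minv_right)

lemma matrix_inv_minv:
  assumes "det A = 1"
  shows "matrix_inv A = minv A"
proof -
  have "A ** matrix_inv A = mat 1 \<and> matrix_inv A ** A = mat 1"
    unfolding matrix_inv_def
    by (rule someI[of _ "minv A"]) (simp add: minv_left minv_right assms)
  then show ?thesis
    by (metis assms matrix_mul_assoc matrix_mul_lid matrix_mul_rid minv_left)
qed

lemma det_uminus2 [simp]: "det (- A) = det A" for A :: "complex^2^2"
  by (simp add: det_2)

lemma det_translation [simp]: "det (translation w) = 1"
  by (simp add: det_2)

lemma translation_mult: "translation a ** translation b = translation (a + b)"
  by (simp add: mat_eq_iff matrix_mult_nth)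

lemma matrix_mult_uminus: "(- A) ** B = - (A ** B)" "A ** (- B) = - (A ** B)"
  for A B :: "complex^2^2"
  by (simp_all add: mat_eq_iff matrix_mult_nth)

text \<open>Elements of \<open>PSL\<^sub>2(\<complex>)\<close> are matrices up to sign.\<close>

definition peq :: "complex^2^2 \<Rightarrow> complex^2^2 \<Rightarrow> bool"  (infix \<open>\<doteq>\<close> 50) where
  "A \<doteq> B \<longleftrightarrow> A = B \<or> A = - B"

lemma peq_refl [simp]: "A \<doteq> A"
  and peq_sym: "A \<doteq> B \<Longrightarrow> B \<doteq> A"
  and peq_trans [trans]: "A \<doteq> B \<Longrightarrow> B \<doteq> C \<Longrightarrow> A \<doteq> C"
  and peq_minv: "A \<doteq> B \<Longrightarrow> minv A \<doteq> minv B"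
  and peq_uminus_left: "- A \<doteq> B \<longleftrightarrow> A \<doteq> B"
  and peq_uminus_right: "A \<doteq> - B \<longleftrightarrow> A \<doteq> B"
  by (auto simp: peq_def minv_uminus)

lemma peq_eq_trans [trans]: "A \<doteq> B \<Longrightarrow> B = C \<Longrightarrow> A \<doteq> C" "A = B \<Longrightarrow> B \<doteq> C \<Longrightarrow> A \<doteq> C"
  by auto

lemma peq_mult: "A \<doteq> B \<Longrightarrow> C \<doteq> D \<Longrightarrow> A ** C \<doteq> B ** D"
  by (auto simp: peq_def matrix_mult_uminus)

primrec mpow_nat :: "complex^2^2 \<Rightarrow> nat \<Rightarrow> complex^2^2" where
  "mpow_nat A 0 = mat 1"
| "mpow_nat A (Suc n) = A ** mpow_nat A n"

definition mpow :: "complex^2^2 \<Rightarrow> int \<Rightarrow> complex^2^2" where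
  "mpow A k = (if k \<ge> 0 then mpow_nat A (nat k) else mpow_nat (minv A) (nat (- k)))"

lemma group_SL2C: "group SL2C"
proof (rule groupI)
  fix A assume "A \<in> carrier SL2C"
  then show "\<exists>y\<in>carrier SL2C. y \<otimes>\<^bsub>SL2C\<^esub> A = \<one>\<^bsub>SL2C\<^esub>"
    by (intro bexI[of _ "minv A"]) (auto simp: SL2C_def minv_left)
qed (auto simp: SL2C_def det_mul matrix_mul_assoc)

lemma carrier_SL2C [simp]: "A \<in> carrier SL2C \<longleftrightarrow> det A = 1"
  and mult_SL2C [simp]: "A \<otimes>\<^bsub>SL2C\<^esub> B = A ** B"
  and one_SL2C [simp]: "\<one>\<^bsub>SL2C\<^esub> = mat 1"
  by (simp_all add: SL2C_def)

lemma inv_SL2C: "det A = 1 \<Longrightarrow> inv\<^bsub>SL2C\<^esub> A = minv A"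
  by (rule group.inv_equality[OF group_SL2C]) (simp_all add: minv_left)

lemma subgroup_SL2C_D:
  assumes "subgroup \<Gamma> SL2C"
  shows "A \<in> \<Gamma> \<Longrightarrow> det A = 1" "mat 1 \<in> \<Gamma>" "A \<in> \<Gamma> \<Longrightarrow> B \<in> \<Gamma> \<Longrightarrow> A ** B \<in> \<Gamma>"
    "A \<in> \<Gamma> \<Longrightarrow> minv A \<in> \<Gamma>"
  using subgroup.mem_carrier[OF assms, of A] subgroup.one_closed[OF assms]
    subgroup.m_closed[OF assms, of A B] subgroup.m_inv_closed[OF assms, of A]
    inv_SL2C[of A] by auto

section \<open>Subfields of the complex numbers\<close>

lemma ring_of_type_algebra_simps:
  "\<one>\<^bsub>(ring_of_type_algebra :: complex ring)\<^esub> = 1" "\<zero>\<^bsub>(ring_of_type_algebra :: complex ring)\<^esub> = 0"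
  "(x :: complex) \<oplus>\<^bsub>ring_of_type_algebra\<^esub> y = x + y" "(x :: complex) \<otimes>\<^bsub>ring_of_type_algebra\<^esub> y = x * y"
  "carrier (ring_of_type_algebra :: complex ring) = UNIV"
  by (simp_all add: ring_of_type_algebra_def)

lemma a_inv_ring_of_type_algebra: "\<ominus>\<^bsub>ring_of_type_algebra\<^esub> (x :: complex) = - x"
proof -
  interpret ring "ring_of_type_algebra :: complex ring"
    by (rule ring_from_type_algebra)
  show ?thesis
    by (rule minus_equality) (simp_all add: ring_of_type_algebra_simps)
qed

lemma m_inv_ring_of_type_algebra:
  assumes "x \<noteq> 0"
  shows "inv\<^bsub>ring_of_type_algebra\<^esub> (x :: complex) = inverse x"
proof -
  interpret field "ring_of_type_algebra :: complex ring"
    by (rule field_from_type_algebra)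
  show ?thesis
    using comm_inv_char[of x "inverse x"] assms by (simp add: ring_of_type_algebra_simps)
qed

text \<open>Stated with the operations of the type class instead of a ring record. As
  \<open>inverse 0 = 0\<close>, closure under \<open>inverse\<close> can be asked of every
  element.\<close>

definition is_subfield :: "complex set \<Rightarrow> bool" where
  "is_subfield K \<longleftrightarrow> 1 \<in> K \<and> (\<forall>x\<in>K. \<forall>y\<in>K. x + y \<in> K \<and> x * y \<in> K) \<and>
     (\<forall>x\<in>K. - x \<in> K \<and> inverse x \<in> K)"

lemma is_subfield_closed:
  assumes "is_subfield K"
  shows "0 \<in> K" "1 \<in> K" "x \<in> K \<Longrightarrow> y \<in> K \<Longrightarrow> x + y \<in> K" "x \<in> K \<Longrightarrow> y \<in> K \<Longrightarrow> x * y \<in> K"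
    "x \<in> K \<Longrightarrow> - x \<in> K" "x \<in> K \<Longrightarrow> y \<in> K \<Longrightarrow> x - y \<in> K" "x \<in> K \<Longrightarrow> inverse x \<in> K"
    "x \<in> K \<Longrightarrow> y \<in> K \<Longrightarrow> x / y \<in> K" "x \<in> K \<Longrightarrow> x ^ n \<in> K" "of_nat n \<in> K" "of_int m \<in> K"
    "numeral b \<in> K"
proof -
  show 1: "1 \<in> K" and add: "\<And>x y. x \<in> K \<Longrightarrow> y \<in> K \<Longrightarrow> x + y \<in> K"
    and mult: "\<And>x y. x \<in> K \<Longrightarrow> y \<in> K \<Longrightarrow> x * y \<in> K"
    and minus: "\<And>x. x \<in> K \<Longrightarrow> - x \<in> K" and inv: "\<And>x. x \<in> K \<Longrightarrow> inverse x \<in> K"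
    using assms by (auto simp: is_subfield_def)
  show 0: "0 \<in> K"
    using add[OF 1 minus[OF 1]] by simp
  show "x \<in> K \<Longrightarrow> y \<in> K \<Longrightarrow> x - y \<in> K"
    using add[of x "- y"] minus by simp
  show "x \<in> K \<Longrightarrow> y \<in> K \<Longrightarrow> x / y \<in> K"
    using mult[of x "inverse y"] inv by (simp add: field_simps)
  show "x \<in> K \<Longrightarrow> x ^ n \<in> K"
    by (induction n) (auto intro: 1 mult)
  have nat: "of_nat n \<in> K" for n
    by (induction n) (auto intro: 0 1 add)
  then show "of_nat n \<in> K" .
  show "of_int m \<in> K"
    using nat minus by (cases m rule: int_cases2) auto
  show "numeral b \<in> K"
    using nat[of "numeral b"] by simp
qed

lemma is_subfield_generated: "is_subfield (generated_subfield S)"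
proof -
  let ?K = "generated_subfield S"
  note gf = generate_field.intros[where R = "ring_of_type_algebra :: complex ring",
      unfolded ring_of_type_algebra_simps a_inv_ring_of_type_algebra]
  have "x \<in> ?K \<Longrightarrow> inverse x \<in> ?K" for x
    using gf(4)[of x S] m_inv_ring_of_type_algebra[of x] by (cases "x = 0") auto
  then show ?thesis
    using gf by (auto simp: is_subfield_def)
qed

lemma generated_subfield_incl: "S \<subseteq> generated_subfield S"
  by (auto intro: generate_field.incl)

lemma generated_subfield_minimal:
  assumes "S \<subseteq> K" "is_subfield K"
  shows "generated_subfield S \<subseteq> K"
proof
  fix x assume "x \<in> generated_subfield S"
  then show "x \<in> K"
    by (induction rule: generate_field.induct)
       (use assms is_subfield_closed[OF assms(2)] in \<open>auto simp: ring_of_type_algebra_simps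
          a_inv_ring_of_type_algebra m_inv_ring_of_type_algebra\<close>)
qed

section \<open>Absolute values of the peripheral eigenvalues and the sign of their
  logarithms\<close>

section \<open>The filling equation\<close>

text \<open>\<open>m\<close> and \<open>L\<close> are the eigenvalues of the meridian and the longitude of the filled component,
  \<open>x\<close> is the trace of the meridian and \<open>\<beta>\<close> the cusp parameter of the other component.\<close>

definition cusp_eigenvalues :: "complex \<Rightarrow> complex \<Rightarrow> complex \<Rightarrow> complex \<Rightarrow> bool" where
  "cusp_eigenvalues x \<beta> m L \<longleftrightarrow> m \<noteq> 0 \<and> L \<noteq> 0 \<and> m + 1 / m = x \<and> L + 1 / L = 4 - x - x\<^sup>2 \<and>
     L - 1 / L = - \<beta> * (m - 1 / m) \<and> \<beta>\<^sup>2 = (x + 1)\<^sup>2 - 4"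

text \<open>Polarisation |z|^2 - |w|^2 = Re ((z - w) conj (z + w)) at w = 1/z. It expresses the sign
  of log|z| through z + 1/z and z - 1/z, the quantities that the filling controls.\<close>

lemma norm_real_sum_inverse:
  "(cmod z)\<^sup>2 - 1 / (cmod z)\<^sup>2 = Re ((z - 1 / z) * cnj (z + 1 / z))"
proof -
  have "(cmod z)\<^sup>2 - (cmod w)\<^sup>2 = Re ((z - w) * cnj (z + w))" for w
    unfolding cmod_power2 by (simp add: power2_eq_square algebra_simps)
  from this[of "1 / z"] show ?thesis
    by (simp add: norm_divide power_divide del: complex_cnj_divide)
qed

lemma unit_norm_sum_inverse:
  assumes "cmod z = 1"
  shows "Im (z + 1 / z) = 0" "\<bar>Re (z + 1 / z)\<bar> \<le> 2"
proof -
  have "1 / z = cnj z"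
    using assms complex_norm_square[of z] by (auto simp: divide_eq_eq mult.commute)
  then show "Im (z + 1 / z) = 0" "\<bar>Re (z + 1 / z)\<bar> \<le> 2"
    using abs_Re_le_cmod[of z] assms by auto
qed

text \<open>Off the unit circle a real z + 1/z forces z to be real, and then (z + 1/z)^2 - 4 = (z -
  1/z)^2 \<ge> 0.\<close>

lemma real_sum_inverse_unit_norm:
  assumes "z \<noteq> 0" "Im (z + 1 / z) = 0" "\<bar>Re (z + 1 / z)\<bar> < 2"
  shows "cmod z = 1"
proof (rule ccontr)
  assume n: "cmod z \<noteq> 1"
  define a b where "a = Re z" "b = Im z"
  have N: "(cmod z)\<^sup>2 = a\<^sup>2 + b\<^sup>2" "a\<^sup>2 + b\<^sup>2 > 0" "a\<^sup>2 + b\<^sup>2 \<noteq> 1"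
    using assms(1) n by (auto simp: a_b_def cmod_power2 complex_eq_iff sum_power2_gt_zero_iff cmod_def)
  have z1: "Re (1 / z) = a / (a\<^sup>2 + b\<^sup>2)" "Im (1 / z) = - b / (a\<^sup>2 + b\<^sup>2)"
    by (simp_all add: a_b_def Re_divide Im_divide)
  have "b - b / (a\<^sup>2 + b\<^sup>2) = 0"
    using assms(2) z1 by (simp add: a_b_def)
  then have "b * (a\<^sup>2 + b\<^sup>2) = b"
    using N(2) by (metis (no_types) eq_iff_diff_eq_0 less_irrefl nonzero_eq_divide_eq)
  then have "b * (a\<^sup>2 + b\<^sup>2 - 1) = 0"
    by (simp add: algebra_simps)
  then have b: "b = 0"
    using N(3) by simp
  then have a: "a \<noteq> 0"
    using N(2) by auto
  have "\<bar>a + 1 / a\<bar> < 2"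
    using assms(3) z1(1) b a by (simp add: a_b_def power2_eq_square)
  then have "(a + 1 / a)\<^sup>2 < 2\<^sup>2"
    using abs_square_less_1[of "(a + 1/a)/2"] by (simp add: power_divide)
  moreover have "(a + 1 / a)\<^sup>2 - 4 = (a - 1 / a)\<^sup>2"
    using a by (simp add: power2_sum power2_diff)
  ultimately show False
    using zero_le_power2[of "a - 1 / a"] by simp
qed

lemma sgn_norm_inverse:
  assumes "z \<noteq> 0"
  shows "sgn ((cmod z)\<^sup>2 - 1 / (cmod z)\<^sup>2) = sgn (ln (cmod z))"
proof -
  have a: "cmod z > 0" using assms by simp
  consider "cmod z < 1" | "cmod z = 1" | "cmod z > 1" by linarith
  then show ?thesis
  proof cases
    case 1
    then have "(cmod z)\<^sup>2 < 1" using a by (simp add: power_less_one_iff)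
    moreover have "1 < 1 / (cmod z)\<^sup>2" using a calculation by (simp add: field_simps)
    ultimately have "(cmod z)\<^sup>2 - 1 / (cmod z)\<^sup>2 < 0" by linarith
    then show ?thesis using 1 a by simp
  next
    case 2 then show ?thesis by simp
  next
    case 3
    then have "(cmod z)\<^sup>2 > 1" using a by (simp add: one_less_power)
    moreover have "1 > 1 / (cmod z)\<^sup>2" using a calculation by (simp add: field_simps)
    ultimately have "(cmod z)\<^sup>2 - 1 / (cmod z)\<^sup>2 > 0" by linarith
    then show ?thesis using 3 a by simp
  qed
qed

text \<open>Minus twice the product of |L|^2 - |L|^-2 and |m|^2 - |m|^-2. That product involves the
  root s = m - 1/m of x^2 - 4 only as s^2 and |s|^2, so it is a function of x and \<beta>. The sign
  of \<open>QQ\<close> is opposite to that of log|m| log|L|.\<close>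

definition QQ :: "complex \<Rightarrow> complex \<Rightarrow> real" where
  "QQ x \<beta> = Re (\<beta> * (x\<^sup>2 - 4) * cnj (4 - x - x\<^sup>2) * cnj x) +
     cmod (x\<^sup>2 - 4) * Re (\<beta> * cnj (4 - x - x\<^sup>2) * x)"

lemma cusp_eigenvalues_product:
  assumes "cusp_eigenvalues x \<beta> m L"
  shows "((cmod L)\<^sup>2 - 1 / (cmod L)\<^sup>2) * ((cmod m)\<^sup>2 - 1 / (cmod m)\<^sup>2) = - QQ x \<beta> / 2"
proof -
  define s where "s = m - 1 / m"
  have m: "m \<noteq> 0" "L \<noteq> 0" and x: "m + 1 / m = x" and Z: "L + 1 / L = 4 - x - x\<^sup>2"
    and S: "L - 1 / L = - \<beta> * s"
    using assms by (auto simp: cusp_eigenvalues_def s_def)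
  have s2: "s\<^sup>2 = x\<^sup>2 - 4"
    using m by (simp add: s_def x[symmetric] power2_sum power2_diff)
  have ss: "s * cnj s = of_real (cmod (x\<^sup>2 - 4))"
    unfolding s2[symmetric] norm_power complex_norm_square[symmetric] ..
  have RR: "Re A * Re B = (Re (A * B) + Re (A * cnj B)) / 2" for A B
    by simp
  define Z' where "Z' = cnj (4 - x - x\<^sup>2)"
  have "((cmod L)\<^sup>2 - 1 / (cmod L)\<^sup>2) * ((cmod m)\<^sup>2 - 1 / (cmod m)\<^sup>2) =
      Re (- \<beta> * s * Z') * Re (s * cnj x)"
    unfolding norm_real_sum_inverse x Z S Z'_def
    by (simp add: s_def)
  also have "\<dots> = - (Re (\<beta> * s\<^sup>2 * Z' * cnj x) + Re (\<beta> * Z' * x * (s * cnj s))) / 2"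
    unfolding RR by (simp add: power2_eq_square algebra_simps)
  also have "\<dots> = - QQ x \<beta> / 2"
    unfolding QQ_def s2 ss Z'_def by (simp add: algebra_simps)
  finally show ?thesis .
qed

text \<open>Solve the two quadratic equations for m and L. The candidates for L and 1/L multiply to
  1 because (4 - x - x^2)^2 - ((x + 1)^2 - 4) (x^2 - 4) = 4.\<close>

lemma cusp_eigenvalues_exist:
  assumes "\<beta>\<^sup>2 = (x + 1)\<^sup>2 - 4"
  shows "\<exists>m L. cusp_eigenvalues x \<beta> m L"
proof -
  define s where "s = csqrt (x\<^sup>2 - 4)"
  have s: "s\<^sup>2 = x\<^sup>2 - 4"
    by (simp add: s_def)
  define m L where "m = (x + s) / 2" "L = (4 - x - x\<^sup>2 - \<beta> * s) / 2"
  have 1: "(x + s) * (x - s) = 4"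
    using s by (simp add: power2_eq_square algebra_simps)
  have "(4 - x - x\<^sup>2 - \<beta> * s) * (4 - x - x\<^sup>2 + \<beta> * s) = (4 - x - x\<^sup>2)\<^sup>2 - \<beta>\<^sup>2 * s\<^sup>2"
    by (simp add: power2_eq_square algebra_simps)
  also have "\<dots> = 4"
    unfolding s assms by (simp add: power2_eq_square algebra_simps)
  finally have 2: "(4 - x - x\<^sup>2 - \<beta> * s) * (4 - x - x\<^sup>2 + \<beta> * s) = 4" .
  have m: "m \<noteq> 0" "1 / m = (x - s) / 2"
  proof -
    show "m \<noteq> 0" using 1 by (auto simp: m_L_def)
    then show "1 / m = (x - s) / 2"
      using 1 by (simp add: m_L_def divide_eq_eq mult.commute)
  qed
  have L: "L \<noteq> 0" "1 / L = (4 - x - x\<^sup>2 + \<beta> * s) / 2"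
  proof -
    show "L \<noteq> 0" using 2 by (auto simp: m_L_def)
    then show "1 / L = (4 - x - x\<^sup>2 + \<beta> * s) / 2"
      using 2 by (simp add: m_L_def divide_eq_eq mult.commute)
  qed
  have "cusp_eigenvalues x \<beta> m L"
    unfolding cusp_eigenvalues_def m(2) L(2) using m(1) L(1) assms
    by (simp add: m_L_def field_simps)
  then show ?thesis by blast
qed

text \<open>A zero puts m or L on the unit circle. If |m| = 1 then x = m + 1/m is real. If |L| = 1
  then 4 - x - x^2 is real and at most 2 in absolute value; for non-real x this forces Re x = -1/2,
  where its value exceeds 17/4.\<close>

lemma QQ_nonzero:
  assumes "\<beta>\<^sup>2 = (x + 1)\<^sup>2 - 4" "Im x \<noteq> 0"
  shows "QQ x \<beta> \<noteq> 0"
proof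
  assume Q: "QQ x \<beta> = 0"
  obtain m L where mL: "cusp_eigenvalues x \<beta> m L"
    using cusp_eigenvalues_exist[OF assms(1)] by blast
  from cusp_eigenvalues_product[OF mL] Q
  have "(cmod L)\<^sup>2 - 1 / (cmod L)\<^sup>2 = 0 \<or> (cmod m)\<^sup>2 - 1 / (cmod m)\<^sup>2 = 0"
    by simp
  then have "sgn (ln (cmod L)) = 0 \<or> sgn (ln (cmod m)) = 0"
    using mL sgn_norm_inverse[of L] sgn_norm_inverse[of m] by (auto simp: cusp_eigenvalues_def)
  then have "cmod L = 1 \<or> cmod m = 1"
    using mL by (auto simp: cusp_eigenvalues_def sgn_eq_0_iff)
  then show False
  proof
    assume 1: "cmod m = 1"
    have "m + 1 / m = x"
      using mL by (simp only: cusp_eigenvalues_def)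
    from unit_norm_sum_inverse(1)[OF 1, unfolded this] show False
      using assms(2) by simp
  next
    assume 1: "cmod L = 1"
    have "L + 1 / L = 4 - x - x\<^sup>2"
      using mL by (simp only: cusp_eigenvalues_def)
    note Z = unit_norm_sum_inverse[OF 1, unfolded this]
    have "Im x * (2 * Re x + 1) = 0"
      using Z(1) by (simp add: power2_eq_square algebra_simps)
    then have re: "Re x = - 1 / 2"
      using assms(2) by auto
    have "Re (4 - x - x\<^sup>2) = 4 + 1 / 4 + (Im x)\<^sup>2"
      by (simp add: power2_eq_square re)
    then show False
      using Z(2) zero_le_power2[of "Im x"] by linarith
  qed
qed

text \<open>Keeps \<open>csqrt\<close> off its cut, so that it provides a continuous branch of
  \<beta>. For non-real x the number is real only on the line Re x = -1, where it equals 4 + (Im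
  x)^2.\<close>

lemma neg_discriminant_slit:
  assumes "Im x \<noteq> 0 \<or> - 3 < Re x \<and> Re x < 1"
  shows "4 - (x + 1)\<^sup>2 \<notin> \<real>\<^sub>\<le>\<^sub>0"
proof
  assume "4 - (x + 1)\<^sup>2 \<in> \<real>\<^sub>\<le>\<^sub>0"
  then have *: "Im (4 - (x + 1)\<^sup>2) = 0" "Re (4 - (x + 1)\<^sup>2) \<le> 0"
    by (simp_all add: complex_nonpos_Reals_iff)
  then have "(Re x + 1) * Im x = 0" and "4 - (Re x + 1)\<^sup>2 + (Im x)\<^sup>2 \<le> 0"
    by (simp_all add: power2_eq_square algebra_simps)
  moreover have "(Re x + 1)\<^sup>2 < 2\<^sup>2" if "\<bar>Re x + 1\<bar> < 2"
    using that abs_le_square_iff[of 2 "Re x + 1"] by linarith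
  moreover have "\<bar>Re x + 1\<bar> < 2" if "Im x = 0"
    using assms that by auto
  ultimately show False
    using zero_le_power2[of "Im x"] by (cases "Im x = 0") (auto simp: add_eq_0_iff)
qed

lemma square_roots_eq_or_minus: "a\<^sup>2 = b\<^sup>2 \<Longrightarrow> a = b \<or> a = - b" for a b :: complex
  by (simp add: power2_eq_iff)

text \<open>On the upper half-plane \<open>Q = QQ x \<beta>\<close> is continuous and has no zero, hence has constant sign once
  a branch of \<open>\<beta>\<close> is chosen.\<close>

lemma QQ_same_sign:
  assumes "Im x > 0" "Im y > 0"
  shows "QQ x (\<i> * csqrt (4 - (x + 1)\<^sup>2)) * QQ y (\<i> * csqrt (4 - (y + 1)\<^sup>2)) > 0"
proof -
  let ?f = "\<lambda>x. QQ x (\<i> * csqrt (4 - (x + 1)\<^sup>2))"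
  let ?H = "{x. Im x > 0}"
  have "continuous_on ?H ?f"
  proof -
    have "continuous_on ?H (\<lambda>x. csqrt (4 - (x + 1)\<^sup>2))"
      by (rule continuous_on_compose2[OF continuous_on_csqrt])
         (use neg_discriminant_slit in \<open>auto intro!: continuous_intros\<close>)
    then show ?thesis
      unfolding QQ_def by (intro continuous_intros)
  qed
  then have "connected (?f ` ?H)"
    by (intro connected_continuous_image convex_connected convex_halfspace_Im_gt)
  moreover have "0 \<notin> ?f ` ?H"
    using QQ_nonzero by (auto simp: power_mult_distrib)
  ultimately have "\<not> (\<exists>a\<in>?f ` ?H. \<exists>b\<in>?f ` ?H. a \<le> 0 \<and> 0 \<le> b)"
    unfolding connected_iff_interval by blast
  then have "\<not> (?f x \<le> 0 \<and> 0 \<le> ?f y)" "\<not> (?f y \<le> 0 \<and> 0 \<le> ?f x)"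
    using assms by blast+
  then show ?thesis
    by (auto simp: zero_less_mult_iff)
qed

lemma cusp_eigenvalues_cnj:
  assumes "cusp_eigenvalues x \<beta> m L"
  shows "cusp_eigenvalues (cnj x) (cnj \<beta>) (cnj m) (cnj L)"
proof -
  have m: "m \<noteq> 0" "L \<noteq> 0" and e: "m + 1 / m = x" "L + 1 / L = 4 - x - x\<^sup>2"
    "L - 1 / L = - \<beta> * (m - 1 / m)" "\<beta>\<^sup>2 = (x + 1)\<^sup>2 - 4"
    using assms by (auto simp: cusp_eigenvalues_def)
  show ?thesis
    unfolding cusp_eigenvalues_def
    using m e[THEN arg_cong[of _ _ cnj]] by simp
qed

text \<open>With -P/Q as the common ratio of log|L| to log|m|, the product of the four logarithms is
  a square. But the complex conjugate of the second solution sits over a point of the upper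
  half-plane with the opposite branch of \<beta>, so the two values of \<open>QQ\<close> have
  opposite signs.\<close>

lemma no_conjugate_filling_upper:
  fixes P Q :: real
  assumes e: "cusp_eigenvalues x \<beta> m L" "cusp_eigenvalues (- 2 - x) \<beta> m' L'"
    and Q: "Q \<noteq> 0" "P * ln (cmod m) + Q * ln (cmod L) = 0" "P * ln (cmod m') + Q * ln (cmod L') = 0"
    and x: "Im x > 0"
  shows False
proof -
  \<comment> \<open>-2 - x lies in the lower half-plane; its complex conjugate is the mirror image
    of x in the line Re = -1.\<close>
  define y where "y = - 2 - cnj x"
  have y: "Im y > 0"
    using x by (simp add: y_def)
  let ?b = "\<lambda>x. csqrt (4 - (x + 1)\<^sup>2)"
  have e': "cusp_eigenvalues y (cnj \<beta>) (cnj m') (cnj L')"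
    using cusp_eigenvalues_cnj[OF e(2)] by (simp add: y_def)
  have "\<beta>\<^sup>2 = (\<i> * ?b x)\<^sup>2"
    using e(1) by (simp add: cusp_eigenvalues_def power_mult_distrib)
  then obtain \<sigma> :: real where \<sigma>: "\<sigma> = 1 \<or> \<sigma> = -1" "\<beta> = \<sigma> * (\<i> * ?b x)"
    using square_roots_eq_or_minus[of \<beta> "\<i> * ?b x"] that[of 1] that[of "-1"] by auto
  have "4 - (y + 1)\<^sup>2 = cnj (4 - (x + 1)\<^sup>2)"
    by (simp add: y_def power2_eq_square algebra_simps)
  then have byc: "?b y = cnj (?b x)"
    using cnj_csqrt[OF neg_discriminant_slit[of x]] x by simp
  \<comment> \<open>Conjugation carries \<open>csqrt\<close> at x to \<open>csqrt\<close> at y but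
    turns \<i> into -\<i>: the branch sign flips.\<close>
  have \<sigma>': "cnj \<beta> = - \<sigma> * (\<i> * ?b y)"
    unfolding byc by (subst \<sigma>(2)) (simp add: algebra_simps)
  have lin: "QQ z (of_real t * w) = t * QQ z w" for z t w
    by (simp add: QQ_def algebra_simps)
  have Q1: "QQ x \<beta> = \<sigma> * QQ x (\<i> * ?b x)"
    by (subst \<sigma>(2)) (rule lin)
  have Q2: "QQ y (cnj \<beta>) = - \<sigma> * QQ y (\<i> * ?b y)"
    using lin[of y "- \<sigma>"] by (simp add: \<sigma>')
  have "QQ x \<beta> * QQ y (cnj \<beta>) = - (QQ x (\<i> * ?b x) * QQ y (\<i> * ?b y))"
    unfolding Q1 Q2 using \<sigma>(1) by auto
  then have neg: "QQ x \<beta> * QQ y (cnj \<beta>) < 0"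
    using QQ_same_sign[OF x y] by linarith
  let ?N = "\<lambda>z. (cmod z)\<^sup>2 - 1 / (cmod z)\<^sup>2"
  have prod: "(?N L * ?N m) * (?N L' * ?N m') < 0"
    using cusp_eigenvalues_product[OF e(1)] cusp_eigenvalues_product[OF e'] neg by simp
  have nz: "m \<noteq> 0" "L \<noteq> 0" "m' \<noteq> 0" "L' \<noteq> 0"
    using e by (auto simp: cusp_eigenvalues_def)
  define a b c d where abcd: "a = ln (cmod m)" "b = ln (cmod L)" "c = ln (cmod m')" "d = ln (cmod L')"
  have "sgn ((?N L * ?N m) * (?N L' * ?N m')) = sgn ((b * a) * (d * c))"
    using nz by (simp add: sgn_mult sgn_norm_inverse abcd)
  then have "(b * a) * (d * c) < 0"
    using prod by (metis sgn_less)
  moreover have "b = - (P / Q) * a" "d = - (P / Q) * c"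
    using Q by (simp_all add: abcd field_simps) 
  then have "(b * a) * (d * c) = (P / Q * a * c)\<^sup>2"
    by (simp add: power2_eq_square)
  ultimately show False
    by (metis not_less zero_le_power2)
qed

text \<open>For real x with |x| < 2, or x = -1 at the edge of the range considered, the meridian
  eigenvalue has modulus 1. The equation and Q \<noteq> 0 then give |L| = 1, whereas 4 - x - x^2 > 2
  for -2 < x < 1.\<close>

lemma no_conjugate_filling_real:
  fixes P Q :: real
  assumes e: "cusp_eigenvalues x \<beta> m L"
    and Q: "Q \<noteq> 0" "P * ln (cmod m) + Q * ln (cmod L) = 0"
    and x: "Im x = 0" "- 1 \<le> Re x" "Re x < 1"
  shows False
proof -
  have nz: "m \<noteq> 0" "L \<noteq> 0" and m: "m + 1 / m = x" and L: "L + 1 / L = 4 - x - x\<^sup>2"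
    using e by (auto simp: cusp_eigenvalues_def)
  have "cmod m = 1"
    using real_sum_inverse_unit_norm[of m] nz m x by simp
  then have "ln (cmod L) = 0"
    using Q by simp
  then have "cmod L = 1"
    using nz by simp
  then have "\<bar>Re (4 - x - x\<^sup>2)\<bar> \<le> 2"
    using unit_norm_sum_inverse(2)[of L] L by simp
  then have "(Re x)\<^sup>2 + Re x \<ge> 2"
    using x(1) by (simp add: power2_eq_square)
  moreover have "(1 - Re x) * (Re x + 2) > 0"
    using x by simp
  ultimately show False
    by (simp add: power2_eq_square algebra_simps)
qed

text \<open>The traces x and -2 - x can share \<beta>, since \<beta>^2 depends on (x + 1)^2 only.
  The statement is symmetric under exchanging the solutions, which reduces it to the open upper
  half-plane and a real segment.\<close>

proposition no_conjugate_filling: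
  fixes P Q :: real
  assumes e: "cusp_eigenvalues x \<beta> m L" "cusp_eigenvalues (- 2 - x) \<beta> m' L'"
    and Q: "Q \<noteq> 0" "P * ln (cmod m) + Q * ln (cmod L) = 0" "P * ln (cmod m') + Q * ln (cmod L') = 0"
    and \<beta>: "Im \<beta> \<noteq> 0"
  shows False
proof -
  have flip: "cusp_eigenvalues (- 2 - (- 2 - x)) \<beta> m L"
    using e(1) by simp
  consider "Im x > 0" | "Im x < 0" | "Im x = 0" by linarith
  then show False
  proof cases
    case 1
    then show ?thesis using no_conjugate_filling_upper[OF e Q] by simp
  next
    case 2
    then show ?thesis using no_conjugate_filling_upper[OF e(2) flip Q(1,3,2)] by simp
  next
    case 3
    have b2: "\<beta>\<^sup>2 = (x + 1)\<^sup>2 - 4"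
      using e by (simp add: cusp_eigenvalues_def)
    have xr: "x = of_real (Re x)"
      using 3 by (simp add: complex_eq_iff)
    have bb: "\<beta>\<^sup>2 = of_real ((Re x + 1)\<^sup>2 - 4)"
      unfolding b2 by (subst xr) simp
    \<comment> \<open>\<beta> is not real although \<beta>^2 is, so \<beta>^2 is negative. Then x
      lies within distance 2 of -1, and x or -2 - x lies in [-1, 1).\<close>
    have "(Re x + 1)\<^sup>2 - 4 < 0"
    proof (rule ccontr)
      assume "\<not> ?thesis"
      then have "\<beta>\<^sup>2 = (of_real (sqrt ((Re x + 1)\<^sup>2 - 4)))\<^sup>2"
        using bb by (metis not_less of_real_power real_sqrt_pow2)
      then show False
        using square_roots_eq_or_minus \<beta> by fastforce
    qed
    then have "\<bar>Re x + 1\<bar> < 2"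
      using abs_le_square_iff[of 2 "Re x + 1"] by auto
    then consider "- 1 \<le> Re x" "Re x < 1" | "- 1 \<le> Re (- 2 - x)" "Re (- 2 - x) < 1"
      by fastforce
    then show ?thesis
      using no_conjugate_filling_real[OF e(1) Q(1,2) 3] no_conjugate_filling_real[OF e(2) Q(1,3)] 3
      by cases auto
  qed
qed

section \<open>Normal form of a pair of generators whose longitude fixes infinity\<close>

section \<open>Normalised generators\<close>

text \<open>A word for the homological longitude of the component with meridian \<open>u\<close>.
  Its total exponent is 0 in \<open>u\<close> and 3 in \<open>v\<close>, the linking number up to
  sign.\<close>

definition longitude :: "complex^2^2 \<Rightarrow> complex^2^2 \<Rightarrow> complex^2^2" where
  "longitude u v = (v ** u ** v) ** minv (u ** v ** u) ** (v ** u ** v)"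

lemma peq_longitude: "u \<doteq> u' \<Longrightarrow> v \<doteq> v' \<Longrightarrow> longitude u v \<doteq> longitude u' v'"
  unfolding longitude_def by (intro peq_mult peq_minv)

lemma peq_mpow:
  assumes "A \<doteq> B"
  shows "mpow A k \<doteq> mpow B k"
proof -
  have "mpow_nat A n \<doteq> mpow_nat B n" if "A \<doteq> B" for A B n
    by (induction n) (auto intro: peq_mult that)
  then show ?thesis
    using assms peq_minv by (auto simp: mpow_def)
qed

text \<open>The relations \<open>r q = 1\<close> and \<open>(r - 1) e = 1\<close> are kept instead of quotients, so that all identities
  become ideal membership problems.\<close>

definition norm_gen :: "complex \<Rightarrow> complex \<Rightarrow> complex \<Rightarrow> complex^2^2" where
  "norm_gen r q e = mat2 (1 + e - q) (- r) q 0"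

text \<open>Source of the cusp shape \<beta> = q + e: in PSL2 the unfilled meridian is translation
  by 1 and its longitude translation by q + e. Eliminating r from the two relations leaves q e = e -
  q.\<close>

lemma norm_gen_longitude:
  assumes "r * q = 1" "(r - 1) * e = 1"
  shows "longitude (translation 1) (norm_gen r q e) = - translation (q + e)"
proof -
  have "q * e = e - q"
    using assms by Groebner_Basis.algebra
  then show ?thesis
    using assms(1)
    unfolding mat_eq_iff longitude_def norm_gen_def
    by (simp add: matrix_mult_nth; intro conjI; Groebner_Basis.algebra)
qed

text \<open>The right-hand side is (1 + q - q^2) 1 - (q + e) u, with u the normalised generator: the
  longitude lies in the algebra spanned by 1 and u. An eigenvector of u for m is therefore one of
  the longitude for 1 + q - q^2 - (q + e) m.\<close>

lemma longitude_norm_gen: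
  assumes "r * q = 1" "(r - 1) * e = 1"
  shows "longitude (norm_gen r q e) (translation 1) =
    mat2 (1 + q - q\<^sup>2 - (q + e) * (1 + e - q)) ((q + e) * r) (- (q + e) * q) (1 + q - q\<^sup>2)"
proof -
  have "q * e = e - q"
    using assms by Groebner_Basis.algebra
  then show ?thesis
    using assms(1)
    unfolding mat_eq_iff longitude_def norm_gen_def
    by (simp add: matrix_mult_nth; intro conjI; Groebner_Basis.algebra)
qed

text \<open>The vanishing entry is the equation of a curve in the entries of \<open>u\<close>, and
  that equation is a difference of two squares. Its two components are interchanged by u -> -u, so
  up to sign a single normal form remains.\<close>

lemma norm_gen_exists:
  assumes "u $ 2 $ 2 = 0" "det u = 1" "longitude (translation 1) u $ 2 $ 1 = 0"
  shows "\<exists>r q e. r * q = 1 \<and> (r - 1) * e = 1 \<and> u \<doteq> norm_gen r q e"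
proof -
  define x c k where "x = u$1$1" "c = u$2$1" "k = - (u$1$2)"
  have ck: "c * k = 1"
    using assms(1,2) by (simp add: det_2 x_c_k_def algebra_simps)
  then have ne: "c \<noteq> 0" "k \<noteq> 0"
    by auto
  have u: "u = mat2 x (- k) c 0"
    using assms(1) by (simp add: mat_eq_iff x_c_k_def)
  define s where "s = x * k + 1"
  \<comment> \<open>The factor k^5 clears the denominators that come from c = 1/k.\<close>
  have "longitude (translation 1) u $ 2 $ 1 * k ^ 5 = k\<^sup>2 * s\<^sup>2 - (s + k\<^sup>2)\<^sup>2"
    unfolding u longitude_def s_def using ck
    by (simp add: matrix_mult_nth) Groebner_Basis.algebra
  then have curve: "k\<^sup>2 * s\<^sup>2 = (s + k\<^sup>2)\<^sup>2"
    using assms(3) by simp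
  have s: "s \<noteq> 0"
    using curve ne by auto
  define r where "r = 1 + k\<^sup>2 / s"
  have r: "r * s = s + k\<^sup>2"
    using s by (simp add: r_def field_simps)
  have "(r * s)\<^sup>2 = (k * s)\<^sup>2"
    using curve r by (simp add: power_mult_distrib)
  then have "r * s = k * s \<or> r * s = (- k) * s"
    by (simp add: power2_eq_iff)
  then have "r = k \<or> r = - k"
    using s by (metis mult_right_cancel)
  then obtain \<sigma> where \<sigma>: "\<sigma> = 1 \<or> \<sigma> = -1" "k = \<sigma> * r"
    by force
  define q where "q = \<sigma> * c"
  define e where "e = s / k\<^sup>2"
  have rq: "r * q = 1"
    using \<sigma> ck by (auto simp: q_def mult.commute)
  have re: "(r - 1) * e = 1"
    using s ne by (simp add: r_def e_def)
  have xs: "x * \<sigma> = 1 + e - q"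
  proof -
    have ek: "e * k\<^sup>2 = s"
      using ne by (simp add: e_def)
    have "(x * \<sigma>) * k\<^sup>2 = (1 + e - q) * k\<^sup>2"
    proof -
      have "k\<^sup>2 = r\<^sup>2" "\<sigma> * \<sigma> = 1" using \<sigma> by auto
      have "(x * \<sigma>) * k\<^sup>2 = (s - 1) * (\<sigma> * k)"
        by (simp add: s_def power2_eq_square)
      also have "\<sigma> * k = r" using \<sigma> by auto
      also have "(s - 1) * r = k\<^sup>2 + s - r"
        using r by (simp add: algebra_simps)
      also have "r = q * k\<^sup>2"
        unfolding \<open>k\<^sup>2 = r\<^sup>2\<close> using rq by Groebner_Basis.algebra
      finally show ?thesis
        using ek by (simp add: algebra_simps)
    qed
    then show ?thesis using ne by simp
  qed
  have "norm_gen r q e = mat2 (x * \<sigma>) (- r) (\<sigma> * c) 0"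
    unfolding norm_gen_def xs q_def ..
  then have "u = norm_gen r q e \<or> u = - norm_gen r q e"
    using \<sigma>(1) \<sigma>(2) unfolding u by (elim disjE) (simp_all add: mat_eq_iff)
  then show ?thesis
    using rq re unfolding peq_def by blast
qed

definition is_eigenvector :: "complex^2^2 \<Rightarrow> complex \<times> complex \<Rightarrow> complex \<Rightarrow> bool" where
  "is_eigenvector A y l \<longleftrightarrow> A$1$1 * fst y + A$1$2 * snd y = l * fst y \<and>
     A$2$1 * fst y + A$2$2 * snd y = l * snd y"

lemma is_eigenvector_mult:
  assumes "is_eigenvector A y l" "is_eigenvector B y k"
  shows "is_eigenvector (A ** B) y (l * k)"
proof -
  have A: "A$1$1 * fst y + A$1$2 * snd y = l * fst y" "A$2$1 * fst y + A$2$2 * snd y = l * snd y"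
    and B: "B$1$1 * fst y + B$1$2 * snd y = k * fst y" "B$2$1 * fst y + B$2$2 * snd y = k * snd y"
    using assms by (auto simp: is_eigenvector_def)
  show ?thesis
    unfolding is_eigenvector_def matrix_mult_nth using A B by Groebner_Basis.algebra
qed

lemma is_eigenvector_minv:
  assumes "is_eigenvector A y l" "det A = 1" "l \<noteq> 0"
  shows "is_eigenvector (minv A) y (1 / l)"
proof -
  have A: "A$1$1 * fst y + A$1$2 * snd y = l * fst y" "A$2$1 * fst y + A$2$2 * snd y = l * snd y"
    and d: "A$1$1 * A$2$2 - A$1$2 * A$2$1 = 1"
    using assms by (auto simp: is_eigenvector_def det_2)
  have "l * (A$2$2 * fst y - A$1$2 * snd y) = fst y" "l * (- A$2$1 * fst y + A$1$1 * snd y) = snd y"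
    using A d by Groebner_Basis.algebra+
  then show ?thesis
    unfolding is_eigenvector_def using assms(3)
    by (simp add: nonzero_eq_divide_eq mult.commute)
qed

lemma is_eigenvector_mpow:
  assumes "is_eigenvector A y l" "det A = 1" "l \<noteq> 0"
  shows "is_eigenvector (mpow A n) y (l powi n)"
proof -
  have nat: "is_eigenvector (mpow_nat A k) y (l ^ k)" if "is_eigenvector A y l" for A l k
    by (induction k) (simp_all add: is_eigenvector_mult that, simp add: is_eigenvector_def)
  show ?thesis
    using nat[OF assms(1)] nat[OF is_eigenvector_minv[OF assms]]
    by (auto simp: mpow_def power_int_def power_divide field_simps)
qed

text \<open>The relation in \<open>PSL\<^sub>2(\<complex>)\<close> imposed by the filling, read off on a common eigenvector of the
  meridian and the longitude.\<close>

lemma norm_gen_filling: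
  assumes rq: "r * q = 1" "(r - 1) * e = 1"
    and rel: "mpow (norm_gen r q e) P ** mpow (longitude (norm_gen r q e) (translation 1)) Q \<doteq> mat 1"
  shows "\<exists>m L. cusp_eigenvalues (1 + e - q) (q + e) m L \<and>
    of_int P * ln (cmod m) + of_int Q * ln (cmod L) = 0"
proof -
  let ?u = "norm_gen r q e"
  let ?l = "longitude ?u (translation 1)"
  define x where "x = 1 + e - q"
  have qe: "q * e = e - q"
    using rq by Groebner_Basis.algebra
  \<comment> \<open>A root of m^2 - x m + 1, the characteristic polynomial of the generator, whose
    trace is x.\<close>
  define m where "m = (x + csqrt (x\<^sup>2 - 4)) / 2"
  have "m * (x - m) = (x\<^sup>2 - (csqrt (x\<^sup>2 - 4))\<^sup>2) / 4"
    by (simp add: m_def power2_eq_square field_simps)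
  then have mm: "m * (x - m) = 1"
    by simp
  then have m0: "m \<noteq> 0" and im: "1 / m = x - m"
    by (auto simp: divide_eq_eq mult.commute)
  define a where "a = 1 + q - q\<^sup>2"
  define L where "L = a - (q + e) * m"
  have LL: "L * (a - (q + e) * (x - m)) = 1"
    unfolding L_def a_def using mm qe unfolding x_def by Groebner_Basis.algebra
  then have L0: "L \<noteq> 0" and iL: "1 / L = a - (q + e) * (x - m)"
    by (auto simp: divide_eq_eq mult.commute)
  have "cusp_eigenvalues x (q + e) m L"
    unfolding cusp_eigenvalues_def im iL
  proof (intro conjI m0 L0)
    show "m + (x - m) = x" by simp
    show "L + (a - (q + e) * (x - m)) = 4 - x - x\<^sup>2"
      unfolding L_def a_def x_def using qe by Groebner_Basis.algebra
    show "L - (a - (q + e) * (x - m)) = - (q + e) * (m - (x - m))"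
      unfolding L_def by (simp add: algebra_simps)
    show "(q + e)\<^sup>2 = (x + 1)\<^sup>2 - 4"
      unfolding x_def using qe by Groebner_Basis.algebra
  qed
  moreover have "of_int P * ln (cmod m) + of_int Q * ln (cmod L) = 0"
  proof -
    \<comment> \<open>The second row (q, 0) of the generator dictates this vector, as q (m r) =
      m.\<close>
    let ?y = "(m * r, 1 :: complex)"
    have eu: "is_eigenvector ?u ?y m"
      unfolding is_eigenvector_def norm_gen_def using mm rq(1)
      by (simp add: x_def) Groebner_Basis.algebra
    have el: "is_eigenvector ?l ?y L"
      unfolding is_eigenvector_def longitude_norm_gen[OF rq] L_def a_def
      using mm rq(1) by (simp add: x_def) Groebner_Basis.algebra
    have du: "det ?u = 1"
      using rq(1) by (simp add: norm_gen_def det_2)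
    have dl: "det ?l = 1"
      by (simp add: longitude_def det_mul du)
    have "is_eigenvector (mpow ?u P ** mpow ?l Q) ?y (m powi P * L powi Q)"
      by (intro is_eigenvector_mult is_eigenvector_mpow eu el du dl m0 L0)
    then have "m powi P * L powi Q = 1 \<or> m powi P * L powi Q = - 1"
      using rel by (auto simp: peq_def is_eigenvector_def)
    then have "cmod (m powi P * L powi Q) = 1"
      by auto
    then have "ln (cmod m powi P * cmod L powi Q) = 0"
      by (simp add: norm_mult norm_power_int)
    then show ?thesis
      using m0 L0 by (simp add: ln_mult ln_powr flip: powr_real_of_int')
  qed
  ultimately show ?thesis
    unfolding x_def by blast
qed

section \<open>Descent of the normal form to the cusp field, and equality of the two fields\<close>

section \<open>Conjugation over the cusp field\<close>

text \<open>The non-trivial automorphism of K(q) over K, written in the basis 1, q. Both q and t - q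
  are roots of X^2 - t X + n, so products have the same coordinates with respect to either root;
  coordinates are unique because q is not in K.\<close>

lemma quadratic_conjugation:
  assumes K: "is_subfield K" and q: "q \<notin> K" "q\<^sup>2 = t * q - n" "t \<in> K" "n \<in> K"
  obtains F \<sigma> where "K \<subseteq> F" "q \<in> F"
    "\<And>x y. x \<in> F \<Longrightarrow> y \<in> F \<Longrightarrow> x + y \<in> F" "\<And>x y. x \<in> F \<Longrightarrow> y \<in> F \<Longrightarrow> x * y \<in> F"
    "\<And>x y. x \<in> F \<Longrightarrow> y \<in> F \<Longrightarrow> \<sigma> (x + y) = \<sigma> x + \<sigma> y"
    "\<And>x y. x \<in> F \<Longrightarrow> y \<in> F \<Longrightarrow> \<sigma> (x * y) = \<sigma> x * \<sigma> y"
    "\<And>x. x \<in> K \<Longrightarrow> \<sigma> x = x" "\<sigma> q = t - q"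
proof -
  note cl = is_subfield_closed[OF K]
  define F where "F = {a + b * q | a b. a \<in> K \<and> b \<in> K}"
  have uniq: "a = c \<and> b = d" if "a + b * q = c + d * q" "a \<in> K" "b \<in> K" "c \<in> K" "d \<in> K" for a b c d
  proof -
    have "b = d"
    proof (rule ccontr)
      assume "b \<noteq> d"
      then have "q = (c - a) / (b - d)"
        using that(1) by (simp add: field_simps)
      then show False
        using q(1) that cl(6,8) by metis
    qed
    then show ?thesis using that(1) by simp
  qed
  define \<sigma> where "\<sigma> z = (THE w. \<exists>a\<in>K. \<exists>b\<in>K. z = a + b * q \<and> w = a + b * (t - q))" for z
  have \<sigma>: "\<sigma> (a + b * q) = a + b * (t - q)" if "a \<in> K" "b \<in> K" for a b
    unfolding \<sigma>_def by (rule the_equality) (use that uniq in blast)+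
  have mult: "(a + b * q) * (c + d * q) = (a * c - b * d * n) + (a * d + b * c + b * d * t) * q" for a b c d
    using q(2) by Groebner_Basis.algebra
  have mult': "(a + b * (t - q)) * (c + d * (t - q)) = (a * c - b * d * n) + (a * d + b * c + b * d * t) * (t - q)"
    for a b c d
    using q(2) by Groebner_Basis.algebra
  show ?thesis
  proof (rule that[of F \<sigma>])
    show "K \<subseteq> F"
    proof
      fix x assume "x \<in> K"
      then show "x \<in> F" unfolding F_def using cl(1) by force
    qed
    show "q \<in> F"
      unfolding F_def using cl(1,2) by force
    fix x y assume "x \<in> F" "y \<in> F"
    then obtain a b c d where x: "x = a + b * q" "a \<in> K" "b \<in> K" and y: "y = c + d * q" "c \<in> K" "d \<in> K"
      unfolding F_def by blast
    have s: "x + y = (a + c) + (b + d) * q"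
      unfolding x y by (simp add: algebra_simps)
    show "x + y \<in> F"
      unfolding s F_def using cl(3) x y by blast
    show "\<sigma> (x + y) = \<sigma> x + \<sigma> y"
      unfolding s \<sigma>[OF cl(3)[OF x(2) y(2)] cl(3)[OF x(3) y(3)]] unfolding x(1) y(1) \<sigma>[OF x(2,3)] \<sigma>[OF y(2,3)]
      by (simp add: algebra_simps)
    have k: "a * c - b * d * n \<in> K" "a * d + b * c + b * d * t \<in> K"
      using x y q cl by simp_all
    show "x * y \<in> F"
      unfolding x(1) y(1) mult F_def using k by blast
    show "\<sigma> (x * y) = \<sigma> x * \<sigma> y"
      unfolding x(1) y(1) mult \<sigma>[OF k] \<sigma>[OF x(2,3)] \<sigma>[OF y(2,3)] mult' ..
  next
    fix x assume "x \<in> K"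
    then show "\<sigma> x = x" using \<sigma>[of x 0] cl(1) by simp
  next
    show "\<sigma> q = t - q" using \<sigma>[of 0 1] cl(1,2) by simp
  qed
qed

text \<open>Otherwise conjugating all entries of the filling relation gives the same relation for q'
  = b + 2 - q and e' = q - 2. Since q' + e' = b while the meridian trace x becomes -2 - x, this is
  the pair of solutions excluded by \<open>no_conjugate_filling\<close>.\<close>

lemma cusp_field_contains_shape:
  assumes K: "is_subfield K" and rq: "r * q = 1" "(r - 1) * e = 1" and \<beta>: "q + e \<in> K" "Im (q + e) \<noteq> 0"
    and Q: "Q \<noteq> 0"
    and rel: "mpow (norm_gen r q e) P ** mpow (longitude (norm_gen r q e) (translation 1)) Q \<doteq> mat 1"
  shows "q \<in> K"
proof (rule ccontr)
  assume nq: "q \<notin> K"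
  define b where "b = q + e"
  note cl = is_subfield_closed[OF K]
  have bK: "b \<in> K" and b0: "b \<noteq> 0"
    using \<beta> by (auto simp: b_def complex_eq_iff)
  have qe: "q * e = e - q"
    using rq by Groebner_Basis.algebra
  have q2: "q\<^sup>2 = (b + 2) * q - b"
    unfolding b_def using qe by Groebner_Basis.algebra
  obtain F \<sigma> where F: "K \<subseteq> F" "q \<in> F"
    and add: "\<And>x y. x \<in> F \<Longrightarrow> y \<in> F \<Longrightarrow> x + y \<in> F" and mult: "\<And>x y. x \<in> F \<Longrightarrow> y \<in> F \<Longrightarrow> x * y \<in> F"
    and sadd: "\<And>x y. x \<in> F \<Longrightarrow> y \<in> F \<Longrightarrow> \<sigma> (x + y) = \<sigma> x + \<sigma> y"
    and smult: "\<And>x y. x \<in> F \<Longrightarrow> y \<in> F \<Longrightarrow> \<sigma> (x * y) = \<sigma> x * \<sigma> y"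
    and sK: "\<And>x. x \<in> K \<Longrightarrow> \<sigma> x = x" and sq: "\<sigma> q = (b + 2) - q"
    by (rule quadratic_conjugation[OF K nq q2 cl(3)[OF bK cl(12)] bK]) blast
  have one: "1 \<in> F" "\<sigma> 1 = 1" and zero: "0 \<in> F" "\<sigma> 0 = 0" and m1: "- 1 \<in> F" "\<sigma> (- 1) = - 1"
    using F(1) sK cl(1,2,5) by blast+
  have neg: "- x \<in> F" "\<sigma> (- x) = - \<sigma> x" if "x \<in> F" for x
    using mult[OF m1(1) that] smult[OF m1(1) that] m1(2) by simp_all
  have eF: "e \<in> F" "\<sigma> e = b - \<sigma> q"
  proof -
    have "e = b + (- q)" by (simp add: b_def)
    then show "e \<in> F" "\<sigma> e = b - \<sigma> q"
      using add[of b "- q"] sadd[of b "- q"] neg[OF F(2)] F(1) bK sK by auto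
  qed
  have rF: "r \<in> F"
  proof -
    \<comment> \<open>Writing r with the denominator b from K, instead of as 1/q, shows that it lies
      in K + K q.\<close>
    have "r = inverse b * (b + 2 + (- q))"
    proof -
      have "b * r = b + 2 - q"
        unfolding b_def using rq by Groebner_Basis.algebra
      then show ?thesis using b0 by (simp add: field_simps)
    qed
    moreover have "inverse b \<in> F" "b + 2 \<in> F"
      using F(1) cl bK by auto
    ultimately show ?thesis
      using mult add neg F(2) by metis
  qed
  define r' q' e' where "r' = \<sigma> r" "q' = \<sigma> q" "e' = \<sigma> e"
  have rq': "r' * q' = 1"
    using smult[OF rF F(2)] rq(1) one(2) by (simp add: r'_q'_e'_def)
  have re': "(r' - 1) * e' = 1"
  proof -
    have "r + - 1 \<in> F" "\<sigma> (r + - 1) = r' - 1"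
      using add[OF rF m1(1)] sadd[OF rF m1(1)] m1(2) by (simp_all add: r'_q'_e'_def)
    then show ?thesis
      using smult[of "r + - 1" e] eF(1) rq(2) one(2) by (simp add: r'_q'_e'_def)
  qed
  define inF where "inF A \<longleftrightarrow> A$1$1 \<in> F \<and> A$1$2 \<in> F \<and> A$2$1 \<in> F \<and> A$2$2 \<in> F" for A :: "complex^2^2"
  define sm where "sm A = mat2 (\<sigma> (A$1$1)) (\<sigma> (A$1$2)) (\<sigma> (A$2$1)) (\<sigma> (A$2$2))" for A :: "complex^2^2"
  have inF_mult: "inF (A ** B)" and sm_mult: "sm (A ** B) = sm A ** sm B" if "inF A" "inF B" for A B
    using that unfolding inF_def sm_def by (auto simp: matrix_mult_nth mat_eq_iff add mult sadd smult)
  have inF_minv: "inF (minv A)" and sm_minv: "sm (minv A) = minv (sm A)" if "inF A" for A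
    using that unfolding inF_def sm_def by (auto simp: mat_eq_iff neg)
  have one_inF: "inF (mat 1)" "sm (mat 1) = mat 1" "sm (- mat 1) = - mat 1"
    unfolding inF_def sm_def using one zero m1 by (auto simp: mat_eq_iff)
  have pow_nat: "inF (mpow_nat A k) \<and> sm (mpow_nat A k) = mpow_nat (sm A) k" if "inF A" for A k
    by (induction k) (auto simp: one_inF inF_mult sm_mult that)
  have pow: "inF (mpow A k)" "sm (mpow A k) = mpow (sm A) k" if "inF A" for A k
    using pow_nat[OF that] pow_nat[OF inF_minv[OF that]] sm_minv[OF that] by (auto simp: mpow_def)
  let ?u = "norm_gen r q e"
  have u: "inF ?u" "sm ?u = norm_gen r' q' e'"
  proof -
    have "1 + e \<in> F" "\<sigma> (1 + e) = 1 + e'"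
      using add[OF one(1) eF(1)] sadd[OF one(1) eF(1)] one(2) by (auto simp: r'_q'_e'_def)
    then have "1 + e - q \<in> F" "\<sigma> (1 + e - q) = 1 + e' - q'"
      using add[of "1 + e" "- q"] sadd[of "1 + e" "- q"] neg[OF F(2)] by (auto simp: r'_q'_e'_def)
    then show "inF ?u" "sm ?u = norm_gen r' q' e'"
      unfolding inF_def sm_def norm_gen_def using neg[OF rF] F(2) zero
      by (auto simp: mat_eq_iff r'_q'_e'_def)
  qed
  have v: "inF (translation 1)" "sm (translation 1) = translation 1"
    unfolding inF_def sm_def using one zero by (auto simp: mat_eq_iff)
  have l: "inF (longitude ?u (translation 1))"
    "sm (longitude ?u (translation 1)) = longitude (norm_gen r' q' e') (translation 1)"
    unfolding longitude_def by (simp_all add: inF_mult sm_mult inF_minv sm_minv u v)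
  have "sm (mpow ?u P ** mpow (longitude ?u (translation 1)) Q) =
      mpow (norm_gen r' q' e') P ** mpow (longitude (norm_gen r' q' e') (translation 1)) Q"
    using sm_mult[OF pow(1)[OF u(1)] pow(1)[OF l(1)]] pow(2)[OF u(1)] pow(2)[OF l(1)] u(2) l(2) by simp
  then have rel': "mpow (norm_gen r' q' e') P ** mpow (longitude (norm_gen r' q' e') (translation 1)) Q \<doteq> mat 1"
    using rel one_inF unfolding peq_def by metis
  obtain m L where 1: "cusp_eigenvalues (1 + e - q) b m L"
    "of_int P * ln (cmod m) + of_int Q * ln (cmod L) = 0"
    using norm_gen_filling[OF rq rel] unfolding b_def by blast
  have b': "q' + e' = b" and x': "1 + e' - q' = - 2 - (1 + e - q)"
    using eF(2) sq by (simp_all add: r'_q'_e'_def b_def)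
  obtain m' L' where 2: "cusp_eigenvalues (- 2 - (1 + e - q)) b m' L'"
    "of_int P * ln (cmod m') + of_int Q * ln (cmod L') = 0"
    using norm_gen_filling[OF rq' re' rel'] unfolding b' x' by blast
  show False
    using no_conjugate_filling[OF 1(1) 2(1) _ 1(2) 2(2)] Q \<beta>(2) by (simp add: b_def)
qed

lemma generate_SL2C_induct [consumes 2, case_names gen inv mult one]:
  assumes "A \<in> generate SL2C S" "S \<subseteq> carrier SL2C"
    and "\<And>A. A \<in> S \<Longrightarrow> P A" "\<And>A. A \<in> S \<Longrightarrow> P (minv A)"
    and "\<And>A B. det A = 1 \<Longrightarrow> det B = 1 \<Longrightarrow> P A \<Longrightarrow> P B \<Longrightarrow> P (A ** B)" and "P (mat 1)"
  shows "P A"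
proof -
  have "det A = 1 \<and> P A"
    using assms(1)
  proof (induction rule: generate.induct)
    case (inv h)
    then have "det h = 1" using assms(2) by auto
    then show ?case using assms(4)[OF inv] by (simp add: inv_SL2C)
  qed (use assms in \<open>auto simp: det_mul\<close>)
  then show ?thesis ..
qed

lemma generate_subset_subgroup:
  assumes "subgroup \<Gamma> SL2C" "S \<subseteq> \<Gamma>"
  shows "generate SL2C S \<subseteq> \<Gamma>"
  by (rule group.generate_subgroup_incl[OF group_SL2C assms(2,1)])

definition conj_by :: "complex^2^2 \<Rightarrow> complex^2^2 \<Rightarrow> complex^2^2" where
  "conj_by D A = D ** A ** minv D"

lemma conj_by_mult: "det D = 1 \<Longrightarrow> conj_by D (A ** B) = conj_by D A ** conj_by D B"
  by (simp add: conj_by_def matrix_mul_assoc[symmetric] minv_cancel)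

lemma conj_by_minv: "conj_by D (minv A) = minv (conj_by D A)"
  by (simp add: conj_by_def minv_mult matrix_mul_assoc)

lemma conj_by_mat1: "det D = 1 \<Longrightarrow> conj_by D (mat 1) = mat 1"
  by (simp add: conj_by_def minv_right)

lemma conj_by_uminus: "conj_by D (- A) = - conj_by D A"
  by (simp add: conj_by_def matrix_mult_uminus)

lemma peq_conj_by: "A \<doteq> B \<Longrightarrow> conj_by D A \<doteq> conj_by D B"
  by (auto simp: peq_def conj_by_uminus)

lemma det_conj_by: "det D = 1 \<Longrightarrow> det (conj_by D A) = det A"
  by (simp add: conj_by_def det_mul)

lemma trace_conj_by: "det D = 1 \<Longrightarrow> trace (conj_by D A) = trace A"
  using trace_mul_sym[of "D ** A" "minv D"]
  by (simp add: conj_by_def matrix_mul_assoc minv_left)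

lemma conj_by_longitude: "det D = 1 \<Longrightarrow> conj_by D (longitude u v) = longitude (conj_by D u) (conj_by D v)"
  by (simp add: longitude_def conj_by_mult conj_by_minv)

lemma conj_by_mpow:
  assumes "det D = 1"
  shows "conj_by D (mpow A k) = mpow (conj_by D A) k"
proof -
  have "conj_by D (mpow_nat A n) = mpow_nat (conj_by D A) n" for A n
    by (induction n) (auto simp: conj_by_mult conj_by_mat1 assms)
  then show ?thesis
    by (simp add: mpow_def conj_by_minv)
qed

text \<open>A quarter of the trace of \<open>v\<^sup>2 u v\<^sup>2 u\<^sup>-\<^sup>1\<close> and of \<open>l\<^sup>2 u v\<^sup>2 u\<^sup>-\<^sup>1\<close> is \<open>1/2\<close> minus a square times \<open>1\<close> and
  \<open>\<beta>\<close>, respectively; this recovers \<open>\<beta>\<close> from traces of products of squares.\<close>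

lemma trace_translation_conj:
  assumes "u$1$1 * u$2$2 - u$1$2 * u$2$1 = 1"
  shows "trace (translation a ** (u ** translation b ** minv u)) = 2 - a * b * (u$2$1)\<^sup>2"
  using assms unfolding trace2 by (simp add: matrix_mult_nth) Groebner_Basis.algebra

text \<open>In normal form all entries of the group lie in the field generated by q and \<beta>, and
  both of these are in the cusp field; this bounds the traces. Conversely \<beta> is a quotient of
  two numbers obtained from traces of products of squares, and \<tau> is a rational Moebius image of
  \<beta>.\<close>

theorem invariant_trace_field_eq_cusp_field:
  assumes \<Gamma>: "subgroup \<Gamma> SL2C"
    and uv: "u \<in> \<Gamma>" "v \<in> \<Gamma>" "\<Gamma> \<subseteq> generate SL2C {u, v, - mat 1}"
    and cusp: "{A \<in> \<Gamma>. A$2$1 = 0} =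
       (\<Union>m n :: int. {translation (of_int m * w1 + of_int n * w2),
                       - translation (of_int m * w1 + of_int n * w2)})"
    and w: "w1 \<noteq> 0" "Im (w2 / w1) \<noteq> 0"
    and v: "v$2$1 = 0" and l: "longitude v u $ 2 $ 1 = 0"
    and rel: "mpow u P ** mpow (longitude u v) Q \<doteq> mat 1" "Q \<noteq> 0"
    and nonelem: "\<exists>A\<in>\<Gamma>. A$2$1 \<noteq> 0"
  shows "invariant_trace_field \<Gamma> = cusp_field (w2 / w1)"
proof -
  note sg = subgroup_SL2C_D[OF \<Gamma>]
  have gens: "{u, v, - mat 1} \<subseteq> carrier SL2C"
    using uv sg(1) by auto
  define \<Lambda> where "\<Lambda> = {of_int m * w1 + of_int n * w2 | m n :: int. True}"
  have \<Lambda>: "\<exists>w\<in>\<Lambda>. A \<doteq> translation w" if "A \<in> \<Gamma>" "A$2$1 = 0" for A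
  proof -
    have "A \<in> {A \<in> \<Gamma>. A$2$1 = 0}" using that by simp
    then obtain m n :: int where "A \<doteq> translation (of_int m * w1 + of_int n * w2)"
      unfolding cusp peq_def by blast
    then show ?thesis unfolding \<Lambda>_def by blast
  qed
  have \<Lambda>': "translation w \<in> \<Gamma>" if w: "w \<in> \<Lambda>" for w
  proof -
    obtain m n :: int where "w = of_int m * w1 + of_int n * w2"
      using w unfolding \<Lambda>_def by blast
    then have "translation w \<in> {A \<in> \<Gamma>. A$2$1 = 0}"
      unfolding cusp by blast
    then show ?thesis by simp
  qed
  have w1\<Lambda>: "w1 \<in> \<Lambda>" and w2\<Lambda>: "w2 \<in> \<Lambda>"
  proof -
    have "w1 = of_int 1 * w1 + of_int 0 * w2" "w2 = of_int 0 * w1 + of_int 1 * w2"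
      by simp_all
    then show "w1 \<in> \<Lambda>" "w2 \<in> \<Lambda>"
      unfolding \<Lambda>_def by blast+
  qed
  have lG: "longitude v u \<in> \<Gamma>"
    unfolding longitude_def using uv sg by auto
  obtain \<alpha> where \<alpha>: "\<alpha> \<in> \<Lambda>" "v \<doteq> translation \<alpha>"
    using \<Lambda>[OF uv(2) v] by blast
  obtain \<beta>' where \<beta>': "\<beta>' \<in> \<Lambda>" "longitude v u \<doteq> translation \<beta>'"
    using \<Lambda>[OF lG l] by blast
  \<comment> \<open>If \<open>u\<close> fixed infinity, as \<open>v\<close> does, the whole group
    would be triangular.\<close>
  have u21: "u$2$1 \<noteq> 0"
  proof
    assume u0: "u$2$1 = 0"
    have "A$2$1 = 0" if "A \<in> generate SL2C {u, v, - mat 1}" for A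
      using that gens by (induction rule: generate_SL2C_induct) (use u0 v gens in \<open>auto simp: matrix_mult_nth\<close>)
    then show False using nonelem uv by blast
  qed
  \<comment> \<open>If \<open>v\<close> were 1 or -1, everything would commute with
    \<open>u\<close>, but a non-trivial translation commutes only with maps fixing infinity.\<close>
  have \<alpha>0: "\<alpha> \<noteq> 0"
  proof
    assume "\<alpha> = 0"
    then have v1: "v = mat 1 \<or> v = - mat 1"
      using \<alpha> by (auto simp: peq_def mat_eq_iff)
    have comm: "A ** u = u ** A" if "A \<in> generate SL2C {u, v, - mat 1}" for A
      using that gens
    proof (induction rule: generate_SL2C_induct)
      case (inv A)
      have "det u = 1" using uv sg by blast
      then have "minv u ** u = u ** minv u" by (simp add: minv_left minv_right)
      then show ?case using inv v1 by (auto simp: minv_uminus matrix_mult_uminus)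
    next
      case (mult A B)
      then show ?case by (metis matrix_mul_assoc)
    qed (use v1 in \<open>auto simp: matrix_mult_uminus\<close>)
    have "translation w1 ** u = u ** translation w1"
      using comm \<Lambda>'[OF w1\<Lambda>] uv by blast
    then have "w1 * u$2$1 = 0"
      by (auto simp: mat_eq_iff matrix_mult_nth)
    then show False using w(1) u21 by simp
  qed
  define d where "d = csqrt (1 / \<alpha>)"
  have d2: "d * d = 1 / \<alpha>"
    by (simp add: d_def flip: power2_eq_square)
  have d0: "d \<noteq> 0"
    using d2 \<alpha>0 by auto
  \<comment> \<open>-y is the preimage of infinity under \<open>u\<close>. The map \<open>D\<close>
    moves it to 0, which makes the lower right entry vanish, and rescales translation by \<alpha> to
    translation by 1.\<close>
  define y where "y = u$2$2 / u$2$1"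
  define D where "D = mat2 d (d * y) 0 (1 / d)"
  have D: "det D = 1"
    using d0 by (simp add: D_def det_2)
  note cm = conj_by_mult[OF D] and c1 = conj_by_mat1[OF D]
  have ctr: "conj_by D (translation w) = translation (w / \<alpha>)" for w
  proof -
    have "d * (w * d) = w / \<alpha>" using d2 by (metis mult.left_commute mult.right_neutral times_divide_eq_right)
    then show ?thesis
      using d0 by (simp add: conj_by_def D_def mat_eq_iff matrix_mult_nth algebra_simps)
  qed
  have cu22: "conj_by D u $ 2 $ 2 = 0"
    using d0 u21 by (simp add: conj_by_def D_def matrix_mult_nth y_def)
  have cv: "conj_by D v \<doteq> translation 1"
    using peq_conj_by[OF \<alpha>(2), of D] \<alpha>0 by (simp add: ctr)
  have cl: "conj_by D (longitude v u) \<doteq> translation (\<beta>' / \<alpha>)"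
    using peq_conj_by[OF \<beta>'(2), of D] by (simp add: ctr)
  have lon: "longitude (translation 1) (conj_by D u) \<doteq> translation (\<beta>' / \<alpha>)"
    using cl peq_longitude[OF cv peq_refl] peq_trans peq_sym
    unfolding conj_by_longitude[OF D] by blast
  then have "longitude (translation 1) (conj_by D u) $ 2 $ 1 = 0"
    by (auto simp: peq_def)
  moreover have "det (conj_by D u) = 1"
    using uv sg by (simp add: det_conj_by D)
  ultimately obtain r q e where rq: "r * q = 1" "(r - 1) * e = 1" and cu: "conj_by D u \<doteq> norm_gen r q e"
    using norm_gen_exists[OF cu22] by blast
  define \<beta> where "\<beta> = q + e"
  have "translation (\<beta>' / \<alpha>) \<doteq> - translation \<beta>"
    using lon peq_longitude[OF peq_refl cu] peq_trans peq_sym norm_gen_longitude[OF rq]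
    unfolding \<beta>_def by metis
  then have \<beta>\<alpha>: "\<beta> = \<beta>' / \<alpha>"
    by (auto simp: peq_def mat_eq_iff)
  have qe: "q * e = e - q"
    using rq by Groebner_Basis.algebra
  have entries: "conj_by D A $ 1 $ 1 \<in> K \<and> conj_by D A $ 1 $ 2 \<in> K \<and>
      conj_by D A $ 2 $ 1 \<in> K \<and> conj_by D A $ 2 $ 2 \<in> K"
    if "A \<in> \<Gamma>" "is_subfield K" "q \<in> K" "\<beta> \<in> K" for A K
  proof -
    note cl = is_subfield_closed[OF that(2)]
    have e: "e \<in> K" using cl(6)[OF that(4,3)] by (simp add: \<beta>_def)
    have "r = inverse q" using rq(1) by (metis inverse_unique mult.commute)
    then have r: "r \<in> K" using cl(7) that by simp
    have "A \<in> generate SL2C {u, v, - mat 1}" using that uv by blast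
    then show ?thesis
      using gens
    proof (induction rule: generate_SL2C_induct)
      case (gen A)
      then show ?case
        using cu cv that(3) e r by (auto simp: peq_def norm_gen_def conj_by_uminus c1 intro!: cl)
    next
      case (inv A)
      then show ?case
        using cu cv that(3) e r by (auto simp: peq_def norm_gen_def conj_by_uminus conj_by_minv c1 intro!: cl)
    next
      case (mult A B)
      then show ?case by (auto simp: cm matrix_mult_nth intro!: cl)
    qed (auto simp: c1 intro!: cl)
  qed
  obtain m1 n1 m2 n2 :: int where \<alpha>mn: "\<alpha> = of_int m1 * w1 + of_int n1 * w2"
    and \<beta>mn: "\<beta>' = of_int m2 * w1 + of_int n2 * w2"
    using \<alpha> \<beta>' unfolding \<Lambda>_def by blast
  define \<tau> where "\<tau> = w2 / w1"
  have w2: "w2 = \<tau> * w1"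
    using w(1) by (simp add: \<tau>_def)
  \<comment> \<open>The translations of meridian and longitude both lie in the lattice, so \<beta>
    and \<tau> are related by a Moebius transformation with integer coefficients.\<close>
  have \<beta>\<tau>: "\<beta> * (of_int m1 + of_int n1 * \<tau>) = of_int m2 + of_int n2 * \<tau>"
  proof -
    have "\<beta> * \<alpha> = \<beta>'" using \<alpha>0 \<beta>\<alpha> by simp
    then have "(\<beta> * (of_int m1 + of_int n1 * \<tau>)) * w1 = (of_int m2 + of_int n2 * \<tau>) * w1"
      unfolding \<alpha>mn \<beta>mn w2 by (simp add: algebra_simps)
    then show ?thesis using w(1) by simp
  qed
  have mn0: "of_int m1 + of_int n1 * \<tau> \<noteq> 0"
  proof -
    have "\<alpha> = (of_int m1 + of_int n1 * \<tau>) * w1"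
      unfolding \<alpha>mn w2 by (simp add: algebra_simps)
    then show ?thesis using \<alpha>0 by auto
  qed
  have real_subfield: "is_subfield \<real>"
    by (auto simp: is_subfield_def)
  \<comment> \<open>A real \<beta> makes (2 q - \<beta> - 2)^2 = \<beta>^2 + 4 positive. Then q is
    real, so are all entries of the conjugated group, and every lattice vector is a real multiple of
    \<alpha>, against the rank of the lattice.\<close>
  have Im\<beta>: "Im \<beta> \<noteq> 0"
  proof
    assume Imb: "Im \<beta> = 0"
    then have \<beta>R: "\<beta> = of_real (Re \<beta>)" by (simp add: complex_eq_iff)
    have "(2 * q - \<beta> - 2)\<^sup>2 = \<beta>\<^sup>2 + 4"
      unfolding \<beta>_def using qe by Groebner_Basis.algebra
    also have "\<dots> = (of_real (sqrt ((Re \<beta>)\<^sup>2 + 4)))\<^sup>2"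
      by (subst \<beta>R) (simp flip: of_real_power)
    finally have "2 * q - \<beta> - 2 \<in> \<real>"
      using square_roots_eq_or_minus by fastforce
    then have "q \<in> \<real>"
      using Imb by (simp add: complex_is_Real_iff)
    moreover have "\<beta> \<in> \<real>" using \<beta>R by (metis Reals_of_real)
    ultimately have "w / \<alpha> \<in> \<real>" if "w \<in> \<Lambda>" for w
      using entries[OF \<Lambda>'[OF that] real_subfield] by (simp add: ctr)
    from Reals_divide[OF this[OF w2\<Lambda>] this[OF w1\<Lambda>]]
    have "(w2 / \<alpha>) / (w1 / \<alpha>) \<in> \<real>" .
    then show False
      using w \<alpha>0 by (simp add: complex_is_Real_iff)
  qed
  define K where "K = cusp_field \<tau>"
  have K: "is_subfield K" and \<tau>K: "\<tau> \<in> K"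
    unfolding K_def cusp_field_def using is_subfield_generated generated_subfield_incl by auto
  note Kcl = is_subfield_closed[OF K]
  have \<beta>K: "\<beta> \<in> K"
  proof -
    have "\<beta> = (of_int m2 + of_int n2 * \<tau>) / (of_int m1 + of_int n1 * \<tau>)"
      using \<beta>\<tau> mn0 by (simp add: nonzero_eq_divide_eq)
    then show ?thesis
      using Kcl \<tau>K by simp
  qed
  have "mpow (norm_gen r q e) P ** mpow (longitude (norm_gen r q e) (translation 1)) Q \<doteq>
      mpow (conj_by D u) P ** mpow (longitude (conj_by D u) (conj_by D v)) Q"
    by (intro peq_mult peq_mpow peq_longitude peq_sym[OF cu] peq_sym[OF cv])
  also have "mpow (conj_by D u) P ** mpow (longitude (conj_by D u) (conj_by D v)) Q =
      conj_by D (mpow u P ** mpow (longitude u v) Q)"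
    by (simp add: cm conj_by_mpow D conj_by_longitude)
  also have "\<dots> \<doteq> mat 1"
    using peq_conj_by[OF rel(1), of D] by (simp add: c1)
  finally have qK: "q \<in> K"
    using cusp_field_contains_shape[OF K rq] \<beta>K Im\<beta> rel(2) unfolding \<beta>_def by blast
  let ?S = "{A ** A | A. A \<in> \<Gamma>}"
  have S: "?S \<subseteq> \<Gamma>" using sg by auto
  have SC: "?S \<subseteq> carrier SL2C" using S sg(1) by auto
  have "trace A \<in> K" if "A \<in> generate SL2C ?S" for A
  proof -
    have "A \<in> \<Gamma>" using that generate_subset_subgroup[OF \<Gamma> S] by blast
    then have "trace (conj_by D A) \<in> K"
      using entries[OF _ K qK \<beta>K] Kcl by (simp add: trace2)
    then show ?thesis by (simp add: trace_conj_by D)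
  qed
  then have sub1: "invariant_trace_field \<Gamma> \<subseteq> K"
    unfolding invariant_trace_field_def by (intro generated_subfield_minimal K) auto
  define F where "F = invariant_trace_field \<Gamma>"
  have F: "is_subfield F"
    unfolding F_def invariant_trace_field_def by (rule is_subfield_generated)
  note Fcl = is_subfield_closed[OF F]
  have trF: "trace A \<in> F" if "A \<in> generate SL2C ?S" for A
    unfolding F_def invariant_trace_field_def
    by (rule subsetD[OF generated_subfield_incl]) (rule imageI[OF that])
  have q0: "q \<noteq> 0" using rq by auto
  \<comment> \<open>The trace of A^2 times the square of u v u^-1. Subtracted from 2, the cases w =
    \<alpha> and w = \<beta>' give 4 q^2 and 4 \<beta> q^2, whose quotient is \<beta>.\<close>
  have shape_in_F: "2 - w / \<alpha> * 4 * q\<^sup>2 \<in> F" if "A \<in> \<Gamma>" "A \<doteq> translation w" for A w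
  proof -
    let ?B = "u ** v ** minv u"
    have "?B \<in> \<Gamma>"
      using uv sg(3,4) by simp
    then have AB: "A ** A \<in> generate SL2C ?S" "?B ** ?B \<in> generate SL2C ?S"
      using that(1) by (auto intro!: generate.incl)
    then have "(A ** A) ** (?B ** ?B) \<in> generate SL2C ?S"
      using generate.eng[OF AB] by simp
    then have "trace (conj_by D ((A ** A) ** (?B ** ?B))) \<in> F"
      using trF by (simp add: trace_conj_by D)
    moreover have sq: "M ** M = N ** N" if "M \<doteq> N" for M N
      using that by (auto simp: peq_def matrix_mult_uminus)
    have "conj_by D A \<doteq> translation (w / \<alpha>)"
      using peq_conj_by[OF that(2), of D] by (simp add: ctr)
    then have 1: "conj_by D A ** conj_by D A = translation (2 * w / \<alpha>)"
      using sq by (simp add: translation_mult)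
    have "conj_by D ?B \<doteq> norm_gen r q e ** translation 1 ** minv (norm_gen r q e)"
      unfolding cm conj_by_minv by (intro peq_mult peq_minv cu cv)
    then have 2: "conj_by D ?B ** conj_by D ?B =
        (norm_gen r q e ** translation 1 ** minv (norm_gen r q e)) **
        (norm_gen r q e ** translation 1 ** minv (norm_gen r q e))"
      using sq by blast
    have dn: "det (norm_gen r q e) = 1"
      using rq by (simp add: norm_gen_def det_2)
    have 3: "(norm_gen r q e ** translation 1 ** minv (norm_gen r q e)) **
        (norm_gen r q e ** translation 1 ** minv (norm_gen r q e)) =
        norm_gen r q e ** translation 2 ** minv (norm_gen r q e)"
    proof -
      have "(norm_gen r q e ** translation 1 ** minv (norm_gen r q e)) **
        (norm_gen r q e ** translation 1 ** minv (norm_gen r q e)) =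
        norm_gen r q e ** (translation 1 ** translation 1) ** minv (norm_gen r q e)"
        by (simp add: matrix_mul_assoc[symmetric] minv_cancel[OF dn])
      then show ?thesis by (simp add: translation_mult)
    qed
    have "conj_by D ((A ** A) ** (?B ** ?B)) =
        translation (2 * w / \<alpha>) ** (norm_gen r q e ** translation 2 ** minv (norm_gen r q e))"
      unfolding cm[of "A ** A"] cm[of A] cm[of ?B] 1 2 3 ..
    moreover have "trace \<dots> = 2 - w / \<alpha> * 4 * q\<^sup>2"
      by (subst trace_translation_conj) (use rq in \<open>simp_all add: norm_gen_def\<close>)
    ultimately show ?thesis by simp
  qed
  have t: "2 - 4 * q\<^sup>2 \<in> F" "2 - \<beta> * 4 * q\<^sup>2 \<in> F"
    using shape_in_F[OF uv(2) \<alpha>(2)] shape_in_F[OF lG \<beta>'(2)] \<alpha>0 by (simp_all add: \<beta>\<alpha>)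
  have "(2 - (2 - \<beta> * 4 * q\<^sup>2)) / (2 - (2 - 4 * q\<^sup>2)) \<in> F"
    by (rule Fcl(8)[OF Fcl(6)[OF Fcl(12) t(2)] Fcl(6)[OF Fcl(12) t(1)]])
  then have \<beta>F: "\<beta> \<in> F"
    using q0 by simp
  \<comment> \<open>As \<beta> is not real, a zero forces n1 = n2 = 0, and then \<beta> = m2/m1
    would be rational.\<close>
  have den: "of_int n1 * \<beta> - of_int n2 \<noteq> 0"
  proof
    assume 0: "of_int n1 * \<beta> - of_int n2 = 0"
    then have "Im (of_int n1 * \<beta> - of_int n2) = 0" by simp
    then have n1: "n1 = 0" using Im\<beta> by simp
    then have n2: "n2 = 0" using 0 by simp
    have "m1 \<noteq> 0" using mn0 n1 by simp
    then have "\<beta> = of_int m2 / of_int m1"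
      using \<beta>\<tau> n1 n2 by (simp add: field_simps)
    then show False
      using Im\<beta> by (simp add: complex_is_Real_iff[symmetric])
  qed
  have "\<tau> * (of_int n1 * \<beta> - of_int n2) = of_int m2 - of_int m1 * \<beta>"
    using \<beta>\<tau> by (simp add: algebra_simps)
  then have "\<tau> = (of_int m2 - of_int m1 * \<beta>) / (of_int n1 * \<beta> - of_int n2)"
    using den by (simp add: nonzero_eq_divide_eq)
  then have "\<tau> \<in> F"
    using Fcl \<beta>F by simp
  then have "K \<subseteq> F"
    unfolding K_def cusp_field_def by (intro generated_subfield_minimal F) auto
  then show ?thesis
    using sub1 unfolding F_def K_def \<tau>_def by blast
qed

section \<open>The isometric action on upper half-space and its proper discontinuity\<close>

section \<open>The action on upper half-space\<close>

text \<open>(P, R) and (p, q) are the rows of A times the matrix with rows (z, t) and (1, 0). In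
  these coordinates the action is a quotient of Hermitian products of rows, which makes the
  composition law computable.\<close>

lemma act_eq:
  assumes "P = A$1$1 * z + A$1$2" "R = A$1$1 * of_real t" "p = A$2$1 * z + A$2$2" "q = A$2$1 * of_real t"
  shows "act A (z, t) = ((P * cnj p + R * cnj q) / of_real ((cmod p)\<^sup>2 + (cmod q)\<^sup>2), t / ((cmod p)\<^sup>2 + (cmod q)\<^sup>2))"
  unfolding act_def assms
  by (simp add: Let_def norm_mult power_mult_distrib power2_eq_square mult.assoc mult.left_commute)

definition act_den :: "complex^2^2 \<Rightarrow> point \<Rightarrow> real" where
  "act_den A x = (cmod (A$2$1 * fst x + A$2$2))\<^sup>2 + (cmod (A$2$1))\<^sup>2 * (snd x)\<^sup>2"

lemma snd_act: "snd (act A x) = snd x / act_den A x"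
  by (simp add: act_def act_den_def Let_def)

lemma act_den_pos:
  assumes "det A = 1" "x \<in> H3"
  shows "act_den A x > 0"
proof (cases "A$2$1 = 0")
  case True
  then have "A$2$2 \<noteq> 0" using assms(1) by (auto simp: det_2)
  then show ?thesis using True by (simp add: act_den_def)
next
  case False
  then have "(cmod (A$2$1))\<^sup>2 * (snd x)\<^sup>2 > 0" using assms(2) by (simp add: H3_def)
  then show ?thesis by (simp add: act_den_def add_nonneg_pos)
qed

lemma act_in_H3: "det A = 1 \<Longrightarrow> x \<in> H3 \<Longrightarrow> act A x \<in> H3"
  using act_den_pos[of A x] by (simp add: H3_def snd_act)

text \<open>Parseval's identity in C^2 for the orthogonal basis (p, q), (-conj q, conj p), cleared
  of denominators.\<close>

lemma hermitian_identity:
  "(P2 * cnj p + R2 * cnj q) * cnj (p2 * cnj p + q2 * cnj q) + (R2 * p - P2 * q) * cnj (q2 * p - p2 * q) =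
    (p * cnj p + q * cnj q) * (P2 * cnj p2 + R2 * cnj q2)"
  by (simp add: algebra_simps)

lemma lagrange_identity:
  "(cmod (p2 * cnj p + q2 * cnj q))\<^sup>2 + (cmod (q2 * p - p2 * q))\<^sup>2 =
    ((cmod p)\<^sup>2 + (cmod q)\<^sup>2) * ((cmod p2)\<^sup>2 + (cmod q2)\<^sup>2)"
proof -
  have "complex_of_real ((cmod (p2 * cnj p + q2 * cnj q))\<^sup>2 + (cmod (q2 * p - p2 * q))\<^sup>2) =
    complex_of_real (((cmod p)\<^sup>2 + (cmod q)\<^sup>2) * ((cmod p2)\<^sup>2 + (cmod q2)\<^sup>2))"
    unfolding of_real_add of_real_mult complex_norm_square by (rule hermitian_identity)
  then show ?thesis
    by (simp only: of_real_eq_iff)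
qed

text \<open>The rows of A B are combinations of the rows of B. The factor n = |p|^2 + |q|^2
  introduced by acting with B cancels by \<open>hermitian_identity\<close> in the numerator and by
  \<open>lagrange_identity\<close> in the denominator.\<close>

lemma act_mult:
  assumes A: "det A = 1" and B: "det B = 1" and x: "x \<in> H3"
  shows "act (A ** B) x = act A (act B x)"
proof -
  obtain z t where xz: "x = (z, t)" and t: "t > 0"
    using x by (cases x) (auto simp: H3_def)
  define P R p q where B_row: "P = B$1$1 * z + B$1$2" "R = B$1$1 * of_real t"
    "p = B$2$1 * z + B$2$2" "q = B$2$1 * of_real t"
  define n where "n = (cmod p)\<^sup>2 + (cmod q)\<^sup>2"
  have n: "n > 0"
    using act_den_pos[OF B x] by (simp add: act_den_def n_def B_row xz norm_mult power_mult_distrib)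
  have nc: "of_real n = p * cnj p + q * cnj q"
    by (simp only: n_def of_real_add complex_norm_square)
  define P2 R2 p2 q2 where AB_row: "P2 = A$1$1 * P + A$1$2 * p" "R2 = A$1$1 * R + A$1$2 * q"
    "p2 = A$2$1 * P + A$2$2 * p" "q2 = A$2$1 * R + A$2$2 * q"
  define n2 where "n2 = (cmod p2)\<^sup>2 + (cmod q2)\<^sup>2"
  have AB: "act (A ** B) x = ((P2 * cnj p2 + R2 * cnj q2) / of_real n2, t / n2)"
    unfolding n2_def xz
    by (rule act_eq) (simp_all add: AB_row B_row matrix_mult_nth algebra_simps)
  have n2: "n2 > 0"
  proof -
    have "p2 = (A ** B)$2$1 * z + (A ** B)$2$2" "q2 = (A ** B)$2$1 * of_real t"
      by (simp_all add: AB_row B_row matrix_mult_nth algebra_simps)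
    then have "n2 = act_den (A ** B) x"
      by (simp add: n2_def act_den_def xz norm_mult power_mult_distrib)
    then show ?thesis
      using act_den_pos[of "A ** B", OF _ x] A B by (simp add: det_mul)
  qed
  have det: "R * p - P * q = of_real t"
  proof -
    have "R * p - P * q = (B$1$1 * B$2$2 - B$1$2 * B$2$1) * of_real t"
      by (simp add: B_row algebra_simps)
    then show ?thesis using B by (simp add: det_2)
  qed
  define z' where "z' = (P * cnj p + R * cnj q) / of_real n"
  have Bx: "act B x = (z', t / n)"
    unfolding z'_def n_def xz by (rule act_eq) (simp_all add: B_row)
  have nz: "complex_of_real n \<noteq> 0" using n by simp
  have zn: "z' * of_real n = P * cnj p + R * cnj q"
    using nz by (simp add: z'_def)
  have 1: "A$1$1 * z' + A$1$2 = (P2 * cnj p + R2 * cnj q) / of_real n"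
  proof -
    have "(A$1$1 * z' + A$1$2) * of_real n = A$1$1 * (P * cnj p + R * cnj q) + A$1$2 * (p * cnj p + q * cnj q)"
      unfolding zn[symmetric] nc[symmetric] by (simp add: algebra_simps)
    also have "\<dots> = P2 * cnj p + R2 * cnj q"
      unfolding AB_row by (simp add: algebra_simps)
    finally show ?thesis using nz by (simp add: nonzero_eq_divide_eq)
  qed
  have 2: "A$2$1 * z' + A$2$2 = (p2 * cnj p + q2 * cnj q) / of_real n"
  proof -
    have "(A$2$1 * z' + A$2$2) * of_real n = A$2$1 * (P * cnj p + R * cnj q) + A$2$2 * (p * cnj p + q * cnj q)"
      unfolding zn[symmetric] nc[symmetric] by (simp add: algebra_simps)
    also have "\<dots> = p2 * cnj p + q2 * cnj q"
      unfolding AB_row by (simp add: algebra_simps)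
    finally show ?thesis using nz by (simp add: nonzero_eq_divide_eq)
  qed
  have 3: "A$1$1 * of_real (t / n) = (R2 * p - P2 * q) / of_real n"
    "A$2$1 * of_real (t / n) = (q2 * p - p2 * q) / of_real n"
    unfolding AB_row of_real_divide det[symmetric] by (simp_all add: algebra_simps)
  define m where "m = (cmod ((p2 * cnj p + q2 * cnj q) / of_real n))\<^sup>2 + (cmod ((q2 * p - p2 * q) / of_real n))\<^sup>2"
  have m: "m = n2 / n"
  proof -
    have "m = ((cmod (p2 * cnj p + q2 * cnj q))\<^sup>2 + (cmod (q2 * p - p2 * q))\<^sup>2) / n\<^sup>2"
      unfolding m_def norm_divide power_divide using n by (simp add: add_divide_distrib[symmetric])
    also have "\<dots> = n * n2 / n\<^sup>2"
      unfolding lagrange_identity n_def n2_def ..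
    finally show ?thesis
      using n by (simp add: power2_eq_square)
  qed
  have "act A (act B x) = (((P2 * cnj p + R2 * cnj q) / of_real n * cnj ((p2 * cnj p + q2 * cnj q) / of_real n) +
      (R2 * p - P2 * q) / of_real n * cnj ((q2 * p - p2 * q) / of_real n)) / of_real m, t / n / m)"
    unfolding Bx m_def by (rule act_eq) (simp_all only: 1 2 3)
  also have "(P2 * cnj p + R2 * cnj q) / of_real n * cnj ((p2 * cnj p + q2 * cnj q) / of_real n) +
      (R2 * p - P2 * q) / of_real n * cnj ((q2 * p - p2 * q) / of_real n) =
      ((P2 * cnj p + R2 * cnj q) * cnj (p2 * cnj p + q2 * cnj q) + (R2 * p - P2 * q) * cnj (q2 * p - p2 * q)) / (of_real n * of_real n)"
    by (simp only: complex_cnj_divide complex_cnj_complex_of_real times_divide_times_eq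
        add_divide_distrib[symmetric])
  also have "\<dots> = (P2 * cnj p2 + R2 * cnj q2) / of_real n"
    unfolding hermitian_identity nc[symmetric] using nz by simp
  finally show ?thesis
    unfolding AB m using n n2 by simp
qed

lemma act_mat1 [simp]: "act (mat 1) x = x"
  by (cases x) (simp add: act_def Let_def)

lemma act_uminus [simp]: "act (- A) x = act A x"
proof (cases x)
  case (Pair z t)
  show ?thesis
    unfolding Pair act_eq[OF refl refl refl refl, of A]
    by (subst act_eq[of "- (A$1$1 * z + A$1$2)" _ _ "- (A$1$1 * of_real t)" _ "- (A$2$1 * z + A$2$2)" "- (A$2$1 * of_real t)"])
       (simp_all only: norm_minus_cancel complex_cnj_minus minus_mult_minus, simp_all)
qed

lemma act_peq: "A \<doteq> B \<Longrightarrow> act A x = act B x"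
  by (auto simp: peq_def)

lemma act_minv: "det A = 1 \<Longrightarrow> x \<in> H3 \<Longrightarrow> act (minv A) (act A x) = x" "det A = 1 \<Longrightarrow> x \<in> H3 \<Longrightarrow> act A (act (minv A) x) = x"
  by (simp_all add: act_mult[symmetric] minv_left minv_right)

lemma act_translation [simp]: "act (translation w) (z, t) = (z + w, t)"
  by (simp add: act_def Let_def)

lemma open_H3 [simp]: "open H3"
proof -
  have *: "H3 = UNIV \<times> {0<..}" by (auto simp: H3_def)
  show ?thesis unfolding * by (intro open_Times open_UNIV open_greaterThan)
qed

lemma convex_H3: "convex H3"
proof -
  have *: "H3 = UNIV \<times> {0<..}" by (auto simp: H3_def)
  show ?thesis unfolding * by (intro convex_Times convex_UNIV convex_real_interval)
qed

lemma continuous_on_act: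
  assumes "det A = 1"
  shows "continuous_on H3 (act A)"
proof -
  have "(cmod (A$2$1 * fst x + A$2$2))\<^sup>2 + (cmod (A$2$1))\<^sup>2 * (snd x)\<^sup>2 \<noteq> 0" if "x \<in> H3" for x
    using act_den_pos[OF assms that] unfolding act_den_def by linarith
  then show ?thesis
    unfolding act_def Let_def by (auto intro!: continuous_intros simp del: of_real_add of_real_power)
qed

lemma homeomorphism_act:
  assumes "det A = 1"
  shows "homeomorphism H3 H3 (act A) (act (minv A))"
  unfolding homeomorphism_def
  using assms act_minv[of A] act_in_H3[of A] act_in_H3[of "minv A"] continuous_on_act[of A] continuous_on_act[of "minv A"]
  by (auto simp: image_iff) (metis, metis)

lemma open_act_image:
  assumes "det A = 1" "open U" "U \<subseteq> H3"
  shows "open (act A ` U)"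
  using homeomorphism_imp_open_map[OF homeomorphism_act[OF assms(1)], of U] assms
  by (metis open_H3 open_subset openin_open_eq openin_subset)

section \<open>Discrete groups\<close>

text \<open>Discreteness in sequential form, the shape in which it meets sequences of words and
  limits of conjugates.\<close>

definition discrete_group :: "(complex^2^2) set \<Rightarrow> bool" where
  "discrete_group \<Gamma> \<longleftrightarrow> subgroup \<Gamma> SL2C \<and> - mat 1 \<in> \<Gamma> \<and>
     (\<forall>g A. range g \<subseteq> \<Gamma> \<longrightarrow> A \<in> \<Gamma> \<longrightarrow> g \<longlonglongrightarrow> A \<longrightarrow> (\<forall>\<^sub>F n in sequentially. g n = A))"

lemma tendsto_mat_iff:
  fixes f :: "'a \<Rightarrow> complex^2^2"
  shows "(f \<longlongrightarrow> A) F \<longleftrightarrow> (\<forall>i j. ((\<lambda>x. f x $ i $ j) \<longlongrightarrow> A $ i $ j) F)"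
proof
  assume "\<forall>i j. ((\<lambda>x. f x $ i $ j) \<longlongrightarrow> A $ i $ j) F"
  then show "(f \<longlongrightarrow> A) F"
    by (intro vec_tendstoI) blast
qed (intro allI tendsto_vec_nth)

lemma tendsto_matrix_mult:
  fixes f g :: "'a \<Rightarrow> complex^2^2"
  assumes "(f \<longlongrightarrow> A) F" "(g \<longlongrightarrow> B) F"
  shows "((\<lambda>x. f x ** g x) \<longlongrightarrow> A ** B) F"
  unfolding tendsto_mat_iff matrix_mult_nth
  by (intro allI tendsto_add tendsto_mult tendsto_vec_nth assms)

lemma tendsto_minv:
  assumes "(f \<longlongrightarrow> A) F"
  shows "((\<lambda>x. minv (f x)) \<longlongrightarrow> minv A) F"
  unfolding tendsto_mat_iff forall_2 minv_nth
  by (intro conjI tendsto_minus tendsto_vec_nth assms)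

lemma discrete_group_iff: "discrete_group \<Gamma> \<longleftrightarrow> subgroup \<Gamma> SL2C \<and> - mat 1 \<in> \<Gamma> \<and> discrete \<Gamma>"
proof -
  have "(\<forall>g. range g \<subseteq> \<Gamma> \<longrightarrow> g \<longlonglongrightarrow> A \<longrightarrow> (\<forall>\<^sub>F n in sequentially. g n = A)) \<longleftrightarrow> A isolated_in \<Gamma>" if "A \<in> \<Gamma>" for A
  proof
    assume *: "\<forall>g. range g \<subseteq> \<Gamma> \<longrightarrow> g \<longlonglongrightarrow> A \<longrightarrow> (\<forall>\<^sub>F n in sequentially. g n = A)"
    show "A isolated_in \<Gamma>"
      unfolding isolated_in_islimpt_iff islimpt_sequential
    proof (intro conjI notI that)
      assume "\<exists>f. (\<forall>n. f n \<in> \<Gamma> - {A}) \<and> f \<longlonglongrightarrow> A"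
      then obtain f where "\<forall>n. f n \<in> \<Gamma> - {A}" "f \<longlonglongrightarrow> A" by blast
      then have "\<forall>\<^sub>F n in sequentially. f n = A" "\<And>n. f n \<noteq> A" using * by blast+
      then show False by (auto simp: eventually_sequentially)
    qed
  next
    assume "A isolated_in \<Gamma>"
    then obtain T where "open T" "T \<inter> \<Gamma> = {A}" by (auto elim: isolated_inE)
    then show "\<forall>g. range g \<subseteq> \<Gamma> \<longrightarrow> g \<longlonglongrightarrow> A \<longrightarrow> (\<forall>\<^sub>F n in sequentially. g n = A)"
      by (auto elim!: eventually_mono dest!: topological_tendstoD[of _ A _ T])
  qed
  then show ?thesis
    unfolding discrete_group_def discrete_def by blast
qed

lemma discrete_groupD:
  assumes "discrete_group \<Gamma>"
  shows "subgroup \<Gamma> SL2C" "- mat 1 \<in> \<Gamma>" "mat 1 \<in> \<Gamma>" "A \<in> \<Gamma> \<Longrightarrow> det A = 1"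
    "A \<in> \<Gamma> \<Longrightarrow> B \<in> \<Gamma> \<Longrightarrow> A ** B \<in> \<Gamma>" "A \<in> \<Gamma> \<Longrightarrow> minv A \<in> \<Gamma>" "A \<in> \<Gamma> \<Longrightarrow> - A \<in> \<Gamma>"
proof -
  show "subgroup \<Gamma> SL2C" "- mat 1 \<in> \<Gamma>" using assms by (auto simp: discrete_group_def)
  note sg = subgroup_SL2C_D[OF this(1)]
  show "mat 1 \<in> \<Gamma>" "A \<in> \<Gamma> \<Longrightarrow> det A = 1" "A \<in> \<Gamma> \<Longrightarrow> B \<in> \<Gamma> \<Longrightarrow> A ** B \<in> \<Gamma>" "A \<in> \<Gamma> \<Longrightarrow> minv A \<in> \<Gamma>"
    using sg by auto
  show "A \<in> \<Gamma> \<Longrightarrow> - A \<in> \<Gamma>"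
    using sg(3)[OF \<open>- mat 1 \<in> \<Gamma>\<close>, of A] by (simp add: matrix_mult_uminus)
qed

lemma discrete_group_lim:
  assumes "discrete_group \<Gamma>" "range g \<subseteq> \<Gamma>" "A \<in> \<Gamma>" "g \<longlonglongrightarrow> A"
  shows "\<forall>\<^sub>F n in sequentially. g n = A"
  using assms unfolding discrete_group_def by blast

text \<open>An accumulation point of \<Gamma> might lie outside \<Gamma>, where discreteness says
  nothing. But the quotients of consecutive terms of a convergent sequence lie in \<Gamma> and tend
  to 1, so they are eventually 1 and the sequence is eventually constant.\<close>

lemma discrete_group_finite_bounded:
  assumes \<Gamma>: "discrete_group \<Gamma>" and S: "S \<subseteq> \<Gamma>" "bounded S"
  shows "finite S"
proof (rule ccontr)
  assume "infinite S"
  moreover have "compact (closure S)" using S(2) by (simp add: compact_closure)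
  ultimately obtain l where "l islimpt S"
    unfolding compact_eq_Bolzano_Weierstrass using closure_subset by metis
  then obtain f where f: "\<And>n. f n \<in> S - {l}" "f \<longlonglongrightarrow> l"
    unfolding islimpt_sequential by blast
  have det: "det (f n) = 1" for n
    using f S discrete_groupD[OF \<Gamma>] by blast
  have "(\<lambda>n. det (f n)) \<longlonglongrightarrow> det l"
    unfolding det_2 by (intro tendsto_diff tendsto_mult tendsto_vec_nth f(2))
  then have l: "det l = 1"
    using det by (simp add: LIMSEQ_const_iff)
  have "(\<lambda>n. minv (f n) ** f (Suc n)) \<longlonglongrightarrow> minv l ** l"
    using f(2) by (intro tendsto_matrix_mult tendsto_minv LIMSEQ_Suc)
  moreover have "range (\<lambda>n. minv (f n) ** f (Suc n)) \<subseteq> \<Gamma>"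
  proof (intro image_subsetI discrete_groupD(5,6)[OF \<Gamma>])
    show "f n \<in> \<Gamma>" for n using f S by blast
    then show "f (Suc n) \<in> \<Gamma>" for n .
  qed
  ultimately have "\<forall>\<^sub>F n in sequentially. minv (f n) ** f (Suc n) = mat 1"
    using discrete_group_lim[OF \<Gamma> _ discrete_groupD(3)[OF \<Gamma>]] unfolding minv_left[OF l] by blast
  then obtain N where N: "\<And>n. n \<ge> N \<Longrightarrow> minv (f n) ** f (Suc n) = mat 1"
    by (auto simp: eventually_sequentially)
  have "f (Suc n) = f n" if "n \<ge> N" for n
    using minv_cancel(2)[OF det, of n "f (Suc n)"] N[OF that] by simp
  then have "f (N + k) = f N" for k
    by (induction k) auto
  then have "(\<lambda>k. f (N + k)) \<longlonglongrightarrow> f N" by simp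
  moreover have "(\<lambda>k. f (N + k)) \<longlonglongrightarrow> l"
    using f(2) LIMSEQ_ignore_initial_segment[of f l N] by (simp add: add.commute)
  ultimately have "f N = l" by (rule LIMSEQ_unique)
  then show False using f(1) by blast
qed

text \<open>The denominator formula for W A, where W is the inversion: W exchanges the rows up to
  sign, so the upper row of A is governed by the image point.\<close>

lemma act_upper_row:
  assumes "det A = 1" "x \<in> H3"
  shows "(cmod (A$1$1 * fst x + A$1$2))\<^sup>2 + (cmod (A$1$1))\<^sup>2 * (snd x)\<^sup>2 =
    ((cmod (fst (act A x)))\<^sup>2 + (snd (act A x))\<^sup>2) * act_den A x"
proof -
  define W where "W = mat2 0 (-1) 1 0"
  have W: "det W = 1" by (simp add: W_def det_2)
  let ?y = "act A x"
  have n: "act_den A x > 0" "act_den (W ** A) x > 0" "act_den W ?y > 0"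
    using act_den_pos assms W act_in_H3 by (auto simp: det_mul)
  have "snd (act (W ** A) x) = snd (act W ?y)"
    using act_mult[OF W assms] by simp
  then have "snd x / act_den (W ** A) x = snd x / act_den A x / act_den W ?y"
    by (simp add: snd_act)
  then have "act_den (W ** A) x = act_den A x * act_den W ?y"
    using n assms(2) by (simp add: H3_def field_simps)
  then show ?thesis
    by (simp add: act_den_def W_def matrix_mult_nth algebra_simps)
qed

lemma norm_vec_le_sum: "norm x \<le> norm (x$1) + norm (x$2)" for x :: "'a::real_normed_vector^2"
  using L2_set_le_sum[of UNIV "\<lambda>i. norm (x$i)"] by (simp add: norm_vec_def sum_2)

text \<open>The height of the image point bounds the lower row of A through the denominator, and its
  position bounds the upper row by \<open>act_upper_row\<close>. Bounded subsets of \<Gamma> are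
  finite.\<close>

lemma finite_returning:
  assumes \<Gamma>: "discrete_group \<Gamma>" and C: "compact C" "C \<subseteq> H3"
  shows "finite {A \<in> \<Gamma>. \<exists>x\<in>C. act A x \<in> C}" (is "finite ?S")
proof (cases "C = {}")
  case False
  have "compact (snd ` C)" "snd ` C \<noteq> {}"
    using C False by (auto intro!: compact_continuous_image continuous_intros)
  then obtain l where l: "l \<in> snd ` C" "\<And>t. t \<in> snd ` C \<Longrightarrow> l \<le> t"
    using compact_attains_inf by metis
  have lpos: "l > 0" using l C by (auto simp: H3_def)
  obtain m where m: "\<And>x. x \<in> C \<Longrightarrow> norm x \<le> m" "m > 0"
    using compact_imp_bounded[OF C(1)] by (auto simp: bounded_pos)
  have mC: "cmod (fst x) \<le> m" "snd x \<le> m" "l \<le> snd x" if "x \<in> C" for x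
    using m(1)[OF that] norm_fst_le[of "fst x" "snd x"] norm_snd_le[of "snd x" "fst x"] l(2) that by auto
  define e where "e = m / l"
  have e: "e > 0" using lpos m by (simp add: e_def)
  define E where "E = 2 * m * m * e"
  have bnd: "cmod c \<le> r / l \<and> cmod d \<le> r + r / l * m"
    if "(cmod (c * z + d))\<^sup>2 + (cmod c)\<^sup>2 * t\<^sup>2 \<le> r\<^sup>2" "r \<ge> 0" "t \<ge> l" "cmod z \<le> m" for c d z r t
  proof -
    have "(cmod c * l)\<^sup>2 \<le> (cmod c)\<^sup>2 * t\<^sup>2"
      unfolding power_mult_distrib using that(3) lpos by (intro mult_left_mono power_mono) auto
    also have "\<dots> \<le> r\<^sup>2" using that(1) zero_le_power2[of "cmod (c * z + d)"] by linarith
    finally have "cmod c * l \<le> r" using that(2) by (rule power2_le_imp_le)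
    then have c: "cmod c \<le> r / l" using lpos by (simp add: field_simps)
    have "(cmod (c * z + d))\<^sup>2 \<le> r\<^sup>2"
      using that(1) zero_le_power2[of "cmod c * t"] unfolding power_mult_distrib by linarith
    then have "cmod (c * z + d) \<le> r" using that(2) by (rule power2_le_imp_le)
    moreover have "cmod d \<le> cmod (c * z + d) + cmod (c * z)"
      by (metis add_diff_cancel_left' norm_triangle_ineq4)
    moreover have "cmod (c * z) \<le> r / l * m"
      unfolding norm_mult using c that lpos by (intro mult_mono) auto
    ultimately show ?thesis using c by linarith
  qed
  have "bounded ?S"
  proof -
    define r1 r2 where "r1 = sqrt e" "r2 = sqrt E"
    have r: "r1 \<ge> 0" "r2 \<ge> 0" "r1\<^sup>2 = e" "r2\<^sup>2 = E"
      using e m by (auto simp: r1_r2_def E_def)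
    define Bd where "Bd = r1 / l + (r1 + r1 / l * m) + r2 / l + (r2 + r2 / l * m)"
    have "norm A \<le> 4 * Bd" if A: "A \<in> ?S" for A
    proof -
      obtain x where x: "x \<in> C" "act A x \<in> C" using A by blast
      have d: "det A = 1" and xH: "x \<in> H3" using A x C discrete_groupD[OF \<Gamma>] by auto
      have dp: "act_den A x > 0" using act_den_pos d xH by blast
      have "act_den A x = snd x / snd (act A x)"
        using xH dp by (simp add: snd_act H3_def)
      also have "\<dots> \<le> m / l"
        using mC[OF x(1)] mC[OF x(2)] lpos m by (intro frac_le) auto
      finally have den: "act_den A x \<le> e" by (simp add: e_def)
      have "(cmod (A$1$1 * fst x + A$1$2))\<^sup>2 + (cmod (A$1$1))\<^sup>2 * (snd x)\<^sup>2 \<le> (m\<^sup>2 + m\<^sup>2) * e"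
        unfolding act_upper_row[OF d xH]
        using mC[OF x(2)] den dp lpos m by (intro mult_mono add_mono power_mono) auto
      also have "\<dots> = E" by (simp add: E_def power2_eq_square)
      finally have up: "(cmod (A$1$1 * fst x + A$1$2))\<^sup>2 + (cmod (A$1$1))\<^sup>2 * (snd x)\<^sup>2 \<le> r2\<^sup>2"
        using r by simp
      have lo: "(cmod (A$2$1 * fst x + A$2$2))\<^sup>2 + (cmod (A$2$1))\<^sup>2 * (snd x)\<^sup>2 \<le> r1\<^sup>2"
        using den r by (simp add: act_den_def)
      have "cmod (A$1$1) \<le> r2 / l" "cmod (A$1$2) \<le> r2 + r2 / l * m"
        "cmod (A$2$1) \<le> r1 / l" "cmod (A$2$2) \<le> r1 + r1 / l * m"
        using bnd[OF up r(2)] bnd[OF lo r(1)] mC[OF x(1)] by auto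
      moreover have "0 \<le> r1 / l" "0 \<le> r2 / l" "0 \<le> r1 / l * m" "0 \<le> r2 / l * m"
        using r lpos m by auto
      ultimately have "cmod (A$1$1) \<le> Bd" "cmod (A$1$2) \<le> Bd" "cmod (A$2$1) \<le> Bd" "cmod (A$2$2) \<le> Bd"
        unfolding Bd_def using r(1,2) by linarith+
      moreover have "norm A \<le> cmod (A$1$1) + cmod (A$1$2) + cmod (A$2$1) + cmod (A$2$2)"
        using norm_vec_le_sum[of A] norm_vec_le_sum[of "A$1"] norm_vec_le_sum[of "A$2"] by simp
      ultimately show ?thesis by linarith
    qed
    then show ?thesis by (auto simp: bounded_iff)
  qed
  then show ?thesis
    by (rule discrete_group_finite_bounded[OF \<Gamma>, rotated]) blast
qed auto

text \<open>Only finitely many elements return a compact neighbourhood of x and y to itself. Each of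
  those not taking x to y is excluded by separating its image of x from y, and finitely many such
  conditions can be intersected.\<close>

lemma separating_neighbourhoods:
  assumes \<Gamma>: "discrete_group \<Gamma>" and xy: "x \<in> H3" "y \<in> H3"
  obtains U V where "open U" "open V" "x \<in> U" "y \<in> V" "U \<subseteq> H3" "V \<subseteq> H3"
    "\<And>A. A \<in> \<Gamma> \<Longrightarrow> act A ` U \<inter> V \<noteq> {} \<Longrightarrow> act A x = y"
proof -
  obtain r where r: "r > 0" "cball x r \<subseteq> H3" using xy(1) open_contains_cball open_H3 by blast
  obtain s where s: "s > 0" "cball y s \<subseteq> H3" using xy(2) open_contains_cball open_H3 by blast
  define C where "C = cball x r \<union> cball y s"
  define S where "S = {A \<in> \<Gamma>. \<exists>x\<in>C. act A x \<in> C}"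
  have "finite S"
    unfolding S_def by (rule finite_returning[OF \<Gamma>]) (use r s in \<open>auto simp: C_def\<close>)
  have "\<exists>U V. open U \<and> open V \<and> x \<in> U \<and> y \<in> V \<and> (act A x \<noteq> y \<longrightarrow> act A ` (U \<inter> H3) \<inter> V = {})" if "A \<in> S" for A
  proof (cases "act A x = y")
    case True
    then show ?thesis by (intro exI[of _ UNIV]) auto
  next
    case False
    then obtain U' V where V: "open U'" "open V" "act A x \<in> U'" "y \<in> V" "U' \<inter> V = {}"
      using hausdorff by metis
    have "det A = 1" using that discrete_groupD[OF \<Gamma>] by (auto simp: S_def)
    then have "open (H3 \<inter> act A -` U')"
      using V(1) continuous_on_act continuous_on_open_vimage[of H3 "act A"] by (auto simp: Int_commute)
    then show ?thesis
      using V xy by (intro exI[of _ "H3 \<inter> act A -` U'"] exI[of _ V]) auto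
  qed
  then have "\<forall>A\<in>S. \<exists>W. open (fst W) \<and> open (snd W) \<and> x \<in> fst W \<and> y \<in> snd W \<and>
      (act A x \<noteq> y \<longrightarrow> act A ` (fst W \<inter> H3) \<inter> snd W = {})"
    by (metis fst_conv snd_conv)
  from bchoice[OF this] obtain W where W: "\<And>A. A \<in> S \<Longrightarrow> open (fst (W A)) \<and> open (snd (W A)) \<and>
      x \<in> fst (W A) \<and> y \<in> snd (W A) \<and> (act A x \<noteq> y \<longrightarrow> act A ` (fst (W A) \<inter> H3) \<inter> snd (W A) = {})"
    by blast
  define Uf Vf where "Uf A = fst (W A)" "Vf A = snd (W A)" for A
  note UV = W[folded Uf_Vf_def]
  define U V where "U = ball x r \<inter> (\<Inter>A\<in>S. Uf A)" "V = ball y s \<inter> (\<Inter>A\<in>S. Vf A)"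
  show ?thesis
  proof (rule that)
    show "open U" "open V" using UV \<open>finite S\<close> by (auto simp: U_V_def intro!: open_Int open_INT)
    show "x \<in> U" "y \<in> V" using UV r s by (auto simp: U_V_def)
    show UH: "U \<subseteq> H3" "V \<subseteq> H3" using r s by (auto simp: U_V_def)
    fix A assume A: "A \<in> \<Gamma>" "act A ` U \<inter> V \<noteq> {}"
    then obtain a where a: "a \<in> U" "act A a \<in> V" by blast
    then have "a \<in> C" "act A a \<in> C"
      unfolding C_def U_V_def by (auto simp: ball_subset_cball[THEN subsetD])
    then have "A \<in> S" unfolding S_def using A(1) by blast
    moreover have "act A ` (Uf A \<inter> H3) \<inter> Vf A \<noteq> {}"
      using A(2) UH(1) \<open>A \<in> S\<close> unfolding U_V_def by blast
    ultimately show "act A x = y" using UV by blast  qed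
qed

text \<open>A quotient map \<open>P\<close> from \<open>\<H>\<^sup>3\<close> to a space \<open>M\<close> whose fibres are the orbits of \<open>\<Gamma>\<close>; unlike the
  orbit space itself this notion is stable under conjugation of \<open>\<Gamma>\<close>.\<close>

definition orbit_map :: "(complex^2^2) set \<Rightarrow> 'a topology \<Rightarrow> (point \<Rightarrow> 'a) \<Rightarrow> bool" where
  "orbit_map \<Gamma> M P \<longleftrightarrow> continuous_map (top_of_set H3) M P \<and> open_map (top_of_set H3) M P \<and>
     P ` H3 = topspace M \<and> (\<forall>x\<in>H3. \<forall>y\<in>H3. P x = P y \<longleftrightarrow> (\<exists>A\<in>\<Gamma>. y = act A x))"

lemma orbit_mapD:
  assumes "orbit_map \<Gamma> M P"
  shows "openin M V \<Longrightarrow> open {x \<in> H3. P x \<in> V}" "open U \<Longrightarrow> U \<subseteq> H3 \<Longrightarrow> openin M (P ` U)"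
    "x \<in> H3 \<Longrightarrow> P x \<in> topspace M" "P ` H3 = topspace M"
    "x \<in> H3 \<Longrightarrow> y \<in> H3 \<Longrightarrow> P x = P y \<longleftrightarrow> (\<exists>A\<in>\<Gamma>. y = act A x)"
proof -
  show "open {x \<in> H3. P x \<in> V}" if "openin M V"
  proof -
    have "openin (top_of_set H3) {x \<in> topspace (top_of_set H3). P x \<in> V}"
      by (rule openin_continuous_map_preimage) (use assms that in \<open>auto simp: orbit_map_def\<close>)
    then show ?thesis by (simp add: openin_open_eq)
  qed
  show "openin M (P ` U)" if "open U" "U \<subseteq> H3"
    using assms that by (auto simp: orbit_map_def open_map_def openin_open_eq)
qed (use assms in \<open>auto simp: orbit_map_def\<close>)

lemma orbit_map_act:
  assumes "orbit_map \<Gamma> M P" "discrete_group \<Gamma>" "A \<in> \<Gamma>" "x \<in> H3"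
  shows "P (act A x) = P x"
  using orbit_mapD(5)[OF assms(1,4), of "act A x"] act_in_H3 discrete_groupD(4)[OF assms(2,3)] assms(3,4)
  by auto

lemma orbit_map_orbit_space:
  assumes "discrete_group \<Gamma>"
  shows "orbit_map \<Gamma> (orbit_space \<Gamma>) (orbit \<Gamma>)"
  unfolding orbit_map_def
proof (intro conjI ballI)
  note dg = discrete_groupD[OF assms]
  have orb: "orbit \<Gamma> x = orbit \<Gamma> y \<longleftrightarrow> (\<exists>A\<in>\<Gamma>. y = act A x)" if xy: "x \<in> H3" "y \<in> H3" for x y
  proof
    assume "orbit \<Gamma> x = orbit \<Gamma> y"
    moreover have "y \<in> orbit \<Gamma> y" unfolding orbit_def using dg(3) by (force intro: image_eqI[of _ _ "mat 1"])
    ultimately show "\<exists>A\<in>\<Gamma>. y = act A x" unfolding orbit_def by auto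
  next
    assume "\<exists>A\<in>\<Gamma>. y = act A x"
    then obtain A where A: "A \<in> \<Gamma>" "y = act A x" by blast
    have "act B y \<in> orbit \<Gamma> x" if "B \<in> \<Gamma>" for B
      using act_mult[OF dg(4)[OF that] dg(4)[OF A(1)] xy(1)] dg(5)[OF that A(1)] A(2)
      unfolding orbit_def by (metis imageI)
    moreover have "act B x \<in> orbit \<Gamma> y" if "B \<in> \<Gamma>" for B
    proof -
      have "act B x = act (B ** minv A) y"
        using act_mult[OF dg(4)[OF that] _ xy(2), of "minv A"] act_minv(1)[OF dg(4)[OF A(1)] xy(1)] A
          dg(4)[OF A(1)] by simp
      then show ?thesis
        unfolding orbit_def using dg(5)[OF that dg(6)[OF A(1)]] by (metis imageI)
    qed
    ultimately show "orbit \<Gamma> x = orbit \<Gamma> y"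
      unfolding orbit_def by blast
  qed
  show "orbit \<Gamma> x = orbit \<Gamma> y \<longleftrightarrow> (\<exists>A\<in>\<Gamma>. y = act A x)" if "x \<in> H3" "y \<in> H3" for x y
    using orb that .
  show "orbit \<Gamma> ` H3 = topspace (orbit_space \<Gamma>)"
    by (simp add: topspace_orbit_space)
  show "continuous_map (top_of_set H3) (orbit_space \<Gamma>) (orbit \<Gamma>)"
    unfolding continuous_map_def by (auto simp: topspace_orbit_space openin_orbit_space)
  show "open_map (top_of_set H3) (orbit_space \<Gamma>) (orbit \<Gamma>)"
    unfolding open_map_def openin_orbit_space
  proof (intro allI impI conjI)
    fix U assume "openin (top_of_set H3) U"
    then have U: "open U" "U \<subseteq> H3" by (auto simp: openin_open_eq)
    then show "orbit \<Gamma> ` U \<subseteq> orbit \<Gamma> ` H3" by blast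
    have "{x \<in> H3. orbit \<Gamma> x \<in> orbit \<Gamma> ` U} = (\<Union>A\<in>\<Gamma>. act A ` U)"
    proof (intro equalityI subsetI)
      fix x assume "x \<in> {x \<in> H3. orbit \<Gamma> x \<in> orbit \<Gamma> ` U}"
      then obtain y where y: "x \<in> H3" "y \<in> U" "orbit \<Gamma> y = orbit \<Gamma> x" by auto
      then show "x \<in> (\<Union>A\<in>\<Gamma>. act A ` U)" using orb[of y x] U(2) by auto
    next
      fix x assume "x \<in> (\<Union>A\<in>\<Gamma>. act A ` U)"
      then obtain A y where y: "A \<in> \<Gamma>" "y \<in> U" "x = act A y" by blast
      then have "x \<in> H3" using U(2) act_in_H3 dg(4) by blast
      then show "x \<in> {x \<in> H3. orbit \<Gamma> x \<in> orbit \<Gamma> ` U}" using orb[of y x] U(2) y by blast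
    qed
    moreover have "open (\<Union>A\<in>\<Gamma>. act A ` U)"
      using open_act_image U dg(4) by blast
    ultimately show "openin (top_of_set H3) {x \<in> H3. orbit \<Gamma> x \<in> orbit \<Gamma> ` U}"
      by (metis (no_types, lifting) mem_Collect_eq open_H3 openin_open_eq subsetI)
  qed
qed

lemma orbit_map_Hausdorff:
  assumes "orbit_map \<Gamma> M P" "discrete_group \<Gamma>"
  shows "Hausdorff_space M"
  unfolding Hausdorff_space_def
proof (intro allI impI)
  fix a b assume ab: "a \<in> topspace M \<and> b \<in> topspace M \<and> a \<noteq> b"
  note P = orbit_mapD[OF assms(1)]
  obtain x y where xy: "x \<in> H3" "y \<in> H3" "a = P x" "b = P y"
    using ab P(4) by blast
  obtain U V where UV: "open U" "open V" "x \<in> U" "y \<in> V" "U \<subseteq> H3" "V \<subseteq> H3"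
    "\<And>A. A \<in> \<Gamma> \<Longrightarrow> act A ` U \<inter> V \<noteq> {} \<Longrightarrow> act A x = y"
    using separating_neighbourhoods[OF assms(2) xy(1,2)] by metis
  have "disjnt (P ` U) (P ` V)"
  proof (rule ccontr)
    assume "\<not> disjnt (P ` U) (P ` V)"
    then obtain u v where uv: "u \<in> U" "v \<in> V" "P u = P v" by (auto simp: disjnt_iff)
    then obtain A where "A \<in> \<Gamma>" "v = act A u" using P(5)[of u v] UV by blast
    then have "act A x = y" using UV(7)[of A] uv by blast
    then show False using ab xy P(5)[OF xy(1,2)] \<open>A \<in> \<Gamma>\<close> by blast
  qed
  then show "\<exists>U V. openin M U \<and> openin M V \<and> a \<in> U \<and> b \<in> V \<and> disjnt U V"
    using P(2) UV xy by blast
qed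

definition free_at :: "(complex^2^2) set \<Rightarrow> point \<Rightarrow> bool" where
  "free_at \<Gamma> x \<longleftrightarrow> (\<forall>A\<in>\<Gamma>. act A x = x \<longrightarrow> A \<doteq> mat 1)"

lemma free_at_peq:
  assumes "free_at \<Gamma> x" "discrete_group \<Gamma>" "x \<in> H3" "A \<in> \<Gamma>" "B \<in> \<Gamma>" "act A x = act B x"
  shows "A \<doteq> B"
proof -
  note dg = discrete_groupD[OF assms(2)]
  have "act (minv B ** A) x = x"
    using act_mult[of "minv B" A x] act_minv(1)[of B x] dg(4)[OF assms(4)] dg(4)[OF assms(5)] assms(3,6) by simp
  then have "minv B ** A \<doteq> mat 1"
    using assms(1) dg(5)[OF dg(6)[OF assms(5)] assms(4)] by (simp add: free_at_def)
  then have "B ** (minv B ** A) \<doteq> B ** mat 1"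
    by (intro peq_mult peq_refl)
  then show ?thesis
    unfolding minv_cancel(2)[OF dg(4)[OF assms(5)]] matrix_mul_rid .
qed

text \<open>Over the image of a small N the sheets are the translates of N. Freeness makes them
  disjoint and \<open>p\<close> injective on each; openness of \<open>p\<close> makes each
  homeomorphic to the image.\<close>

lemma covering_space_orbit_map:
  fixes p :: "point \<Rightarrow> point"
  assumes \<Gamma>: "discrete_group \<Gamma>" and H: "open H" "H \<subseteq> H3"
    and inv: "\<And>A x. A \<in> \<Gamma> \<Longrightarrow> x \<in> H \<Longrightarrow> act A x \<in> H"
    and free: "\<And>x. x \<in> H \<Longrightarrow> free_at \<Gamma> x"
    and p: "continuous_on H p" "p ` H = Y" "\<And>U. open U \<Longrightarrow> U \<subseteq> H \<Longrightarrow> open (p ` U)"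
    and fib: "\<And>x y. x \<in> H \<Longrightarrow> y \<in> H \<Longrightarrow> p x = p y \<longleftrightarrow> (\<exists>A\<in>\<Gamma>. y = act A x)"
  shows "covering_space H p Y"
proof (rule covering_spaceI[OF p(1,2)])
  note dg = discrete_groupD[OF \<Gamma>]
  fix y assume "y \<in> Y"
  then obtain x where x: "x \<in> H" "y = p x" using p(2) by blast
  then have xH: "x \<in> H3" using H by blast
  obtain U V where UV: "open U" "open V" "x \<in> U" "x \<in> V" "U \<subseteq> H3" "V \<subseteq> H3"
    "\<And>A. A \<in> \<Gamma> \<Longrightarrow> act A ` U \<inter> V \<noteq> {} \<Longrightarrow> act A x = x"
    using separating_neighbourhoods[OF \<Gamma> xH xH] by metis
  define N where "N = U \<inter> V \<inter> H"
  have N: "open N" "x \<in> N" "N \<subseteq> H" using UV H x by (auto simp: N_def)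
  have sep: "A \<doteq> mat 1" if "A \<in> \<Gamma>" "act A ` N \<inter> N \<noteq> {}" for A
  proof -
    have "act A x = x" using UV(7)[OF that(1)] that(2) by (auto simp: N_def)
    then show ?thesis using free[OF x(1)] that(1) by (simp add: free_at_def)
  qed
  define T where "T = p ` N"
  have oY: "open Y" using p(2,3) H by blast
  have T: "open T" "T \<subseteq> Y" using p N by (auto simp: T_def)
  define v where "v = (\<lambda>A. act A ` N) ` \<Gamma>"
  have vH: "open u" "u \<subseteq> H" if "u \<in> v" for u
  proof -
    obtain A where A: "A \<in> \<Gamma>" "u = act A ` N" using \<open>u \<in> v\<close> by (auto simp: v_def)
    then show "u \<subseteq> H" using inv N by blast
    show "open u" using open_act_image[OF dg(4)[OF A(1)] N(1)] N(3) H(2) A(2) by blast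
  qed
  show "\<exists>T. y \<in> T \<and> openin (top_of_set Y) T \<and> (\<exists>v. \<Union> v = H \<inter> p -` T \<and>
      (\<forall>u\<in>v. openin (top_of_set H) u) \<and> pairwise disjnt v \<and> (\<forall>u\<in>v. \<exists>q. homeomorphism u T p q))"
  proof (intro exI[of _ T] conjI exI[of _ v] ballI)
    show "y \<in> T" using x N by (auto simp: T_def)
    show "openin (top_of_set Y) T" using T oY by (simp add: openin_open_eq)
    show "\<Union> v = H \<inter> p -` T"
    proof (intro equalityI subsetI)
      fix z assume "z \<in> \<Union> v"
      then obtain A n where A: "A \<in> \<Gamma>" "n \<in> N" "z = act A n" by (auto simp: v_def)
      then have z: "z \<in> H" "n \<in> H" using inv[OF A(1)] N(3) by blast+
      then have "p n = p z" using fib[of n z] A by blast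
      then show "z \<in> H \<inter> p -` T" using A z by (auto simp: T_def intro: image_eqI[OF sym])
    next
      fix z assume "z \<in> H \<inter> p -` T"
      then obtain n where "z \<in> H" "n \<in> N" "p n = p z" by (auto simp: T_def)
      then show "z \<in> \<Union> v" using fib[of n z] N by (auto simp: v_def)
    qed
    show "openin (top_of_set H) u" if "u \<in> v" for u
      using vH[OF that] H by (simp add: openin_open_eq)
    show "pairwise disjnt v"
      unfolding pairwise_def
    proof (intro ballI impI, rule ccontr)
      fix u u' assume u: "u \<in> v" "u' \<in> v" "u \<noteq> u'" "\<not> disjnt u u'"
      then obtain A B where A: "A \<in> \<Gamma>" "u = act A ` N" and B: "B \<in> \<Gamma>" "u' = act B ` N"
        by (auto simp: v_def)
      obtain n n' where n: "n \<in> N" "n' \<in> N" "act A n = act B n'"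
        using u(4) A B by (auto simp: disjnt_iff)
      have nH: "n \<in> H3" "n' \<in> H3" using n N H by auto
      have "act (minv B ** A) n = n'"
        using act_mult[of "minv B" A n] act_minv(1)[of B n'] nH n(3) dg(4)[OF A(1)] dg(4)[OF B(1)] by simp
      then have "minv B ** A \<doteq> mat 1"
        using sep[of "minv B ** A"] dg(5)[OF dg(6)[OF B(1)] A(1)] n by blast
      then have "B ** (minv B ** A) \<doteq> B ** mat 1" by (intro peq_mult peq_refl)
      then have "A \<doteq> B" unfolding minv_cancel(2)[OF dg(4)[OF B(1)]] matrix_mul_rid .
      then have "u = u'" using A(2) B(2) act_peq by (metis (mono_tags, lifting) image_cong)
      then show False using u(3) by blast
    qed
    show "\<exists>q. homeomorphism u T p q" if uv: "u \<in> v" for u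
    proof -
      obtain A where A: "A \<in> \<Gamma>" "u = act A ` N" using uv by (auto simp: v_def)
      have inj: "inj_on p u"
      proof (rule inj_onI)
        fix a b assume ab: "a \<in> u" "b \<in> u" "p a = p b"
        obtain n n' where n: "n \<in> N" "n' \<in> N" "a = act A n" "b = act A n'" using ab A by blast
        have "p n = p a" "p n' = p b"
          using fib[of n a] fib[of n' b] n A inv N by blast+
        then have "p n = p n'" using ab by simp
        then obtain B where B: "B \<in> \<Gamma>" "n' = act B n" using fib[of n n'] n N by blast
        then have "B \<doteq> mat 1" using sep[OF B(1)] n by blast
        then have "n' = n" using B act_peq[of B "mat 1"] by simp
        then show "a = b" using n by simp
      qed
      have im: "p ` u = T"
      proof (intro equalityI subsetI)
        fix z assume "z \<in> p ` u"
        then obtain n where "n \<in> N" "z = p (act A n)" using A by blast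
        moreover have "p n = p (act A n)" if "n \<in> N" for n using fib[of n "act A n"] A inv N that by blast
        ultimately show "z \<in> T" unfolding T_def by auto
      next
        fix z assume "z \<in> T"
        then obtain n where "n \<in> N" "z = p n" by (auto simp: T_def)
        moreover have "p n = p (act A n)" if "n \<in> N" for n using fib[of n "act A n"] A inv N that by blast
        ultimately show "z \<in> p ` u" using A by auto
      qed
      have "\<exists>q. homeomorphism u T p q"
      proof (rule homeomorphism_injective_open_map[OF _ im inj])
        show "continuous_on u p" using p(1) vH(2)[OF uv] continuous_on_subset by blast
        show "openin (top_of_set T) (p ` U)" if "openin (top_of_set u) U" for U
        proof -
          have "open U" "U \<subseteq> u" using that vH(1)[OF uv] by (auto simp: openin_open_eq)
          then have "open (p ` U)" "p ` U \<subseteq> T" using p(3)[of U] vH(2)[OF uv] im by blast+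
          then show ?thesis using T(1) by (simp add: openin_open_eq)
        qed
      qed blast
      then show ?thesis .
    qed
  qed
qed

section \<open>Connectedness after removing sets of codimension two\<close>

section \<open>Removing thin sets\<close>

text \<open>A splitting of S - Z would extend over Z: the connected set C places all of N - Z on one
  side, so adjoining such sets N to the two sides gives disjoint open sets covering S. C may be
  larger than N - Z, which allows it to be obtained by lifting.\<close>

lemma connected_diff_thin:
  fixes S :: "'a::topological_space set"
  assumes S: "connected S" and SZ: "open (S - Z)"
    and thin: "\<And>U. open U \<Longrightarrow> U \<subseteq> S \<Longrightarrow> U \<noteq> {} \<Longrightarrow> U - Z \<noteq> {}"
    and local: "\<And>z. z \<in> S \<Longrightarrow> z \<in> Z \<Longrightarrow> \<exists>N C. open N \<and> z \<in> N \<and> N \<subseteq> S \<and> connected C \<and> N - Z \<subseteq> C \<and> C \<subseteq> S - Z"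
  shows "connected (S - Z)"
proof (rule ccontr)
  assume "\<not> connected (S - Z)"
  then obtain A B where AB: "open A" "open B" "S - Z \<subseteq> A \<union> B" "A \<inter> B \<inter> (S - Z) = {}"
    "A \<inter> (S - Z) \<noteq> {}" "B \<inter> (S - Z) \<noteq> {}"
    unfolding connected_def by blast
  define A1 B1 where "A1 = A \<inter> (S - Z)" "B1 = B \<inter> (S - Z)"
  have 1: "open A1" "open B1" "A1 \<inter> B1 = {}" "A1 \<union> B1 = S - Z" "A1 \<noteq> {}" "B1 \<noteq> {}"
    using AB SZ by (auto simp: A1_B1_def)
  define A2 B2 where "A2 = \<Union>{N. open N \<and> N \<subseteq> S \<and> N - Z \<subseteq> A1}" "B2 = \<Union>{N. open N \<and> N \<subseteq> S \<and> N - Z \<subseteq> B1}"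
  have "open A2" "open B2" by (auto simp: A2_B2_def)
  have "A1 \<subseteq> A2" "B1 \<subseteq> B2" using 1 unfolding A2_B2_def by blast+
  have disj: "A2 \<inter> B2 = {}"
  proof (rule ccontr)
    assume "A2 \<inter> B2 \<noteq> {}"
    then obtain N N' where N: "open N" "N \<subseteq> S" "N - Z \<subseteq> A1" "open N'" "N' \<subseteq> S" "N' - Z \<subseteq> B1" "N \<inter> N' \<noteq> {}"
      unfolding A2_B2_def by blast
    then have "N \<inter> N' - Z \<noteq> {}" using thin[of "N \<inter> N'"] by blast
    then show False using N 1(3) by blast
  qed
  have "S \<subseteq> A2 \<union> B2"
  proof
    fix z assume z: "z \<in> S"
    show "z \<in> A2 \<union> B2"
    proof (cases "z \<in> Z")
      case True
      obtain N C where N: "open N" "z \<in> N" "N \<subseteq> S" "connected C" "N - Z \<subseteq> C" "C \<subseteq> S - Z"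
        using local[OF z True] by blast
      have "A1 \<inter> C = {} \<or> B1 \<inter> C = {}"
      proof (rule connectedD[OF N(4) 1(1,2)])
        show "A1 \<inter> B1 \<inter> C = {}" unfolding 1(3) by simp
        show "C \<subseteq> A1 \<union> B1" unfolding 1(4) by (rule N(6))
      qed
      moreover have "C \<subseteq> A1 \<union> B1" unfolding 1(4) by (rule N(6))
      ultimately have "C \<subseteq> A1 \<or> C \<subseteq> B1" by auto
      then have "N - Z \<subseteq> A1 \<or> N - Z \<subseteq> B1" using N(5) by auto
      then show ?thesis using N(1-3) unfolding A2_B2_def by auto
    next
      case False
      then show ?thesis using z 1(4) \<open>A1 \<subseteq> A2\<close> \<open>B1 \<subseteq> B2\<close> by blast
    qed
  qed
  moreover have "A2 \<inter> S \<noteq> {}" "B2 \<inter> S \<noteq> {}"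
    using 1 \<open>A1 \<subseteq> A2\<close> \<open>B1 \<subseteq> B2\<close> by blast+
  ultimately show False
    using S \<open>open A2\<close> \<open>open B2\<close> disj unfolding connected_def by blast
qed

text \<open>Quantified over all connected open sets so that the property passes to finite unions, by
  removing the members one after the other.\<close>

definition thin :: "'a::real_normed_vector set \<Rightarrow> bool" where
  "thin Z \<longleftrightarrow> closed Z \<and> (\<forall>S. open S \<longrightarrow> connected S \<longrightarrow> connected (S - Z) \<and> (S \<noteq> {} \<longrightarrow> S - Z \<noteq> {}))"

text \<open>Around a point of the set the complement is the union of four half-balls, on the two
  sides of \<phi> = a and of \<psi> = b. Each is convex and neighbouring ones meet;
  \<open>e1\<close> and \<open>e2\<close> are dual directions that exhibit points of the
  overlaps.\<close>

lemma thin_codim2: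
  assumes lin: "bounded_linear \<phi>" "bounded_linear \<psi>"
    and e: "\<phi> e1 = (1::real)" "\<psi> e1 = (0::real)" "\<phi> e2 = 0" "\<psi> e2 = 1"
  shows "thin {x. \<phi> x = a \<and> \<psi> x = b}" (is "thin ?Z")
  unfolding thin_def
proof (intro conjI allI impI)
  interpret f: bounded_linear \<phi> by (rule lin(1))
  interpret g: bounded_linear \<psi> by (rule lin(2))
  have cont: "continuous_on A \<phi>" "continuous_on A \<psi>" for A
    by (auto intro: f.continuous_on g.continuous_on continuous_on_id)
  have "closed {x. \<phi> x = a}" "closed {x. \<psi> x = b}"
    using cont by (auto intro!: closed_Collect_eq continuous_on_const)
  then show cl: "closed ?Z" by (simp add: closed_Collect_conj)
  have shift: "\<exists>d>0. \<forall>\<sigma> \<tau>. \<bar>\<sigma>\<bar> \<le> 1 \<longrightarrow> \<bar>\<tau>\<bar> \<le> 1 \<longrightarrow> z + (d * \<sigma>) *\<^sub>R e1 + (d * \<tau>) *\<^sub>R e2 \<in> ball z r"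
    if "r > 0" for z and r :: real
  proof -
    define d where "d = r / (norm e1 + norm e2 + 1)"
    have n: "norm e1 + norm e2 + 1 > 0" by (simp add: add_nonneg_pos)
    then have d: "d > 0" using that by (simp add: d_def)
    show ?thesis
    proof (intro exI[of _ d] conjI allI impI d)
      fix \<sigma> \<tau> :: real assume st: "\<bar>\<sigma>\<bar> \<le> 1" "\<bar>\<tau>\<bar> \<le> 1"
      have "norm ((d * \<sigma>) *\<^sub>R e1 + (d * \<tau>) *\<^sub>R e2) \<le> \<bar>d * \<sigma>\<bar> * norm e1 + \<bar>d * \<tau>\<bar> * norm e2"
        by (rule order_trans[OF norm_triangle_ineq]) simp
      also have "\<dots> \<le> d * norm e1 + d * norm e2"
        using st d by (intro add_mono mult_right_mono) (auto simp: abs_mult)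
      also have "\<dots> < d * (norm e1 + norm e2 + 1)" using d by (simp add: algebra_simps)
      also have "\<dots> = r" using n by (simp add: d_def)
      finally show "z + (d * \<sigma>) *\<^sub>R e1 + (d * \<tau>) *\<^sub>R e2 \<in> ball z r"
        unfolding mem_ball dist_norm by (subst norm_minus_commute) (simp add: add.assoc)
    qed
  qed
  have ne: "U - ?Z \<noteq> {}" if U: "open U" "U \<noteq> {}" for U
  proof -
    obtain z where "z \<in> U" using U by blast
    then obtain r where r: "r > 0" "ball z r \<subseteq> U" using U(1) open_contains_ball by metis
    obtain d where d: "d > 0" "\<And>\<sigma> \<tau>. \<bar>\<sigma>\<bar> \<le> 1 \<Longrightarrow> \<bar>\<tau>\<bar> \<le> 1 \<Longrightarrow> z + (d * \<sigma>) *\<^sub>R e1 + (d * \<tau>) *\<^sub>R e2 \<in> ball z r"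
      using shift[OF r(1)] by blast
    have "z \<in> U" "z + d *\<^sub>R e1 \<in> U" using d(2)[of 0 0] d(2)[of 1 0] r by auto
    moreover have "\<phi> (z + d *\<^sub>R e1) = \<phi> z + d" by (simp add: f.add f.scaleR e)
    ultimately show ?thesis using d(1) by (cases "\<phi> z = a") auto
  qed
  fix S :: "'a set" assume S: "open S" "connected S"
  show "S \<noteq> {} \<Longrightarrow> S - ?Z \<noteq> {}" by (rule ne[OF S(1)])
  show "connected (S - ?Z)"
  proof (rule connected_diff_thin[OF S(2)])
  show "open (S - ?Z)" using S(1) cl by (rule open_Diff)
  show "\<And>U. open U \<Longrightarrow> U \<subseteq> S \<Longrightarrow> U \<noteq> {} \<Longrightarrow> U - ?Z \<noteq> {}" by (rule ne)
  fix z assume z: "z \<in> S" "z \<in> ?Z"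
  then obtain r where r: "r > 0" "ball z r \<subseteq> S" using S(1) open_contains_ball by metis
  define H where "H = (\<lambda>h (c::real). ball z r \<inter> {x. h x > c})"
  have hs: "convex {x. h x > (c::real)}" if "bounded_linear h" for h and c
  proof -
    interpret hh: bounded_linear h by (rule that)
    have "{x. h x > c} = h -` {c<..}" by auto
    then show ?thesis by (metis convex_real_interval(3) convex_linear_vimage hh.linear_axioms)
  qed
  have conv: "connected (H \<phi> a)" "connected (H \<psi> b)" "connected (H (\<lambda>x. - \<phi> x) (- a))" "connected (H (\<lambda>x. - \<psi> x) (- b))"
    unfolding H_def by (intro convex_connected convex_Int convex_ball hs bounded_linear_minus lin)+
  obtain d where d: "d > 0" "\<And>\<sigma> \<tau>. \<bar>\<sigma>\<bar> \<le> 1 \<Longrightarrow> \<bar>\<tau>\<bar> \<le> 1 \<Longrightarrow> z + (d * \<sigma>) *\<^sub>R e1 + (d * \<tau>) *\<^sub>R e2 \<in> ball z r"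
    using shift[OF r(1)] by blast
  have val: "\<phi> (z + (d * \<sigma>) *\<^sub>R e1 + (d * \<tau>) *\<^sub>R e2) = a + d * \<sigma>" "\<psi> (z + (d * \<sigma>) *\<^sub>R e1 + (d * \<tau>) *\<^sub>R e2) = b + d * \<tau>" for \<sigma> \<tau>
    using z by (simp_all add: f.add f.scaleR g.add g.scaleR e)
  have "z + (d * 1) *\<^sub>R e1 + (d * 1) *\<^sub>R e2 \<in> H \<phi> a \<inter> H \<psi> b"
    "z + (d * 1) *\<^sub>R e1 + (d * (-1)) *\<^sub>R e2 \<in> H \<phi> a \<inter> H (\<lambda>x. - \<psi> x) (- b)"
    "z + (d * (-1)) *\<^sub>R e1 + (d * 1) *\<^sub>R e2 \<in> H \<psi> b \<inter> H (\<lambda>x. - \<phi> x) (- a)"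
    unfolding H_def using d(2)[of 1 1] d(2)[of 1 "-1"] d(2)[of "-1" 1] val[of 1 1] val[of 1 "-1"] val[of "-1" 1] d(1)
    by simp_all
  then have "connected ((H \<phi> a \<union> H (\<lambda>x. - \<psi> x) (- b)) \<union> (H \<psi> b \<union> H (\<lambda>x. - \<phi> x) (- a)))"
    by (intro connected_Un conv) blast+
  moreover have "(H \<phi> a \<union> H (\<lambda>x. - \<psi> x) (- b)) \<union> (H \<psi> b \<union> H (\<lambda>x. - \<phi> x) (- a)) = ball z r - ?Z"
    unfolding H_def by auto
  ultimately show "\<exists>N C. open N \<and> z \<in> N \<and> N \<subseteq> S \<and> connected C \<and> N - ?Z \<subseteq> C \<and> C \<subseteq> S - ?Z"
    using r by (intro exI[of _ "ball z r"] exI[of _ "ball z r - ?Z"]) auto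
  qed
qed

text \<open>The arc is the radial projection of a convex cone. For unit w, |v - w|^2 = 2 - 2 Re
  (conj v w), so |v - w| < d means Re (conj v w) > 1 - d^2/2, which is the constant
  \<open>c\<close>.\<close>

lemma connected_circle_arc:
  assumes v: "cmod v = 1" and d: "0 < d" "d \<le> 1"
  shows "connected (circle \<inter> ball v d)"
proof -
  define c where "c = 1 - d\<^sup>2 / 2"
  have c: "c > 0" using d power_le_one[of d 2] by (simp add: c_def)
  define W where "W = {w. c * cmod w < Re (cnj v * w)}"
  have dist: "(dist v w)\<^sup>2 = 2 - 2 * Re (cnj v * w)" if "cmod w = 1" for w
  proof -
    have "(cmod (v - w))\<^sup>2 = (cmod v)\<^sup>2 + (cmod w)\<^sup>2 - 2 * Re (cnj v * w)"
      unfolding cmod_power2 by (simp add: power2_eq_square algebra_simps)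
    then show ?thesis using v that by (simp add: dist_norm)
  qed
  have "convex W"
    unfolding W_def convex_alt
  proof (intro ballI allI impI, unfold mem_Collect_eq)
    fix x y :: complex and u :: real
    assume *: "c * cmod x < Re (cnj v * x)" "c * cmod y < Re (cnj v * y)" "0 \<le> u \<and> u \<le> 1"
    have "c * cmod ((1 - u) *\<^sub>R x + u *\<^sub>R y) \<le> c * ((1 - u) * cmod x + u * cmod y)"
      using * c norm_triangle_ineq[of "(1 - u) *\<^sub>R x" "u *\<^sub>R y"] by (intro mult_left_mono) auto
    also have "\<dots> = (1 - u) * (c * cmod x) + u * (c * cmod y)" by (simp add: algebra_simps)
    also have "\<dots> < (1 - u) * Re (cnj v * x) + u * Re (cnj v * y)"
    proof (cases "u = 0")
      case False
      then have "u * (c * cmod y) < u * Re (cnj v * y)" using * by simp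
      moreover have "(1 - u) * (c * cmod x) \<le> (1 - u) * Re (cnj v * x)" using * by (intro mult_left_mono) auto
      ultimately show ?thesis by linarith
    qed (use * in simp)
    also have "\<dots> = Re (cnj v * ((1 - u) *\<^sub>R x + u *\<^sub>R y))"
      by (simp add: algebra_simps)
    finally show "c * cmod ((1 - u) *\<^sub>R x + u *\<^sub>R y) < Re (cnj v * ((1 - u) *\<^sub>R x + u *\<^sub>R y))" .
  qed
  moreover have W0: "w \<noteq> 0" if "w \<in> W" for w using that by (auto simp: W_def)
  ultimately have "connected (sgn ` W)"
    by (intro connected_continuous_image convex_connected) (auto intro!: continuous_intros)
  moreover have "sgn ` W = circle \<inter> ball v d"
  proof (intro equalityI subsetI)
    fix w assume "w \<in> sgn ` W"
    then obtain x where x: "x \<in> W" "w = sgn x" by blast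
    have w1: "cmod w = 1" using x W0 by (simp add: norm_sgn)
    have "Re (cnj v * w) = Re (cnj v * x) / cmod x"
      using x by (simp add: sgn_div_norm scaleR_conv_of_real field_simps)
    also have "\<dots> > c" using x W0[OF x(1)] by (simp add: W_def field_simps)
    finally have "(dist v w)\<^sup>2 < d\<^sup>2" using dist[OF w1] by (simp add: c_def)
    then show "w \<in> circle \<inter> ball v d" using w1 d by (simp add: power2_less_imp_less)
  next
    fix w assume "w \<in> circle \<inter> ball v d"
    then have w: "cmod w = 1" "(dist v w)\<^sup>2 < d\<^sup>2" using d by (auto intro: power_strict_mono)
    then have "w \<in> W" using dist[OF w(1)] by (simp add: W_def c_def)
    moreover have "sgn w = w" using w by (simp add: sgn_div_norm)
    ultimately show "w \<in> sgn ` W" by (metis imageI)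
  qed
  ultimately show ?thesis by simp
qed

section \<open>Fixed points of elliptic elements\<close>

text \<open>With a, b, c, d the entries of A, a root z of c z^2 + (d - a) z - b is a fixed point of
  the Moebius map; w -> -1/(w - z) sends it to infinity.\<close>

lemma upper_triangular_conjugate:
  assumes "det A = 1"
  shows "\<exists>C. det C = 1 \<and> conj_by C A $ 2 $ 1 = 0"
proof (cases "A$2$1 = 0")
  case True
  then show ?thesis by (intro exI[of _ "mat 1"]) (simp add: conj_by_def)
next
  case False
  define D where "D = csqrt ((A$1$1 + A$2$2)\<^sup>2 - 4)"
  define z where "z = (A$1$1 - A$2$2 + D) / (2 * A$2$1)"
  have D: "D\<^sup>2 = (A$1$1 + A$2$2)\<^sup>2 - 4" by (simp add: D_def)
  have z: "2 * A$2$1 * z = A$1$1 - A$2$2 + D" using False by (simp add: z_def)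
  have d: "A$1$1 * A$2$2 - A$1$2 * A$2$1 = 1" using assms by (simp add: det_2)
  have "4 * A$2$1 * (A$2$1 * z\<^sup>2 + (A$2$2 - A$1$1) * z - A$1$2) = 0"
    using z D d by Groebner_Basis.algebra
  then have z0: "A$2$1 * z\<^sup>2 + (A$2$2 - A$1$1) * z - A$1$2 = 0" using False by simp
  show ?thesis
    by (intro exI[of _ "mat2 0 (-1) 1 (- z)"])
       (use z0 in \<open>simp add: det_2 conj_by_def matrix_mult_nth power2_eq_square algebra_simps\<close>)
qed

text \<open>A fixed point of positive height forces |d| = 1, so the map is z -> a^2 z + a b at
  constant height. If a^2 were 1 it would be trivial; otherwise it rotates about a vertical
  line.\<close>

lemma upper_triangular_fixed_points:
  assumes B: "det B = 1" "B$2$1 = 0" "\<not> B \<doteq> mat 1" and x: "x \<in> H3" "act B x = x"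
  shows "\<exists>z. {y \<in> H3. act B y = y} = {y \<in> H3. fst y = z}"
proof -
  define a b d where "a = B$1$1" "b = B$1$2" "d = B$2$2"
  have ad: "a * d = 1" using B by (simp add: det_2 a_b_d_def)
  have d0: "d \<noteq> 0" "a \<noteq> 0" using ad by auto
  have actB: "act B y = ((a * fst y + b) * cnj d / of_real ((cmod d)\<^sup>2), snd y / (cmod d)\<^sup>2)" for y
    using B(2) by (simp add: act_def Let_def a_b_d_def)
  have "snd x = snd x / (cmod d)\<^sup>2" using x(2) actB[of x] by (metis snd_conv)
  then have "(cmod d)\<^sup>2 = 1" using x(1) d0 by (simp add: H3_def field_simps)
  then have act1: "act B y = ((a * fst y + b) * cnj d, snd y)" for y using actB[of y] by simp
  have dd: "d * cnj d = 1" using \<open>(cmod d)\<^sup>2 = 1\<close> complex_norm_square[of d] by simp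
  then have "cnj d = a" using ad d0 by (metis mult.commute mult_left_cancel)
  then have act2: "act B y = (a\<^sup>2 * fst y + a * b, snd y)" for y
    using act1[of y] by (simp add: power2_eq_square algebra_simps)
  have a2: "a\<^sup>2 \<noteq> 1"
  proof
    assume a2: "a\<^sup>2 = 1"
    then have "a * b = 0" using act2[of x] x(2) by (cases x) simp
    then have "b = 0" using d0 by simp
    moreover have "a = 1 \<or> a = - 1" using a2 by (simp add: power2_eq_1_iff)
    moreover have "d = a" using ad a2 d0 by (metis mult_left_cancel power2_eq_square)
    ultimately have "B \<doteq> mat 1"
      using B(2) by (auto simp: peq_def mat_eq_iff a_b_d_def)
    then show False using B(3) by blast
  qed
  define z where "z = a * b / (1 - a\<^sup>2)"
  have "act B y = y \<longleftrightarrow> fst y = z" for y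
  proof -
    have "act B y = y \<longleftrightarrow> a\<^sup>2 * fst y + a * b = fst y" using act2[of y] by (cases y) auto
    also have "\<dots> \<longleftrightarrow> fst y * (1 - a\<^sup>2) = a * b" by (auto simp: algebra_simps)
    also have "\<dots> \<longleftrightarrow> fst y = z" using a2 by (simp add: z_def nonzero_eq_divide_eq)
    finally show ?thesis .
  qed
  then show ?thesis by blast
qed

text \<open>After conjugation the axis is a vertical line, which has codimension two and does not
  disconnect a ball; the ball is carried back by the conjugating isometry.\<close>

lemma elliptic_local_complement:
  assumes A: "det A = 1" "\<not> A \<doteq> mat 1" and x: "x \<in> H3" "act A x = x" and N: "open N" "x \<in> N" "N \<subseteq> H3"
  shows "\<exists>N'. open N' \<and> x \<in> N' \<and> N' \<subseteq> N \<and> connected (N' - {y. act A y = y})"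
proof -
  obtain C where C: "det C = 1" "conj_by C A $ 2 $ 1 = 0"
    using upper_triangular_conjugate[OF A(1)] by blast
  define B where "B = conj_by C A"
  have B: "det B = 1" using A C by (simp add: B_def det_conj_by)
  have Ci: "det (minv C) = 1" using C by simp
  have AB: "A = conj_by (minv C) B"
    by (simp add: B_def conj_by_def matrix_mul_assoc[symmetric] minv_cancel C minv_left)
  have BN: "\<not> B \<doteq> mat 1"
    using A(2) peq_conj_by[of B "mat 1" "minv C"] AB conj_by_mat1[OF Ci] by auto
  have BC: "act B (act C y) = act C (act A y)" if "y \<in> H3" for y
    unfolding B_def conj_by_def
    using that C A Ci act_in_H3 by (simp add: act_mult det_mul act_minv)
  have fixiff: "act B (act C y) = act C y \<longleftrightarrow> act A y = y" if "y \<in> H3" for y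
    using BC[OF that] act_minv(1)[OF C(1)] that act_in_H3[OF A(1) that] by metis
  obtain z where z: "{y \<in> H3. act B y = y} = {y \<in> H3. fst y = z}"
    using upper_triangular_fixed_points[OF B _ BN, of "act C x"] C fixiff[OF x(1)] x act_in_H3 by (auto simp: B_def)
  have oC: "open (act C ` N)" using open_act_image[OF C(1) N(1,3)] .
  then obtain r where r: "r > 0" "ball (act C x) r \<subseteq> act C ` N"
    using N(2) open_contains_ball by (metis imageI)
  define V where "V = ball (act C x) r"
  have VH: "V \<subseteq> H3" using r N(3) act_in_H3[OF C(1)] unfolding V_def by blast
  define N' where "N' = act (minv C) ` V"
  have "thin {y :: point. Re (fst y) = Re z \<and> Im (fst y) = Im z}"
    by (rule thin_codim2[where ?e1.0 = "(1, 0)" and ?e2.0 = "(\<i>, 0)"])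
       (auto intro!: bounded_linear_compose[OF bounded_linear_Re bounded_linear_fst]
         bounded_linear_compose[OF bounded_linear_Im bounded_linear_fst])
  then have "connected (V - {y. Re (fst y) = Re z \<and> Im (fst y) = Im z})"
    unfolding thin_def V_def by (simp add: connected_ball)
  also have "V - {y. Re (fst y) = Re z \<and> Im (fst y) = Im z} = V - {y. act B y = y}"
    using z VH by (auto simp: complex_eq_iff set_eq_iff)
  finally have "connected (act (minv C) ` (V - {y. act B y = y}))"
    using VH by (intro connected_continuous_image continuous_on_subset[OF continuous_on_act[OF Ci]]) auto
  moreover have "act (minv C) ` (V - {y. act B y = y}) = N' - {y. act A y = y}"
  proof -
    have "act B v = v \<longleftrightarrow> act A (act (minv C) v) = act (minv C) v" if "v \<in> V" for v
    proof -
      have vH: "v \<in> H3" using that VH by blast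
      show ?thesis
        using fixiff[OF act_in_H3[OF Ci vH]] unfolding act_minv(2)[OF C(1) vH] .
    qed
    then show ?thesis unfolding N'_def by auto
  qed
  moreover have "open N'" unfolding N'_def using open_act_image[OF Ci _ VH] by (simp add: V_def)
  moreover have "x \<in> N'"
    unfolding N'_def using act_minv(1)[OF C(1) x(1)] r(1) by (metis V_def centre_in_ball imageI)
  moreover have "N' \<subseteq> N"
  proof
    fix y assume "y \<in> N'"
    then obtain n where n: "n \<in> N" "y = act (minv C) (act C n)" using r(2) unfolding N'_def V_def by blast
    then have "n \<in> H3" using N(3) by blast
    then show "y \<in> N" using act_minv(1)[OF C(1)] n by metis
  qed
  ultimately show ?thesis by metis
qed

section \<open>From the filled orbifold to a covering of the link complement in R^3\<close>

section \<open>The orbifold as a covering of the link complement\<close>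

lemma topspace_S3 [simp]: "topspace S3 = UNIV"
  by (auto simp: S3_def) (metis not_None_eq rangeI)

lemma openin_S3_Some: "open U \<Longrightarrow> openin S3 (Some ` U)"
  by (simp add: S3_def)

lemma open_vimage_Some: "openin S3 U \<Longrightarrow> open {y. Some y \<in> U}"
  using openin_continuous_map_preimage[OF continuous_map_Some[of euclidean], of U]
  by (simp add: S3_def)

lemma openin_S3_compl:
  assumes "compact K"
  shows "openin S3 (- Some ` K)"
proof -
  have "closedin S3 (Some ` K)"
    unfolding S3_def using assms by (simp add: compact_imp_closed)
  then show ?thesis
    by (simp add: closedin_def Compl_eq_Diff_UNIV)
qed

lemma open_embedding:
  assumes h: "embedding_map T M h" and im: "openin M (h ` topspace T)"
  shows "openin T U \<Longrightarrow> openin M (h ` U)" "openin M V \<Longrightarrow> openin T {x \<in> topspace T. h x \<in> V}"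
    "inj_on h (topspace T)"
proof -
  have hom: "homeomorphic_map T (subtopology M (h ` topspace T)) h"
    using h by (simp add: embedding_map_def)
  show "openin M (h ` U)" if "openin T U"
    using homeomorphic_imp_open_map[OF hom] that openin_trans_full[OF _ im] by (simp add: open_map_def)
  show "openin T {x \<in> topspace T. h x \<in> V}" if "openin M V"
    using continuous_map_into_fulltopology[OF homeomorphic_imp_continuous_map[OF hom]] that
    by (rule openin_continuous_map_preimage)
  show "inj_on h (topspace T)"
    by (rule homeomorphic_imp_injective_map[OF hom])
qed

text \<open>\<open>P\<close> is any open quotient map with the orbits as fibres, so that the setting
  can be conjugated. \<open>p\<close> and \<open>q\<close> stand for the slope divided by its gcd
  and \<open>k\<close> for the cone order, doubled in the isotropy count because -1 is
  included.\<close>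

locale dehn_orbifold =
  fixes \<Gamma> :: "(complex^2^2) set" and M :: "'a topology" and P :: "point \<Rightarrow> 'a"
    and K K' :: "point set" and e :: "complex \<times> complex \<Rightarrow> point option"
    and f :: "point option \<Rightarrow> 'a" and g :: "complex \<times> complex \<Rightarrow> 'a"
    and p q r s :: int and core :: "'a set" and k :: nat
  assumes dg: "discrete_group \<Gamma>" and om: "orbit_map \<Gamma> M P"
    and compact_K: "compact K" "compact K'"
    and nbhd: "homologically_framed_nbhd K K' e"
    and emb_f: "embedding_map (subtopology S3 (- (Some ` K \<union> Some ` K'))) M f"
    and open_f: "openin M (f ` (- (Some ` K \<union> Some ` K')))"
    and emb_g: "embedding_map (top_of_set (UNIV \<times> circle)) M g"
    and open_g: "openin M (g ` (UNIV \<times> circle))"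
    and cover: "topspace M = f ` (- (Some ` K \<union> Some ` K')) \<union> g ` (UNIV \<times> circle)"
    and core: "core = g ` ({0} \<times> circle)" "core \<inter> f ` (- (Some ` K \<union> Some ` K')) = {}"
    and glue: "\<And>z v. z \<noteq> 0 \<Longrightarrow> v \<in> circle \<Longrightarrow>
      g (z, v) = f (e (sgn z powi q * v powi s, of_real (cmod z) * sgn z powi p * v powi r))"
    and isotropy_free: "\<And>x. x \<in> H3 \<Longrightarrow> P x \<notin> core \<Longrightarrow> free_at \<Gamma> x"
    and isotropy_core: "\<And>x. x \<in> H3 \<Longrightarrow> P x \<in> core \<Longrightarrow> card (isotropy \<Gamma> x) = 2 * k" "k > 0"
begin

lemmas \<Gamma> = discrete_groupD[OF dg]
lemmas P = orbit_mapD[OF om]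

definition L :: "point set" where "L = K \<union> K'"

definition XL :: "point option set" where "XL = - (Some ` K \<union> Some ` K')"

lemmas filling = emb_f[folded XL_def] open_f[folded XL_def] cover[folded XL_def] core(2)[folded XL_def]

definition \<phi> :: "point \<Rightarrow> 'a" where "\<phi> y = f (Some y)"

lemma open_compl_L: "open (- L)"
  unfolding L_def by (intro open_Compl closed_Un compact_imp_closed compact_K)

lemma openin_XL: "openin S3 XL"
  using openin_S3_compl[OF compact_Un[OF compact_K]] by (simp only: image_Un XL_def)

lemma Some_in_XL: "Some y \<in> XL \<longleftrightarrow> y \<notin> L"
  by (auto simp: L_def XL_def)

lemma f_open: "openin S3 U \<Longrightarrow> U \<subseteq> XL \<Longrightarrow> openin M (f ` U)"
  using open_embedding(1)[OF filling(1), of U] filling(2) openin_XL by (simp add: openin_open_subtopology)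

lemma f_cont: "openin M V \<Longrightarrow> openin S3 {x \<in> XL. f x \<in> V}"
  using open_embedding(2)[OF filling(1), of V] filling(2) openin_XL by (simp add: openin_open_subtopology)

lemma f_inj: "inj_on f XL"
  using open_embedding(3)[OF filling(1)] filling(2) by simp

lemma g_open: "openin (top_of_set (UNIV \<times> circle)) U \<Longrightarrow> openin M (g ` U)"
  using open_embedding(1)[OF emb_g, of U] open_g by simp

lemma g_cont: "openin M V \<Longrightarrow> openin (top_of_set (UNIV \<times> circle)) {x \<in> UNIV \<times> circle. g x \<in> V}"
  using open_embedding(2)[OF emb_g, of V] open_g by simp

lemma \<phi>_open: "open U \<Longrightarrow> U \<subseteq> - L \<Longrightarrow> openin M (\<phi> ` U)"
proof -
  assume "open U" "U \<subseteq> - L"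
  then have "openin M (f ` (Some ` U))"
    by (intro f_open openin_S3_Some image_subsetI, simp) (unfold Some_in_XL, blast)
  then show ?thesis by (simp add: \<phi>_def image_image)
qed

lemma \<phi>_cont: "openin M V \<Longrightarrow> open {y. y \<notin> L \<and> \<phi> y \<in> V}"
  using open_vimage_Some[OF f_cont, of V] unfolding \<phi>_def by (simp only: mem_Collect_eq Some_in_XL)

lemma \<phi>_inj: "inj_on \<phi> (- L)"
  using f_inj Some_in_XL unfolding \<phi>_def inj_on_def by (metis ComplD option.inject)

lemma e_facts:
  shows "embedding_map (top_of_set (circle \<times> UNIV)) S3 e" "openin S3 (e ` (circle \<times> UNIV))"
    "e ` (circle \<times> {0}) = Some ` K" "e ` (circle \<times> UNIV) \<inter> Some ` K' = {}"
  using nbhd by (auto simp: homologically_framed_nbhd_def)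

lemma e_inj: "inj_on e (circle \<times> UNIV)"
  using open_embedding(3)[OF e_facts(1)] e_facts(2) by simp

lemma e_in_XL:
  assumes "u \<in> circle" "z \<noteq> 0"
  shows "e (u, z) \<in> XL"
proof -
  have "e (u, z) \<notin> Some ` K"
  proof
    assume "e (u, z) \<in> Some ` K"
    then have "e (u, z) \<in> e ` (circle \<times> {0})" unfolding e_facts(3) .
    then obtain w where "w \<in> circle" "e (u, z) = e (w, 0)" by blast
    then have "(u, z) = (w, 0)" using inj_onD[OF e_inj, of "(u, z)" "(w, 0)"] assms by blast
    then show False using assms by simp
  qed
  moreover have "e (u, z) \<notin> Some ` K'" using e_facts(4) assms by blast
  ultimately show ?thesis by (simp add: XL_def)
qed

lemma cmod_powi_unit: "cmod w = 1 \<Longrightarrow> cmod (w powi n) = 1"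
  by (simp add: norm_power_int)

lemma g_eq_f:
  assumes "z \<noteq> 0" "v \<in> circle"
  shows "g (z, v) \<in> f ` XL"
proof -
  have "cmod (sgn z) = 1" "cmod v = 1" using assms by (simp_all add: norm_sgn)
  then have "sgn z powi q * v powi s \<in> circle" "of_real (cmod z) * sgn z powi p * v powi r \<noteq> 0"
    using assms by (auto simp: norm_mult cmod_powi_unit sgn_zero_iff)
  then show ?thesis using glue[OF assms] e_in_XL by auto
qed

lemma not_core_iff: "y \<in> topspace M - core \<longleftrightarrow> y \<in> f ` XL"
proof
  assume y: "y \<in> topspace M - core"
  show "y \<in> f ` XL"
  proof (cases "y \<in> f ` XL")
    case False
    then obtain z v where zv: "y = g (z, v)" "v \<in> circle" using y filling(3) by blast
    then have "z \<noteq> 0" using y core(1) by blast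
    then show ?thesis using g_eq_f zv by blast
  qed
next
  assume "y \<in> f ` XL"
  then show "y \<in> topspace M - core" using filling(3,4) by blast
qed

lemma core_closed: "openin M (topspace M - core)"
  using filling(2) not_core_iff by (metis subset_antisym subsetI)

text \<open>An open set lying over the core would have an open image inside the core, but every
  point of the core is a limit of points g (z, v) with z \<noteq> 0, which lie off it.\<close>

lemma core_thin:
  assumes "open U" "U \<subseteq> H3" "U \<noteq> {}"
  shows "U - {x. P x \<in> core} \<noteq> {}"
proof
  assume "U - {x. P x \<in> core} = {}"
  then have U: "P ` U \<subseteq> core" by blast
  obtain x where "x \<in> U" using assms by blast
  then obtain v where v: "v \<in> circle" "P x = g (0, v)" using U core(1) by auto
  have "openin (top_of_set (UNIV \<times> circle)) {w \<in> UNIV \<times> circle. g w \<in> P ` U}"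
    using g_cont P(2) assms by blast
  then obtain T where T: "open T" "{w \<in> UNIV \<times> circle. g w \<in> P ` U} = (UNIV \<times> circle) \<inter> T"
    by (auto simp: openin_open)
  have "(0, v) \<in> {w \<in> UNIV \<times> circle. g w \<in> P ` U}" using v \<open>x \<in> U\<close> by force
  then have "(0, v) \<in> T" unfolding T(2) by blast
  then obtain A B where AB: "open A" "open B" "0 \<in> A" "v \<in> B" "A \<times> B \<subseteq> T"
    using T(1) open_prod_elim by (metis mem_Sigma_iff)
  obtain d where d: "d > 0" "ball 0 d \<subseteq> A" using AB open_contains_ball by metis
  define z where "z = complex_of_real (d / 2)"
  have "z \<in> ball 0 d" using d(1) by (simp add: z_def)
  then have z: "z \<in> A" "z \<noteq> 0" using d by (auto simp: z_def)
  then have "g (z, v) \<in> core" using AB T(2) v U by blast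
  moreover have "g (z, v) \<in> f ` XL" using g_eq_f z v by blast
  ultimately show False using filling(4) by blast
qed

lemma free_neighbourhood:
  assumes "x \<in> H3"
  obtains N where "open N" "x \<in> N" "N \<subseteq> H3" "\<And>A. A \<in> \<Gamma> \<Longrightarrow> act A ` N \<inter> N \<noteq> {} \<Longrightarrow> act A x = x"
proof -
  obtain U V where "open U" "open V" "x \<in> U" "x \<in> V" "U \<subseteq> H3" "V \<subseteq> H3"
    "\<And>A. A \<in> \<Gamma> \<Longrightarrow> act A ` U \<inter> V \<noteq> {} \<Longrightarrow> act A x = x"
    using separating_neighbourhoods[OF dg assms assms] by metis
  then show ?thesis using that[of "U \<inter> V"] by blast
qed

lemma injective_neighbourhood:
  assumes "x \<in> H3" "free_at \<Gamma> x" "open N" "N \<subseteq> H3" "\<And>A. A \<in> \<Gamma> \<Longrightarrow> act A ` N \<inter> N \<noteq> {} \<Longrightarrow> act A x = x"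
  shows "inj_on P N"
proof (rule inj_onI)
  fix a b assume ab: "a \<in> N" "b \<in> N" "P a = P b"
  then obtain A where A: "A \<in> \<Gamma>" "b = act A a" using P(5)[of a b] assms(4) by blast
  then have "act A x = x" using assms(5)[OF A(1)] ab by blast
  then have "A \<doteq> mat 1" using assms(2) A(1) by (simp add: free_at_def)
  then show "a = b" using A(2) act_peq[of A "mat 1"] by simp
qed

text \<open>If z is fixed only by 1 and -1, \<open>P\<close> is injective near z, and the product of
  a punctured disc with an arc lifts to a connected set. Otherwise nearby core points have isotropy
  contained in that of z and of equal size, hence the same isotropy; so the core lifts to the axis
  of one elliptic element.\<close>

lemma core_complement_local:
  assumes z: "z \<in> H3" "P z \<in> core"
  shows "\<exists>N C. open N \<and> z \<in> N \<and> N \<subseteq> H3 \<and> connected C \<and> N - {x. P x \<in> core} \<subseteq> C \<and> C \<subseteq> H3 - {x. P x \<in> core}"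
proof -
  obtain N0 where N0: "open N0" "z \<in> N0" "N0 \<subseteq> H3" "\<And>A. A \<in> \<Gamma> \<Longrightarrow> act A ` N0 \<inter> N0 \<noteq> {} \<Longrightarrow> act A z = z"
    using free_neighbourhood[OF z(1)] by metis
  have iso_sub: "isotropy \<Gamma> y \<subseteq> isotropy \<Gamma> z" if "y \<in> N0" for y
    using N0(4) that unfolding isotropy_def by force
  have iso_card: "card (isotropy \<Gamma> z) = 2 * k" using isotropy_core z by blast
  then have fin: "finite (isotropy \<Gamma> z)" using isotropy_core(2) card.infinite by force
  show ?thesis
  proof (cases "free_at \<Gamma> z")
    case True
    have inj: "inj_on P N0" by (rule injective_neighbourhood[OF z(1) True N0(1,3,4)])
    obtain v where v: "v \<in> circle" "P z = g (0, v)" using z core(1) by auto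
    have "openin (top_of_set (UNIV \<times> circle)) {w \<in> UNIV \<times> circle. g w \<in> P ` N0}"
      using g_cont P(2) N0 by blast
    then obtain T where T: "open T" "{w \<in> UNIV \<times> circle. g w \<in> P ` N0} = (UNIV \<times> circle) \<inter> T"
      by (auto simp: openin_open)
    have "(0, v) \<in> {w \<in> UNIV \<times> circle. g w \<in> P ` N0}" using v N0(2) by force
    then have "(0, v) \<in> T" unfolding T(2) by blast
    then obtain A B where AB: "open A" "open B" "0 \<in> A" "v \<in> B" "A \<times> B \<subseteq> T"
      using T(1) open_prod_elim by (metis mem_Sigma_iff)
    obtain d where d: "d > 0" "ball 0 d \<subseteq> A" using AB open_contains_ball by metis
    obtain d' where d': "d' > 0" "ball v d' \<subseteq> B" using AB open_contains_ball by metis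
    define d2 where "d2 = min d' 1"
    define W where "W = ball (0::complex) d \<times> (circle \<inter> ball v d2)"
    have d2: "0 < d2" "d2 \<le> 1" "ball v d2 \<subseteq> B" using d' by (auto simp: d2_def)
    have WT: "W \<subseteq> (UNIV \<times> circle) \<inter> T" using AB d d2 unfolding W_def by blast
    have gW: "g w \<in> P ` N0" if "w \<in> W" for w using WT T(2) that by blast
    have oW: "openin (top_of_set (UNIV \<times> circle)) W"
      unfolding W_def by (rule openin_Times) (auto simp: openin_open_Int)
    define N where "N = N0 \<inter> {x \<in> H3. P x \<in> g ` W}"
    define lift where "lift w = inv_into N0 P (g w)" for w
    have lift: "lift w \<in> N0" "P (lift w) = g w" if "w \<in> W" for w
      using gW[OF that] by (auto simp: lift_def inv_into_into f_inv_into_f)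
    have contl: "continuous_on W lift"
    proof (subst continuous_openin_preimage_eq, intro allI impI)
      fix U :: "point set" assume U: "open U"
      have "W \<inter> lift -` U = W \<inter> {w \<in> UNIV \<times> circle. g w \<in> P ` (N0 \<inter> U)}"
      proof (intro equalityI subsetI)
        fix w assume w: "w \<in> W \<inter> {w \<in> UNIV \<times> circle. g w \<in> P ` (N0 \<inter> U)}"
        then obtain n where n: "n \<in> N0" "n \<in> U" "g w = P n" by blast
        have wW: "w \<in> W" using w by blast
        have "P (lift w) = P n" using lift(2)[OF wW] n(3) by simp
        then have "lift w = n" using inj_onD[OF inj _ lift(1)[OF wW] n(1)] by blast
        then show "w \<in> W \<inter> lift -` U" using wW n(2) by simp
      next
        fix w assume "w \<in> W \<inter> lift -` U"
        then show "w \<in> W \<inter> {w \<in> UNIV \<times> circle. g w \<in> P ` (N0 \<inter> U)}"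
          using lift[of w] WT by (auto intro!: image_eqI[of "g w" P "lift w"])
      qed
      moreover have "openin (top_of_set (UNIV \<times> circle)) {w \<in> UNIV \<times> circle. g w \<in> P ` (N0 \<inter> U)}"
        using g_cont P(2)[of "N0 \<inter> U"] N0 U by blast
      ultimately have "openin (top_of_set (UNIV \<times> circle)) (W \<inter> lift -` U)"
        using oW by (simp add: openin_Int)
      then show "openin (top_of_set W) (W \<inter> lift -` U)"
        by (rule openin_subset_trans) (use WT in auto)
    qed
    define C where "C = lift ` ((ball 0 d - {0}) \<times> (circle \<inter> ball v d2))"
    have "connected C"
      unfolding C_def
    proof (rule connected_continuous_image)
      show "continuous_on ((ball 0 d - {0}) \<times> (circle \<inter> ball v d2)) lift"
        by (rule continuous_on_subset[OF contl]) (auto simp: W_def)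
      have "connected (ball 0 d - {0 :: complex})"
        by (rule connected_punctured_ball) simp
      moreover have "connected (circle \<inter> ball v d2)"
        using v(1) d2 by (intro connected_circle_arc) auto
      ultimately show "connected ((ball 0 d - {0 :: complex}) \<times> (circle \<inter> ball v d2))"
        by (simp add: connected_Times_eq)
    qed
    moreover have "open N"
      unfolding N_def using N0(1) P(1)[OF g_open[OF oW]] by blast
    moreover have "z \<in> N" unfolding N_def W_def using N0 z v d d2 by auto
    moreover have "N - {x. P x \<in> core} \<subseteq> C"
    proof
      fix x assume x: "x \<in> N - {x. P x \<in> core}"
      then obtain w where w: "w \<in> W" "P x = g w" "x \<in> N0" by (auto simp: N_def)
      have "x = lift w" using inj lift[OF w(1)] w by (metis inj_onD)
      moreover have "fst w \<noteq> 0" using x w core(1) by (cases w) (auto simp: W_def)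
      ultimately show "x \<in> C" using w(1) by (cases w) (auto simp: C_def W_def)
    qed
    moreover have "C \<subseteq> H3 - {x. P x \<in> core}"
    proof
      fix x assume "x \<in> C"
      then obtain w where w: "x = lift w" "fst w \<noteq> 0" "w \<in> W" unfolding C_def W_def by fastforce
      then have "P x \<in> f ` XL" using lift(2)[OF w(3)] g_eq_f[of "fst w" "snd w"] by (auto simp: W_def)
      then show "x \<in> H3 - {x. P x \<in> core}" using lift(1)[OF w(3)] w(1) N0(3) filling(4) by blast
    qed
    ultimately show ?thesis using N0(3) unfolding N_def by blast
  next
    case False
    then obtain A where A: "A \<in> \<Gamma>" "act A z = z" "\<not> A \<doteq> mat 1" by (auto simp: free_at_def)
    obtain N where N: "open N" "z \<in> N" "N \<subseteq> N0" "connected (N - {y. act A y = y})"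
      using elliptic_local_complement[OF \<Gamma>(4)[OF A(1)] A(3) z(1) A(2) N0(1-3)] by blast
    have "P y \<in> core \<longleftrightarrow> act A y = y" if y: "y \<in> N" for y
    proof
      have yH: "y \<in> H3" using y N N0 by blast
      show "act A y = y" if "P y \<in> core"
      proof -
        have "isotropy \<Gamma> y = isotropy \<Gamma> z"
          using card_subset_eq[OF fin iso_sub[of y]] isotropy_core(1)[OF yH that] iso_card y N(3) by auto
        then show ?thesis using A by (auto simp: isotropy_def)
      qed
      show "P y \<in> core" if "act A y = y"
        using isotropy_free[OF yH] that A by (auto simp: free_at_def)
    qed
    then have "N - {x. P x \<in> core} = N - {y. act A y = y}" by blast
    then show ?thesis using N N0(3)
      by (intro exI[of _ N] exI[of _ "N - {y. act A y = y}"]) auto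
  qed
qed

lemma connected_H3_core: "connected (H3 - {x. P x \<in> core})"
proof (rule connected_diff_thin)
  show "connected H3" by (rule convex_connected[OF convex_H3])
  have "H3 - {x. P x \<in> core} = {x \<in> H3. P x \<in> topspace M - core}" using P(3) by auto
  then show "open (H3 - {x. P x \<in> core})" using P(1)[OF core_closed] by simp
qed (use core_thin core_complement_local in blast)+

text \<open>The part of upper half-space over R^3 minus the link. The fibre over the point at
  infinity of the three-sphere is removed together with the core, so that the base is an open subset
  of R^3.\<close>

definition Hcov :: "point set" where "Hcov = {x \<in> H3. P x \<in> \<phi> ` (- L)}"

lemma Hcov_alt: "Hcov = (H3 - {x. P x \<in> core}) - {x. P x = f None}"
proof (intro equalityI subsetI)
  fix x assume "x \<in> Hcov"
  then obtain y where y: "x \<in> H3" "y \<notin> L" "P x = f (Some y)" by (auto simp: Hcov_def \<phi>_def)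
  then have S: "Some y \<in> XL" "P x \<in> f ` XL" by (simp_all only: Some_in_XL not_False_eq_True imageI)
  have "P x \<noteq> f None"
  proof
    assume "P x = f None"
    then have "f (Some y) = f None" using y(3) by simp
    moreover have "None \<in> XL" by (simp add: XL_def image_iff)
    ultimately show False using inj_onD[OF f_inj _ S(1)] by blast
  qed
  then show "x \<in> (H3 - {x. P x \<in> core}) - {x. P x = f None}"
    using y(1) S(2) not_core_iff[of "P x"] by simp
next
  fix x assume x: "x \<in> (H3 - {x. P x \<in> core}) - {x. P x = f None}"
  then have "P x \<in> f ` XL" using P(3)[of x] not_core_iff by blast
  then obtain u where u: "u \<in> XL" "P x = f u" by blast
  then obtain y where y: "u = Some y" using x by (cases u) auto
  then have "y \<in> - L" using u(1) Some_in_XL by blast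
  then show "x \<in> Hcov" using u(2) x y by (auto simp: Hcov_def \<phi>_def)
qed

lemma open_Hcov: "open Hcov" "Hcov \<subseteq> H3"
  using P(1)[OF \<phi>_open[OF open_compl_L]] by (auto simp: Hcov_def)

lemma free_Hcov: "x \<in> Hcov \<Longrightarrow> free_at \<Gamma> x"
  using isotropy_free by (auto simp: Hcov_alt)

text \<open>Away from the core \<open>P\<close> is locally injective, so the fibre over infinity
  meets a small ball in at most its centre, and a punctured ball is connected.\<close>

lemma connected_Hcov: "connected Hcov"
  unfolding Hcov_alt
proof (rule connected_diff_thin[OF connected_H3_core])
  let ?S = "H3 - {x. P x \<in> core}"
  show "open (?S - {x. P x = f None})" using open_Hcov by (simp add: Hcov_alt)
  have loc: "\<exists>r>0. ball z r \<subseteq> ?S \<and> (\<forall>y\<in>ball z r. P y = P z \<longrightarrow> y = z)" if z: "z \<in> ?S" for z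
  proof -
    have zH: "z \<in> H3" "P z \<notin> core" using z by auto
    obtain N where N: "open N" "z \<in> N" "N \<subseteq> H3" "\<And>A. A \<in> \<Gamma> \<Longrightarrow> act A ` N \<inter> N \<noteq> {} \<Longrightarrow> act A z = z"
      using free_neighbourhood[OF zH(1)] by metis
    have inj: "inj_on P N" by (rule injective_neighbourhood[OF zH(1) isotropy_free[OF zH] N(1,3,4)])
    have "?S = {x \<in> H3. P x \<in> topspace M - core}" using P(3) by auto
    then have "open (N \<inter> ?S)" using P(1)[OF core_closed] N(1) by auto
    then obtain r where r: "r > 0" "ball z r \<subseteq> N \<inter> ?S" using N(2) z open_contains_ball by (metis IntI)
    then show ?thesis using inj N(2) by (metis (no_types, lifting) IntE inj_onD subset_iff)
  qed
  show "U - {x. P x = f None} \<noteq> {}" if U: "open U" "U \<subseteq> ?S" "U \<noteq> {}" for U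
  proof
    assume sub: "U - {x. P x = f None} = {}"
    obtain z where z: "z \<in> U" using U by blast
    obtain r where r: "r > 0" "\<forall>y\<in>ball z r. P y = P z \<longrightarrow> y = z" using loc U z by blast
    have "open (U \<inter> ball z r)" using U by auto
    moreover have "U \<inter> ball z r = {z}"
    proof (intro equalityI subsetI)
      fix y assume y: "y \<in> U \<inter> ball z r"
      then have "P y = f None" "P z = f None" using sub z by blast+
      then show "y \<in> {z}" using r(2) y by simp
    qed (use z r(1) in auto)
    ultimately show False using not_open_singleton by metis
  qed
  fix z assume z: "z \<in> ?S" "z \<in> {x. P x = f None}"
  obtain r where r: "r > 0" "ball z r \<subseteq> ?S" "\<forall>y\<in>ball z r. P y = P z \<longrightarrow> y = z" using loc z by blast
  have "connected (ball z r - {z})" by (rule connected_punctured_ball) simp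
  moreover have "ball z r - {x. P x = f None} = ball z r - {z}"
  proof (intro equalityI subsetI)
    fix y assume "y \<in> ball z r - {z}"
    then show "y \<in> ball z r - {x. P x = f None}" using r(3) z(2) by auto
  qed (use z(2) in auto)
  ultimately show "\<exists>N C. open N \<and> z \<in> N \<and> N \<subseteq> ?S \<and> connected C \<and> N - {x. P x = f None} \<subseteq> C \<and>
      C \<subseteq> ?S - {x. P x = f None}"
    using r(1,2) z(2) by (intro exI[of _ "ball z r"] exI[of _ "ball z r - {z}"]) (auto simp del: Diff_subset)
qed

definition proj :: "point \<Rightarrow> point" where
  "proj x = inv_into (- L) \<phi> (P x)"

lemma proj: "x \<in> Hcov \<Longrightarrow> proj x \<notin> L" "x \<in> Hcov \<Longrightarrow> \<phi> (proj x) = P x"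
  using inv_into_into[of "P x" \<phi> "- L"] f_inv_into_f[of "P x" \<phi> "- L"] by (auto simp: Hcov_def proj_def)

lemma proj_eqI: "y \<notin> L \<Longrightarrow> P x = \<phi> y \<Longrightarrow> proj x = y"
  using inv_into_f_f[OF \<phi>_inj, of y] by (simp add: proj_def)

lemma proj_eq_iff: "x \<in> Hcov \<Longrightarrow> y \<in> Hcov \<Longrightarrow> proj x = proj y \<longleftrightarrow> (\<exists>A\<in>\<Gamma>. y = act A x)"
proof -
  assume xy: "x \<in> Hcov" "y \<in> Hcov"
  then have "proj x = proj y \<longleftrightarrow> P x = P y" by (metis proj(2) proj_def)
  then show ?thesis using P(5)[of x y] xy open_Hcov(2) by auto
qed

lemma act_Hcov: "A \<in> \<Gamma> \<Longrightarrow> x \<in> Hcov \<Longrightarrow> act A x \<in> Hcov"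
  using orbit_map_act[OF om dg] act_in_H3 \<Gamma>(4) by (auto simp: Hcov_def)

lemma proj_act: "A \<in> \<Gamma> \<Longrightarrow> x \<in> Hcov \<Longrightarrow> proj (act A x) = proj x"
  using orbit_map_act[OF om dg, of A x] subsetD[OF open_Hcov(2), of x] by (simp add: proj_def)

lemma proj_vimage:
  assumes "U \<subseteq> - L"
  shows "{x \<in> Hcov. proj x \<in> U} = {x \<in> H3. P x \<in> \<phi> ` U}"
proof (intro equalityI subsetI)
  fix x assume "x \<in> {x \<in> H3. P x \<in> \<phi> ` U}"
  then obtain y where y: "x \<in> H3" "y \<in> U" "P x = \<phi> y" by blast
  then have "y \<in> - L" using assms by blast
  then have "x \<in> Hcov" "proj x = y" using y proj_eqI[of y x] by (auto simp: Hcov_def)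
  then show "x \<in> {x \<in> Hcov. proj x \<in> U}" using y by simp
next
  fix x assume x: "x \<in> {x \<in> Hcov. proj x \<in> U}"
  then have "P x = \<phi> (proj x)" "x \<in> H3" using proj(2)[of x] open_Hcov(2) by auto
  then show "x \<in> {x \<in> H3. P x \<in> \<phi> ` U}" using x by blast
qed

lemma continuous_on_proj: "continuous_on Hcov proj"
proof (subst continuous_openin_preimage_eq, intro allI impI)
  fix U :: "point set" assume U: "open U"
  have "Hcov \<inter> proj -` U = {x \<in> Hcov. proj x \<in> U \<inter> - L}" using proj(1) by auto
  also have "\<dots> = {x \<in> H3. P x \<in> \<phi> ` (U \<inter> - L)}" by (rule proj_vimage) auto
  finally show "openin (top_of_set Hcov) (Hcov \<inter> proj -` U)"
    using P(1)[OF \<phi>_open[of "U \<inter> - L"]] U open_compl_L open_Hcov by (simp add: openin_open_eq) auto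
qed

lemma proj_open:
  assumes "open U" "U \<subseteq> Hcov"
  shows "open (proj ` U)"
proof -
  have "proj ` U = {y. y \<notin> L \<and> \<phi> y \<in> P ` U}"
  proof (intro equalityI subsetI)
    fix y assume "y \<in> proj ` U"
    then show "y \<in> {y. y \<notin> L \<and> \<phi> y \<in> P ` U}" using proj assms(2) by force
  next
    fix y assume "y \<in> {y. y \<notin> L \<and> \<phi> y \<in> P ` U}"
    then obtain x where x: "x \<in> U" "y \<notin> L" "P x = \<phi> y" by auto
    from proj_eqI[OF x(2,3)] show "y \<in> proj ` U" using x(1) by blast
  qed
  then show ?thesis using \<phi>_cont[OF P(2)[of U]] assms open_Hcov(2) by auto
qed

lemma proj_surj: "proj ` Hcov = - L"
proof (intro equalityI subsetI)
  fix y assume y: "y \<in> - L"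
  then have "\<phi> y \<in> topspace M" using Some_in_XL[of y] unfolding filling(3) \<phi>_def by blast
  then obtain x where "x \<in> H3" "P x = \<phi> y" using P(4) by (metis imageE)
  then show "y \<in> proj ` Hcov" using proj_eqI[of y x] y by (force simp: Hcov_def)
qed (use proj in auto)

lemma covering_proj: "covering_space Hcov proj (- L)"
  by (rule covering_space_orbit_map[OF dg open_Hcov act_Hcov free_Hcov continuous_on_proj proj_surj
      proj_open proj_eq_iff])

end

section \<open>The diagram as a subset of the plane, and a decomposition of the complement\<close>

section \<open>The diagram\<close>

definition vseg :: "real \<Rightarrow> real \<Rightarrow> real \<Rightarrow> complex set" where
  "vseg a b c = {z. Re z = a \<and> b \<le> Im z \<and> Im z \<le> c}"

definition hseg :: "real \<Rightarrow> real \<Rightarrow> real \<Rightarrow> complex set" where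
  "hseg a b c = {z. Im z = a \<and> b \<le> Re z \<and> Re z \<le> c}"

definition V1 :: "complex set" where "V1 = vseg 0 0 6 \<union> vseg 2 4 6 \<union> vseg 6 2 4 \<union> vseg 4 0 2"
definition V2 :: "complex set" where "V2 = vseg 1 5 7 \<union> vseg 3 1 5 \<union> vseg 5 1 3 \<union> vseg 7 3 7"
definition H1 :: "complex set" where "H1 = hseg 6 0 2 \<union> hseg 4 2 6 \<union> hseg 2 4 6 \<union> hseg 0 0 4"
definition H2 :: "complex set" where "H2 = hseg 5 1 3 \<union> hseg 1 3 5 \<union> hseg 3 5 7 \<union> hseg 7 1 7"
definition C1 :: "complex set" where
  "C1 = {Complex 0 0, Complex 0 6, Complex 2 6, Complex 2 4, Complex 6 4, Complex 6 2, Complex 4 2, Complex 4 0}"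
definition C2 :: "complex set" where
  "C2 = {Complex 1 7, Complex 1 5, Complex 3 5, Complex 3 1, Complex 5 1, Complex 5 3, Complex 7 3, Complex 7 7}"

lemma closed_segment_vertical:
  "closed_segment (Complex a b, h) (Complex a c, h) = {(z, t). Re z = a \<and> Im z \<in> closed_segment b c \<and> t = h}"
  by (auto simp: in_segment complex_eq_iff algebra_simps)

lemma closed_segment_horizontal:
  "closed_segment (Complex b a, h) (Complex c a, h) = {(z, t). Im z = a \<and> Re z \<in> closed_segment b c \<and> t = h}"
  by (auto simp: in_segment complex_eq_iff algebra_simps)

lemma closed_segment_height:
  "closed_segment (z, b) (z, c) = {(w, t). w = z \<and> t \<in> closed_segment b c}" for b c :: real
  by (auto simp: in_segment algebra_simps simp flip: scaleR_left_distrib)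

lemma link_component1_eq:
  "link_component1 = {(z, t). z \<in> V1 \<and> t = 1 \<or> z \<in> H1 \<and> t = 0 \<or> z \<in> C1 \<and> 0 \<le> t \<and> t \<le> 1}"
proof (rule Set.set_eqI)
  fix x :: "point"
  obtain z t where x: "x = (z, t)" by (cases x)
  show "x \<in> link_component1 \<longleftrightarrow>
      x \<in> {(z, t). z \<in> V1 \<and> t = 1 \<or> z \<in> H1 \<and> t = 0 \<or> z \<in> C1 \<and> 0 \<le> t \<and> t \<le> 1}"
    unfolding x link_component1_def closed_polygon_def V1_def H1_def C1_def vseg_def hseg_def
    apply (simp add: lessThan_nat_numeral lessThan_Suc closed_segment_vertical closed_segment_horizontal
      closed_segment_height closed_segment_eq_real_ivl)
    apply (simp only: conj_disj_distribR disj_ac conj_assoc)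
    done
qed

lemma link_component2_eq:
  "link_component2 = {(z, t). z \<in> V2 \<and> t = 1 \<or> z \<in> H2 \<and> t = 0 \<or> z \<in> C2 \<and> 0 \<le> t \<and> t \<le> 1}"
proof (rule Set.set_eqI)
  fix x :: "point"
  obtain z t where x: "x = (z, t)" by (cases x)
  show "x \<in> link_component2 \<longleftrightarrow>
      x \<in> {(z, t). z \<in> V2 \<and> t = 1 \<or> z \<in> H2 \<and> t = 0 \<or> z \<in> C2 \<and> 0 \<le> t \<and> t \<le> 1}"
    unfolding x link_component2_def closed_polygon_def V2_def H2_def C2_def vseg_def hseg_def
    apply (simp add: lessThan_nat_numeral lessThan_Suc closed_segment_vertical closed_segment_horizontal
      closed_segment_height closed_segment_eq_real_ivl)
    apply (simp only: conj_disj_distribR disj_ac conj_assoc)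
    done
qed

lemma closed_segs: "closed (vseg a b c)" "closed (hseg a b c)"
  unfolding vseg_def hseg_def
  by (intro closed_Collect_conj closed_Collect_eq closed_Collect_le continuous_intros)+

lemma closed_VH: "closed V1" "closed V2" "closed H1" "closed H2" "closed C1" "closed C2"
  unfolding V1_def V2_def H1_def H2_def C1_def C2_def
  by (intro closed_Un closed_segs finite_imp_closed; simp)+

lemma bounded_VH: "V1 \<union> V2 \<union> H1 \<union> H2 \<union> C1 \<union> C2 \<subseteq> cbox 0 (Complex 7 7)"
  unfolding V1_def V2_def H1_def H2_def C1_def C2_def vseg_def hseg_def
  by (auto simp: in_cbox_complex_iff)

lemma compact_component_shape:
  assumes "closed V" "closed H" "closed C" "V \<union> H \<union> C \<subseteq> cbox 0 (Complex 7 7)"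
  shows "compact {(z, t). z \<in> V \<and> t = 1 \<or> z \<in> H \<and> t = 0 \<or> z \<in> C \<and> 0 \<le> t \<and> t \<le> (1::real)}" (is "compact ?S")
proof -
  have "?S = V \<times> {1} \<union> H \<times> {0} \<union> C \<times> {0..1}" by auto
  moreover have "compact V" "compact H" "compact C"
    using assms by (metis (no_types, lifting) compact_cbox closed_Int_compact inf.absorb1 le_sup_iff)+
  ultimately show ?thesis by (simp add: compact_Times compact_Un)
qed

lemma compact_link: "compact link_component1" "compact link_component2"
  unfolding link_component1_eq link_component2_eq
  by (intro compact_component_shape closed_VH; use bounded_VH in blast)+

text \<open>The projection of all over-strands, which run at height 1; \<open>Hl\<close> collects
  the under-strands at height 0.\<close>

definition Vl :: "complex set" where "Vl = V1 \<union> V2"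
definition Hl :: "complex set" where "Hl = H1 \<union> H2"

lemmas diagram_defs = Vl_def Hl_def V1_def V2_def H1_def H2_def C1_def C2_def vseg_def hseg_def

definition Lk :: "point set" where "Lk = link_component1 \<union> link_component2"

lemma Lk_eq: "Lk = {(z, t). z \<in> Vl \<and> t = 1 \<or> z \<in> Hl \<and> t = 0 \<or> z \<in> C1 \<union> C2 \<and> 0 \<le> t \<and> t \<le> 1}"
  unfolding Lk_def link_component1_eq link_component2_eq Vl_def Hl_def by auto

text \<open>The points whose upward vertical ray misses the link; \<open>Dn\<close> does the same
  for downward rays. What remains of the complement lies between the two strands of a
  crossing.\<close>

definition Up :: "point set" where
  "Up = {(z, t). (z \<in> Vl \<longrightarrow> t > 1) \<and> (z \<in> Hl \<longrightarrow> t > 0)}"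

definition Dn :: "point set" where
  "Dn = {(z, t). (z \<in> Vl \<longrightarrow> t < 1) \<and> (z \<in> Hl \<longrightarrow> t < 0)}"

lemma closed_Vl_Hl: "closed Vl" "closed Hl"
  by (simp_all add: Vl_def Hl_def closed_Un closed_VH)

lemma open_Up: "open Up" and open_Dn: "open Dn"
proof -
  have cl: "closed {x :: point. fst x \<in> A \<and> snd x \<le> c}" "closed {x :: point. fst x \<in> A \<and> c \<le> snd x}"
    if "closed A" for A c
  proof -
    have "{x :: point. fst x \<in> A \<and> snd x \<le> c} = A \<times> {..c}" "{x :: point. fst x \<in> A \<and> c \<le> snd x} = A \<times> {c..}"
      by auto
    then show "closed {x :: point. fst x \<in> A \<and> snd x \<le> c}" "closed {x :: point. fst x \<in> A \<and> c \<le> snd x}"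
      using that by (simp_all add: closed_Times)
  qed
  have "Up = - ({x. fst x \<in> Vl \<and> snd x \<le> 1} \<union> {x. fst x \<in> Hl \<and> snd x \<le> 0})"
    "Dn = - ({x. fst x \<in> Vl \<and> 1 \<le> snd x} \<union> {x. fst x \<in> Hl \<and> 0 \<le> snd x})"
    by (auto simp: Up_def Dn_def not_le not_less)
  note eqs = this
  show "open Up" "open Dn"
    unfolding eqs by (intro open_Compl closed_Un cl closed_Vl_Hl)+
qed

lemma corners_subset: "C1 \<subseteq> V1 \<inter> H1" "C2 \<subseteq> V2 \<inter> H2"
  by (auto simp: diagram_defs)

lemma Up_disjoint: "Up \<inter> Lk = {}" and Dn_disjoint: "Dn \<inter> Lk = {}"
  using corners_subset unfolding Up_def Dn_def Lk_eq Vl_def Hl_def by fastforce+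

text \<open>Push vertically in direction \<sigma> until beyond the link, at \<sigma> t \<ge> 2, and
  contract there linearly to one point.\<close>

lemma contractible_vertical:
  fixes U :: "point set" and \<sigma> :: real
  assumes \<sigma>: "\<sigma> = 1 \<or> \<sigma> = -1"
    and up: "\<And>z t d. (z, t) \<in> U \<Longrightarrow> d \<ge> 0 \<Longrightarrow> (z, t + \<sigma> * d) \<in> U"
    and top: "\<And>z t. \<sigma> * t \<ge> 2 \<Longrightarrow> (z, t) \<in> U"
  shows "contractible U"
proof -
  define h where "h x = (fst x, \<sigma> * max (\<sigma> * snd x) 2)" for x :: "point"
  have "homotopic_with_canon (\<lambda>x. True) U U id h"
  proof (rule homotopic_with_linear)
    show "continuous_on U h" unfolding h_def by (intro continuous_intros)
    fix x assume x: "x \<in> U"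
    show "closed_segment (id x) (h x) \<subseteq> U"
    proof
      fix y assume "y \<in> closed_segment (id x) (h x)"
      then obtain a where a: "0 \<le> a" "a \<le> 1" "y = (1 - a) *\<^sub>R x + a *\<^sub>R h x" by (auto simp: in_segment)
      define d where "d = a * (max (\<sigma> * snd x) 2 - \<sigma> * snd x)"
      have "d \<ge> 0" using a by (simp add: d_def)
      moreover have "y = (fst x, snd x + \<sigma> * d)"
        unfolding a(3) h_def d_def using \<sigma>
        by (cases x, elim disjE) (simp_all add: algebra_simps flip: scaleR_left_distrib)
      ultimately show "y \<in> U" using up[of "fst x" "snd x" d] x by simp
    qed
  qed (simp add: continuous_on_id)
  moreover have "homotopic_with_canon (\<lambda>x. True) U U h (\<lambda>x. (0, \<sigma> * 2))"
  proof (rule homotopic_with_linear)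
    show "continuous_on U h" unfolding h_def by (intro continuous_intros)
    fix x assume x: "x \<in> U"
    show "closed_segment (h x) (0, \<sigma> * 2) \<subseteq> U"
    proof
      fix y assume "y \<in> closed_segment (h x) (0, \<sigma> * 2)"
      then obtain a where a: "0 \<le> a" "a \<le> 1" "y = (1 - a) *\<^sub>R h x + a *\<^sub>R (0, \<sigma> * 2)" by (auto simp: in_segment)
      have "\<sigma> * snd y = (1 - a) * max (\<sigma> * snd x) 2 + a * 2"
        unfolding a(3) h_def using \<sigma> by (elim disjE) (simp_all add: algebra_simps)
      also have "\<dots> \<ge> (1 - a) * 2 + a * 2" using a by (intro add_mono mult_left_mono) auto
      finally have "\<sigma> * snd y \<ge> 2" by simp
      then show "y \<in> U" using top[of "snd y" "fst y"] by simp
    qed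
  qed (simp add: continuous_on_const)
  ultimately have "homotopic_with_canon (\<lambda>x. True) U U id (\<lambda>x. (0, \<sigma> * 2))"
    by (rule homotopic_with_trans)
  then show ?thesis unfolding contractible_def by blast
qed

lemma contractible_Up: "contractible Up" and contractible_Dn: "contractible Dn"
proof -
  show "contractible Up"
    by (rule contractible_vertical[of 1]) (auto simp: Up_def)
  show "contractible Dn"
    by (rule contractible_vertical[of "-1"]) (auto simp: Dn_def)
qed

text \<open>Listed so that the open squares of half-side 1 around them meet the diagram only in the
  two lines that cross, away from all corners.\<close>

definition crossings :: "(real \<times> real) set" where
  "crossings = {(2, 5), (6, 3), (4, 1), (1, 6), (3, 4), (5, 2)}"

definition square :: "real \<times> real \<Rightarrow> complex set" where
  "square c = {z. \<bar>Re z - fst c\<bar> < 1 \<and> \<bar>Im z - snd c\<bar> < 1}"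

lemma Vl_square: "c \<in> crossings \<Longrightarrow> z \<in> square c \<Longrightarrow> z \<in> Vl \<longleftrightarrow> Re z = fst c"
  and Hl_square: "c \<in> crossings \<Longrightarrow> z \<in> square c \<Longrightarrow> z \<in> Hl \<longleftrightarrow> Im z = snd c"
  and corner_square: "c \<in> crossings \<Longrightarrow> z \<in> square c \<Longrightarrow> z \<notin> C1 \<union> C2"
  unfolding crossings_def square_def diagram_defs
  apply -
  apply (elim insertE emptyE; simp add: abs_less_iff; linarith)
  apply (elim insertE emptyE; simp add: abs_less_iff; linarith)
  apply (elim insertE emptyE; auto simp: abs_less_iff)
  done

lemma convex_square: "convex (square c)" "open (square c)"
proof -
  have *: "square c = {z. Re z < fst c + 1} \<inter> {z. Re z > fst c - 1} \<inter> ({z. Im z < snd c + 1} \<inter> {z. Im z > snd c - 1})"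
    by (auto simp: square_def abs_less_iff)
  show "convex (square c)" unfolding *
    by (intro convex_Int convex_halfspace_Re_lt convex_halfspace_Re_gt convex_halfspace_Im_lt convex_halfspace_Im_gt)
  show "open (square c)" unfolding *
    by (intro open_Int open_halfspace_Re_lt open_halfspace_Re_gt open_halfspace_Im_lt open_halfspace_Im_gt)
qed

definition cbx :: "real \<times> real \<Rightarrow> point set" where
  "cbx c = square c \<times> {0<..<1}"

lemma convex_cbx: "convex (cbx c)" "open (cbx c)"
  by (simp_all add: cbx_def convex_Times open_Times convex_square)

lemma cbx_disjoint: "c \<in> crossings \<Longrightarrow> cbx c \<inter> Lk = {}"
  using corner_square[of c] unfolding cbx_def Lk_eq by auto

lemma Vl_Hl_crossing:
  assumes "z \<in> Vl" "z \<in> Hl" "z \<notin> C1 \<union> C2"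
  shows "\<exists>c\<in>crossings. z \<in> square c"
proof -
  have "z \<in> {Complex 2 5, Complex 6 3, Complex 4 1, Complex 1 6, Complex 3 4, Complex 5 2}"
    using assms unfolding diagram_defs
    apply (simp add: complex_eq_iff)
    apply (elim disjE conjE; simp)
    done
  then show ?thesis
    unfolding crossings_def square_def by (elim insertE emptyE) simp_all
qed

lemma cover_compl_Lk: "- Lk = Up \<union> Dn \<union> (\<Union>c\<in>crossings. cbx c)"
proof (intro equalityI subsetI)
  fix x assume x: "x \<in> - Lk"
  obtain z t where xz: "x = (z, t)" by (cases x)
  show "x \<in> Up \<union> Dn \<union> (\<Union>c\<in>crossings. cbx c)"
  proof (cases "x \<in> Up \<union> Dn")
    case False
    then have 1: "z \<in> Vl \<and> t \<le> 1 \<or> z \<in> Hl \<and> t \<le> 0" "z \<in> Vl \<and> 1 \<le> t \<or> z \<in> Hl \<and> 0 \<le> t"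
      by (auto simp: xz Up_def Dn_def not_less)
    have 2: "\<not> (z \<in> Vl \<and> t = 1)" "\<not> (z \<in> Hl \<and> t = 0)" "\<not> (z \<in> C1 \<union> C2 \<and> 0 \<le> t \<and> t \<le> 1)"
      using x by (auto simp: xz Lk_eq)
    have 3: "z \<in> Vl \<and> z \<in> Hl \<and> 0 < t \<and> t < 1"
      using 1 2(1,2) by (smt (verit))
    then obtain c where "c \<in> crossings" "z \<in> square c" using Vl_Hl_crossing 2(3) by force
    then show ?thesis using 3 by (auto simp: xz cbx_def)
  qed blast
qed (use Up_disjoint Dn_disjoint cbx_disjoint in blast)

section \<open>Sections of the covering and the deck transformations between them\<close>

section \<open>Sections over simply connected pieces\<close>

context dehn_orbifold begin

definition is_section :: "point set \<Rightarrow> (point \<Rightarrow> point) \<Rightarrow> bool" where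
  "is_section U s' \<longleftrightarrow> continuous_on U s' \<and> (\<forall>y\<in>U. s' y \<in> Hcov \<and> proj (s' y) = y)"

lemma is_section_exists:
  assumes "simply_connected U" "open U" "U \<inter> L = {}"
  shows "\<exists>s'. is_section U s'"
proof -
  have "(\<lambda>y. y) \<in> U \<rightarrow> - L" using assms(3) by blast
  from covering_space_lift[OF covering_proj assms(1) open_imp_locally_path_connected[OF assms(2)]
      continuous_on_id this]
  obtain h where "continuous_on U h" "h \<in> U \<rightarrow> Hcov" "\<And>y. y \<in> U \<Longrightarrow> proj (h y) = y" by metis
  then show ?thesis unfolding is_section_def by (intro exI[of _ h]) (simp add: Pi_iff)
qed

lemma is_section_subset: "is_section U s' \<Longrightarrow> V \<subseteq> U \<Longrightarrow> is_section V s'"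
  unfolding is_section_def using continuous_on_subset by blast

lemma is_section_act:
  assumes "is_section U s'" "A \<in> \<Gamma>"
  shows "is_section U (\<lambda>y. act A (s' y))"
proof -
  have "continuous_on U (act A \<circ> s')"
    using assms open_Hcov(2) unfolding is_section_def
    by (intro continuous_on_compose continuous_on_subset[OF continuous_on_act[OF \<Gamma>(4)[OF assms(2)]]]) auto
  then show ?thesis
    using assms act_Hcov proj_act by (simp add: is_section_def comp_def)
qed

text \<open>Both sides lift the same map and agree at one point, so uniqueness of lifts gives
  agreement on a connected domain: the deck transformation between two lifts is constant.\<close>

lemma lift_transition:
  fixes F1 F2 :: "'b::real_normed_vector \<Rightarrow> point"
  assumes F: "continuous_on S F1" "continuous_on S F2" "\<And>y. y \<in> S \<Longrightarrow> F1 y \<in> Hcov" "\<And>y. y \<in> S \<Longrightarrow> F2 y \<in> Hcov"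
    and pr: "\<And>y. y \<in> S \<Longrightarrow> proj (F1 y) = proj (F2 y)"
    and S: "connected S" "x \<in> S" "y \<in> S" and A: "A \<in> \<Gamma>" "F1 x = act A (F2 x)"
  shows "F1 y = act A (F2 y)"
proof (rule covering_space_lift_unique[OF covering_proj, of F1 x "\<lambda>y. act A (F2 y)" S "\<lambda>y. proj (F2 y)"])
  show "continuous_on S (\<lambda>y. act A (F2 y))"
    using F(2,4) open_Hcov(2)
    by (intro continuous_on_compose2[OF continuous_on_subset[OF continuous_on_act[OF \<Gamma>(4)[OF A(1)]]] F(2)]) auto
  show "continuous_on S (\<lambda>y. proj (F2 y))"
    using F(2,4) by (intro continuous_on_compose2[OF continuous_on_proj F(2)]) auto
  show "(\<lambda>y. proj (F2 y)) \<in> S \<rightarrow> - L" using F(4) proj(1) by blast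
  show "(\<lambda>y. act A (F2 y)) \<in> S \<rightarrow> Hcov" using F(4) act_Hcov[OF A(1)] by blast
  show "proj (F2 y) = proj (act A (F2 y))" if "y \<in> S" for y using proj_act[OF A(1) F(4)[OF that]] by simp
qed (use F pr S A in auto)

lemma section_transition_at:
  assumes "is_section U s1" "is_section U s2" "connected U" "x \<in> U" "y \<in> U" "A \<in> \<Gamma>" "s1 x = act A (s2 x)"
  shows "s1 y = act A (s2 y)"
  by (rule lift_transition[of U s1 s2]) (use assms in \<open>auto simp: is_section_def\<close>)

lemma section_transition:
  assumes s12: "is_section U s1" "is_section U s2" and U: "connected U" "U \<noteq> {}"
  shows "\<exists>A\<in>\<Gamma>. \<forall>y\<in>U. s1 y = act A (s2 y)"
proof -
  obtain x where x: "x \<in> U" using U by blast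
  have "proj (s2 x) = proj (s1 x)" "s1 x \<in> Hcov" "s2 x \<in> Hcov" using s12 x by (auto simp: is_section_def)
  then obtain A where "A \<in> \<Gamma>" "s1 x = act A (s2 x)" using proj_eq_iff by blast
  then show ?thesis using section_transition_at[OF s12 U(1) x] by blast
qed

lemma Hcov_peq: "x \<in> Hcov \<Longrightarrow> A \<in> \<Gamma> \<Longrightarrow> B \<in> \<Gamma> \<Longrightarrow> act A x = act B x \<Longrightarrow> A \<doteq> B"
  using free_at_peq[OF free_Hcov dg] open_Hcov(2) by blast

lemma act_mult_Hcov: "x \<in> Hcov \<Longrightarrow> A \<in> \<Gamma> \<Longrightarrow> B \<in> \<Gamma> \<Longrightarrow> act (A ** B) x = act A (act B x)"
  using act_mult[of A B x] \<Gamma>(4) open_Hcov(2) by blast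

text \<open>Sheets are open because \<open>P\<close> is injective near a point of
  \<open>Hcov\<close>, the action there being free: a continuous section whose value stays in that
  neighbourhood must return the point itself.\<close>

lemma section_translates_open:
  assumes "is_section U s'" "open U" "B \<in> \<Gamma>"
  shows "open {x \<in> Hcov. proj x \<in> U \<and> x = act B (s' (proj x))}" (is "open ?E")
proof (subst open_subopen, intro ballI)
  fix x0 assume x0: "x0 \<in> ?E"
  then have x0H: "x0 \<in> H3" "x0 \<in> Hcov" using open_Hcov(2) by auto
  obtain N where N: "open N" "x0 \<in> N" "N \<subseteq> H3" "\<And>A. A \<in> \<Gamma> \<Longrightarrow> act A ` N \<inter> N \<noteq> {} \<Longrightarrow> act A x0 = x0"
    using free_neighbourhood[OF x0H(1)] by metis
  have inj: "inj_on P N" by (rule injective_neighbourhood[OF x0H(1) free_Hcov[OF x0H(2)] N(1,3,4)])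
  define D where "D = Hcov \<inter> proj -` U"
  have oD: "open D" unfolding D_def
    using continuous_on_proj open_Hcov(1) assms(2) by (simp add: continuous_on_open_vimage Int_commute)
  have "continuous_on D ((\<lambda>y. act B (s' y)) \<circ> proj)"
    using is_section_act[OF assms(1,3)] continuous_on_proj unfolding is_section_def D_def
    by (intro continuous_on_compose) (auto intro: continuous_on_subset)
  then have "open (D \<inter> ((\<lambda>y. act B (s' y)) \<circ> proj) -` N)"
    using oD N(1) by (simp add: continuous_on_open_vimage Int_commute comp_def)
  then have "open (N \<inter> (D \<inter> ((\<lambda>y. act B (s' y)) \<circ> proj) -` N))" (is "open ?W") using N(1) by blast
  moreover have "x0 \<in> ?W" using x0 N(2) by (simp add: D_def)
  moreover have "?W \<subseteq> ?E"
  proof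
    fix x assume x: "x \<in> ?W"
    then have *: "x \<in> Hcov" "proj x \<in> U" "x \<in> N" "act B (s' (proj x)) \<in> N" by (auto simp: D_def)
    have "proj (act B (s' (proj x))) = proj x" "act B (s' (proj x)) \<in> Hcov"
      using is_section_act[OF assms(1,3)] *(2) by (auto simp: is_section_def)
    then have "P (act B (s' (proj x))) = P x" using proj(2) *(1) by metis
    then have "act B (s' (proj x)) = x" using inj_onD[OF inj] * by blast
    then show "x \<in> ?E" using * by simp
  qed
  ultimately show "\<exists>T. open T \<and> x0 \<in> T \<and> T \<subseteq> ?E" by blast
qed

text \<open>A connected set is covered by the \<open>G\<close>-translates of the sheets as soon as \<open>G\<close> contains all
  transition elements.\<close>

lemma transitions_generate:
  assumes U: "\<And>i. i \<in> I \<Longrightarrow> open (U i)" "\<And>i. i \<in> I \<Longrightarrow> is_section (U i) (t i)" "connected {x \<in> Hcov. proj x \<in> (\<Union>i\<in>I. U i)}"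
    and G: "subgroup G SL2C" "- mat 1 \<in> G" "G \<subseteq> \<Gamma>"
    and tr: "\<And>i j y. i \<in> I \<Longrightarrow> j \<in> I \<Longrightarrow> y \<in> U i \<Longrightarrow> y \<in> U j \<Longrightarrow> \<exists>A\<in>G. t i y = act A (t j y)"
    and ne: "(\<Union>i\<in>I. U i) \<noteq> {}"
  shows "\<Gamma> \<subseteq> G"
proof
  note Gs = subgroup_SL2C_D[OF G(1)]
  have Gneg: "- A \<in> G" if "A \<in> G" for A
    using Gs(3)[OF G(2) that] by (simp add: matrix_mult_uminus)
  define E where "E i B = {x \<in> Hcov. proj x \<in> U i \<and> x = act B (t i (proj x))}" for i B
  have oE: "open (E i B)" if "i \<in> I" "B \<in> \<Gamma>" for i B
    unfolding E_def using section_translates_open[OF U(2,1)] that by blast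
  \<comment> \<open>Sheets labelled by G and sheets labelled by the other elements. They are open,
    disjoint and together cover the connected preimage, so the second family is empty.\<close>
  define Y Z where "Y = (\<Union>i\<in>I. \<Union>B\<in>G. E i B)" "Z = (\<Union>i\<in>I. \<Union>B\<in>\<Gamma> - G. E i B)"
  have "open Y" "open Z" unfolding Y_Z_def using oE G(3) by blast+
  have exE: "\<exists>B\<in>\<Gamma>. x \<in> E i B" if x: "x \<in> Hcov" "i \<in> I" "proj x \<in> U i" for x i
  proof -
    have "proj (t i (proj x)) = proj x" "t i (proj x) \<in> Hcov"
      using U(2)[OF x(2)] x(3) by (auto simp: is_section_def)
    then obtain B where "B \<in> \<Gamma>" "x = act B (t i (proj x))" using proj_eq_iff x(1) by blast
    then show ?thesis using x by (auto simp: E_def)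
  qed
  let ?H = "{x \<in> Hcov. proj x \<in> (\<Union>i\<in>I. U i)}"
  have "?H \<subseteq> Y \<union> Z"
  proof
    fix x assume "x \<in> ?H"
    then obtain i where x: "x \<in> Hcov" and i: "i \<in> I" "proj x \<in> U i" by blast
    then show "x \<in> Y \<union> Z" using exE[OF x i] unfolding Y_Z_def by blast
  qed
  have disj: "Y \<inter> Z = {}"
  proof (rule ccontr)
    assume "Y \<inter> Z \<noteq> {}"
    then obtain x i j A B where x: "i \<in> I" "j \<in> I" "A \<in> G" "B \<in> \<Gamma>" "B \<notin> G" "x \<in> E i A" "x \<in> E j B"
      unfolding Y_Z_def by blast
    let ?y = "proj x"
    have y: "?y \<in> U i" "?y \<in> U j" "x = act A (t i ?y)" "x = act B (t j ?y)" using x(6,7) by (auto simp: E_def)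
    obtain C where C: "C \<in> G" "t i ?y = act C (t j ?y)" using tr[OF x(1,2) y(1,2)] by blast
    have tj: "t j ?y \<in> Hcov" using U(2)[OF x(2)] y(2) by (auto simp: is_section_def)
    have "act (A ** C) (t j ?y) = act B (t j ?y)"
      using act_mult_Hcov[OF tj, of A C] x(3) C G(3) y by auto
    then have "A ** C \<doteq> B"
      using Hcov_peq[OF tj] \<Gamma>(5) x C(1) G(3) by blast
    then have "B = A ** C \<or> B = - (A ** C)" by (auto simp: peq_def)
    then have "B \<in> G" using Gs(3)[OF x(3) C(1)] Gneg by metis
    then show False using x(5) by blast
  qed
  obtain y i where i: "i \<in> I" "y \<in> U i" using ne by blast
  have ty: "t i y \<in> Hcov" "proj (t i y) = y" using U(2)[OF i(1)] i(2) by (auto simp: is_section_def)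
  have mem: "act B (t i y) \<in> E i B" if "B \<in> \<Gamma>" for B
    unfolding E_def using ty i(2) act_Hcov proj_act that by auto
  have "t i y \<in> Y"
    using mem[OF \<Gamma>(3)] i(1) Gs(2) unfolding Y_Z_def by force
  have ZH: "Z \<inter> ?H = {}"
  proof -
    have "t i y \<in> ?H" using ty i by auto
    then have "Y \<inter> ?H \<noteq> {}" using \<open>t i y \<in> Y\<close> by blast
    moreover have "Y \<inter> ?H = {} \<or> Z \<inter> ?H = {}"
      by (rule connectedD[OF U(3) \<open>open Y\<close> \<open>open Z\<close> _ \<open>?H \<subseteq> Y \<union> Z\<close>]) (simp add: disj)
    ultimately show ?thesis by blast
  qed
  fix B assume B: "B \<in> \<Gamma>"
  have "act B (t i y) \<in> ?H" using act_Hcov[OF B ty(1)] proj_act[OF B ty(1)] ty(2) i by auto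
  then show "B \<in> G" using ZH mem[OF B] i(1) B unfolding Y_Z_def by blast
qed

end

section \<open>Face elements and crossing relations\<close>

section \<open>The Dehn presentation\<close>

locale link_orbifold = dehn_orbifold \<Gamma> M P link_component1 link_component2 e f g p q r s core k
  for \<Gamma> M P e f g p q r s core k
begin

lemma L_eq: "L = Lk"
  by (simp add: L_def Lk_def)

lemma sections_exist: "\<exists>s'. is_section Up s'" "\<exists>s'. is_section Dn s'" "c \<in> crossings \<Longrightarrow> \<exists>s'. is_section (cbx c) s'"
proof -
  show "\<exists>s'. is_section Up s'"
    by (rule is_section_exists[OF contractible_imp_simply_connected[OF contractible_Up] open_Up])
       (simp add: L_eq Up_disjoint)
  show "\<exists>s'. is_section Dn s'"
    by (rule is_section_exists[OF contractible_imp_simply_connected[OF contractible_Dn] open_Dn])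
       (simp add: L_eq Dn_disjoint)
  show "\<exists>s'. is_section (cbx c) s'" if "c \<in> crossings"
    by (rule is_section_exists[OF convex_imp_simply_connected[OF convex_cbx(1)] convex_cbx(2)])
       (simp add: L_eq cbx_disjoint that)
qed

definition sp :: "point \<Rightarrow> point" where "sp = (SOME s'. is_section Up s')"

lemma sp: "is_section Up sp"
  unfolding sp_def using sections_exist(1) by (rule someI_ex)

lemma face_in_Up_Dn: "z \<notin> Vl \<Longrightarrow> z \<notin> Hl \<Longrightarrow> (z, t) \<in> Up \<and> (z, t) \<in> Dn"
  by (simp add: Up_def Dn_def)

lemma outer_point: "- 1 \<notin> Vl" "- 1 \<notin> Hl"
  by (auto simp: diagram_defs)

text \<open>The section over the lower part is normalised to agree with the upper one over the outer face.\<close>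

lemma sm_exists: "\<exists>s'. is_section Dn s' \<and> sp (- 1, 0) = s' (- 1, 0)"
proof -
  obtain s' where s': "is_section Dn s'" using sections_exist(2) by blast
  have i: "(- 1, 0) \<in> Up" "(- 1, 0) \<in> Dn" using face_in_Up_Dn outer_point by blast+
  have "proj (sp (- 1, 0)) = proj (s' (- 1, 0))" "sp (- 1, 0) \<in> Hcov" "s' (- 1, 0) \<in> Hcov"
    using sp s' i unfolding is_section_def by auto
  then obtain A where "A \<in> \<Gamma>" "sp (- 1, 0) = act A (s' (- 1, 0))" using proj_eq_iff by metis
  then show ?thesis using is_section_act[OF s'] by blast
qed

definition sm :: "point \<Rightarrow> point" where
  "sm = (SOME s'. is_section Dn s' \<and> sp (- 1, 0) = s' (- 1, 0))"

lemma sm: "is_section Dn sm" "sp (- 1, 0) = sm (- 1, 0)"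
  using someI_ex[OF sm_exists] unfolding sm_def by blast+

text \<open>The deck transformation between the upper and the lower section over a face. It is the
  generator that the Dehn presentation attaches to this region: a loop through the face of
  \<open>z\<close> and the outer face, where the two sections agree.\<close>

definition trans_at :: "complex \<Rightarrow> complex^2^2 \<Rightarrow> bool" where
  "trans_at z A \<longleftrightarrow> A \<in> \<Gamma> \<and> (\<forall>t. sp (z, t) = act A (sm (z, t)))"

abbreviation face :: "complex set \<Rightarrow> bool" where
  "face Q \<equiv> connected Q \<and> Q \<inter> (Vl \<union> Hl) = {}"

lemma trans_convex:
  assumes Q: "face Q" and z: "z \<in> Q" "z' \<in> Q" and A: "A \<in> \<Gamma>" "sp (z, t) = act A (sm (z, t))"
  shows "sp (z', t') = act A (sm (z', t'))"
proof -
  have "Q \<times> UNIV \<subseteq> Up" "Q \<times> UNIV \<subseteq> Dn" using Q face_in_Up_Dn by auto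
  then have "is_section (Q \<times> UNIV) sp" "is_section (Q \<times> UNIV) sm"
    using sp sm(1) is_section_subset by blast+
  then show ?thesis
    by (rule section_transition_at[of _ _ _ "(z, t)"])
       (use Q z A in \<open>auto intro!: connected_Times\<close>)
qed

lemma trans_face: "face Q \<Longrightarrow> z \<in> Q \<Longrightarrow> z' \<in> Q \<Longrightarrow> trans_at z A \<Longrightarrow> trans_at z' A"
  unfolding trans_at_def using trans_convex by blast

lemma trans_exists:
  assumes "z \<notin> Vl" "z \<notin> Hl"
  shows "\<exists>A. trans_at z A"
proof -
  have i: "(z, 0) \<in> Up" "(z, 0) \<in> Dn" using face_in_Up_Dn assms by blast+
  have "proj (sp (z, 0)) = proj (sm (z, 0))" "sp (z, 0) \<in> Hcov" "sm (z, 0) \<in> Hcov"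
    using sp sm(1) i unfolding is_section_def by auto
  then obtain A where "A \<in> \<Gamma>" "sp (z, 0) = act A (sm (z, 0))" using proj_eq_iff by metis
  then show ?thesis
    unfolding trans_at_def using trans_convex[of "{z}" z z A 0] assms by auto
qed

lemma sm_Hcov: "z \<notin> Vl \<Longrightarrow> z \<notin> Hl \<Longrightarrow> sm (z, t) \<in> Hcov" and sp_Hcov: "z \<notin> Vl \<Longrightarrow> z \<notin> Hl \<Longrightarrow> sp (z, t) \<in> Hcov"
  using sp sm(1) face_in_Up_Dn[of z t] unfolding is_section_def by auto

lemma trans_peq: "trans_at z A \<Longrightarrow> A \<doteq> B \<Longrightarrow> trans_at z B"
proof -
  assume A: "trans_at z A" "A \<doteq> B"
  then have "B = A \<or> B = - A" by (auto simp: peq_def)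
  then have "B \<in> \<Gamma>" using A(1) \<Gamma>(7) by (auto simp: trans_at_def)
  then show "trans_at z B" using A act_peq[OF A(2)] by (simp add: trans_at_def)
qed

lemma trans_outer: "trans_at (- 1) (mat 1)"
  unfolding trans_at_def using trans_convex[of "{- 1}" "- 1" "- 1" "mat 1" 0] outer_point sm(2) \<Gamma>(3) by auto

text \<open>Between the strands, the left and right halves of the box belong to \<open>Up\<close>
  and its top and bottom halves to \<open>Dn\<close>. One section over the box therefore differs
  from \<open>sp\<close> by hL, hR and from \<open>sm\<close> by kT, kB. The four quadrants give hL
  A = kT, hR B = kT, hL C = kB, hR D = kB, so both quotients equal hL^-1 hR.\<close>

lemma trans_crossing:
  assumes c: "c \<in> crossings" and z: "NW \<in> square c" "NE \<in> square c" "SW \<in> square c" "SE \<in> square c"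
    "Re NW < fst c" "Im NW > snd c" "Re NE > fst c" "Im NE > snd c"
    "Re SW < fst c" "Im SW < snd c" "Re SE > fst c" "Im SE < snd c"
    and A: "trans_at NW A" "trans_at NE B" "trans_at SW C" "trans_at SE D"
  shows "A ** minv B \<doteq> C ** minv D"
proof -
  obtain s1 where s1: "is_section (cbx c) s1" using sections_exist(3)[OF c] by blast
  define half where "half h b = (square c \<inter> {z. h z > (b::real)}) \<times> {0<..<1::real}" for h b
  have half: "half h b \<subseteq> cbx c" for h b by (auto simp: half_def cbx_def)
  have half_conv: "connected (half h b)" if "convex {z. h z > b}" for h b
    unfolding half_def using that convex_square by (intro convex_connected convex_Times convex_Int) auto
  define l where "l z = - Re z" for z
  define d where "d z = - Im z" for z
  have cv: "convex {z. l z > b}" "convex {z. Re z > b}" "convex {z. Im z > b}" "convex {z. d z > b}" for b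
    using convex_halfspace_Re_lt[of "- b"] convex_halfspace_Im_lt[of "- b"]
    by (simp_all add: l_def d_def convex_halfspace_Re_gt convex_halfspace_Im_gt less_minus_iff)
  have upL: "half l (- fst c) \<subseteq> Up" and upR: "half Re (fst c) \<subseteq> Up"
    and dnT: "half Im (snd c) \<subseteq> Dn" and dnB: "half d (- snd c) \<subseteq> Dn"
    using Vl_square[OF c] Hl_square[OF c] unfolding half_def Up_def Dn_def l_def d_def by auto
  have m: "(NW, 1/2) \<in> half l (- fst c)" "(NW, 1/2) \<in> half Im (snd c)" "(NE, 1/2) \<in> half Re (fst c)" "(NE, 1/2) \<in> half Im (snd c)"
    "(SW, 1/2) \<in> half l (- fst c)" "(SW, 1/2) \<in> half d (- snd c)" "(SE, 1/2) \<in> half Re (fst c)" "(SE, 1/2) \<in> half d (- snd c)"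
    using z by (auto simp: half_def l_def d_def)
  have ex: "\<exists>h\<in>\<Gamma>. \<forall>y\<in>half w b. s1 y = act h (t y)"
    if "half w b \<subseteq> U" "is_section U t" "convex {z. w z > b}" "x \<in> half w b" for w b U t x
    by (rule section_transition[OF is_section_subset[OF s1 half] is_section_subset[OF that(2,1)] half_conv[OF that(3)]])
       (use that in blast)
  obtain hL where hL: "hL \<in> \<Gamma>" "\<And>y. y \<in> half l (- fst c) \<Longrightarrow> s1 y = act hL (sp y)"
    using ex[OF upL sp cv(1) m(1)] by blast
  obtain hR where hR: "hR \<in> \<Gamma>" "\<And>y. y \<in> half Re (fst c) \<Longrightarrow> s1 y = act hR (sp y)"
    using ex[OF upR sp cv(2) m(3)] by blast
  obtain kT where kT: "kT \<in> \<Gamma>" "\<And>y. y \<in> half Im (snd c) \<Longrightarrow> s1 y = act kT (sm y)"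
    using ex[OF dnT sm(1) cv(3) m(2)] by blast
  obtain kB where kB: "kB \<in> \<Gamma>" "\<And>y. y \<in> half d (- snd c) \<Longrightarrow> s1 y = act kB (sm y)"
    using ex[OF dnB sm(1) cv(4) m(6)] by blast
  have Q: "h ** Ma \<doteq> k'" if "h \<in> \<Gamma>" "k' \<in> \<Gamma>" "trans_at w Ma" "s1 (w, 1/2) = act h (sp (w, 1/2))" "s1 (w, 1/2) = act k' (sm (w, 1/2))"
    "w \<notin> Vl" "w \<notin> Hl" for h Ma k' w
  proof -
    have Ma: "Ma \<in> \<Gamma>" "sp (w, 1/2) = act Ma (sm (w, 1/2))" using that(3) by (auto simp: trans_at_def)
    have "act (h ** Ma) (sm (w, 1/2)) = act k' (sm (w, 1/2))"
      using act_mult_Hcov[OF sm_Hcov[OF that(6,7)] that(1) Ma(1)] Ma(2) that(4,5) by simp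
    then show ?thesis
      using Hcov_peq[OF sm_Hcov[OF that(6,7)] \<Gamma>(5)[OF that(1) Ma(1)] that(2)] by blast
  qed
  have nVH: "NW \<notin> Vl" "NW \<notin> Hl" "NE \<notin> Vl" "NE \<notin> Hl" "SW \<notin> Vl" "SW \<notin> Hl" "SE \<notin> Vl" "SE \<notin> Hl"
    using z Vl_square[OF c] Hl_square[OF c] by auto
  have R: "hL ** A \<doteq> kT" "hR ** B \<doteq> kT" "hL ** C \<doteq> kB" "hR ** D \<doteq> kB"
    using Q[OF hL(1) kT(1) A(1) hL(2)[OF m(1)] kT(2)[OF m(2)] nVH(1,2)]
      Q[OF hR(1) kT(1) A(2) hR(2)[OF m(3)] kT(2)[OF m(4)] nVH(3,4)]
      Q[OF hL(1) kB(1) A(3) hL(2)[OF m(5)] kB(2)[OF m(6)] nVH(5,6)]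
      Q[OF hR(1) kB(1) A(4) hR(2)[OF m(7)] kB(2)[OF m(8)] nVH(7,8)] by blast+
  have det: "det hL = 1" "det hR = 1" "det kT = 1" "det kB = 1" using hL hR kT kB \<Gamma>(4) by blast+
  have inv: "Ma \<doteq> minv h ** k'" if "h ** Ma \<doteq> k'" "det h = 1" for h Ma k'
  proof -
    have "minv h ** (h ** Ma) \<doteq> minv h ** k'" by (intro peq_mult peq_refl that(1))
    then show ?thesis unfolding minv_cancel(1)[OF that(2)] .
  qed
  note I = inv[OF R(1) det(1)] inv[OF R(2) det(2)] inv[OF R(3) det(1)] inv[OF R(4) det(2)]
  have quot: "Ma ** minv Mb \<doteq> minv hL ** hR" if "Ma \<doteq> minv hL ** k'" "Mb \<doteq> minv hR ** k'" "det k' = 1" for Ma Mb k'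
  proof -
    have "Ma ** minv Mb \<doteq> (minv hL ** k') ** minv (minv hR ** k')" by (intro peq_mult peq_minv that)
    also have "\<dots> = minv hL ** hR"
      by (simp add: minv_mult matrix_mul_assoc[symmetric] minv_cancel(2)[OF that(3)])
    finally show ?thesis .
  qed
  have AB: "A ** minv B \<doteq> minv hL ** hR" by (rule quot[OF I(1,2) det(3)])
  show "A ** minv B \<doteq> C ** minv D"
    using AB quot[OF I(3,4) det(4)] peq_trans peq_sym by blast
qed

text \<open>The parts of the crossing boxes outside \<open>Up\<close> and \<open>Dn\<close> are vertical segments, whose removal does
  not disconnect the covering.\<close>

lemma connected_Up_Dn: "connected {x \<in> Hcov. proj x \<in> Up \<union> Dn}"
proof -
  define Z where "Z = {x. proj x \<notin> Up \<union> Dn}"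
  define l where "l c = {y :: point. Re (fst y) = fst c \<and> Im (fst y) = snd c}" for c
  have "bounded_linear (\<lambda>x :: point. Re (fst x))" "bounded_linear (\<lambda>x :: point. Im (fst x))"
    by (auto intro: bounded_linear_compose[OF bounded_linear_Re bounded_linear_fst]
        bounded_linear_compose[OF bounded_linear_Im bounded_linear_fst])
  then have l: "thin (l c)" for c
    unfolding l_def by (rule thin_codim2[of _ _ "(1, 0)" "(\<i>, 0)"]) auto
  have boxl: "y \<in> Up \<union> Dn \<longleftrightarrow> y \<notin> l c" if "c \<in> crossings" "y \<in> cbx c" for c y
    using that Vl_square[of c "fst y"] Hl_square[of c "fst y"]
    by (cases y) (auto simp: cbx_def Up_def Dn_def l_def)
  have local: "\<exists>c\<in>crossings. \<exists>s'. \<exists>B\<in>\<Gamma>. is_section (cbx c) s' \<and> proj z \<in> cbx c \<and> z = act B (s' (proj z))"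
    if z: "z \<in> Hcov" "z \<in> Z" for z
  proof -
    have "proj z \<in> - Lk" using proj(1)[OF z(1)] L_eq by simp
    then obtain c where c: "c \<in> crossings" "proj z \<in> cbx c" using z(2) unfolding cover_compl_Lk Z_def by blast
    obtain s' where s': "is_section (cbx c) s'" using sections_exist(3)[OF c(1)] by blast
    then have "proj (s' (proj z)) = proj z" "s' (proj z) \<in> Hcov" using c(2) by (auto simp: is_section_def)
    then obtain B where "B \<in> \<Gamma>" "z = act B (s' (proj z))" using proj_eq_iff z(1) by blast
    then show ?thesis using c s' by blast
  qed
  have "connected (Hcov - Z)"
  proof (rule connected_diff_thin[OF connected_Hcov])
    have "Hcov - Z = Hcov \<inter> proj -` (Up \<union> Dn)" by (auto simp: Z_def)
    then show "open (Hcov - Z)"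
      using continuous_on_proj open_Hcov(1) open_Up open_Dn by (metis continuous_on_open_vimage Int_commute open_Un)
    show "U - Z \<noteq> {}" if U: "open U" "U \<subseteq> Hcov" "U \<noteq> {}" for U
    proof
      assume UZ: "U - Z = {}"
      obtain z where z: "z \<in> U" using U by blast
      then obtain c where c: "c \<in> crossings" "proj z \<in> cbx c" using local[of z] U(2) UZ by blast
      have "open (proj ` U \<inter> cbx c)" using proj_open[OF U(1,2)] convex_cbx(2) by blast
      then obtain d where d: "d > 0" "ball (proj z) d \<subseteq> proj ` U \<inter> cbx c"
        using z c(2) open_contains_ball by (metis IntI imageI)
      then have "ball (proj z) d - l c \<noteq> {}" using l[of c] unfolding thin_def by simp
      then obtain x where x: "x \<in> U" "proj x \<in> cbx c" "proj x \<notin> l c" using d(2) by blast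
      then show False using boxl[OF c(1) x(2)] UZ unfolding Z_def by blast
    qed
    fix z assume z: "z \<in> Hcov" "z \<in> Z"
    obtain c s' B where c: "c \<in> crossings" "is_section (cbx c) s'" "B \<in> \<Gamma>" "proj z \<in> cbx c" "z = act B (s' (proj z))"
      using local[OF z] by blast
    note sB = is_section_act[OF c(2,3)]
    define N C where "N = {x \<in> Hcov. proj x \<in> cbx c \<and> x = act B (s' (proj x))}"
      and "C = (\<lambda>y. act B (s' y)) ` (cbx c - l c)"
    have "connected (cbx c - l c)" using l convex_connected[OF convex_cbx(1)] convex_cbx(2) by (simp add: thin_def)
    then have "connected C" unfolding C_def
      using sB unfolding is_section_def by (intro connected_continuous_image) (auto intro: continuous_on_subset)
    moreover have "C \<subseteq> Hcov - Z"
    proof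
      fix x assume "x \<in> C"
      then obtain y where y: "y \<in> cbx c" "y \<notin> l c" "x = act B (s' y)" unfolding C_def by blast
      then have "x \<in> Hcov" "proj x = y" using sB by (simp_all add: is_section_def)
      then show "x \<in> Hcov - Z" using boxl[OF c(1) y(1)] y(2) by (simp add: Z_def)
    qed
    moreover have "N - Z \<subseteq> C" using boxl[OF c(1)] unfolding N_def Z_def C_def by blast
    moreover have "open N" unfolding N_def by (rule section_translates_open[OF c(2) convex_cbx(2) c(3)])
    moreover have "z \<in> N" "N \<subseteq> Hcov" using z c by (auto simp: N_def)
    ultimately show "\<exists>N C. open N \<and> z \<in> N \<and> N \<subseteq> Hcov \<and> connected C \<and> N - Z \<subseteq> C \<and> C \<subseteq> Hcov - Z" by blast
  qed
  moreover have "Hcov - Z = {x \<in> Hcov. proj x \<in> Up \<union> Dn}" by (auto simp: Z_def)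
  ultimately show ?thesis by simp
qed

end

section \<open>The eight faces of the diagram and their words in two meridians\<close>

definition R :: "real \<Rightarrow> real \<Rightarrow> real \<Rightarrow> real \<Rightarrow> complex set" where
  "R a b c d = {z. a < Re z \<and> Re z < b \<and> c < Im z \<and> Im z < d}"

lemma convex_R: "convex (R a b c d)"
proof -
  have "R a b c d = {z. Re z > a} \<inter> {z. Re z < b} \<inter> ({z. Im z > c} \<inter> {z. Im z < d})" by (auto simp: R_def)
  then show ?thesis
    by (simp add: convex_Int convex_halfspace_Re_lt convex_halfspace_Re_gt convex_halfspace_Im_lt convex_halfspace_Im_gt)
qed

text \<open>Faces are given as unions of convex pieces with common points, up to some points on the
  integer grid, so that connectedness and membership reduce to linear inequalities.\<close>

definition F0 :: "complex set" where
  "F0 = {z. Im z < 0} \<union> {z. Re z < 0} \<union> {z. Re z > 7} \<union> {z. Im z > 7} \<union> {z. Re z < 1 \<and> Im z > 6} \<union>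
     {z. Re z > 6 \<and> Im z < 3} \<union> {z. Re z > 5 \<and> Im z < 2} \<union> {z. Re z > 4 \<and> Im z < 1}"
definition F1 :: "complex set" where "F1 = R 0 1 0 6 \<union> R 0 2 4 5 \<union> R 0 3 1 4 \<union> R 0 4 0 1"
definition F2 :: "complex set" where "F2 = R 3 4 1 4 \<union> R 3 6 3 4 \<union> R 3 5 2 4"
definition F3 :: "complex set" where "F3 = R 4 5 1 2"
definition F4 :: "complex set" where "F4 = R 5 6 2 3"
definition F5 :: "complex set" where "F5 = R 6 7 3 7 \<union> R 1 7 6 7 \<union> R 2 7 5 7 \<union> R 3 7 4 7"
definition F6 :: "complex set" where "F6 = R 2 3 4 5"
definition F7 :: "complex set" where "F7 = R 1 2 5 6"

lemmas face_defs = F0_def F1_def F2_def F3_def F4_def F5_def F6_def F7_def R_def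

lemma connected_Un_convex: "z \<in> A \<Longrightarrow> z \<in> B \<Longrightarrow> connected A \<Longrightarrow> convex B \<Longrightarrow> connected (A \<union> B)"
  for z :: "'a::real_normed_vector"
  by (rule connected_Un) (auto intro: convex_connected)

lemma connected_faces: "connected F0" "connected F1" "connected F2" "connected F5"
proof -
  note u = connected_Un_convex
  note c = convex_R convex_connected convex_halfspace_Re_lt convex_halfspace_Re_gt convex_halfspace_Im_lt convex_halfspace_Im_gt
  have q: "convex {z. Re z < a \<and> Im z > b}" "convex {z. Re z > a \<and> Im z < b}" for a b
    unfolding Collect_conj_eq
    by (intro convex_Int convex_halfspace_Re_lt convex_halfspace_Re_gt convex_halfspace_Im_lt convex_halfspace_Im_gt)+
  show "connected F0" unfolding F0_def
    by (rule u[of "Complex 8 (-1)"], simp, simp, rule u[of "Complex 8 (-1)"], simp, simp,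
        rule u[of "Complex 8 (-1)"], simp, simp, rule u[of "Complex (-1) 8"], simp, simp,
        rule u[of "Complex (-1) 8"], simp, simp, rule u[of "Complex 8 (-1)"], simp, simp,
        rule u[of "Complex (-1) (-1)"]) (simp_all add: c q)
  show "connected F1" unfolding F1_def
    by (rule u[of "Complex (1/2) (1/2)"], simp add: R_def, simp add: R_def,
        rule u[of "Complex (1/2) 3"], simp add: R_def, simp add: R_def,
        rule u[of "Complex (1/2) (9/2)"]) (simp_all add: c, simp_all add: R_def)
  show "connected F2" unfolding F2_def
    by (rule u[of "Complex (7/2) (7/2)"], simp add: R_def, simp add: R_def,
        rule u[of "Complex (7/2) (7/2)"]) (simp_all add: c, simp_all add: R_def)
  show "connected F5" unfolding F5_def
    by (rule u[of "Complex (13/2) (9/2)"], simp add: R_def, simp add: R_def,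
        rule u[of "Complex (13/2) (11/2)"], simp add: R_def, simp add: R_def,
        rule u[of "Complex (13/2) (13/2)"]) (simp_all add: c, simp_all add: R_def)
qed

context link_orbifold begin

lemma faces: "face F0" "face F1" "face F2" "face F3" "face F4" "face F5" "face F6" "face F7"
  by (intro conjI connected_faces; (simp add: F3_def F4_def F6_def F7_def convex_R convex_connected; fail)?;
      auto simp: face_defs diagram_defs)+

text \<open>The faces used for \<open>mu\<close> and \<open>mv\<close> are separated from the outer
  face by a strand of the first and of the second component respectively, so these are meridians of
  the two components. \<open>mw\<close> is the word that \<open>trans_words\<close> attaches to
  F2.\<close>

definition mu :: "complex^2^2" where "mu = (SOME A. trans_at (Complex (1/2) (1/2)) A)"
definition mv :: "complex^2^2" where "mv = minv (SOME A. trans_at (Complex (13/2) (13/2)) A)"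
definition mw :: "complex^2^2" where "mw = minv mv ** minv mu ** minv mv ** mu ** mv ** mu"

lemma mu: "trans_at (Complex (1/2) (1/2)) mu" and mv: "trans_at (Complex (13/2) (13/2)) (minv mv)"
proof -
  have "\<exists>A. trans_at (Complex (1/2) (1/2)) A" "\<exists>A. trans_at (Complex (13/2) (13/2)) A"
    by (rule trans_exists; simp add: diagram_defs)+
  then show "trans_at (Complex (1/2) (1/2)) mu" "trans_at (Complex (13/2) (13/2)) (minv mv)"
    unfolding mu_def mv_def minv_minv by (blast intro: someI_ex)+
qed

lemma mu_mv_in: "mu \<in> \<Gamma>" "mv \<in> \<Gamma>" "mw \<in> \<Gamma>"
proof -
  have "minv mv \<in> \<Gamma>" and u: "mu \<in> \<Gamma>" using mu mv by (auto simp: trans_at_def)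
  then have "minv (minv mv) \<in> \<Gamma>" using \<Gamma>(6)[of "minv mv"] by blast
  then have v: "mv \<in> \<Gamma>" by simp
  then show "mu \<in> \<Gamma>" "mv \<in> \<Gamma>" "mw \<in> \<Gamma>"
    using u v unfolding mw_def by (auto intro!: \<Gamma>(5) \<Gamma>(6)[of mu] \<Gamma>(6)[of mv])
qed

lemma mu_mv_det: "det mu = 1" "det mv = 1" "det mw = 1"
  using mu_mv_in \<Gamma>(4) by blast+

lemma peq_solve:
  assumes "A ** minv B \<doteq> C" "det B = 1" "det C = 1"
  shows "A \<doteq> C ** B" "B \<doteq> minv C ** A"
proof -
  have "A ** minv B ** B \<doteq> C ** B" by (intro peq_mult peq_refl assms(1))
  then show 1: "A \<doteq> C ** B" by (simp add: matrix_mul_assoc[symmetric] minv_left assms(2))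
  have "minv C ** A \<doteq> minv C ** (C ** B)" by (intro peq_mult peq_refl 1)
  then show "B \<doteq> minv C ** A" unfolding minv_cancel(1)[OF assms(3)] by (rule peq_sym)
qed

lemma trans_det: "trans_at z A \<Longrightarrow> det A = 1"
  unfolding trans_at_def using \<Gamma>(4) by blast

lemmas cancel = matrix_mul_assoc[symmetric] minv_mult minv_minv minv_cancel minv_left minv_right mu_mv_det

text \<open>Five of the six crossings determine, in turn, the elements of F7, F6, F2, F3 and F4. The
  crossing at (5, 2) then relates elements that are already known, and this is the relation of the
  group.\<close>

lemma trans_words:
  "trans_at (Complex (3/2) (11/2)) (minv mv ** mu)"
  "trans_at (Complex (5/2) (9/2)) (minv mv ** minv mu ** mv ** mu)"
  "trans_at (Complex (7/2) (7/2)) mw"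
  "trans_at (Complex (9/2) (3/2)) (minv mu ** mw)"
  "trans_at (Complex (11/2) (5/2)) (mw ** mv)"
  and relation: "mu ** mw \<doteq> mw ** mw ** mv"
proof -
  have "\<exists>A. trans_at (Complex (3/2) (11/2)) A" "\<exists>A. trans_at (Complex (5/2) (9/2)) A"
    "\<exists>A. trans_at (Complex (7/2) (7/2)) A" "\<exists>A. trans_at (Complex (9/2) (3/2)) A"
    "\<exists>A. trans_at (Complex (11/2) (5/2)) A"
    by (rule trans_exists; simp add: diagram_defs)+
  then obtain A7 A6 A2 A3 A4 where A: "trans_at (Complex (3/2) (11/2)) A7" "trans_at (Complex (5/2) (9/2)) A6"
    "trans_at (Complex (7/2) (7/2)) A2" "trans_at (Complex (9/2) (3/2)) A3" "trans_at (Complex (11/2) (5/2)) A4"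
    by blast
  note d = A[THEN trans_det] mu_mv_det
  note F = trans_face[OF faces(1) _ _ trans_outer] trans_face[OF faces(2) _ _ mu] trans_face[OF faces(3) _ _ A(3)]
    trans_face[OF faces(6) _ _ mv]
  have c16: "mat 1 ** minv (minv mv) \<doteq> mu ** minv A7"
    by (rule trans_crossing[of "(1, 6)" "Complex (1/2) (13/2)" "Complex (3/2) (13/2)" "Complex (1/2) (11/2)" "Complex (3/2) (11/2)"])
       (simp_all add: crossings_def square_def A F face_defs)
  have c25: "A7 ** minv (minv mv) \<doteq> mu ** minv A6"
    by (rule trans_crossing[of "(2, 5)" "Complex (3/2) (11/2)" "Complex (5/2) (11/2)" "Complex (3/2) (9/2)" "Complex (5/2) (9/2)"])
       (simp_all add: crossings_def square_def A F face_defs)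
  have c34: "A6 ** minv (minv mv) \<doteq> mu ** minv A2"
    by (rule trans_crossing[of "(3, 4)" "Complex (5/2) (9/2)" "Complex (7/2) (9/2)" "Complex (5/2) (7/2)" "Complex (7/2) (7/2)"])
       (simp_all add: crossings_def square_def A F face_defs)
  have c41: "A2 ** minv A3 \<doteq> mu ** minv (mat 1)"
    by (rule trans_crossing[of "(4, 1)" "Complex (7/2) (3/2)" "Complex (9/2) (3/2)" "Complex (7/2) (1/2)" "Complex (9/2) (1/2)"])
       (simp_all add: crossings_def square_def A F face_defs)
  have c63: "A2 ** minv (minv mv) \<doteq> A4 ** minv (mat 1)"
    by (rule trans_crossing[of "(6, 3)" "Complex (11/2) (7/2)" "Complex (13/2) (7/2)" "Complex (11/2) (5/2)" "Complex (13/2) (5/2)"])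
       (simp_all add: crossings_def square_def A F face_defs)
  have c52: "A2 ** minv A4 \<doteq> A3 ** minv (mat 1)"
    by (rule trans_crossing[of "(5, 2)" "Complex (9/2) (5/2)" "Complex (11/2) (5/2)" "Complex (9/2) (3/2)" "Complex (11/2) (3/2)"])
       (simp_all add: crossings_def square_def A F face_defs)
  have 7: "A7 \<doteq> minv mv ** mu"
    using peq_solve(2)[OF peq_sym[OF c16]] d by simp
  have 6: "A6 \<doteq> minv mv ** minv mu ** mv ** mu"
  proof -
    have "A6 \<doteq> minv (A7 ** mv) ** mu"
      using peq_solve(2)[OF peq_sym[OF c25]] d by (simp add: det_mul)
    also have "\<dots> \<doteq> minv ((minv mv ** mu) ** mv) ** mu"
      by (intro peq_mult peq_minv 7 peq_refl)
    finally show ?thesis by (simp add: cancel)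
  qed
  have 2: "A2 \<doteq> mw"
  proof -
    have "A2 \<doteq> minv (A6 ** mv) ** mu"
      using peq_solve(2)[OF peq_sym[OF c34]] d by (simp add: det_mul)
    also have "\<dots> \<doteq> minv ((minv mv ** minv mu ** mv ** mu) ** mv) ** mu"
      by (intro peq_mult peq_minv 6 peq_refl)
    finally show ?thesis by (simp add: cancel mw_def)
  qed
  have 3: "A3 \<doteq> minv mu ** mw"
  proof -
    have "A3 \<doteq> minv mu ** A2"
      using peq_solve(2)[OF c41[unfolded minv_mat1 matrix_mul_rid]] d by simp
    also have "\<dots> \<doteq> minv mu ** mw" by (intro peq_mult 2 peq_refl)
    finally show ?thesis .
  qed
  have 4: "A4 \<doteq> mw ** mv"
  proof -
    have "A4 \<doteq> A2 ** mv" using peq_sym[OF c63] by simp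
    also have "\<dots> \<doteq> mw ** mv" by (intro peq_mult 2 peq_refl)
    finally show ?thesis .
  qed
  show "trans_at (Complex (3/2) (11/2)) (minv mv ** mu)"
    "trans_at (Complex (5/2) (9/2)) (minv mv ** minv mu ** mv ** mu)"
    "trans_at (Complex (7/2) (7/2)) mw" "trans_at (Complex (9/2) (3/2)) (minv mu ** mw)"
    "trans_at (Complex (11/2) (5/2)) (mw ** mv)"
    using trans_peq[OF A(1) 7] trans_peq[OF A(2) 6] trans_peq[OF A(3) 2] trans_peq[OF A(4) 3] trans_peq[OF A(5) 4] by auto
  have "mw ** minv (mw ** mv) \<doteq> A2 ** minv A4"
    by (intro peq_mult peq_minv peq_sym[OF 2] peq_sym[OF 4])
  also have "\<dots> \<doteq> A3" using c52 by simp
  also have "\<dots> \<doteq> minv mu ** mw" by (rule 3)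
  finally have "mw ** minv (mw ** mv) \<doteq> minv mu ** mw" .
  from peq_mult[OF peq_mult[OF peq_refl this] peq_refl, of mu "mw ** mv"]
  have "mu ** (mw ** minv (mw ** mv)) ** (mw ** mv) \<doteq> mu ** (minv mu ** mw) ** (mw ** mv)" .
  moreover have "mu ** (mw ** minv (mw ** mv)) ** (mw ** mv) = mu ** mw"
    by (simp add: matrix_mul_assoc[symmetric] minv_left det_mul mu_mv_det)
  moreover have "mu ** (minv mu ** mw) ** (mw ** mv) = mw ** mw ** mv"
    by (simp add: matrix_mul_assoc[symmetric] minv_cancel mu_mv_det)
  ultimately show "mu ** mw \<doteq> mw ** mw ** mv" by (simp only:)
qed

lemma trans_faces: "z \<in> F0 \<Longrightarrow> trans_at z (mat 1)" "z \<in> F1 \<Longrightarrow> trans_at z mu" "z \<in> F2 \<Longrightarrow> trans_at z mw"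
  "z \<in> F3 \<Longrightarrow> trans_at z (minv mu ** mw)" "z \<in> F4 \<Longrightarrow> trans_at z (mw ** mv)" "z \<in> F5 \<Longrightarrow> trans_at z (minv mv)"
  "z \<in> F6 \<Longrightarrow> trans_at z (minv mv ** minv mu ** mv ** mu)" "z \<in> F7 \<Longrightarrow> trans_at z (minv mv ** mu)"
  by (rule trans_face[OF faces(1) _ _ trans_outer] trans_face[OF faces(2) _ _ mu] trans_face[OF faces(3) _ _ trans_words(3)]
      trans_face[OF faces(4) _ _ trans_words(4)] trans_face[OF faces(5) _ _ trans_words(5)] trans_face[OF faces(6) _ _ mv]
      trans_face[OF faces(7) _ _ trans_words(2)] trans_face[OF faces(8) _ _ trans_words(1)];
      simp add: face_defs; fail)+

definition \<Gamma>0 :: "(complex^2^2) set" where "\<Gamma>0 = generate SL2C {mu, mv, - mat 1}"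

lemma \<Gamma>0: "subgroup \<Gamma>0 SL2C" "- mat 1 \<in> \<Gamma>0" "\<Gamma>0 \<subseteq> \<Gamma>" "mu \<in> \<Gamma>0" "mv \<in> \<Gamma>0"
proof -
  have "{mu, mv, - mat 1} \<subseteq> carrier SL2C" using mu_mv_det by simp
  then show "subgroup \<Gamma>0 SL2C" unfolding \<Gamma>0_def by (rule group.generate_is_subgroup[OF group_SL2C])
  show "\<Gamma>0 \<subseteq> \<Gamma>"
    unfolding \<Gamma>0_def by (rule generate_subset_subgroup[OF \<Gamma>(1)]) (use mu_mv_in \<Gamma>(2) in auto)
qed (auto simp: \<Gamma>0_def intro: generate.incl)

lemmas \<Gamma>0_closed = subgroup_SL2C_D[OF \<Gamma>0(1)]

lemma face_words_in_\<Gamma>0: "mat 1 \<in> \<Gamma>0" "minv mv \<in> \<Gamma>0" "minv mv ** mu \<in> \<Gamma>0" "minv mv ** minv mu ** mv ** mu \<in> \<Gamma>0"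
  "mw \<in> \<Gamma>0" "minv mu ** mw \<in> \<Gamma>0" "mw ** mv \<in> \<Gamma>0"
  unfolding mw_def using \<Gamma>0(4,5) by (auto intro!: \<Gamma>0_closed(2-))

text \<open>Points off the integer grid suffice, since the transition elements are locally constant.\<close>

lemma trans_generic:
  assumes x: "\<forall>n\<in>{0,1,2,3,4,5,6,7}. Re z \<noteq> n" "\<forall>n\<in>{0,1,2,3,4,5,6,7}. Im z \<noteq> n"
  shows "\<exists>A\<in>\<Gamma>0. trans_at z A"
proof -
  have ne: "Re z \<noteq> 0" "Re z \<noteq> 1" "Re z \<noteq> 2" "Re z \<noteq> 3" "Re z \<noteq> 4" "Re z \<noteq> 5" "Re z \<noteq> 6" "Re z \<noteq> 7"
    "Im z \<noteq> 0" "Im z \<noteq> 1" "Im z \<noteq> 2" "Im z \<noteq> 3" "Im z \<noteq> 4" "Im z \<noteq> 5" "Im z \<noteq> 6" "Im z \<noteq> 7"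
    using x by auto
  have "z \<in> F0 \<union> F1 \<union> F2 \<union> F3 \<union> F4 \<union> F5 \<union> F6 \<union> F7"
  proof (cases "Re z < 0 \<or> Re z > 7 \<or> Im z < 0 \<or> Im z > 7")
    case True
    then show ?thesis unfolding F0_def by blast
  next
    case False
    then have b: "0 < Re z" "Re z < 7" "0 < Im z" "Im z < 7" using ne(1,8,9,16) by linarith+
    consider "Im z < 1" | "1 < Im z" "Im z < 2" | "2 < Im z" "Im z < 3" | "3 < Im z" "Im z < 4" | "4 < Im z" "Im z < 5"
      | "5 < Im z" "Im z < 6" | "6 < Im z" using ne(10,11,12,13,14,15) by linarith
    then show ?thesis
    proof cases
      case 1
      consider "Re z < 4" | "Re z > 4" using ne(5) by linarith
      then show ?thesis using 1 b by cases (simp_all add: face_defs)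
    next
      case 2
      consider "Re z < 3" | "3 < Re z" "Re z < 4" | "4 < Re z" "Re z < 5" | "Re z > 5" using ne(4,5,6) by linarith
      then show ?thesis using 2 b by cases (simp_all add: face_defs)
    next
      case 3
      consider "Re z < 3" | "3 < Re z" "Re z < 5" | "5 < Re z" "Re z < 6" | "Re z > 6" using ne(4,6,7) by linarith
      then show ?thesis using 3 b by cases (simp_all add: face_defs)
    next
      case 4
      consider "Re z < 3" | "3 < Re z" "Re z < 6" | "6 < Re z" using ne(4,7) by linarith
      then show ?thesis using 4 b by cases (simp_all add: face_defs)
    next
      case 5
      consider "Re z < 2" | "2 < Re z" "Re z < 3" | "3 < Re z" using ne(3,4) by linarith
      then show ?thesis using 5 b by cases (simp_all add: face_defs)
    next
      case 6
      consider "Re z < 1" | "1 < Re z" "Re z < 2" | "2 < Re z" using ne(2,3) by linarith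
      then show ?thesis using 6 b by cases (simp_all add: face_defs)
    next
      case 7
      consider "Re z < 1" | "1 < Re z" using ne(2) by linarith
      then show ?thesis using 7 b by cases (simp_all add: face_defs)
    qed
  qed
  then show ?thesis using trans_faces[of z] face_words_in_\<Gamma>0 \<Gamma>0(4) by (elim UnE) blast+
qed


text \<open>A ball inside the face contains points off the integer grid, where the word is
  known.\<close>

lemma trans_in_\<Gamma>0:
  assumes "z \<notin> Vl" "z \<notin> Hl"
  shows "\<exists>A\<in>\<Gamma>0. trans_at z A"
proof -
  have "open (- (Vl \<union> Hl))" by (intro open_Compl closed_Un closed_Vl_Hl)
  then obtain d where d: "d > 0" "ball z d \<subseteq> - (Vl \<union> Hl)"
    using assms open_contains_ball by (metis ComplI UnE)
  then have fb: "face (ball z d)" by auto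
  have pick: "\<exists>x. \<bar>x - a\<bar> < d / 2 \<and> (\<forall>n\<in>{0,1,2,3,4,5,6,7}. x \<noteq> n)" for a :: real
  proof -
    have "infinite ({a - d / 2 <..< a + d / 2} - {0,1,2,3,4,5,6,7})"
      using d(1) by (intro Diff_infinite_finite) auto
    then obtain x where x: "x \<in> {a - d / 2 <..< a + d / 2} - {0,1,2,3,4,5,6,7}"
      by (metis ex_in_conv finite.emptyI)
    then have "\<bar>x - a\<bar> < d / 2" unfolding Diff_iff greaterThanLessThan_iff by linarith
    then show ?thesis using x by blast
  qed
  obtain x where x: "\<bar>x - Re z\<bar> < d / 2" "\<forall>n\<in>{0,1,2,3,4,5,6,7}. x \<noteq> n" using pick by blast
  obtain y where y: "\<bar>y - Im z\<bar> < d / 2" "\<forall>n\<in>{0,1,2,3,4,5,6,7}. y \<noteq> n" using pick by blast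
  have "cmod (z - Complex x y) \<le> \<bar>Re (z - Complex x y)\<bar> + \<bar>Im (z - Complex x y)\<bar>" by (rule cmod_le)
  then have "Complex x y \<in> ball z d" using x(1) y(1) by (simp add: dist_norm abs_minus_commute)
  moreover obtain A where "A \<in> \<Gamma>0" "trans_at (Complex x y) A"
    using trans_generic[of "Complex x y"] x(2) y(2) by auto
  ultimately show ?thesis using trans_face[OF fb] d(1) by (metis centre_in_ball)
qed

text \<open>The preimage of \<open>Up\<close> and \<open>Dn\<close> is connected, so two families of
  sheets suffice, and their transition elements are the face words.\<close>

lemma generators: "\<Gamma> \<subseteq> \<Gamma>0"
proof (rule transitions_generate[of UNIV "\<lambda>i. if i then Up else Dn" "\<lambda>i. if i then sp else sm"])
  have A: "\<exists>A\<in>\<Gamma>0. sp y = act A (sm y)" if "y \<in> Up" "y \<in> Dn" for y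
  proof -
    obtain z t where y: "y = (z, t)" by (cases y)
    have "z \<notin> Vl" "z \<notin> Hl" using that by (auto simp: y Up_def Dn_def)
    then obtain A where "A \<in> \<Gamma>0" "trans_at z A" using trans_in_\<Gamma>0 by blast
    then show ?thesis by (auto simp: trans_at_def y)
  qed
  have B: "\<exists>A\<in>\<Gamma>0. sm y = act A (sp y)" if y: "y \<in> Up" "y \<in> Dn" for y
  proof -
    obtain A where A: "A \<in> \<Gamma>0" "sp y = act A (sm y)" using A[OF y] by blast
    have "sm y \<in> H3" using sm(1) y(2) open_Hcov(2) by (auto simp: is_section_def)
    then have "sm y = act (minv A) (sp y)" using A act_minv(1)[of A "sm y"] \<Gamma>0_closed(1) by simp
    then show ?thesis using \<Gamma>0_closed(4)[OF A(1)] by blast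
  qed
  have refl: "\<exists>A\<in>\<Gamma>0. a = act A a" for a using \<Gamma>0_closed(2) by (intro bexI[of _ "mat 1"]) auto
  show "\<exists>A\<in>\<Gamma>0. (if i then sp else sm) y = act A ((if j then sp else sm) y)"
    if "y \<in> (if i then Up else Dn)" "y \<in> (if j then Up else Dn)" for i j y
    using that A B refl by (cases i; cases j) simp_all
  have "(\<Union>i. if i then Up else Dn) = Up \<union> Dn" by (auto split: if_splits)
  then show "connected {x \<in> Hcov. proj x \<in> (\<Union>i. if i then Up else Dn)}" using connected_Up_Dn by simp
  show "(\<Union>i. if i then Up else Dn) \<noteq> {}" using face_in_Up_Dn[OF outer_point, of 0] by auto
qed (use sp sm(1) open_Up open_Dn \<Gamma>0(1-3) in auto)

end

section \<open>Words and winding numbers of meridians and of pushed-off parallels\<close>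

section \<open>Peripheral loops\<close>

lemma Vl_integer: "z \<in> Vl \<Longrightarrow> Re z \<in> \<int>" and Hl_integer: "z \<in> Hl \<Longrightarrow> Im z \<in> \<int>"
  unfolding diagram_defs by auto

lemma not_integer_shift: "0 < \<epsilon> \<Longrightarrow> \<epsilon> < 1 \<Longrightarrow> of_int n + \<epsilon> \<notin> (\<int> :: real set)"
proof
  assume e: "0 < \<epsilon>" "\<epsilon> < 1" "of_int n + \<epsilon> \<in> \<int>"
  then obtain m where "of_int n + \<epsilon> = of_int m" by (auto elim: Ints_cases)
  then have "\<epsilon> = of_int (m - n)" by simp
  then have "0 < m - n" "m - n < 1" using e(1,2) by linarith+
  then show False by simp
qed

lemma path_component_segment:
  "closed_segment x y \<subseteq> S \<Longrightarrow> path_component S x y" for x y :: "'a::real_normed_vector"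
  unfolding path_component_def by (intro exI[of _ "linepath x y"]) simp

text \<open>The region enclosed by the projection of the first component, which is a simple polygon
  because all crossings involve both components. The two branches of the winding angle will differ
  by 1 outside it.\<close>

definition inner1 :: "complex set" where "inner1 = R 0 2 0 6 \<union> R 0 6 2 4 \<union> R 0 4 0 4"

text \<open>Paths are tracked in the product of the covering with the pullback of \<open>\<real> \<rightarrow> S\<^sup>1\<close> along a map
  \<open>lc\<close> from the complement to the circle; \<open>ap\<close> and \<open>am\<close> are the branches of its logarithm over the
  upper and the lower part, which differ by \<open>\<nu>\<close> over a face.\<close>

locale loops = link_orbifold \<Gamma> M P e f g p q r s core k
  for \<Gamma> M P e f g p q r s core k +
  fixes lc :: "point \<Rightarrow> complex" and ap am :: "point \<Rightarrow> real" and \<nu> :: "complex \<Rightarrow> real"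
  assumes ap: "continuous_on Up ap" "\<And>y. y \<in> Up \<Longrightarrow> lc y = cis (2 * pi * ap y)"
    and am: "continuous_on Dn am" "\<And>y. y \<in> Dn \<Longrightarrow> lc y = cis (2 * pi * am y)"
    and \<nu>: "\<And>z t. z \<notin> Vl \<Longrightarrow> z \<notin> Hl \<Longrightarrow> ap (z, t) = am (z, t) + \<nu> z"
begin

definition tube :: "point set \<Rightarrow> (point \<times> real) set" where
  "tube N = {(x, a). x \<in> Hcov \<and> proj x \<in> N \<and> lc (proj x) = cis (2 * pi * a)}"

definition up :: "complex^2^2 \<Rightarrow> int \<Rightarrow> point \<Rightarrow> point \<times> real" where
  "up A n y = (act A (sp y), ap y + of_int n)"

definition dn :: "complex^2^2 \<Rightarrow> int \<Rightarrow> point \<Rightarrow> point \<times> real" where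
  "dn A n y = (act A (sm y), am y + of_int n)"

lemma cis_shift: "cis (2 * pi * (a + of_int n)) = cis (2 * pi * a)"
  by (simp add: distrib_left flip: cis_mult)

lemma path_component_map:
  assumes "path_component S x y" "continuous_on S h" "h ` S \<subseteq> T"
  shows "path_component T (h x) (h y)"
proof -
  obtain \<gamma> where "path \<gamma>" "path_image \<gamma> \<subseteq> S" "pathstart \<gamma> = x" "pathfinish \<gamma> = y"
    using assms(1) by (auto simp: path_component_def)
  then show ?thesis
    unfolding path_component_def using assms(2,3)
    by (intro exI[of _ "h \<circ> \<gamma>"])
       (auto simp: path_image_compose pathstart_compose pathfinish_compose
         intro!: path_continuous_image intro: continuous_on_subset)
qed

lemma up_move:
  assumes "path_component (Up \<inter> N) y y'" "A \<in> \<Gamma>"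
  shows "path_component (tube N) (up A n y) (up A n y')"
proof (rule path_component_map[OF assms(1)])
  note s = is_section_act[OF sp assms(2)]
  show "continuous_on (Up \<inter> N) (up A n)"
    unfolding up_def using s ap(1) unfolding is_section_def
    by (intro continuous_on_Pair continuous_intros) (auto intro: continuous_on_subset)
  show "up A n ` (Up \<inter> N) \<subseteq> tube N"
    using s ap(2) unfolding is_section_def up_def tube_def by (force simp: cis_shift)
qed

lemma dn_move:
  assumes "path_component (Dn \<inter> N) y y'" "A \<in> \<Gamma>"
  shows "path_component (tube N) (dn A n y) (dn A n y')"
proof (rule path_component_map[OF assms(1)])
  note s = is_section_act[OF sm(1) assms(2)]
  show "continuous_on (Dn \<inter> N) (dn A n)"
    unfolding dn_def using s am(1) unfolding is_section_def
    by (intro continuous_on_Pair continuous_intros) (auto intro: continuous_on_subset)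
  show "dn A n ` (Dn \<inter> N) \<subseteq> tube N"
    using s am(2) unfolding is_section_def dn_def tube_def by (force simp: cis_shift)
qed

text \<open>Change of sheet over a face: the deck element is multiplied on the right by the face
  element, and the branch of the logarithm jumps by \<nu>. The words of loops are accumulated in
  this way.\<close>

lemma trans_off: "z \<notin> Vl \<Longrightarrow> z \<notin> Hl \<Longrightarrow> trans_at z B \<Longrightarrow> A \<in> \<Gamma> \<Longrightarrow> \<nu> z = of_int j \<Longrightarrow>
    up A n (z, t) = dn (A ** B) (n + j) (z, t)"
  using act_mult_Hcov[OF sm_Hcov, of z A B t] \<nu>[of z t] unfolding up_def dn_def trans_at_def by simp

lemma trans_off': "z \<notin> Vl \<Longrightarrow> z \<notin> Hl \<Longrightarrow> trans_at z B \<Longrightarrow> A \<in> \<Gamma> \<Longrightarrow> \<nu> z = of_int j \<Longrightarrow>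
    dn A n (z, t) = up (A ** minv B) (n - j) (z, t)"
proof -
  assume z: "z \<notin> Vl" "z \<notin> Hl" "trans_at z B" and A: "A \<in> \<Gamma>" "\<nu> z = of_int j"
  have B: "B \<in> \<Gamma>" using z(3) by (simp add: trans_at_def)
  have "up (A ** minv B) (n - j) (z, t) = dn (A ** minv B ** B) (n - j + j) (z, t)"
    by (rule trans_off[OF z _ A(2)]) (intro \<Gamma>(5) A(1) \<Gamma>(6) B)
  then show ?thesis by (simp add: matrix_mul_assoc[symmetric] minv_left[OF \<Gamma>(4)[OF B]])
qed

text \<open>A grid point pushed off the link by \<epsilon> in both coordinates. Pushed vertical
  edges have non-integral real part and pushed horizontal ones non-integral imaginary part, so at
  their heights 1 and 0 they stay in \<open>Up\<close> and in \<open>Dn\<close>.\<close>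

definition sh :: "real \<Rightarrow> real \<Rightarrow> real \<Rightarrow> complex" where "sh \<epsilon> a b = Complex (a + \<epsilon>) (b + \<epsilon>)"

lemma sh_off:
  assumes "0 < \<epsilon>" "\<epsilon> < 1"
  shows "sh \<epsilon> (of_int a) b \<notin> Vl" "sh \<epsilon> a' (of_int b') \<notin> Hl"
  using Vl_integer[of "sh \<epsilon> (of_int a) b"] Hl_integer[of "sh \<epsilon> a' (of_int b')"] not_integer_shift[OF assms]
  by (auto simp: sh_def)

definition near :: "point set \<Rightarrow> real \<Rightarrow> point set \<Rightarrow> bool" where
  "near C \<epsilon> N \<longleftrightarrow> 0 < \<epsilon> \<and> \<epsilon> < 1/4 \<and> (\<forall>x y t x' y' t'. (Complex x y, t) \<in> C \<longrightarrow> \<bar>x' - x\<bar> \<le> \<epsilon> \<longrightarrow> \<bar>y' - y\<bar> \<le> \<epsilon> \<longrightarrow> \<bar>t' - t\<bar> \<le> \<epsilon> \<longrightarrow>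
     (Complex x' y', t') \<in> N)"

lemma near_exists:
  assumes "compact C" "open N" "C \<subseteq> N"
  shows "\<exists>\<epsilon>. near C \<epsilon> N"
proof (cases "C = {}")
  case True
  then show ?thesis by (intro exI[of _ "1/8"]) (simp add: near_def)
next
  case False
  obtain d where d: "d > 0" "\<And>x y. x \<in> C \<Longrightarrow> dist x y < d \<Longrightarrow> y \<in> N"
  proof (cases "N = UNIV")
    case True then show ?thesis using that[of 1] by simp
  next
    case F: False
    have "setdist C (- N) > 0"
      using assms F False by (subst setdist_gt_0_compact_closed) auto
    then show ?thesis using that[of "setdist C (- N)"] setdist_le_dist[of _ C _ "- N"] by (metis ComplI not_le)
  qed
  define \<epsilon> where "\<epsilon> = min (d / 4) (1/8)"
  have "near C \<epsilon> N"
    unfolding near_def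
  proof (intro conjI allI impI)
    fix x y t x' y' t' assume C: "(Complex x y, t) \<in> C" and b: "\<bar>x' - x\<bar> \<le> \<epsilon>" "\<bar>y' - y\<bar> \<le> \<epsilon>" "\<bar>t' - t\<bar> \<le> \<epsilon>"
    have "dist (Complex x y) (Complex x' y') \<le> \<bar>x - x'\<bar> + \<bar>y - y'\<bar>"
      using cmod_le[of "Complex x y - Complex x' y'"] by (simp add: dist_norm)
    moreover have "dist (Complex x y, t) (Complex x' y', t') \<le> dist (Complex x y) (Complex x' y') + dist t t'"
      unfolding dist_Pair_Pair by (rule sqrt_sum_squares_le_sum) auto
    ultimately have "dist (Complex x y, t) (Complex x' y', t') \<le> 3 * \<epsilon>"
      using b by (simp add: dist_real_def abs_minus_commute)
    also have "\<dots> < d" using d(1) by (simp add: \<epsilon>_def)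
    finally show "(Complex x' y', t') \<in> N" using d(2)[OF C] by blast
  qed (use d(1) in \<open>auto simp: \<epsilon>_def\<close>)
  then show ?thesis ..
qed

lemma edge_up:
  assumes n: "near C \<epsilon> N" and C: "\<And>y. y \<in> closed_segment b c \<Longrightarrow> (Complex (of_int a) y, 1) \<in> C"
  shows "path_component (Up \<inter> N) (sh \<epsilon> (of_int a) b, 1) (sh \<epsilon> (of_int a) c, 1)"
proof (rule path_component_segment, rule subsetI)
  fix w assume "w \<in> closed_segment (sh \<epsilon> (of_int a) b, 1::real) (sh \<epsilon> (of_int a) c, 1)"
  then obtain z where w: "w = (z, 1)" "Re z = of_int a + \<epsilon>" "Im z \<in> closed_segment (b + \<epsilon>) (c + \<epsilon>)"
    unfolding sh_def closed_segment_vertical by auto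
  have e: "0 < \<epsilon>" "\<epsilon> < 1" using n by (auto simp: near_def)
  have "Im z - \<epsilon> \<in> closed_segment b c"
    using w(3) by (auto simp: closed_segment_eq_real_ivl split: if_splits)
  then have "(Complex (of_int a) (Im z - \<epsilon>), 1) \<in> C" by (rule C)
  then have "(Complex (Re z) (Im z), 1) \<in> N"
    using n w(2) e unfolding near_def by (smt (verit))
  moreover have "z \<notin> Vl" using Vl_integer[of z] not_integer_shift[OF e, of a] w(2) by auto
  ultimately show "w \<in> Up \<inter> N" by (simp add: w(1) Up_def)
qed

lemma edge_dn:
  assumes n: "near C \<epsilon> N" and C: "\<And>x. x \<in> closed_segment b c \<Longrightarrow> (Complex x (of_int a), 0) \<in> C"
  shows "path_component (Dn \<inter> N) (sh \<epsilon> b (of_int a), 0) (sh \<epsilon> c (of_int a), 0)"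
proof (rule path_component_segment, rule subsetI)
  fix w assume "w \<in> closed_segment (sh \<epsilon> b (of_int a), 0::real) (sh \<epsilon> c (of_int a), 0)"
  then obtain z where w: "w = (z, 0)" "Im z = of_int a + \<epsilon>" "Re z \<in> closed_segment (b + \<epsilon>) (c + \<epsilon>)"
    unfolding sh_def closed_segment_horizontal by auto
  have e: "0 < \<epsilon>" "\<epsilon> < 1" using n by (auto simp: near_def)
  have "Re z - \<epsilon> \<in> closed_segment b c"
    using w(3) by (auto simp: closed_segment_eq_real_ivl split: if_splits)
  then have "(Complex (Re z - \<epsilon>) (of_int a), 0) \<in> C" by (rule C)
  then have "(Complex (Re z) (Im z), 0) \<in> N"
    using n w(2) e unfolding near_def by (smt (verit))
  moreover have "z \<notin> Hl" using Hl_integer[of z] not_integer_shift[OF e, of a] w(2) by auto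
  ultimately show "w \<in> Dn \<inter> N" by (simp add: w(1) Dn_def)
qed

lemma corner_move:
  assumes n: "near C \<epsilon> N" and C: "\<And>t. 0 \<le> t \<Longrightarrow> t \<le> 1 \<Longrightarrow> (Complex (of_int a) (of_int b), t) \<in> C"
  shows "path_component (Up \<inter> N) (sh \<epsilon> (of_int a) (of_int b), 0) (sh \<epsilon> (of_int a) (of_int b), 1)"
proof (rule path_component_segment, rule subsetI)
  let ?z = "sh \<epsilon> (of_int a) (of_int b)"
  fix w assume "w \<in> closed_segment (?z, 0::real) (?z, 1)"
  then obtain t where w: "w = (?z, t)" "0 \<le> t" "t \<le> 1"
    unfolding closed_segment_height by (auto simp: closed_segment_eq_real_ivl)
  have e: "0 < \<epsilon>" "\<epsilon> < 1" using n by (auto simp: near_def)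
  have "?z = Complex (of_int a + \<epsilon>) (of_int b + \<epsilon>)" by (simp add: sh_def)
  then have "(?z, t) \<in> N"
    using n C[OF w(2,3)] e unfolding near_def by (smt (verit))
  then show "w \<in> Up \<inter> N" using sh_off[OF e] by (simp add: w(1) Up_def)
qed

text \<open>One period of the parallel: along a vertical edge, down at the corner through the face
  of \<open>B\<close>, along a horizontal edge, and up at the next corner through the face of
  \<open>B'\<close>.\<close>

lemma two_edges:
  assumes n: "near C \<epsilon> N" and A: "A \<in> \<Gamma>"
    and v: "\<And>y. y \<in> closed_segment (of_int b) (of_int b') \<Longrightarrow> (Complex (of_int a) y, 1) \<in> C"
    and h: "\<And>x. x \<in> closed_segment (of_int a) (of_int a') \<Longrightarrow> (Complex x (of_int b'), 0) \<in> C"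
    and c: "\<And>t. 0 \<le> t \<Longrightarrow> t \<le> 1 \<Longrightarrow> (Complex (of_int a) (of_int b'), t) \<in> C"
    and c': "\<And>t. 0 \<le> t \<Longrightarrow> t \<le> 1 \<Longrightarrow> (Complex (of_int a') (of_int b'), t) \<in> C"
    and F: "trans_at (sh \<epsilon> (of_int a) (of_int b')) B" "trans_at (sh \<epsilon> (of_int a') (of_int b')) B'"
    and \<nu>': "\<nu> (sh \<epsilon> (of_int a) (of_int b')) = of_int i" "\<nu> (sh \<epsilon> (of_int a') (of_int b')) = of_int j"
  shows "path_component (tube N) (up A m (sh \<epsilon> (of_int a) (of_int b), 1))
    (up (A ** B ** minv B') (m + i - j) (sh \<epsilon> (of_int a') (of_int b'), 1))"
proof -
  have e: "0 < \<epsilon>" "\<epsilon> < 1" using n by (auto simp: near_def)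
  have B: "B \<in> \<Gamma>" "B' \<in> \<Gamma>" using F by (auto simp: trans_at_def)
  note [trans] = path_component_trans
  let ?p = "sh \<epsilon> (of_int a) (of_int b')" and ?q = "sh \<epsilon> (of_int a') (of_int b')"
  have "path_component (tube N) (up A m (sh \<epsilon> (of_int a) (of_int b), 1)) (up A m (?p, 1))"
    by (rule up_move[OF edge_up[OF n v] A])
  also have "path_component (tube N) \<dots> (up A m (?p, 0))"
    by (rule up_move[OF path_component_sym[OF corner_move[OF n c]] A])
  also have "up A m (?p, 0) = dn (A ** B) (m + i) (?p, 0)"
    by (rule trans_off[OF sh_off[OF e] F(1) A \<nu>'(1)])
  also have "path_component (tube N) \<dots> (dn (A ** B) (m + i) (?q, 0))"
    by (rule dn_move[OF edge_dn[OF n h] \<Gamma>(5)[OF A B(1)]])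
  also have "dn (A ** B) (m + i) (?q, 0) = up (A ** B ** minv B') (m + i - j) (?q, 0)"
    by (rule trans_off'[OF sh_off[OF e] F(2) \<Gamma>(5)[OF A B(1)] \<nu>'(2)])
  also have "path_component (tube N) \<dots> (up (A ** B ** minv B') (m + i - j) (?q, 1))"
    by (rule up_move[OF corner_move[OF n c'] \<Gamma>(5)[OF \<Gamma>(5)[OF A B(1)] \<Gamma>(6)[OF B(2)]]])
  finally show ?thesis .
qed

lemma near_subset: "near C \<epsilon> N \<Longrightarrow> 0 < \<epsilon>' \<Longrightarrow> \<epsilon>' \<le> \<epsilon> \<Longrightarrow> near C \<epsilon>' N"
  unfolding near_def by (smt (verit))

lemma path_component_slanted:
  assumes "\<And>u. 0 \<le> u \<Longrightarrow> u \<le> 1 \<Longrightarrow> (Complex (x1 + u * (x2 - x1)) y, t1 + u * (t2 - t1)) \<in> S"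
  shows "path_component S (Complex x1 y, t1) (Complex x2 y, t2 :: real)"
proof (rule path_component_segment, rule subsetI)
  fix w assume "w \<in> closed_segment (Complex x1 y, t1) (Complex x2 y, t2)"
  then obtain u where u: "0 \<le> u" "u \<le> 1" "w = (1 - u) *\<^sub>R (Complex x1 y, t1) + u *\<^sub>R (Complex x2 y, t2)"
    by (auto simp: closed_segment_def)
  have "w = (Complex (x1 + u * (x2 - x1)) y, t1 + u * (t2 - t1))"
    unfolding u(3) by (simp add: complex_eq_iff algebra_simps)
  then show "w \<in> S" using assms[OF u(1,2)] by simp
qed

text \<open>A meridian: leave the upper side of a vertical edge, pass below it, and return above it.\<close>

lemma meridian_move:
  assumes n: "near {(Complex (of_int a) (of_int b), 1)} \<epsilon> N" and A: "A \<in> \<Gamma>"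
    and F: "trans_at (sh \<epsilon> (of_int a) (of_int b)) B" "trans_at (Complex (of_int a - \<epsilon>) (of_int b + \<epsilon>)) B'"
    and \<nu>': "\<nu> (sh \<epsilon> (of_int a) (of_int b)) = of_int i" "\<nu> (Complex (of_int a - \<epsilon>) (of_int b + \<epsilon>)) = of_int j"
  shows "path_component (tube N) (up A m (sh \<epsilon> (of_int a) (of_int b), 1))
    (up (A ** B ** minv B') (m + i - j) (sh \<epsilon> (of_int a) (of_int b), 1))"
proof -
  have e: "0 < \<epsilon>" "\<epsilon> < 1" using n by (auto simp: near_def)
  have B: "B \<in> \<Gamma>" "B' \<in> \<Gamma>" using F by (auto simp: trans_at_def)
  define x y :: real where "x = of_int a" "y = of_int b + \<epsilon>"
  note xy = x_y_def
  let ?z = "Complex (x + \<epsilon>) y" and ?z' = "Complex (x - \<epsilon>) y"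
  have z: "sh \<epsilon> (of_int a) (of_int b) = ?z" "Complex (of_int a - \<epsilon>) (of_int b + \<epsilon>) = ?z'"
    by (simp_all add: sh_def xy)
  have N: "(Complex x' y, t) \<in> N" if "\<bar>x' - x\<bar> \<le> \<epsilon>" "\<bar>t - 1\<bar> \<le> \<epsilon>" for x' t
    using n that e unfolding near_def xy by (smt (verit) singletonI)
  have H: "Complex x' y \<notin> Hl" for x'
    using Hl_integer[of "Complex x' y"] not_integer_shift[OF e, of b] by (auto simp: xy)
  have V: "x' = x" if "Complex x' y \<in> Vl" "\<bar>x' - x\<bar> \<le> \<epsilon>" for x'
  proof -
    have "x' \<in> \<int>" using Vl_integer[OF that(1)] by simp
    then obtain k where "x' = of_int k" by (auto elim: Ints_cases)
    then have "\<bar>real_of_int (k - a)\<bar> < 1" using that(2) e by (simp add: xy)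
    then have "k = a" by linarith
    then show ?thesis using \<open>x' = of_int k\<close> by (simp add: xy)
  qed
  have V': "?z \<notin> Vl" "?z' \<notin> Vl" using V[of "x + \<epsilon>"] V[of "x - \<epsilon>"] e by auto
  note [trans] = path_component_trans
  have 1: "path_component (Dn \<inter> N) (?z, 1) (?z', 1 - \<epsilon>)"
  proof (rule path_component_slanted)
    fix u :: real assume u: "0 \<le> u" "u \<le> 1"
    have "u * \<epsilon> \<le> 1 * \<epsilon>" "0 \<le> u * \<epsilon>" using u e by (auto intro: mult_right_mono)
    moreover have "x + \<epsilon> + u * (x - \<epsilon> - (x + \<epsilon>)) = x + \<epsilon> - 2 * (u * \<epsilon>)" "1 + u * (1 - \<epsilon> - 1) = 1 - u * \<epsilon>"
      by (simp_all add: algebra_simps)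
    ultimately have b: "\<bar>x + \<epsilon> + u * (x - \<epsilon> - (x + \<epsilon>)) - x\<bar> \<le> \<epsilon>" "\<bar>1 + u * (1 - \<epsilon> - 1) - 1\<bar> \<le> \<epsilon>"
      and c: "x + \<epsilon> + u * (x - \<epsilon> - (x + \<epsilon>)) = x \<Longrightarrow> 1 + u * (1 - \<epsilon> - 1) < 1"
      using e by linarith+
    show "(Complex (x + \<epsilon> + u * (x - \<epsilon> - (x + \<epsilon>))) y, 1 + u * (1 - \<epsilon> - 1)) \<in> Dn \<inter> N"
      using N[OF b] H V[OF _ b(1)] c unfolding Dn_def by blast
  qed
  have 2: "path_component (Up \<inter> N) (?z', 1 - \<epsilon>) (?z', 1 + \<epsilon>)"
  proof (rule path_component_slanted)
    fix u :: real assume u: "0 \<le> u" "u \<le> 1"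
    have "u * \<epsilon> \<le> 1 * \<epsilon>" "0 \<le> u * \<epsilon>" using u e by (auto intro: mult_right_mono)
    moreover have "1 - \<epsilon> + u * (1 + \<epsilon> - (1 - \<epsilon>)) = 1 - \<epsilon> + 2 * (u * \<epsilon>)" "u * (x - \<epsilon> - (x - \<epsilon>)) = 0"
      by (simp_all add: algebra_simps)
    ultimately have b: "\<bar>x - \<epsilon> + u * (x - \<epsilon> - (x - \<epsilon>)) - x\<bar> \<le> \<epsilon>" "\<bar>1 - \<epsilon> + u * (1 + \<epsilon> - (1 - \<epsilon>)) - 1\<bar> \<le> \<epsilon>"
      using e by linarith+
    show "(Complex (x - \<epsilon> + u * (x - \<epsilon> - (x - \<epsilon>))) y, 1 - \<epsilon> + u * (1 + \<epsilon> - (1 - \<epsilon>))) \<in> Up \<inter> N"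
      using N[OF b] H V'(2) unfolding Up_def by simp
  qed
  have 3: "path_component (Up \<inter> N) (?z', 1 + \<epsilon>) (?z, 1)"
  proof (rule path_component_slanted)
    fix u :: real assume u: "0 \<le> u" "u \<le> 1"
    have "u * \<epsilon> \<le> 1 * \<epsilon>" "0 \<le> u * \<epsilon>" using u e by (auto intro: mult_right_mono)
    moreover have "x - \<epsilon> + u * (x + \<epsilon> - (x - \<epsilon>)) = x - \<epsilon> + 2 * (u * \<epsilon>)" "1 + \<epsilon> + u * (1 - (1 + \<epsilon>)) = 1 + \<epsilon> - u * \<epsilon>"
      by (simp_all add: algebra_simps)
    ultimately have b: "\<bar>x - \<epsilon> + u * (x + \<epsilon> - (x - \<epsilon>)) - x\<bar> \<le> \<epsilon>" "\<bar>1 + \<epsilon> + u * (1 - (1 + \<epsilon>)) - 1\<bar> \<le> \<epsilon>"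
      and c: "x - \<epsilon> + u * (x + \<epsilon> - (x - \<epsilon>)) = x \<Longrightarrow> 1 + \<epsilon> + u * (1 - (1 + \<epsilon>)) > 1"
      using e by linarith+
    show "(Complex (x - \<epsilon> + u * (x + \<epsilon> - (x - \<epsilon>))) y, 1 + \<epsilon> + u * (1 - (1 + \<epsilon>))) \<in> Up \<inter> N"
      using N[OF b] H V[OF _ b(1)] c unfolding Up_def by blast
  qed
  have AB: "A ** B \<in> \<Gamma>" "A ** B ** minv B' \<in> \<Gamma>" using A B \<Gamma>(5,6) by blast+
  have "up A m (?z, 1) = dn (A ** B) (m + i) (?z, 1)"
    by (rule trans_off[OF V'(1) H _ A]) (use F \<nu>' in \<open>simp_all add: z\<close>)
  also have "path_component (tube N) \<dots> (dn (A ** B) (m + i) (?z', 1 - \<epsilon>))"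
    by (rule dn_move[OF 1 AB(1)])
  also have "dn (A ** B) (m + i) (?z', 1 - \<epsilon>) = up (A ** B ** minv B') (m + i - j) (?z', 1 - \<epsilon>)"
    by (rule trans_off'[OF V'(2) H _ AB(1)]) (use F \<nu>' in \<open>simp_all add: z\<close>)
  also have "path_component (tube N) \<dots> (up (A ** B ** minv B') (m + i - j) (?z', 1 + \<epsilon>))"
    by (rule up_move[OF 2 AB(2)])
  also have "path_component (tube N) \<dots> (up (A ** B ** minv B') (m + i - j) (?z, 1))"
    by (rule up_move[OF 3 AB(2)])
  finally show ?thesis unfolding z .
qed

lemma seg_ivl: "y \<in> closed_segment a b \<longleftrightarrow> min a b \<le> y \<and> y \<le> max a (b::real)"
  by (auto simp: closed_segment_eq_real_ivl)

text \<open>The pushed-off parallel is not the homological longitude: its winding number around the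
  component is 2, while that of the meridian is -1. This accounts for the two inverse meridians on
  either side of the longitude. The base point is over (0, 1), inside a vertical edge.\<close>

lemma component1_loops:
  assumes \<nu>1: "\<And>z. \<nu> z = (if z \<in> inner1 then 0 else 1)"
  shows "near link_component1 \<epsilon> N \<Longrightarrow> path_component (tube N) (up (mat 1) 0 (sh \<epsilon> 0 1, 1))
      (up (minv mu ** longitude mu mv ** minv mu) 2 (sh \<epsilon> 0 1, 1))"
    and "near {(Complex 0 1, 1)} \<epsilon> N \<Longrightarrow> path_component (tube N) (up (mat 1) 0 (sh \<epsilon> 0 1, 1)) (up mu (- 1) (sh \<epsilon> 0 1, 1))"
proof -
  note [trans] = path_component_trans
  note fc = sh_def face_defs inner1_def
  note C = link_component1_eq diagram_defs seg_ivl
  show "path_component (tube N) (up (mat 1) 0 (sh \<epsilon> 0 1, 1))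
      (up (minv mu ** longitude mu mv ** minv mu) 2 (sh \<epsilon> 0 1, 1))" if n: "near link_component1 \<epsilon> N"
  proof -
    have e: "0 < \<epsilon>" "\<epsilon> < 1/4" using n by (auto simp: near_def)
    let ?g = "minv mv ** minv mu ** mv ** mu"
    have i: "minv mv \<in> \<Gamma>" "minv mu \<in> \<Gamma>" "minv mw \<in> \<Gamma>" "?g \<in> \<Gamma>"
      by (intro \<Gamma>(5) \<Gamma>(6) mu_mv_in)+
    have "path_component (tube N) (up (mat 1) 0 (sh \<epsilon> (of_int 0) (of_int 1), 1))
        (up (mat 1 ** mat 1 ** minv (minv mv)) (0 + 1 - 1) (sh \<epsilon> (of_int 2) (of_int 6), 1))"
      by (rule two_edges[OF n \<Gamma>(3)])
         (use e in \<open>auto simp: C intro!: trans_faces(1) trans_faces(6), auto simp: fc \<nu>1\<close>)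
    moreover have "path_component (tube N) (up mv 0 (sh \<epsilon> (of_int 2) (of_int 6), 1))
        (up (mv ** ?g ** minv (minv mv)) (0 + 1 - 1) (sh \<epsilon> (of_int 6) (of_int 4), 1))"
      by (rule two_edges[OF n mu_mv_in(2)])
         (use e in \<open>auto simp: C intro!: trans_faces(7) trans_faces(6), auto simp: fc \<nu>1\<close>)
    moreover have "path_component (tube N) (up (mv ** ?g ** mv) 0 (sh \<epsilon> (of_int 6) (of_int 4), 1))
        (up (mv ** ?g ** mv ** mat 1 ** minv mw) (0 + 1 - 0) (sh \<epsilon> (of_int 4) (of_int 2), 1))"
      by (rule two_edges[OF n \<Gamma>(5)[OF \<Gamma>(5)[OF mu_mv_in(2) i(4)] mu_mv_in(2)]])
         (use e in \<open>auto simp: C intro!: trans_faces(1) trans_faces(3), auto simp: fc \<nu>1\<close>)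
    moreover have "path_component (tube N) (up (mv ** ?g ** mv ** minv mw) 1 (sh \<epsilon> (of_int 4) (of_int 2), 1))
        (up (mv ** ?g ** mv ** minv mw ** mat 1 ** minv mu) (1 + 1 - 0) (sh \<epsilon> (of_int 0) (of_int 0), 1))"
      by (rule two_edges[OF n \<Gamma>(5)[OF \<Gamma>(5)[OF \<Gamma>(5)[OF mu_mv_in(2) i(4)] mu_mv_in(2)] i(3)]])
         (use e in \<open>auto simp: C intro!: trans_faces(1) trans_faces(2), auto simp: fc \<nu>1\<close>)
    moreover have "path_component (tube N) (up (mv ** ?g ** mv ** minv mw ** minv mu) 2 (sh \<epsilon> (of_int 0) 0, 1))
        (up (mv ** ?g ** mv ** minv mw ** minv mu) 2 (sh \<epsilon> (of_int 0) 1, 1))"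
      by (rule up_move[OF edge_up[OF n] \<Gamma>(5)[OF \<Gamma>(5)[OF \<Gamma>(5)[OF \<Gamma>(5)[OF mu_mv_in(2) i(4)] mu_mv_in(2)] i(3)] i(2)]])
         (auto simp: C)
    moreover have "mv ** ?g ** mv ** minv mw ** minv mu = minv mu ** longitude mu mv ** minv mu"
      by (simp add: mw_def longitude_def cancel det_mul)
    ultimately show ?thesis
      using path_component_trans by simp blast
  qed
  show "path_component (tube N) (up (mat 1) 0 (sh \<epsilon> 0 1, 1)) (up mu (- 1) (sh \<epsilon> 0 1, 1))"
    if n: "near {(Complex 0 1, 1)} \<epsilon> N"
  proof -
    have e: "0 < \<epsilon>" "\<epsilon> < 1/4" using n by (auto simp: near_def)
    have "path_component (tube N) (up (mat 1) 0 (sh \<epsilon> (of_int 0) (of_int 1), 1))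
        (up (mat 1 ** mu ** minv (mat 1)) (0 + 0 - 1) (sh \<epsilon> (of_int 0) (of_int 1), 1))"
      by (rule meridian_move[OF _ \<Gamma>(3)])
         (use e n in \<open>auto intro!: trans_faces(1) trans_faces(2), auto simp: fc \<nu>1\<close>)
    then show ?thesis by simp
  qed
qed

lemma component2_loops:
  assumes \<nu>0: "\<And>z. \<nu> z = 0" and n: "near link_component2 \<epsilon> N"
  shows "path_component (tube N) (up (mat 1) 0 (sh \<epsilon> 1 6, 1)) (up (minv mv ** mu ** mv ** mw ** mw) 0 (sh \<epsilon> 1 6, 1))"
    and "path_component (tube N) (up (mat 1) 0 (sh \<epsilon> 1 6, 1)) (up (minv mv) 0 (sh \<epsilon> 1 6, 1))"
proof -
  note fc = sh_def face_defs
  note C = link_component2_eq diagram_defs seg_ivl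
  have e: "0 < \<epsilon>" "\<epsilon> < 1/4" using n by (auto simp: near_def)
  let ?g = "minv mv ** mu"
  have i: "minv mv \<in> \<Gamma>" "?g \<in> \<Gamma>" "?g ** mv \<in> \<Gamma>" "?g ** mv ** mw \<in> \<Gamma>" "?g ** mv ** mw ** mw \<in> \<Gamma>"
    by (intro \<Gamma>(5) \<Gamma>(6) mu_mv_in)+
  have "path_component (tube N) (up (mat 1) 0 (sh \<epsilon> (of_int 1) (of_int 6), 1))
      (up (mat 1 ** ?g ** minv (minv mv)) (0 + 0 - 0) (sh \<epsilon> (of_int 3) (of_int 5), 1))"
    by (rule two_edges[OF n \<Gamma>(3)])
       (use e in \<open>auto simp: C \<nu>0 intro!: trans_faces(8) trans_faces(6), auto simp: fc\<close>)
  moreover have "path_component (tube N) (up (?g ** mv) 0 (sh \<epsilon> (of_int 3) (of_int 5), 1))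
      (up (?g ** mv ** mw ** minv (mat 1)) (0 + 0 - 0) (sh \<epsilon> (of_int 5) (of_int 1), 1))"
    by (rule two_edges[OF n i(3)])
       (use e in \<open>auto simp: C \<nu>0 intro!: trans_faces(3) trans_faces(1), auto simp: fc\<close>)
  moreover have "path_component (tube N) (up (?g ** mv ** mw) 0 (sh \<epsilon> (of_int 5) (of_int 1), 1))
      (up (?g ** mv ** mw ** mw ** minv (mat 1)) (0 + 0 - 0) (sh \<epsilon> (of_int 7) (of_int 3), 1))"
    by (rule two_edges[OF n i(4)])
       (use e in \<open>auto simp: C \<nu>0 intro!: trans_faces(3) trans_faces(1), auto simp: fc\<close>)
  moreover have "path_component (tube N) (up (?g ** mv ** mw ** mw) 0 (sh \<epsilon> (of_int 7) (of_int 3), 1))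
      (up (?g ** mv ** mw ** mw ** mat 1 ** minv (mat 1)) (0 + 0 - 0) (sh \<epsilon> (of_int 1) (of_int 7), 1))"
    by (rule two_edges[OF n i(5) _ _ _ _ trans_faces(1) trans_faces(1)])
       (use e in \<open>auto simp: C \<nu>0 fc\<close>)
  moreover have "path_component (tube N) (up (?g ** mv ** mw ** mw) 0 (sh \<epsilon> (of_int 1) 7, 1))
      (up (?g ** mv ** mw ** mw) 0 (sh \<epsilon> (of_int 1) 6, 1))"
    by (rule up_move[OF edge_up[OF n] i(5)]) (auto simp: C)
  ultimately show "path_component (tube N) (up (mat 1) 0 (sh \<epsilon> 1 6, 1)) (up (?g ** mv ** mw ** mw) 0 (sh \<epsilon> 1 6, 1))"
    apply simp
    apply (erule path_component_trans, erule path_component_trans, erule path_component_trans, erule path_component_trans)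
    apply assumption
    done
  have "(Complex 1 6, 1) \<in> link_component2" by (auto simp: C)
  then have "near {(Complex (of_int 1) (of_int 6), 1)} \<epsilon> N" using n unfolding near_def by auto
  then have "path_component (tube N) (up (mat 1) 0 (sh \<epsilon> (of_int 1) (of_int 6), 1))
      (up (mat 1 ** minv mv ** minv (mat 1)) (0 + 0 - 0) (sh \<epsilon> (of_int 1) (of_int 6), 1))"
    by (rule meridian_move[OF _ \<Gamma>(3)])
       (use e in \<open>auto simp: \<nu>0 intro!: trans_faces(6) trans_faces(1), auto simp: fc\<close>)
  then show "path_component (tube N) (up (mat 1) 0 (sh \<epsilon> 1 6, 1)) (up (minv mv) 0 (sh \<epsilon> 1 6, 1))"
    by simp
qed

text \<open>The word read off along the second component is brought to the form of the longitude by
  the group relation, which replaces mw mw by mu mw mv^-1.\<close>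

lemma longitude_word: "minv mv ** mu ** mv ** mw ** mw \<doteq> minv mv ** longitude mv mu ** minv mv"
proof -
  have "mw ** mw \<doteq> mu ** mw ** minv mv"
    using peq_mult[OF peq_sym[OF relation] peq_refl, of "minv mv"] by (simp add: cancel)
  then have "minv mv ** mu ** mv ** (mw ** mw) \<doteq> minv mv ** mu ** mv ** (mu ** mw ** minv mv)"
    by (rule peq_mult[OF peq_refl])
  then show ?thesis by (simp add: mw_def longitude_def cancel det_mul)
qed

end

section \<open>Horoballs at a parabolic fixed point and the cusp of the quotient\<close>

section \<open>A parabolic fixed point at infinity\<close>

locale cusp_group =
  fixes \<Gamma> :: "(complex^2^2) set" and w1 w2 :: complex
  assumes dgc: "discrete_group \<Gamma>"
    and lattice: "{A \<in> \<Gamma>. A$2$1 = 0} = (\<Union>m n :: int. {translation (of_int m * w1 + of_int n * w2),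
                          - translation (of_int m * w1 + of_int n * w2)})"
    and w12: "w1 \<noteq> 0" "Im (w2 / w1) \<noteq> 0"
begin

lemmas \<Gamma>c = discrete_groupD[OF dgc]

lemma lattice_translation: "translation (of_int m * w1 + of_int n * w2) \<in> \<Gamma>"
proof -
  have "translation (of_int m * w1 + of_int n * w2) \<in> {A \<in> \<Gamma>. A$2$1 = 0}" unfolding lattice by blast
  then show ?thesis by simp
qed

lemma snd_act_stabilizer:
  assumes "A \<in> \<Gamma>" "A$2$1 = 0"
  shows "snd (act A x) = snd x"
proof -
  have "A \<in> {A \<in> \<Gamma>. A$2$1 = 0}" using assms by simp
  then obtain w where "A = translation w \<or> A = - translation w" unfolding lattice by blast
  then show ?thesis by (cases x) auto
qed

text \<open>Iterate B -> B T B^-1 from A, with T the translation by w1. The lower left entry c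
  becomes -c^2 w1; if |c w1| < 1 it tends to 0 without vanishing while the diagonal stays bounded,
  so the iterates tend to T and never reach it, contradicting discreteness.\<close>

lemma shimizu:
  assumes A: "A \<in> \<Gamma>" "A$2$1 \<noteq> 0"
  shows "cmod (A$2$1) * cmod w1 \<ge> 1"
proof (rule ccontr)
  define T where "T = translation w1"
  define k where "k = cmod (A$2$1 * w1)"
  assume "\<not> cmod (A$2$1) * cmod w1 \<ge> 1"
  then have k: "0 \<le> k" "k < 1" by (auto simp: k_def norm_mult)
  have T: "T \<in> \<Gamma>" using lattice_translation[of 1 0] by (simp add: T_def)
  define G where "G = rec_nat A (\<lambda>_ B. B ** T ** minv B)"
  have G0: "G 0 = A" and GS: "G (Suc n) = G n ** T ** minv (G n)" for n by (simp_all add: G_def)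
  have Gin: "G n \<in> \<Gamma>" for n by (induction n) (auto simp: G0 GS A intro!: \<Gamma>c(5,6) T)
  define a c where "a n = G n $ 1 $ 1" "c n = G n $ 2 $ 1" for n
  note ac = a_c_def
  have Geq: "G (Suc n) = mat2 (1 - a n * c n * w1) ((a n)\<^sup>2 * w1) (- ((c n)\<^sup>2 * w1)) (1 + a n * c n * w1)" for n
  proof -
    have d: "G n$1$1 * G n$2$2 - G n$1$2 * G n$2$1 = 1" using \<Gamma>c(4)[OF Gin[of n]] by (simp add: det_2)
    then have "G n$1$1 * G n$2$2 = 1 + G n$1$2 * G n$2$1" by (simp add: algebra_simps)
    then show ?thesis
      unfolding GS mat_eq_iff ac T_def by (simp add: matrix_mult_nth power2_eq_square algebra_simps)
  qed
  have cS: "c (Suc n) = - ((c n)\<^sup>2 * w1)" and aS: "a (Suc n) = 1 - a n * c n * w1" for n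
    using Geq[of n] by (simp_all add: ac)
  have c0: "c n \<noteq> 0" for n by (induction n) (use A w12 in \<open>auto simp: ac(2) G0 cS[unfolded ac(2)]\<close>)
  have cb: "cmod (c n * w1) \<le> k ^ Suc n" for n
  proof (induction n)
    case (Suc n)
    have "cmod (c n * w1) \<le> k" using Suc k power_le_one[of k n] mult_left_mono[of "k ^ n" 1 k] by simp
    then have "cmod (c n * w1) * cmod (c n * w1) \<le> k * k ^ Suc n"
      using Suc k by (intro mult_mono) auto
    moreover have "cmod (c (Suc n) * w1) = cmod (c n * w1) * cmod (c n * w1)"
      by (simp add: cS norm_mult power2_eq_square)
    ultimately show ?case by simp
  qed (simp add: k_def ac G0)
  \<comment> \<open>1/(1 - k) is the fixed point of M -> 1 + k M, so any larger bound survives the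
    recursion a -> 1 - a c w1.\<close>
  define Mx where "Mx = max (cmod (A$1$1)) (1 / (1 - k))"
  have ab: "cmod (a n) \<le> Mx" for n
  proof (induction n)
    case (Suc n)
    have "cmod (c n * w1) \<le> k" using cb[of n] k power_le_one[of k n] mult_left_mono[of "k ^ n" 1 k] by simp
    moreover have "0 \<le> Mx" using k by (simp add: Mx_def le_max_iff_disj)
    ultimately have "cmod (a n) * cmod (c n * w1) \<le> Mx * k" using Suc k by (intro mult_mono) auto
    then have "cmod (a (Suc n)) \<le> 1 + Mx * k"
      using norm_triangle_ineq4[of 1 "a n * c n * w1"] by (simp add: aS norm_mult mult.assoc)
    also have "\<dots> \<le> Mx"
    proof -
      have "1 = 1 / (1 - k) * (1 - k)" using k by simp
      also have "\<dots> \<le> Mx * (1 - k)" using k by (intro mult_right_mono) (auto simp: Mx_def)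
      finally show ?thesis by (simp add: algebra_simps)
    qed
    finally show ?case .
  qed (simp add: Mx_def ac G0)
  have "(\<lambda>n. k ^ Suc n) \<longlonglongrightarrow> 0" using k by (intro LIMSEQ_Suc LIMSEQ_power_zero) simp
  then have l: "(\<lambda>n. Mx * k ^ Suc n) \<longlonglongrightarrow> 0" "(\<lambda>n. k ^ Suc n) \<longlonglongrightarrow> 0" by (auto intro: tendsto_mult_right_zero)
  have acl: "(\<lambda>n. a n * c n * w1) \<longlonglongrightarrow> 0"
  proof (rule Lim_null_comparison[OF _ l(1)], rule always_eventually, rule allI)
    fix n
    have "cmod (a n) * cmod (c n * w1) \<le> Mx * k ^ Suc n"
      using ab[of n] cb[of n] by (intro mult_mono) (use norm_ge_zero order_trans ab[of n] in blast)+
    then show "norm (a n * c n * w1) \<le> Mx * k ^ Suc n" by (simp add: norm_mult mult.assoc)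
  qed
  have cl: "(\<lambda>n. c n * w1) \<longlonglongrightarrow> 0"
    by (rule Lim_null_comparison[OF _ l(2)]) (use cb in simp)
  then have "(\<lambda>n. (c n * w1) * (c n * w1) / w1) \<longlonglongrightarrow> 0 * 0 / w1" by (intro tendsto_intros w12)
  then have c2: "(\<lambda>n. (c n)\<^sup>2 * w1) \<longlonglongrightarrow> 0" using w12 by (simp add: power2_eq_square field_simps)
  have "(\<lambda>n. 1 - a n * c n * w1) \<longlonglongrightarrow> 1 - 0" by (intro tendsto_intros acl)
  then have aSl: "(\<lambda>n. a (Suc n)) \<longlonglongrightarrow> 1" by (simp add: aS)
  then have al: "a \<longlonglongrightarrow> 1" by (rule LIMSEQ_imp_Suc)
  have "(\<lambda>n. G (Suc n)) \<longlonglongrightarrow> T"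
    unfolding tendsto_mat_iff forall_2 Geq T_def
    using tendsto_diff[OF tendsto_const acl, of 1] tendsto_mult[OF tendsto_power[OF al, of 2] tendsto_const, of w1]
      tendsto_minus[OF c2] tendsto_add[OF tendsto_const acl, of 1] by simp
  then have "\<forall>\<^sub>F n in sequentially. G (Suc n) = T"
    by (intro discrete_group_lim[OF dgc _ T]) (use Gin in auto)
  then obtain n where "G (Suc n) = T" by (auto simp: eventually_sequentially)
  then have "c (Suc n) = 0" by (simp add: ac T_def)
  then show False using c0 by blast
qed

text \<open>If A has lower left entry c, a point at height t goes to height at most 1/(|c|^2 t), and
  |c| \<ge> 1/|w1| by \<open>shimizu\<close>.\<close>

lemma height_product:
  assumes A: "A \<in> \<Gamma>" "A$2$1 \<noteq> 0" and x: "x \<in> H3"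
  shows "snd x * snd (act A x) \<le> (cmod w1)\<^sup>2"
proof -
  have t: "snd x > 0" using x by (simp add: H3_def)
  have D: "act_den A x > 0" by (rule act_den_pos[OF \<Gamma>c(4)[OF A(1)] x])
  have "1 \<le> (cmod (A$2$1) * cmod w1)\<^sup>2" using shimizu[OF A] by (simp add: one_le_power)
  then have "1 * (snd x)\<^sup>2 \<le> (cmod (A$2$1) * cmod w1)\<^sup>2 * (snd x)\<^sup>2" by (intro mult_right_mono) auto
  also have "\<dots> = (cmod w1)\<^sup>2 * ((cmod (A$2$1))\<^sup>2 * (snd x)\<^sup>2)" by (simp add: power_mult_distrib)
  also have "\<dots> \<le> (cmod w1)\<^sup>2 * act_den A x"
    by (intro mult_left_mono) (auto simp: act_den_def)
  finally show ?thesis using D by (simp add: snd_act field_simps power2_eq_square)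
qed

text \<open>Precise invariance of the horoball above height |w1|: by \<open>height_product\<close>,
  only elements fixing infinity can bring one of its points back into it.\<close>

lemma high_points:
  assumes "A \<in> \<Gamma>" "x \<in> H3" "snd x > cmod w1" "snd (act A x) > cmod w1"
  shows "A$2$1 = 0" "snd (act A x) = snd x"
proof -
  show 0: "A$2$1 = 0"
  proof (rule ccontr)
    assume "A$2$1 \<noteq> 0"
    from height_product[OF assms(1) this assms(2)] show False
      using mult_strict_mono[OF assms(3,4)] assms(3) norm_ge_zero[of w1]
      by (smt (verit) power2_eq_square)
  qed
  show "snd (act A x) = snd x" using snd_act_stabilizer[OF assms(1) 0] .
qed

lemma real_coordinates: "\<exists>a b :: real. z = of_real a * w1 + of_real b * w2"
proof -
  define \<tau> where "\<tau> = w2 / w1"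
  define b where "b = Im (z / w1) / Im \<tau>"
  define a where "a = Re (z / w1) - b * Re \<tau>"
  have "z / w1 = of_real a + of_real b * \<tau>"
    using w12(2) by (simp add: complex_eq_iff a_def b_def flip: \<tau>_def)
  then have "z = (of_real a + of_real b * \<tau>) * w1" using w12 by (simp add: nonzero_divide_eq_eq)
  also have "\<dots> = of_real a * w1 + of_real b * w2" using w12 by (simp add: \<tau>_def algebra_simps)
  finally show ?thesis by blast
qed

definition pgram :: "complex set" where
  "pgram = (\<lambda>(a, b). of_real a * w1 + of_real b * w2) ` ({0..1} \<times> {0..1::real})"

lemma compact_pgram: "compact pgram"
  unfolding pgram_def
  by (rule compact_continuous_image) (auto intro!: continuous_intros compact_Times simp: case_prod_unfold)

lemma translate_to_pgram: "\<exists>A\<in>\<Gamma>. fst (act A x) \<in> pgram \<and> snd (act A x) = snd x"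
proof -
  obtain a b :: real where ab: "fst x = of_real a * w1 + of_real b * w2" using real_coordinates by blast
  let ?A = "translation (of_int (- \<lfloor>a\<rfloor>) * w1 + of_int (- \<lfloor>b\<rfloor>) * w2)"
  have "fst (act ?A x) = of_real (frac a) * w1 + of_real (frac b) * w2"
    using ab by (cases x) (simp add: frac_def algebra_simps)
  moreover have "frac a \<in> {0..1}" "frac b \<in> {0..1}"
    using frac_ge_0 frac_lt_1 less_imp_le by (auto simp: less_imp_le)
  ultimately have "fst (act ?A x) \<in> pgram" unfolding pgram_def by force
  moreover have "snd (act ?A x) = snd x" by (cases x) simp
  ultimately show ?thesis using lattice_translation by blast
qed

end

lemma compactin_increasing:
  assumes S: "compactin M S" and Q: "\<And>n::nat. openin M (Q n)" "\<And>m n. m \<le> n \<Longrightarrow> Q m \<subseteq> Q n" "S \<subseteq> (\<Union>n. Q n)"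
  shows "\<exists>n. S \<subseteq> Q n"
proof -
  obtain F where F: "finite F" "F \<subseteq> range Q" "S \<subseteq> \<Union>F"
    using compactinD[OF S, of "range Q"] Q by (auto simp: ball_simps)
  then obtain I where I: "finite I" "F = Q ` I" using finite_subset_image by (metis subset_UNIV)
  have "S \<subseteq> Q (Max (insert 0 I))"
  proof
    fix x assume "x \<in> S"
    then obtain i where "i \<in> I" "x \<in> Q i" using F(3) I(2) by blast
    moreover have "i \<le> Max (insert 0 I)" using I(1) \<open>i \<in> I\<close> by simp
    ultimately show "x \<in> Q (Max (insert 0 I))" using Q(2) by blast
  qed
  then show ?thesis ..
qed

locale cusped_quotient = cusp_group \<Gamma> w1 w2 for \<Gamma> w1 w2 +
  fixes M :: "'a topology" and P :: "point \<Rightarrow> 'a"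
  assumes omc: "orbit_map \<Gamma> M P"
begin

lemmas Pc = orbit_mapD[OF omc]

lemma continuous_P: "continuous_map (top_of_set H3) M P"
  using omc by (simp add: orbit_map_def)

lemma compactin_image: "compact S \<Longrightarrow> S \<subseteq> H3 \<Longrightarrow> compactin M (P ` S)"
  using image_compactin[OF _ continuous_P, of S] by (simp add: compactin_subtopology)

lemma P_translate: "x \<in> H3 \<Longrightarrow> A \<in> \<Gamma> \<Longrightarrow> P (act A x) = P x"
  by (rule orbit_map_act[OF omc dgc])

lemma compactin_slab:
  assumes "0 < a"
  shows "compactin M (P ` {x. a \<le> snd x \<and> snd x \<le> b})"
proof -
  have "compact (pgram \<times> {a..b})" by (intro compact_Times compact_pgram compact_Icc)
  moreover have "pgram \<times> {a..b} \<subseteq> H3" using assms by (auto simp: H3_def)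
  ultimately have "compactin M (P ` (pgram \<times> {a..b}))" by (rule compactin_image)
  moreover have "P ` (pgram \<times> {a..b}) = P ` {x. a \<le> snd x \<and> snd x \<le> b}"
  proof (intro equalityI subsetI)
    fix y assume "y \<in> P ` {x. a \<le> snd x \<and> snd x \<le> b}"
    then obtain x where x: "y = P x" "a \<le> snd x" "snd x \<le> b" by blast
    then have "x \<in> H3" using assms by (simp add: H3_def)
    obtain A where A: "A \<in> \<Gamma>" "fst (act A x) \<in> pgram" "snd (act A x) = snd x" using translate_to_pgram by blast
    then have "act A x \<in> pgram \<times> {a..b}" using x by (simp add: mem_Times_iff)
    then have "P (act A x) \<in> P ` (pgram \<times> {a..b})" by (rule imageI)
    then show "y \<in> P ` (pgram \<times> {a..b})" using P_translate[OF \<open>x \<in> H3\<close> A(1)] x(1) by simp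
  qed auto
  ultimately show ?thesis by simp
qed

text \<open>The complement of the orbit of the closed horoball at height \<open>t\<close>.\<close>

definition below :: "real \<Rightarrow> point set" where
  "below t = {x \<in> H3. \<forall>A\<in>\<Gamma>. snd (act A x) < t}"

lemma open_below:
  assumes "0 < t"
  shows "open (below t)"
proof (subst open_subopen, intro ballI)
  fix x assume x: "x \<in> below t"
  then have xH: "x \<in> H3" "snd x > 0" by (auto simp: below_def H3_def)
  have xt: "snd x < t" using x \<Gamma>c(3) unfolding below_def by force
  \<comment> \<open>A bound for those heights of images of points near x that reach t: elements
    fixing infinity preserve heights, and the others obey \<open>height_product\<close>. Hence only
    the image of one compact slab has to be avoided, and this is closed.\<close>
  define T where "T = max t ((cmod w1)\<^sup>2 / (snd x / 2))"
  define U :: "point set" where "U = {x'. snd x / 2 < snd x'} \<inter> {x'. snd x' < t}"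
  have oU: "open U" unfolding U_def by (intro open_Int open_Collect_less continuous_intros)
  have UH: "U \<subseteq> H3" using xH by (auto simp: U_def H3_def)
  define V where "V = U \<inter> {x' \<in> H3. P x' \<in> topspace M - P ` {x. t \<le> snd x \<and> snd x \<le> T}}"
  have "closedin M (P ` {x. t \<le> snd x \<and> snd x \<le> T})"
    by (rule compactin_imp_closedin[OF orbit_map_Hausdorff[OF omc dgc] compactin_slab[OF assms]])
  then have "open V" unfolding V_def by (intro open_Int oU Pc(1)) (simp add: closedin_def)
  moreover have "x \<in> V"
  proof -
    have "P x \<noteq> P y" if "t \<le> snd y" for y
    proof
      assume e: "P x = P y"
      have "y \<in> H3" using that assms by (simp add: H3_def)
      then obtain A where "A \<in> \<Gamma>" "y = act A x" using Pc(5)[OF xH(1)] e by blast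
      then show False using x that unfolding below_def by force
    qed
    then show ?thesis using xH xt Pc(3) by (auto simp: V_def U_def)
  qed
  moreover have "V \<subseteq> below t"
  proof
    fix y assume y: "y \<in> V"
    then have yH: "y \<in> H3" "snd x / 2 < snd y" "snd y < t" by (auto simp: V_def U_def)
    have "snd (act A y) < t" if A: "A \<in> \<Gamma>" for A
    proof (rule ccontr)
      assume n: "\<not> snd (act A y) < t"
      have "snd (act A y) \<le> T"
      proof (cases "A$2$1 = 0")
        case True
        then show ?thesis using snd_act_stabilizer[OF A True, of y] yH by (simp add: T_def)
      next
        case False
        have pos: "snd (act A y) > 0" using n assms by linarith
        have "snd x / 2 * snd (act A y) \<le> snd y * snd (act A y)" using yH pos by (intro mult_right_mono) auto
        also have "\<dots> \<le> (cmod w1)\<^sup>2" by (rule height_product[OF A False yH(1)])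
        finally have "snd (act A y) \<le> (cmod w1)\<^sup>2 / (snd x / 2)" using xH(2) by (simp add: field_simps)
        then show ?thesis by (simp add: T_def)
      qed
      then have "P (act A y) \<in> P ` {x. t \<le> snd x \<and> snd x \<le> T}" using n by auto
      then show False using P_translate[OF yH(1) A] y by (simp add: V_def)
    qed
    then show "y \<in> below t" using yH by (simp add: below_def)
  qed
  ultimately show "\<exists>T. open T \<and> x \<in> T \<and> T \<subseteq> below t" by blast
qed

lemma below_disjoint:
  assumes "0 < t"
  shows "P ` below t \<inter> P ` {x. snd x \<ge> t} = {}"
proof (rule ccontr)
  assume "P ` below t \<inter> P ` {x. snd x \<ge> t} \<noteq> {}"
  then obtain z where "z \<in> P ` {x. snd x \<ge> t}" "z \<in> P ` below t" by blast
  then obtain x y where xy: "snd x \<ge> t" "y \<in> below t" "P y = P x" by (metis (mono_tags, lifting) imageE mem_Collect_eq)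
  then have "x \<in> H3" "y \<in> H3" using assms by (auto simp: H3_def below_def)
  then obtain A where "A \<in> \<Gamma>" "x = act A y" using Pc(5) xy(3) by blast
  then show False using xy unfolding below_def by force
qed

text \<open>The open sets \<open>Q n\<close>, made of \<open>below t\<close> and of heights up to t
  + n, exhaust the quotient. But a point at height t + n + 1 is not in \<open>Q n\<close>, because
  an orbit meets the horoball above |w1| at one height only.\<close>

lemma horoball_not_compact:
  assumes "cmod w1 < t" "compactin M C" "P ` {x. snd x \<ge> t} \<subseteq> C"
  shows False
proof -
  have t: "t > 0" using assms(1) norm_ge_zero[of w1] by linarith
  have "P ` {x. snd x \<ge> t} \<inter> P ` below t = {}" using below_disjoint[OF t] by blast
  define Q where "Q n = P ` below t \<union> P ` {x. cmod w1 < snd x \<and> snd x < t + real n}" for n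
  have "\<exists>n. C \<subseteq> Q n"
  proof (rule compactin_increasing[OF assms(2)])
    show "openin M (Q n)" for n
      unfolding Q_def
    proof (intro openin_Un Pc(2) open_below t)
      have "open ({x :: point. cmod w1 < snd x} \<inter> {x. snd x < t + real n})"
        by (intro open_Int open_Collect_less continuous_intros)
      then show "open {x :: point. cmod w1 < snd x \<and> snd x < t + real n}" by (simp add: Collect_conj_eq)
      show "{x. cmod w1 < snd x \<and> snd x < t + real n} \<subseteq> H3" unfolding H3_def by (auto dest: le_less_trans[OF norm_ge_zero])
    qed (auto simp: below_def)
    show "Q m \<subseteq> Q n" if "m \<le> n" for m n unfolding Q_def using that by (intro Un_mono image_mono) auto
    show "C \<subseteq> (\<Union>n. Q n)"
    proof
      fix y assume "y \<in> C"
      then have "y \<in> topspace M" using assms(2) compactin_subset_topspace by blast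
      then obtain x where x: "x \<in> H3" "y = P x" using Pc(4) by blast
      show "y \<in> (\<Union>n. Q n)"
      proof (cases "x \<in> below t")
        case True
        then show ?thesis using x by (auto simp: Q_def)
      next
        case False
        then obtain A where A: "A \<in> \<Gamma>" "snd (act A x) \<ge> t" using x by (force simp: below_def)
        obtain n where "snd (act A x) - t < real n" using reals_Archimedean2 by blast
        then have "act A x \<in> {x. cmod w1 < snd x \<and> snd x < t + real n}" using A assms(1) by auto
        then have "P (act A x) \<in> Q n" unfolding Q_def by (intro UnI2 imageI)
        then have "y \<in> Q n" using P_translate[OF x(1) A(1)] x(2) by simp
        then show ?thesis by blast
      qed
    qed
  qed
  then obtain n where n: "C \<subseteq> Q n" by blast
  define x :: "point" where "x = (0, t + real n + 1)"
  have "P x \<in> P ` {x. snd x \<ge> t}" by (auto simp: x_def)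
  then have "P x \<in> Q n" "P x \<notin> P ` below t" using n assms(3) \<open>_ = {}\<close> by blast+
  then obtain y where y: "cmod w1 < snd y" "snd y < t + real n" "P x = P y" by (auto simp: Q_def)
  have H: "x \<in> H3" "y \<in> H3" using le_less_trans[OF norm_ge_zero y(1)] t by (auto simp: H3_def x_def)
  then obtain A where A: "A \<in> \<Gamma>" "y = act A x" using Pc(5) y(3) by blast
  have "snd y = snd x" using high_points(2)[OF A(1) H(1)] A(2) y(1) assms(1) by (simp add: x_def)
  then show False using y(2) by (simp add: x_def)
qed

text \<open>Moved by A, the path starts in the horoball at infinity and stays in the union of all
  its translates. The other translates form an open set disjoint from it, so the path ends there as
  well, and an element joining two points of that horoball fixes infinity.\<close>

lemma horoball_component:
  assumes t: "cmod w1 \<le> t" and S: "path_component S x (act W x)" "S \<subseteq> H3" and W: "W \<in> \<Gamma>"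
    and A: "A \<in> \<Gamma>" "snd (act A x) > t" and hor: "\<And>y. y \<in> S \<Longrightarrow> P y \<in> P ` {y. snd y > t}"
  shows "conj_by A W $ 2 $ 1 = 0"
proof -
  obtain \<gamma> where \<gamma>: "path \<gamma>" "path_image \<gamma> \<subseteq> S" "pathstart \<gamma> = x" "pathfinish \<gamma> = act W x"
    using S(1) by (auto simp: path_component_def)
  have t0: "t \<ge> 0" using t norm_ge_zero[of w1] by linarith
  have dA: "det A = 1" "det W = 1" using A W \<Gamma>c(4) by blast+
  have "continuous_on S (act A)" using continuous_on_act[OF dA(1)] S(2) continuous_on_subset by blast
  then have "connected (act A ` path_image \<gamma>)"
    using \<gamma> connected_path_image by (intro connected_continuous_image) (auto intro: continuous_on_subset)
  let ?C = "act A ` path_image \<gamma>"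
  have CH: "?C \<subseteq> H3" using \<gamma>(2) S(2) act_in_H3[OF dA(1)] by blast
  define O1 where "O1 = {y :: point. snd y > t}"
  define O2 where "O2 = (\<Union>B\<in>{B\<in>\<Gamma>. B$2$1 \<noteq> 0}. act B ` O1)"
  have O1: "open O1" "O1 \<subseteq> H3" using t0 by (auto simp: O1_def H3_def intro!: open_Collect_less continuous_intros)
  have O2: "open O2" unfolding O2_def using open_act_image[OF _ O1] \<Gamma>c(4) by blast
  have disj: "O1 \<inter> O2 = {}"
  proof (rule ccontr)
    assume "O1 \<inter> O2 \<noteq> {}"
    then obtain B z where "B \<in> \<Gamma>" "B$2$1 \<noteq> 0" "z \<in> O1" "act B z \<in> O1" unfolding O2_def by blast
    then show False using high_points(1)[of B z] O1(2) t by (auto simp: O1_def)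
  qed
  have cov: "?C \<subseteq> O1 \<union> O2"
  proof
    fix y assume y: "y \<in> ?C"
    then obtain s where s: "s \<in> S" "y = act A s" using \<gamma>(2) by blast
    then have "P y = P s" using P_translate A(1) S(2) by blast
    then obtain z where z: "snd z > t" "P z = P y" using hor[OF s(1)] by auto
    then have zH: "z \<in> H3" using t0 by (simp add: H3_def)
    obtain B where B: "B \<in> \<Gamma>" "y = act B z" using Pc(5)[OF zH, of y] z(2) y CH by blast
    show "y \<in> O1 \<union> O2"
    proof (cases "B$2$1 = 0")
      case True
      then show ?thesis using snd_act_stabilizer[OF B(1) True, of z] B(2) z(1) by (simp add: O1_def)
    next
      case False
      then show ?thesis using B z(1) unfolding O2_def O1_def by blast
    qed
  qed
  have "x \<in> path_image \<gamma>" "act W x \<in> path_image \<gamma>"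
    using \<gamma>(3,4) pathstart_in_path_image pathfinish_in_path_image by metis+
  then have xC: "act A x \<in> ?C" "act A (act W x) \<in> ?C" by blast+
  have xO: "act A x \<in> O1" using A(2) by (simp add: O1_def)
  have "O1 \<inter> ?C = {} \<or> O2 \<inter> ?C = {}"
    by (rule connectedD[OF \<open>connected ?C\<close> O1(1) O2 _ cov]) (use disj in blast)
  then have "?C \<subseteq> O1" using cov xC xO by blast
  then have "snd (act A (act W x)) > t" using xC by (auto simp: O1_def)
  moreover have xH: "x \<in> H3" using \<open>x \<in> path_image \<gamma>\<close> \<gamma>(2) S(2) by blast
  moreover have "act (conj_by A W) (act A x) = act A (act W x)"
    unfolding conj_by_def
    using act_mult[of "A ** W" "minv A" "act A x"] act_mult[of A W x] act_minv(1)[OF dA(1) xH] act_in_H3[OF dA(1) xH] dA xH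
    by (simp add: det_mul)
  ultimately show ?thesis
    using high_points(1)[of "conj_by A W" "act A x"] act_in_H3[OF dA(1) xH] A t W
    by (simp add: conj_by_def \<Gamma>c(5,6))
qed

end

section \<open>The unfilled end\<close>

lemma thin_Un: "thin Z \<Longrightarrow> thin Z' \<Longrightarrow> thin (Z \<union> Z')"
proof -
  assume Z: "thin Z" "thin Z'"
  have *: "S - (Z \<union> Z') = (S - Z) - Z'" for S by blast
  have "open (S - Z)" if "open S" for S using Z that by (auto simp: thin_def)
  then show "thin (Z \<union> Z')" using Z unfolding thin_def * by (simp add: closed_Un)
qed

lemma thin_UN: "finite I \<Longrightarrow> (\<And>i. i \<in> I \<Longrightarrow> thin (Z i)) \<Longrightarrow> thin (\<Union>i\<in>I. Z i)"
  by (induction I rule: finite_induct) (auto simp: thin_Un, simp add: thin_def)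

text \<open>Applied with K a link component and Z a finite union of lines containing it: S - Z is
  connected and dense in S - K.\<close>

lemma connected_diff_closed_thin:
  assumes Z: "thin Z" and K: "closed K" "K \<subseteq> Z" and S: "open S" "connected S"
  shows "connected (S - K)"
proof (rule connected_intermediate_closure)
  show "connected (S - Z)" "S - Z \<subseteq> S - K" using Z S K by (auto simp: thin_def)
  show "S - K \<subseteq> closure (S - Z)"
  proof
    fix x assume x: "x \<in> S - K"
    show "x \<in> closure (S - Z)"
    proof (clarsimp simp: closure_approachable)
      fix d :: real assume "0 < d"
      obtain d' where d': "d' > 0" "ball x d' \<subseteq> S" using S(1) x open_contains_ball by blast
      have "ball x (min d d') - Z \<noteq> {}"
        using Z \<open>0 < d\<close> d' unfolding thin_def by (metis ball_eq_empty connected_ball not_le min_less_iff_conj open_ball)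
      then show "\<exists>y\<in>S - Z. dist y x < d" using d' by (force simp: dist_commute)
    qed
  qed
qed

lemma connected_closed_polygon: "connected (closed_polygon vs)" for vs :: "'a::real_normed_vector list"
proof -
  have "m \<le> length vs \<Longrightarrow> connected (\<Union>i<m. closed_segment (vs ! i) (vs ! (Suc i mod length vs)))" for m
  proof (induction m)
    case (Suc m)
    let ?S = "\<lambda>i. closed_segment (vs ! i) (vs ! (Suc i mod length vs))"
    show ?case
    proof (cases m)
      case 0
      then show ?thesis by (simp add: lessThan_Suc convex_connected[OF convex_closed_segment])
    next
      case (Suc j)
      have "vs ! m \<in> (\<Union>i<m. ?S i) \<inter> ?S m"
        using Suc.prems Suc by auto
      then have "connected ((\<Union>i<m. ?S i) \<union> ?S m)"
        using Suc.IH Suc.prems by (intro connected_Un) (auto simp: convex_connected[OF convex_closed_segment])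
      then show ?thesis by (simp add: lessThan_Suc Un_commute)
    qed
  qed simp
  then show ?thesis unfolding closed_polygon_def by blast
qed

lemma nbhd_eq: "C \<noteq> {} \<Longrightarrow> compact C \<Longrightarrow> {y. infdist y C < d} = (\<Union>x\<in>C. ball x d)"
  for C :: "'a::heine_borel set"
proof (intro equalityI subsetI)
  fix y assume C: "C \<noteq> {}" "compact C" and "y \<in> {y. infdist y C < d}"
  then obtain x where "x \<in> C" "infdist y C = dist y x" using infdist_attains_inf[OF compact_imp_closed[OF C(2)] C(1), of y] by blast
  then show "y \<in> (\<Union>x\<in>C. ball x d)" using \<open>y \<in> {y. infdist y C < d}\<close> by (auto simp: dist_commute)
next
  fix y assume C: "C \<noteq> {}" "compact C" and "y \<in> (\<Union>x\<in>C. ball x d)"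
  then obtain x where "x \<in> C" "dist x y < d" by auto
  then show "y \<in> {y. infdist y C < d}" using infdist_le[of x C y] by (simp add: dist_commute)
qed

lemma connected_nbhd:
  fixes C :: "'a::{real_normed_vector,heine_borel} set"
  assumes "C \<noteq> {}" "compact C" "connected C" "d > 0"
  shows "connected {y. infdist y C < d}"
proof -
  have "connected (\<Union>((\<lambda>x. C \<union> ball x d) ` C))"
  proof (rule connected_Union)
    show "connected S" if "S \<in> (\<lambda>x. C \<union> ball x d) ` C" for S
      using that assms by (auto intro!: connected_Un)
    show "\<Inter> ((\<lambda>x. C \<union> ball x d) ` C) \<noteq> {}" using assms(1) by auto
  qed
  moreover have "\<Union>((\<lambda>x. C \<union> ball x d) ` C) = (\<Union>x\<in>C. ball x d)" using assms(4) by auto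
  ultimately show ?thesis using nbhd_eq[OF assms(1,2)] by simp
qed

lemma link_component2_thin: "\<exists>Z. thin Z \<and> link_component2 \<subseteq> Z"
proof -
  have bl: "bounded_linear (\<lambda>x :: point. Re (fst x))" "bounded_linear (\<lambda>x :: point. Im (fst x))"
    "bounded_linear (\<lambda>x :: point. snd x)"
    by (auto intro: bounded_linear_compose[OF bounded_linear_Re bounded_linear_fst]
        bounded_linear_compose[OF bounded_linear_Im bounded_linear_fst] bounded_linear_snd)
  define A B D where "A a = {x :: point. Re (fst x) = a \<and> snd x = 1}"
    and "B b = {x :: point. Im (fst x) = b \<and> snd x = 0}"
    and "D z = {x :: point. Re (fst x) = Re z \<and> Im (fst x) = Im z}" for a b z
  have t: "thin (A a)" "thin (B b)" "thin (D z)" for a b z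
    unfolding A_def B_def D_def
    by (rule thin_codim2[OF bl(1,3), of "(1, 0)" "(0, 1)"] thin_codim2[OF bl(2,3), of "(\<i>, 0)" "(0, 1)"]
        thin_codim2[OF bl(1,2), of "(1, 0)" "(\<i>, 0)"]; simp)+
  let ?I = "{1, 3, 5, 7 :: real}"
  have "thin ((\<Union>a\<in>?I. A a) \<union> (\<Union>b\<in>?I. B b) \<union> (\<Union>z\<in>C2. D z))"
    by (intro thin_Un thin_UN t) (auto simp: C2_def)
  moreover have "link_component2 \<subseteq> (\<Union>a\<in>?I. A a) \<union> (\<Union>b\<in>?I. B b) \<union> (\<Union>z\<in>C2. D z)"
  proof
    fix x assume "x \<in> link_component2"
    then obtain z t where x: "x = (z, t)" "z \<in> V2 \<and> t = 1 \<or> z \<in> H2 \<and> t = 0 \<or> z \<in> C2"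
      unfolding link_component2_eq by blast
    from x(2) show "x \<in> (\<Union>a\<in>?I. A a) \<union> (\<Union>b\<in>?I. B b) \<union> (\<Union>z\<in>C2. D z)"
      unfolding x(1) A_def B_def D_def V2_def H2_def vseg_def hseg_def by auto
  qed
  ultimately show ?thesis by blast
qed

lemma link_component2_end:
  shows "link_component2 \<noteq> {}"
    and "0 < d \<Longrightarrow> connected ({y. infdist y link_component2 < d} - link_component2)"
proof -
  show ne: "link_component2 \<noteq> {}" unfolding link_component2_eq by (auto simp: C2_def intro!: exI[of _ "Complex 1 7"] exI[of _ "0 :: real"])
  obtain Z where Z: "thin Z" "link_component2 \<subseteq> Z" using link_component2_thin by blast
  assume d: "0 < d"
  show "connected ({y. infdist y link_component2 < d} - link_component2)"
  proof (rule connected_diff_closed_thin[OF Z(1) _ Z(2)])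
    show "closed link_component2" using compact_link(2) compact_imp_closed by blast
    show "connected {y. infdist y link_component2 < d}"
      by (rule connected_nbhd[OF ne compact_link(2) _ d]) (simp add: link_component2_def connected_closed_polygon)
    show "open {y. infdist y link_component2 < d}"
      by (intro open_Collect_less continuous_intros)
  qed
qed

lemma Hausdorff_S3: "Hausdorff_space S3"
  by (simp add: S3_def Hausdorff_space_Alexandroff_compactification locally_compact_space_euclidean)

lemma compact_S3: "compact_space S3"
  by (simp add: S3_def)

locale cusped_dehn = dehn_orbifold \<Gamma> M P K K' e f g p q r s core k + cusp_group \<Gamma> w1 w2
  for \<Gamma> M P K K' e f g p q r s core k w1 w2 +
  assumes det_glue: "p * s - q * r = 1"
    and K'_ne: "K' \<noteq> {}" and connected_end: "\<And>d. 0 < d \<Longrightarrow> connected ({y. infdist y K' < d} - K')"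
begin

sublocale cusped_quotient \<Gamma> w1 w2 M P
  by unfold_locales (rule om)

definition nb :: "real \<Rightarrow> point set" where "nb d = {y. infdist y K' < d}"

lemma open_nb: "open (nb d)"
  unfolding nb_def by (intro open_Collect_less continuous_intros)

lemma e_continuous: "continuous_map (top_of_set (circle \<times> UNIV)) S3 e"
  using e_facts(1) unfolding embedding_map_def
  by (blast intro: continuous_map_into_fulltopology homeomorphic_imp_continuous_map)

lemma f_continuous: "continuous_map (subtopology S3 XL) M f"
  using filling(1) unfolding embedding_map_def
  by (blast intro: continuous_map_into_fulltopology homeomorphic_imp_continuous_map)

lemma g_continuous: "continuous_map (top_of_set (UNIV \<times> circle)) M g"
  using emb_g unfolding embedding_map_def
  by (blast intro: continuous_map_into_fulltopology homeomorphic_imp_continuous_map)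

lemma compact_tube: "compactin S3 (e ` (circle \<times> cball 0 1))"
  by (rule image_compactin[OF _ e_continuous]) (auto simp: compactin_subtopology intro!: compact_Times)

lemma separated_end: "\<exists>d0>0. \<forall>y\<in>nb d0. Some y \<notin> e ` (circle \<times> cball 0 1)"
proof -
  define D where "D = {y. Some y \<in> e ` (circle \<times> cball 0 1)}"
  have "closedin S3 (e ` (circle \<times> cball 0 1))"
    by (rule compactin_imp_closedin[OF Hausdorff_S3 compact_tube])
  then have "open {y. Some y \<in> topspace S3 - e ` (circle \<times> cball 0 1)}"
    by (intro open_vimage_Some) (simp add: closedin_def)
  then have cD: "closed D" unfolding D_def closed_def by (simp add: Collect_neg_eq)
  have "K' \<inter> D = {}" using e_facts(4) unfolding D_def by auto
  obtain d where d: "d > 0" "\<And>x y. x \<in> K' \<Longrightarrow> y \<in> D \<Longrightarrow> d \<le> dist x y"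
  proof (cases "D = {}")
    case False
    then have "setdist K' D > 0" using compact_K(2) cD K'_ne \<open>K' \<inter> D = {}\<close> setdist_gt_0_compact_closed by blast
    then show ?thesis using that setdist_le_dist by blast
  qed (use that[of 1] in auto)
  have "y \<notin> D" if "y \<in> nb d" for y
  proof
    assume "y \<in> D"
    have "y \<in> (\<Union>x\<in>K'. ball x d)" using that unfolding nb_def nbhd_eq[OF K'_ne compact_K(2)] .
    then obtain x where x: "x \<in> K'" "y \<in> ball x d" by (rule UN_E)
    show False using d(2)[OF x(1) \<open>y \<in> D\<close>] x(2) by simp
  qed
  then show ?thesis using d(1) unfolding D_def by blast
qed

text \<open>The exponents of \<alpha> and \<open>v\<close> form the inverse of the gluing matrix,
  which is integral because the determinant is 1.\<close>

lemma glue_surj: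
  assumes "u \<in> circle" "w \<noteq> 0"
  shows "\<exists>z v. z \<noteq> 0 \<and> v \<in> circle \<and> cmod z = cmod w \<and> f (e (u, w)) = g (z, v)"
proof -
  define \<sigma> where "\<sigma> = sgn w"
  have n: "cmod u = 1" "cmod \<sigma> = 1" "u \<noteq> 0" "\<sigma> \<noteq> 0" using assms by (auto simp: \<sigma>_def norm_sgn sgn_zero_iff)
  define \<alpha> v where "\<alpha> = u powi (- r) * \<sigma> powi s" "v = u powi p * \<sigma> powi (- q)"
  have \<alpha>: "cmod \<alpha> = 1" "cmod v = 1" using n by (simp_all add: \<alpha>_v_def norm_mult cmod_powi_unit)
  define z where "z = of_real (cmod w) * \<alpha>"
  have z: "z \<noteq> 0" "cmod z = cmod w" "sgn z = \<alpha>"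
    using \<alpha> assms(2) by (auto simp: z_def norm_mult sgn_mult sgn_of_real) (simp add: sgn_div_norm)
  have pm: "x powi a * x powi b = x powi (a + b)" if "x \<noteq> 0" for x :: complex and a b
    using that by (simp add: power_int_add)
  have 1: "\<alpha> powi q * v powi s = (u powi (- r * q) * u powi (p * s)) * (\<sigma> powi (s * q) * \<sigma> powi (- q * s))"
    unfolding \<alpha>_v_def power_int_mult_distrib power_int_mult by (simp add: mult_ac)
  have 2: "\<alpha> powi p * v powi r = (u powi (- r * p) * u powi (p * r)) * (\<sigma> powi (s * p) * \<sigma> powi (- q * r))"
    unfolding \<alpha>_v_def power_int_mult_distrib power_int_mult by (simp add: mult_ac)
  have E: "- r * q + p * s = 1" "s * q + - q * s = 0" "- r * p + p * r = 0" "s * p + - q * r = 1"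
    using det_glue by (simp_all add: algebra_simps)
  have "\<alpha> powi q * v powi s = u" "\<alpha> powi p * v powi r = \<sigma>"
    unfolding 1 2 pm[OF n(3)] pm[OF n(4)] E by simp_all
  moreover have "of_real (cmod w) * \<sigma> = w" using assms(2) by (simp add: \<sigma>_def sgn_div_norm scaleR_conv_of_real)
  ultimately have "g (z, v) = f (e (u, w))"
    using glue[OF z(1), of v] \<alpha>(2) z(2,3) by (simp add: mult.assoc)
  then show ?thesis using z \<alpha>(2) by (metis mem_sphere_0)
qed

text \<open>The remainder is covered by the image of the sphere minus the end and minus an open tube
  around K, together with the closed solid torus of radius 1. Both are compact, and points of the
  punctured tube are reached through the gluing.\<close>

lemma end_complement:
  assumes d0: "\<forall>y\<in>nb d0. Some y \<notin> e ` (circle \<times> cball 0 1)" and d: "0 < d" "d \<le> d0"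
  shows "\<exists>C. compactin M C \<and> topspace M \<subseteq> \<phi> ` (nb d - K') \<union> C"
proof -
  define Z where "Z = - (Some ` nb d) - e ` (circle \<times> ball 0 1)"
  define C where "C = f ` Z \<union> g ` (cball 0 1 \<times> circle)"
  have "openin (top_of_set (circle \<times> UNIV)) (circle \<times> ball (0::complex) 1)"
    by (intro openin_Times) (auto simp: openin_open_eq)
  then have "openin S3 (e ` (circle \<times> ball 0 1))"
    using open_embedding(1)[OF e_facts(1)] e_facts(2) by simp
  then have "openin S3 (Some ` nb d \<union> e ` (circle \<times> ball 0 1))"
    using openin_S3_Some[OF open_nb] by blast
  moreover have "topspace S3 - (Some ` nb d \<union> e ` (circle \<times> ball 0 1)) = Z" by (auto simp: Z_def)
  ultimately have "closedin S3 Z" by (metis closedin_diff closedin_topspace)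
  then have cZ: "compactin S3 Z" using compact_S3 closedin_compact_space by blast
  have Kn: "Some ` K \<subseteq> e ` (circle \<times> ball 0 1)" unfolding e_facts(3)[symmetric] by auto
  have "K' \<subseteq> nb d" using d(1) by (auto simp: nb_def)
  then have ZX: "Z \<subseteq> XL" using Kn unfolding Z_def XL_def by blast
  have "compactin M (f ` Z)"
    by (rule image_compactin[OF _ f_continuous]) (use cZ ZX in \<open>simp add: compactin_subtopology\<close>)
  moreover have "compactin M (g ` (cball 0 1 \<times> circle))"
    by (rule image_compactin[OF _ g_continuous]) (auto simp: compactin_subtopology intro!: compact_Times)
  ultimately have "compactin M C" unfolding C_def by (rule compactin_Un)
  moreover have "topspace M \<subseteq> \<phi> ` (nb d - K') \<union> C"
  proof
    fix y assume y: "y \<in> topspace M"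
    show "y \<in> \<phi> ` (nb d - K') \<union> C"
    proof (cases "y \<in> core")
      case True
      then show ?thesis unfolding core(1) C_def by auto
    next
      case False
      then obtain x where x: "x \<in> XL" "y = f x" using y not_core_iff by blast
      consider "x \<in> Some ` nb d" | "x \<in> e ` (circle \<times> ball 0 1)" | "x \<in> Z" by (auto simp: Z_def)
      then show ?thesis
      proof cases
        case 1
        then obtain z where z: "z \<in> nb d" "x = Some z" by blast
        then have "z \<notin> K'" using x(1) by (auto simp: XL_def)
        then show ?thesis using z x(2) by (auto simp: \<phi>_def)
      next
        case 2
        then obtain u w where uw: "u \<in> circle" "w \<in> ball 0 1" "x = e (u, w)" by blast
        have "w \<noteq> 0"
        proof
          assume "w = 0"
          then have "x \<in> e ` (circle \<times> {0})" using uw by blast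
          then show False using x(1) unfolding e_facts(3) XL_def by blast
        qed
        from glue_surj[OF uw(1) this] obtain z v where "v \<in> circle" "cmod z = cmod w" "f x = g (z, v)"
          using uw(3) by blast
        then have "y \<in> g ` (cball 0 1 \<times> circle)" using uw(2) x(2) by auto
        then show ?thesis by (simp add: C_def)
      qed (use x in \<open>auto simp: C_def\<close>)
    qed
  qed
  ultimately show ?thesis by blast
qed

text \<open>The complements of shrinking closed neighbourhoods of K', each joined with the open
  solid torus, form an increasing open cover of the orbifold. A compact set lies in one of
  them.\<close>

lemma end_escape:
  assumes d0: "0 < d0" "\<forall>y\<in>nb d0. Some y \<notin> e ` (circle \<times> cball 0 1)" and S: "compactin M S"
  shows "\<exists>d. 0 < d \<and> d \<le> d0 \<and> \<phi> ` (nb d - K') \<inter> S = {}"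
proof -
  define d where "d n = d0 / (real n + 1)" for n
  have d: "d n > 0" "d n \<le> d0" for n
  proof -
    show "d n > 0" using d0(1) by (simp add: d_def)
    have "d0 * 1 \<le> d0 * (real n + 1)" using d0(1) by (intro mult_left_mono) auto
    then show "d n \<le> d0" unfolding d_def by (simp add: pos_divide_le_eq)
  qed
  have dm: "d n \<le> d m" if "m \<le> n" for m n
    unfolding d_def using d0(1) that by (intro divide_left_mono) auto
  define cn where "cn n = {y. infdist y K' \<le> d n}" for n
  have cc: "compact (cn n)" for n unfolding cn_def by (rule compact_infdist_le[OF K'_ne compact_K(2) d(1)])
  define Q where "Q n = f ` (XL \<inter> - Some ` cn n) \<union> g ` (ball 0 1 \<times> circle)" for n
  have "\<exists>n. S \<subseteq> Q n"
  proof (rule compactin_increasing[OF S])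
    show "openin M (Q n)" for n
      unfolding Q_def
    proof (intro openin_Un f_open g_open openin_Int openin_XL openin_S3_compl cc)
      show "openin (top_of_set (UNIV \<times> circle)) (ball 0 1 \<times> circle)"
        by (intro openin_Times) (auto simp: openin_open_eq)
    qed auto
    show "Q m \<subseteq> Q n" if "m \<le> n" for m n
      using dm[OF that] unfolding Q_def cn_def by (intro Un_mono image_mono Int_mono) (auto intro: order_trans)
    show "S \<subseteq> (\<Union>n. Q n)"
    proof
      fix y assume "y \<in> S"
      then have y: "y \<in> topspace M" using S compactin_subset_topspace by blast
      show "y \<in> (\<Union>n. Q n)"
      proof (cases "y \<in> core")
        case True
        then show ?thesis unfolding core(1) Q_def by auto
      next
        case False
        then obtain x where x: "x \<in> XL" "y = f x" using y not_core_iff by blast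
        have "\<exists>n. x \<notin> Some ` cn n"
        proof (cases x)
          case (Some z)
          then have "z \<notin> K'" using x(1) by (auto simp: XL_def)
          then have "infdist z K' > 0" using infdist_pos_not_in_closed[OF compact_imp_closed[OF compact_K(2)] K'_ne] by blast
          then obtain n where "inverse (real (Suc n)) < infdist z K' / d0"
            using reals_Archimedean d0(1) by (metis divide_pos_pos)
          then have "d n < infdist z K'" using d0(1) by (simp add: d_def field_simps)
          then have "z \<notin> cn n" by (simp add: cn_def)
          then show ?thesis using Some by (auto intro: exI[of _ n])
        qed auto
        then show ?thesis using x unfolding Q_def by blast
      qed
    qed
  qed
  then obtain n where n: "S \<subseteq> Q n" by blast
  have "\<phi> ` (nb (d n) - K') \<inter> Q n = {}"
  proof (rule ccontr)
    assume "\<phi> ` (nb (d n) - K') \<inter> Q n \<noteq> {}"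
    then obtain y where y: "y \<in> nb (d n)" "y \<notin> K'" "\<phi> y \<in> Q n" by blast
    have yd: "y \<in> nb d0" using y(1) d(2)[of n] by (simp add: nb_def)
    have "Some y \<notin> Some ` K"
    proof
      assume "Some y \<in> Some ` K"
      then have "Some y \<in> e ` (circle \<times> cball 0 1)" unfolding e_facts(3)[symmetric] by auto
      then show False using d0(2) yd by blast
    qed
    then have yX: "Some y \<in> XL" using y(2) by (auto simp: XL_def)
    from y(3) consider x where "x \<in> XL" "x \<notin> Some ` cn n" "f (Some y) = f x"
      | z v where "z \<in> ball 0 1" "v \<in> circle" "f (Some y) = g (z, v)" unfolding Q_def \<phi>_def by blast
    then show False
    proof cases
      case 1
      then have "Some y = x" using inj_onD[OF f_inj] yX by blast
      then show False using 1(2) y(1) by (auto simp: nb_def cn_def)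
    next
      case (2 z v)
      have zn: "z \<noteq> 0"
      proof
        assume "z = 0"
        then have "f (Some y) \<in> core" using 2 core(1) by auto
        then show False using filling(4) yX by blast
      qed
      let ?c = "(sgn z powi q * v powi s, of_real (cmod z) * sgn z powi p * v powi r)"
      have n1: "cmod (sgn z) = 1" "cmod v = 1" using zn 2 by (simp_all add: norm_sgn)
      have c: "?c \<in> circle \<times> cball 0 1" "snd ?c \<noteq> 0"
        using 2(1) n1 zn by (auto simp: norm_mult cmod_powi_unit sgn_zero_iff)
      then have "e ?c \<in> XL" by (intro e_in_XL) auto
      moreover have "f (Some y) = f (e ?c)" using glue[OF zn 2(2)] 2(3) by simp
      ultimately have "Some y = e ?c" using inj_onD[OF f_inj] yX by blast
      then have "Some y \<in> e ` (circle \<times> cball 0 1)" using c(1) by blast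
      then show False using d0(2) yd by blast
    qed
  qed
  then show ?thesis using n d[of n] by blast
qed

lemma continuous_\<phi>: "continuous_map (top_of_set (- L)) M \<phi>"
  unfolding continuous_map_def
proof (intro conjI allI impI)
  show "\<phi> \<in> topspace (top_of_set (- L)) \<rightarrow> topspace M"
    using Some_in_XL filling(3) by (auto simp: \<phi>_def)
  fix U assume "openin M U"
  then have "open {y. y \<notin> L \<and> \<phi> y \<in> U}" by (rule \<phi>_cont)
  then show "openin (top_of_set (- L)) {x \<in> topspace (top_of_set (- L)). \<phi> x \<in> U}"
    using open_compl_L by (simp add: openin_open_eq Collect_conj_eq) auto
qed

text \<open>A connected neighbourhood of the end that avoids one horosphere lies over the open
  horoball or over \<open>below\<close>. In the second case the closed horoball would have its image
  inside the compact remainder, which \<open>horoball_not_compact\<close> forbids.\<close>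

theorem end_in_horoball:
  "\<exists>d>0. \<phi> ` (nb d - K') \<subseteq> P ` {x. snd x > cmod w1 + 1} \<and> nb d \<inter> K = {}"
proof -
  define t where "t = cmod w1 + 1"
  have t: "t > cmod w1" "t > 0" using norm_ge_zero[of w1] by (auto simp: t_def add_nonneg_pos)
  obtain d0 where d0: "0 < d0" "\<forall>y\<in>nb d0. Some y \<notin> e ` (circle \<times> cball 0 1)" using separated_end by blast
  have S: "compactin M (P ` {x. t \<le> snd x \<and> snd x \<le> t})" by (rule compactin_slab[OF t(2)])
  obtain d where d: "0 < d" "d \<le> d0" "\<phi> ` (nb d - K') \<inter> P ` {x. t \<le> snd x \<and> snd x \<le> t} = {}"
    using end_escape[OF d0 S] by blast
  have nK: "nb d \<inter> K = {}"
  proof (rule ccontr)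
    assume "nb d \<inter> K \<noteq> {}"
    then obtain y where y: "y \<in> nb d" "y \<in> K" by blast
    then have "Some y \<in> e ` (circle \<times> {0})" unfolding e_facts(3) by blast
    then have "Some y \<in> e ` (circle \<times> cball 0 1)" by auto
    moreover have "y \<in> nb d0" using y(1) d(2) by (simp add: nb_def)
    ultimately show False using d0(2) by blast
  qed
  let ?E = "\<phi> ` (nb d - K')" and ?B = "P ` {x. snd x > t}" and ?V = "P ` below t"
  have "connectedin (top_of_set (- L)) (nb d - K')"
    using connected_end[OF d(1)] nK unfolding nb_def[symmetric] by (auto simp: connectedin_subtopology L_def)
  then have cE: "connectedin M ?E" by (rule connectedin_continuous_map_image[OF continuous_\<phi>])
  then have Etop: "?E \<subseteq> topspace M" using connectedin_subset_topspace by blast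
  have oB: "openin M ?B"
    by (rule Pc(2)) (use t in \<open>auto simp: H3_def intro!: open_Collect_less continuous_intros\<close>)
  have oV: "openin M ?V" by (rule Pc(2)[OF open_below[OF t(2)]]) (auto simp: below_def)
  have cov: "?E \<subseteq> ?B \<union> ?V"
  proof
    fix y assume y: "y \<in> ?E"
    then obtain x where x: "x \<in> H3" "y = P x" using Etop Pc(4) by blast
    show "y \<in> ?B \<union> ?V"
    proof (cases "x \<in> below t")
      case False
      then obtain A where A: "A \<in> \<Gamma>" "snd (act A x) \<ge> t" using x(1) by (force simp: below_def)
      have yA: "y = P (act A x)" using P_translate[OF x(1) A(1)] x(2) by simp
      have "snd (act A x) \<noteq> t"
      proof
        assume "snd (act A x) = t"
        then have "y \<in> P ` {x. t \<le> snd x \<and> snd x \<le> t}" unfolding yA by (intro imageI) simp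
        then show False using d(3) y by blast
      qed
      then show ?thesis using A(2) unfolding yA by (intro UnI1 imageI) simp
    qed (use x in auto)
  qed
  note VB = below_disjoint[OF t(2)]
  have "?B \<subseteq> P ` {x. snd x \<ge> t}" by (intro image_mono) auto
  then have disj: "?B \<inter> ?V \<inter> ?E = {}" using VB by blast
  have "?V \<inter> ?E = {}"
  proof (rule ccontr)
    assume "?V \<inter> ?E \<noteq> {}"
    then have "?B \<inter> ?E = {}" using connectedinD[OF cE oB oV cov disj] by blast
    then have "?E \<subseteq> ?V" using cov by blast
    moreover obtain C where C: "compactin M C" "topspace M \<subseteq> ?E \<union> C" using end_complement[OF d0(2) d(1,2)] by blast
    moreover have "P ` {x. snd x \<ge> t} \<subseteq> topspace M" using Pc(3) t by (auto simp: H3_def)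
    ultimately have "P ` {x. snd x \<ge> t} \<subseteq> ?E \<union> C" "P ` {x. snd x \<ge> t} \<inter> ?E = {}" using VB by (blast, blast)
    then have "P ` {x. snd x \<ge> t} \<subseteq> C" by blast
    then show False by (rule horoball_not_compact[OF t(1) C(1)])
  qed
  then have "?E \<subseteq> ?B" using cov by blast
  then show ?thesis using d(1) nK unfolding t_def by blast
qed

text \<open>If all elements fixed infinity, height would be a function on the quotient. The end lies
  at large height and the rest is compact, so heights would be bounded away from 0, although every
  positive height occurs.\<close>

theorem not_all_triangular: "\<exists>A\<in>\<Gamma>. A$2$1 \<noteq> 0"
proof (rule ccontr)
  assume "\<not> (\<exists>A\<in>\<Gamma>. A$2$1 \<noteq> 0)"
  then have *: "snd (act A x) = snd x" if "A \<in> \<Gamma>" for A x using snd_act_stabilizer that by blast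
  obtain d0 where d0: "0 < d0" "\<forall>y\<in>nb d0. Some y \<notin> e ` (circle \<times> cball 0 1)" using separated_end by blast
  obtain d where d: "d > 0" "\<phi> ` (nb d - K') \<subseteq> P ` {x. snd x > cmod w1 + 1}" using end_in_horoball by blast
  define d1 where "d1 = min d d0"
  have "nb d1 \<subseteq> nb d" "0 < d1" "d1 \<le> d0" using d(1) d0(1) by (auto simp: nb_def d1_def)
  then obtain C where C: "compactin M C" "topspace M \<subseteq> \<phi> ` (nb d1 - K') \<union> C" using end_complement[OF d0(2)] by blast
  define Q where "Q n = P ` {x. snd x > 1 / (real n + 1)}" for n
  have "\<exists>n. C \<subseteq> Q n"
  proof (rule compactin_increasing[OF C(1)])
    show "openin M (Q n)" for n
      unfolding Q_def by (rule Pc(2))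
         (auto simp: H3_def intro!: open_Collect_less continuous_intros intro: less_trans[of 0 "1 / (real n + 1)"])
    show "Q m \<subseteq> Q n" if "m \<le> n" for m n
    proof -
      have "1 / (real n + 1) \<le> 1 / (real m + 1)" using that by (intro divide_left_mono) auto
      then show ?thesis unfolding Q_def by (intro image_mono) auto
    qed
    show "C \<subseteq> (\<Union>n. Q n)"
    proof
      fix y assume "y \<in> C"
      then obtain x where x: "x \<in> H3" "y = P x" using compactin_subset_topspace[OF C(1)] Pc(4) by blast
      then obtain n where "inverse (real (Suc n)) < snd x" using reals_Archimedean[of "snd x"] by (auto simp: H3_def)
      then show "y \<in> (\<Union>n. Q n)" using x by (auto simp: Q_def inverse_eq_divide add.commute)
    qed
  qed
  then obtain n where n: "C \<subseteq> Q n" by blast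
  define \<eta> where "\<eta> = 1 / (real n + 1) / 2"
  have \<eta>: "0 < \<eta>" "\<eta> < 1 / (real n + 1)" "1 / (real n + 1) \<le> 1" by (auto simp: \<eta>_def field_simps)
  define x :: "point" where "x = (0, \<eta>)"
  have xH: "x \<in> H3" using \<eta> by (simp add: x_def H3_def)
  have "P x \<in> topspace M" by (rule Pc(3)[OF xH])
  moreover have "P x \<notin> P ` {x. snd x > \<theta>}" if "\<theta> > \<eta>" for \<theta>
  proof
    assume "P x \<in> P ` {x. snd x > \<theta>}"
    then obtain y where y: "snd y > \<theta>" "P x = P y" by (metis (mono_tags, lifting) imageE mem_Collect_eq)
    then have "y \<in> H3" using that \<eta>(1) by (simp add: H3_def)
    then obtain A where "A \<in> \<Gamma>" "y = act A x" using Pc(5)[OF xH] y(2) by blast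
    then show False using *[of A x] y(1) that by (simp add: x_def)
  qed
  then have "P x \<notin> P ` {x. snd x > 1 / (real n + 1)}" "P x \<notin> P ` {x. snd x > cmod w1 + 1}"
    using \<eta> order_less_le_trans[OF order_less_le_trans[OF \<eta>(2,3)], of "cmod w1 + 1"] by simp_all
  then have "P x \<notin> Q n" "P x \<notin> P ` {x. snd x > cmod w1 + 1}" unfolding Q_def by simp_all
  moreover have "\<phi> ` (nb d1 - K') \<subseteq> P ` {x. snd x > cmod w1 + 1}" using d(2) \<open>nb d1 \<subseteq> nb d\<close> by blast
  ultimately show False using C(2) n by blast
qed

end

locale cusped_link = link_orbifold \<Gamma> M P e f g p q r s core k + cusp_group \<Gamma> w1 w2
  for \<Gamma> M P e f g p q r s core k w1 w2 +
  assumes det1: "p * s - q * r = 1"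
begin

sublocale cusped_dehn \<Gamma> M P link_component1 link_component2 e f g p q r s core k w1 w2
  by unfold_locales (rule det1 link_component2_end, assumption?)+

text \<open>The parallel and the meridian of the second component run inside the neighbourhood of
  the end that lies over the horoball, so \<open>horoball_component\<close> applies to both words
  with the same A.\<close>

lemma peripheral_triangular:
  "\<exists>A\<in>\<Gamma>. conj_by A mv $ 2 $ 1 = 0 \<and> conj_by A (longitude mv mu) $ 2 $ 1 = 0"
proof -
  obtain d where d: "d > 0" "\<phi> ` (nb d - link_component2) \<subseteq> P ` {x. snd x > cmod w1 + 1}"
    "nb d \<inter> link_component1 = {}" using end_in_horoball by blast
  \<comment> \<open>With the constant circle map and zero branches, a loop records only its deck
    transformation.\<close>
  interpret loops \<Gamma> M P e f g p q r s core k "\<lambda>_. 1" "\<lambda>_. 0" "\<lambda>_. 0" "\<lambda>_. 0"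
    by unfold_locales auto
  have "link_component2 \<subseteq> nb d" using d(1) by (auto simp: nb_def)
  then obtain \<epsilon> where n: "near link_component2 \<epsilon> (nb d)"
    using near_exists[OF compact_link(2) open_nb] by blast
  have eps: "0 < \<epsilon>" "\<epsilon> < 1" using n by (auto simp: near_def)
  define S where "S = {x \<in> Hcov. proj x \<in> nb d}"
  define x where "x = sp (sh \<epsilon> 1 6, 1)"
  have "sh \<epsilon> 1 6 \<notin> Vl" "sh \<epsilon> 1 6 \<notin> Hl" using sh_off[OF eps, of 1 6] sh_off[OF eps, of 1 6] by auto
  then have xH: "x \<in> Hcov" unfolding x_def by (rule sp_Hcov)
  have SH: "S \<subseteq> H3" using open_Hcov(2) by (auto simp: S_def)
  have pc: "path_component S x (act W x)"
    if "path_component (tube (nb d)) (up (mat 1) 0 (sh \<epsilon> 1 6, 1)) (up W 0 (sh \<epsilon> 1 6, 1))" for W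
  proof -
    have "path_component S (fst (up (mat 1) 0 (sh \<epsilon> 1 6, 1))) (fst (up W 0 (sh \<epsilon> 1 6, 1)))"
      by (rule path_component_map[OF that]) (auto simp: tube_def S_def intro!: continuous_intros)
    then show ?thesis by (simp add: up_def x_def)
  qed
  have xS: "x \<in> S" using pc[OF component2_loops(2)[OF _ n]] path_component_mem(1) by blast
  have hor: "P y \<in> P ` {y. snd y > cmod w1 + 1}" if "y \<in> S" for y
  proof -
    have "proj y \<in> nb d - link_component2" "\<phi> (proj y) = P y"
      using that proj[of y] by (auto simp: S_def L_def)
    then show ?thesis using d(2) by (metis imageI subsetD)
  qed
  obtain z where z: "snd z > cmod w1 + 1" "P x = P z" using hor[OF xS] by auto
  have "snd z > 0" using z(1) norm_ge_zero[of w1] by linarith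
  then have "z \<in> H3" by (simp add: H3_def)
  then obtain A where A: "A \<in> \<Gamma>" "z = act A x" using P(5)[of x z] z(2) xS SH by blast
  have tri: "conj_by A W $ 2 $ 1 = 0" if "W \<in> \<Gamma>"
    "path_component (tube (nb d)) (up (mat 1) 0 (sh \<epsilon> 1 6, 1)) (up W 0 (sh \<epsilon> 1 6, 1))" for W
    by (rule horoball_component[OF _ pc[OF that(2)] SH that(1) A(1) _ hor]) (use z A in auto)
  have dA: "det A = 1" using \<Gamma>(4)[OF A(1)] .
  have v: "conj_by A (minv mv) $ 2 $ 1 = 0"
    by (rule tri[OF \<Gamma>(6)[OF mu_mv_in(2)] component2_loops(2)[OF _ n]]) simp
  then have v0: "conj_by A mv $ 2 $ 1 = 0" by (simp add: conj_by_minv)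
  have "minv mv ** mu ** mv ** mw ** mw \<in> \<Gamma>" by (intro \<Gamma>(5) \<Gamma>(6) mu_mv_in)
  from tri[OF this component2_loops(1)[OF _ n]]
  have "conj_by A (minv mv ** mu ** mv ** mw ** mw) $ 2 $ 1 = 0" by simp
  then have W: "conj_by A (minv mv ** longitude mv mu ** minv mv) $ 2 $ 1 = 0"
    using peq_conj_by[OF longitude_word, of A] by (auto simp: peq_def)
  have mult: "(B ** C) $ 2 $ 1 = 0" if "B $ 2 $ 1 = 0" "C $ 2 $ 1 = 0" for B C :: "complex^2^2"
    using that by (simp add: matrix_mult_nth)
  have "longitude mv mu = mv ** ((minv mv ** longitude mv mu ** minv mv) ** mv)"
    by (simp add: cancel)
  then have "conj_by A (longitude mv mu) = conj_by A mv ** (conj_by A (minv mv ** longitude mv mu ** minv mv) ** conj_by A mv)"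
    using conj_by_mult[OF dA] by metis
  then show ?thesis using A(1) v0 mult[OF v0 mult[OF W v0]] by auto
qed

end

section \<open>Winding numbers, null-homologous loops and a map measuring linking\<close>

section \<open>The linking number as a winding number\<close>

lemma continuous_integer_constant:
  fixes h :: "'a::topological_space \<Rightarrow> real"
  assumes "continuous_on S h" "connected S" "\<And>x. x \<in> S \<Longrightarrow> h x \<in> \<int>" "x \<in> S" "y \<in> S"
  shows "h x = h y"
proof -
  have "h constant_on S"
  proof (rule continuous_discrete_range_constant[OF assms(2,1)])
    fix x assume x: "x \<in> S"
    show "\<exists>e>0. \<forall>y. y \<in> S \<and> h y \<noteq> h x \<longrightarrow> e \<le> norm (h y - h x)"
    proof (intro exI[of _ 1] conjI allI impI)
      fix y assume y: "y \<in> S \<and> h y \<noteq> h x"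
      then have "h y - h x \<in> \<int>" "h y - h x \<noteq> 0" using assms(3) x by auto
      then have "1 \<le> \<bar>h y - h x\<bar>" by (rule Ints_nonzero_abs_ge1)
      then show "1 \<le> norm (h y - h x)" by simp
    qed simp
  qed
  then show ?thesis using assms(4,5) by (auto simp: constant_on_def)
qed

lemma exp_lifts_differ:
  fixes G H :: "real \<Rightarrow> complex"
  assumes "continuous_on {0..1} G" "continuous_on {0..1} H" "\<And>t. t \<in> {0..1} \<Longrightarrow> exp (G t) = exp (H t)"
  shows "G 1 - G 0 = H 1 - H 0"
proof -
  define h where "h t = Im (G t - H t) / (2 * pi)" for t
  have GH: "G t - H t = 2 * pi * h t * \<i> \<and> h t \<in> \<int>" if t: "t \<in> {0..1}" for t
  proof -
    obtain n :: int where "G t = H t + (of_int (2 * n) * pi) * \<i>"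
      using assms(3)[OF t] unfolding exp_eq by blast
    then have "G t - H t = of_int (2 * n) * pi * \<i>" by simp
    then have "h t = of_int n" and "G t - H t = 2 * pi * (of_int n) * \<i>" by (simp_all add: h_def)
    then show ?thesis by simp
  qed
  have "h 1 = h 0"
    by (rule continuous_integer_constant[of "{0..1}"])
       (use GH in \<open>auto simp: h_def intro!: continuous_intros assms\<close>)
  then have "G 1 - H 1 = G 0 - H 0" using GH[of 1] GH[of 0] by simp
  then show ?thesis by (simp add: algebra_simps)
qed

text \<open>\<open>t\<close> is the barycentric coordinate with index 0, matching the loop
  \<open>\<lambda>x. l (x 0)\<close> of the framing; so t = 0 is the vertex with index 1.\<close>

definition edge_point :: "real \<Rightarrow> nat \<Rightarrow> real" where
  "edge_point t i = (if i = 0 then t else if i = 1 then 1 - t else 0)"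

definition triangle_point :: "real \<times> real \<Rightarrow> nat \<Rightarrow> real" where
  "triangle_point x i = (if i = 0 then fst x else if i = 1 then snd x else if i = 2 then 1 - fst x - snd x else 0)"

definition triangle :: "(real \<times> real) set" where
  "triangle = {x. 0 \<le> fst x \<and> 0 \<le> snd x \<and> fst x + snd x \<le> 1}"

lemma edge_point: "t \<in> {0..1} \<Longrightarrow> edge_point t \<in> standard_simplex 1"
  by (auto simp: standard_simplex_def edge_point_def)

lemma triangle_point: "x \<in> triangle \<Longrightarrow> triangle_point x \<in> standard_simplex 2"
  by (auto simp: standard_simplex_def triangle_point_def triangle_def numeral_2_eq_2)

lemma continuous_triangle_point:
  "continuous_map (top_of_set triangle) (subtopology (powertop_real UNIV) (standard_simplex 2)) triangle_point"
  unfolding continuous_map_in_subtopology continuous_map_componentwise_UNIV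
proof (intro conjI allI)
  fix k :: nat
  have "continuous_on triangle (\<lambda>x. triangle_point x k)"
    by (cases "k = 0"; cases "k = 1"; cases "k = 2") (auto simp: triangle_point_def intro!: continuous_intros)
  then show "continuous_map (top_of_set triangle) euclideanreal (\<lambda>x. triangle_point x k)" by simp
qed (use triangle_point in auto)

lemma convex_triangle: "convex triangle"
proof -
  have *: "triangle = {x. fst x \<ge> 0} \<inter> {x. snd x \<ge> 0} \<inter> {x. fst x + snd x \<le> (1::real)}" by (auto simp: triangle_def)
  have "convex {x :: real \<times> real. fst x \<ge> 0}" "convex {x :: real \<times> real. snd x \<ge> 0}"
    "convex {x :: real \<times> real. fst x + snd x \<le> 1}"
    using convex_halfspace_ge[of 0 "(1, 0) :: real \<times> real"] convex_halfspace_ge[of 0 "(0, 1) :: real \<times> real"]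
      convex_halfspace_le[of "(1, 1) :: real \<times> real" 1] by (simp_all add: inner_prod_def)
  then show ?thesis unfolding * by (intro convex_Int)
qed

definition log_change :: "(real \<Rightarrow> complex) \<Rightarrow> complex" where
  "log_change u = (THE d. \<exists>G. continuous_on {0..1} G \<and> (\<forall>t\<in>{0..1}. u t = exp (G t)) \<and> d = G 1 - G 0)"

lemma log_change_eq:
  assumes "continuous_on {0..1} G" "\<And>t. t \<in> {0..1} \<Longrightarrow> u t = exp (G t)"
  shows "log_change u = G 1 - G 0"
  unfolding log_change_def
proof (rule the_equality)
  show "\<exists>H. continuous_on {0..1} H \<and> (\<forall>t\<in>{0..1}. u t = exp (H t)) \<and> G 1 - G 0 = H 1 - H 0"
    using assms by blast
  fix d assume "\<exists>H. continuous_on {0..1} H \<and> (\<forall>t\<in>{0..1}. u t = exp (H t)) \<and> d = H 1 - H 0"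
  then obtain H where H: "continuous_on {0..1} H" "\<forall>t\<in>{0..1}. u t = exp (H t)" "d = H 1 - H 0" by blast
  have "H 1 - H 0 = G 1 - G 0"
    by (rule exp_lifts_differ[OF H(1) assms(1)]) (use H(2) assms(2) in simp)
  then show "d = G 1 - G 0" using H(3) by simp
qed

text \<open>Subtracting a discontinuous branch at the two ends makes the change of the logarithm along a
  1-simplex an integer, so that it extends to chains.\<close>

definition turn :: "(real \<Rightarrow> complex) \<Rightarrow> int" where
  "turn u = \<lfloor>Im (log_change u - (Ln (u 1) - Ln (u 0))) / (2 * pi)\<rfloor>"

lemma turn_eq:
  assumes "continuous_on {0..1} G" "\<And>t. t \<in> {0..1} \<Longrightarrow> u t = exp (G t)"
  shows "2 * pi * of_int (turn u) = Im (G 1) - Im (G 0) - (Im (Ln (u 1)) - Im (Ln (u 0)))"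
proof -
  have "\<exists>n :: int. Im (G t) - Im (Ln (u t)) = 2 * pi * of_int n" if "t \<in> {0..1}" for t
  proof -
    have "exp (G t) = exp (Ln (u t))" using assms(2)[OF that] by simp
    then obtain n :: int where "G t = Ln (u t) + (of_int (2 * n) * pi) * \<i>" unfolding exp_eq by blast
    then show ?thesis by (intro exI[of _ n]) simp
  qed
  then obtain m n :: int where mn: "Im (G 1) - Im (Ln (u 1)) = 2 * pi * of_int m" "Im (G 0) - Im (Ln (u 0)) = 2 * pi * of_int n"
    by (metis atLeastAtMost_iff le_numeral_extra(3) zero_le_one order_refl)
  have lce: "log_change u = G 1 - G 0" using assms by (rule log_change_eq)
  have "Im (log_change u - (Ln (u 1) - Ln (u 0))) = 2 * pi * of_int (m - n)"
    unfolding lce using mn by (simp add: algebra_simps)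
  then have "Im (log_change u - (Ln (u 1) - Ln (u 0))) / (2 * pi) = of_int (m - n)" by simp
  then have "turn u = m - n" unfolding turn_def by simp
  then have "2 * pi * of_int (turn u) = 2 * pi * of_int m - 2 * pi * of_int n" by (simp add: right_diff_distrib)
  then show ?thesis using mn by linarith
qed

text \<open>\<open>turn\<close> defines a cocycle: along a 2-simplex the map \<open>lc\<close> has a
  logarithm, since a triangle is contractible, and the alternating sum over the faces cancels. A
  chain bounded by the loop therefore gives it turn 0, and for closed values the branch corrections
  at the two ends agree.\<close>

lemma null_homologous_log:
  fixes lc :: "'b \<Rightarrow> complex"
  assumes lc: "continuous_map S euclidean lc" "\<And>x. x \<in> topspace S \<Longrightarrow> lc x \<noteq> 0"
    and bd: "singular_relboundary 1 S {} (frag_of (restrict (\<lambda>x. l (x 0)) (standard_simplex 1)))"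
    and G: "continuous_on {0..1} G" "\<And>t. t \<in> {0..1} \<Longrightarrow> lc (l t) = exp (G t)" and closed: "lc (l 1) = lc (l 0)"
  shows "Im (G 1) = Im (G 0)"
proof -
  define w where "w \<sigma> = turn (\<lambda>t. lc (\<sigma> (edge_point t)))" for \<sigma>
  \<comment> \<open>Chains on the single generator \<open>()\<close> stand for the integers.\<close>
  define W where "W = frag_extend (\<lambda>\<sigma>. frag_cmul (w \<sigma>) (frag_of ()))"
  let ?l = "restrict (\<lambda>x. l (x 0)) (standard_simplex 1)"
  obtain d where d: "singular_chain (Suc 1) S d" "chain_boundary (Suc 1) d = frag_of ?l"
    using bd unfolding singular_relboundary_def mod_subset_empty by blast
  have face: "w (singular_face 2 0 \<tau>) - w (singular_face 2 1 \<tau>) + w (singular_face 2 2 \<tau>) = 0"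
    if \<tau>: "singular_simplex 2 S \<tau>" for \<tau>
  proof -
    define \<tau>' where "\<tau>' x = lc (\<tau> (triangle_point x))" for x
    have c\<tau>: "continuous_map (subtopology (powertop_real UNIV) (standard_simplex 2)) S \<tau>"
      using \<tau> by (simp add: singular_simplex_def)
    have "continuous_map (top_of_set triangle) S (\<tau> \<circ> triangle_point)"
      by (rule continuous_map_compose[OF continuous_triangle_point c\<tau>])
    then have top: "\<tau> (triangle_point x) \<in> topspace S" if "x \<in> triangle" for x
      using that by (auto simp: continuous_map_def)
    have "continuous_map (top_of_set triangle) euclidean (lc \<circ> (\<tau> \<circ> triangle_point))"
      by (rule continuous_map_compose[OF \<open>continuous_map (top_of_set triangle) S _\<close> lc(1)])
    then have "continuous_on triangle \<tau>'" by (simp add: \<tau>'_def comp_def)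
    then obtain \<psi> where \<psi>: "continuous_on triangle \<psi>" "\<And>x. x \<in> triangle \<Longrightarrow> \<tau>' x = exp (\<psi> x)"
      using continuous_logarithm_on_contractible[OF _ convex_imp_contractible[OF convex_triangle]] lc(2) top
      unfolding \<tau>'_def by metis
    define h0 h1 h2 :: "real \<Rightarrow> real \<times> real" where "h0 t = (0, t)" and "h1 t = (t, 0)" and "h2 t = (t, 1 - t)" for t
    note hd = h0_def h1_def h2_def
    have tri: "h0 t \<in> triangle" "h1 t \<in> triangle" "h2 t \<in> triangle" if "t \<in> {0..1}" for t
      using that by (auto simp: hd triangle_def)
    have fp: "singular_face 2 0 \<tau> (edge_point t) = \<tau> (triangle_point (h0 t))"
      "singular_face 2 1 \<tau> (edge_point t) = \<tau> (triangle_point (h1 t))"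
      "singular_face 2 2 \<tau> (edge_point t) = \<tau> (triangle_point (h2 t))" if "t \<in> {0..1}" for t
      using edge_point[OF that] unfolding singular_face_def
      by (auto simp: simplical_face_def edge_point_def triangle_point_def hd fun_eq_iff intro!: arg_cong[of _ _ \<tau>])
    have cont: "continuous_on {0..1} (\<lambda>t. \<psi> (h0 t))" "continuous_on {0..1} (\<lambda>t. \<psi> (h1 t))" "continuous_on {0..1} (\<lambda>t. \<psi> (h2 t))"
      using tri by (auto intro!: continuous_on_compose2[OF \<psi>(1)] continuous_intros simp: hd)
    have fw: "lc (singular_face 2 0 \<tau> (edge_point t)) = exp (\<psi> (h0 t))"
      "lc (singular_face 2 1 \<tau> (edge_point t)) = exp (\<psi> (h1 t))"
      "lc (singular_face 2 2 \<tau> (edge_point t)) = exp (\<psi> (h2 t))" if "t \<in> {0..1}" for t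
      using fp[OF that] \<psi>(2) tri[OF that] by (simp_all add: \<tau>'_def)
    have ends: "h0 1 = h2 0" "h0 0 = h1 0" "h1 1 = h2 1" by (simp_all add: hd)
    have E: "lc (singular_face 2 0 \<tau> (edge_point 1)) = lc (singular_face 2 2 \<tau> (edge_point 0))"
      "lc (singular_face 2 0 \<tau> (edge_point 0)) = lc (singular_face 2 1 \<tau> (edge_point 0))"
      "lc (singular_face 2 1 \<tau> (edge_point 1)) = lc (singular_face 2 2 \<tau> (edge_point 1))"
      using fw[of 0] fw[of 1] ends by simp_all
    note W = turn_eq[where G = "\<lambda>t. \<psi> (h0 t)", OF cont(1), where u = "\<lambda>t. lc (singular_face 2 0 \<tau> (edge_point t))"]
      turn_eq[where G = "\<lambda>t. \<psi> (h1 t)", OF cont(2), where u = "\<lambda>t. lc (singular_face 2 1 \<tau> (edge_point t))"]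
      turn_eq[where G = "\<lambda>t. \<psi> (h2 t)", OF cont(3), where u = "\<lambda>t. lc (singular_face 2 2 \<tau> (edge_point t))"]
    have "2 * pi * of_int (w (singular_face 2 0 \<tau>)) - 2 * pi * of_int (w (singular_face 2 1 \<tau>))
        + 2 * pi * of_int (w (singular_face 2 2 \<tau>)) = 0"
      using W(1)[OF fw(1)] W(2)[OF fw(2)] W(3)[OF fw(3)] unfolding w_def E ends by simp
    then have "2 * pi * of_int (w (singular_face 2 0 \<tau>) - w (singular_face 2 1 \<tau>) + w (singular_face 2 2 \<tau>)) = 0"
      by (simp add: algebra_simps)
    then show ?thesis by (simp only: mult_eq_0_iff of_int_eq_0_iff) simp
  qed
  have "W (chain_boundary (Suc 1) d) = 0"
  proof -
    have "frag_extend (\<lambda>\<tau>. W (\<Sum>k\<le>2. frag_cmul ((-1) ^ k) (frag_of (singular_face 2 k \<tau>)))) d = 0"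
    proof (rule frag_extend_eq_0)
      fix \<tau> assume "\<tau> \<in> Poly_Mapping.keys d"
      then have "singular_simplex 2 S \<tau>" using d(1) by (auto simp: singular_chain_def numeral_2_eq_2)
      have "W (\<Sum>k\<le>2. frag_cmul ((-1) ^ k) (frag_of (singular_face 2 k \<tau>))) =
          frag_cmul (w (singular_face 2 0 \<tau>) - w (singular_face 2 1 \<tau>) + w (singular_face 2 2 \<tau>)) (frag_of ())"
        by (simp add: W_def numeral_2_eq_2 frag_extend_add frag_extend_cmul frag_extend_diff frag_extend_minus frag_cmul_distrib
            frag_cmul_diff_distrib)
      then show "W (\<Sum>k\<le>2. frag_cmul ((-1) ^ k) (frag_of (singular_face 2 k \<tau>))) = 0"
        using face[OF \<open>singular_simplex 2 S \<tau>\<close>] by simp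
    qed
    moreover have "W (frag_extend F d) = frag_extend (\<lambda>\<tau>. W (F \<tau>)) d" for F
      by (induction d rule: frag_induction[OF subset_UNIV]) (simp_all add: W_def frag_extend_diff)
    ultimately show ?thesis by (simp add: chain_boundary_def numeral_2_eq_2)
  qed
  then have "W (frag_of ?l) = 0" unfolding d(2) .
  then have "w ?l = 0" by (simp add: W_def)
  moreover have "lc (?l (edge_point t)) = exp (G t)" if "t \<in> {0..1}" for t
    using edge_point[OF that] G(2)[OF that] by (simp add: edge_point_def)
  ultimately have "Im (G 1) - Im (G 0) - (Im (Ln (lc (?l (edge_point 1)))) - Im (Ln (lc (?l (edge_point 0))))) = 0"
    using turn_eq[OF G(1), of "\<lambda>t. lc (?l (edge_point t))"] unfolding w_def by simp
  moreover have "?l (edge_point 1) = l 1" "?l (edge_point 0) = l 0"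
    using edge_point[of 1] edge_point[of 0] by (simp_all add: edge_point_def)
  ultimately show ?thesis using closed by simp
qed

text \<open>The real part of \<open>linking_map\<close> vanishes, for heights in \<open>[0, 1]\<close>, over the projection of the first
  component, and the imaginary part on a surface bounded by it; so the argument is the winding angle around that
  component.\<close>

definition height_map :: "point \<Rightarrow> real" where
  "height_map y = infdist (fst y) H1 * (snd y - 1) + infdist (fst y) V1 * snd y + (snd y - max 0 (min 1 (snd y)))"

definition linking_map :: "point \<Rightarrow> complex" where
  "linking_map y =
     of_real (infdist (fst y) (- inner1) - infdist (fst y) inner1 - \<bar>snd y - max 0 (min 1 (snd y))\<bar>) +
     \<i> * of_real (max (-1) (min 1 (height_map y)))"

lemma Re_linking: "Re (linking_map y) = infdist (fst y) (- inner1) - infdist (fst y) inner1 - \<bar>snd y - max 0 (min 1 (snd y))\<bar>"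
  and Im_linking: "Im (linking_map y) = max (-1) (min 1 (height_map y))"
  by (simp_all add: linking_map_def)

lemma open_inner1: "open inner1"
proof -
  have "R a b c d = {z. a < Re z} \<inter> {z. Re z < b} \<inter> ({z. c < Im z} \<inter> {z. Im z < d})" for a b c d
    by (auto simp: R_def)
  then have "open (R a b c d)" for a b c d
    by (simp add: open_Int open_Collect_less continuous_intros)
  then show ?thesis by (simp add: inner1_def open_Un)
qed

lemma inner1_ne: "inner1 \<noteq> {}" "- inner1 \<noteq> {}"
proof -
  have "Complex 1 1 \<in> inner1" "Complex 7 7 \<in> - inner1" by (auto simp: inner1_def R_def)
  then show "inner1 \<noteq> {}" "- inner1 \<noteq> {}" by blast+
qed

lemma closure_inner1: "closure inner1 \<subseteq> inner1 \<union> V1 \<union> H1"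
proof -
  define Q where "Q a b c d = {z. a \<le> Re z} \<inter> {z. Re z \<le> b} \<inter> ({z. c \<le> Im z} \<inter> {z. Im z \<le> d})" for a b c d
  have "closed (Q a b c d)" for a b c d
    unfolding Q_def by (intro closed_Int closed_Collect_le continuous_intros)
  then have "closed (Q 0 2 0 6 \<union> Q 0 6 2 4 \<union> Q 0 4 0 4)" by (intro closed_Un)
  moreover have "inner1 \<subseteq> Q 0 2 0 6 \<union> Q 0 6 2 4 \<union> Q 0 4 0 4"
    unfolding inner1_def R_def Q_def by auto
  ultimately have "closure inner1 \<subseteq> Q 0 2 0 6 \<union> Q 0 6 2 4 \<union> Q 0 4 0 4" by (rule closure_minimal[rotated])
  moreover have "z \<in> inner1 \<union> V1 \<union> H1" if "z \<in> Q 0 2 0 6 \<union> Q 0 6 2 4 \<union> Q 0 4 0 4" for z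
    using that unfolding Q_def inner1_def R_def diagram_defs Un_iff Int_iff mem_Collect_eq by (smt (verit))
  ultimately show ?thesis by blast
qed

lemma V1_H1: "closed V1" "closed H1" "V1 \<noteq> {}" "H1 \<noteq> {}" "V1 \<inter> H1 \<subseteq> C1" "C1 \<subseteq> V1 \<inter> H1"
proof -
  have "Complex 0 0 \<in> V1" "Complex 0 0 \<in> H1" by (auto simp: diagram_defs)
  then show "V1 \<noteq> {}" "H1 \<noteq> {}" by blast+
  show "V1 \<inter> H1 \<subseteq> C1" by (auto simp: diagram_defs complex_eq_iff)
qed (use closed_VH corners_subset in auto)

lemma height_map_sign: "snd y > 1 \<Longrightarrow> height_map y > 0" "snd y < 0 \<Longrightarrow> height_map y < 0"
proof -
  assume "snd y > 1"
  then have "infdist (fst y) H1 * (snd y - 1) \<ge> 0" "infdist (fst y) V1 * snd y \<ge> 0"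
    by (auto intro!: mult_nonneg_nonneg infdist_nonneg)
  then show "height_map y > 0" using \<open>snd y > 1\<close> unfolding height_map_def by simp
next
  assume "snd y < 0"
  then have "infdist (fst y) H1 * (snd y - 1) \<le> 0" "infdist (fst y) V1 * snd y \<le> 0"
    by (auto intro!: mult_nonneg_nonpos infdist_nonneg)
  then show "height_map y < 0" using \<open>snd y < 0\<close> unfolding height_map_def by simp
qed

lemma Im_linking_sign: "Im (linking_map y) > 0 \<longleftrightarrow> height_map y > 0" "Im (linking_map y) < 0 \<longleftrightarrow> height_map y < 0"
  "Im (linking_map y) = 0 \<longleftrightarrow> height_map y = 0"
  unfolding Im_linking by (auto simp: max_def min_def)

lemma inner1_infdist: "z \<in> inner1 \<Longrightarrow> infdist z (- inner1) > 0" "z \<in> inner1 \<Longrightarrow> infdist z inner1 = 0"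
  "z \<notin> inner1 \<Longrightarrow> infdist z (- inner1) = 0" "z \<notin> closure inner1 \<Longrightarrow> infdist z inner1 > 0"
proof -
  show "z \<in> inner1 \<Longrightarrow> infdist z (- inner1) > 0"
    using open_inner1 inner1_ne by (intro infdist_pos_not_in_closed) auto
  show "z \<notin> closure inner1 \<Longrightarrow> infdist z inner1 > 0"
    using inner1_ne(1) in_closure_iff_infdist_zero infdist_nonneg by (metis less_eq_real_def)
qed auto

lemma Re_linking_inner: "z \<in> inner1 \<Longrightarrow> 0 \<le> t \<Longrightarrow> t \<le> 1 \<Longrightarrow> Re (linking_map (z, t)) > 0"
  using inner1_infdist(1,2)[of z] by (simp add: Re_linking)

lemma Re_linking_outer: "z \<notin> inner1 \<Longrightarrow> Re (linking_map (z, t)) \<le> 0" "z \<notin> closure inner1 \<Longrightarrow> Re (linking_map (z, t)) < 0"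
proof -
  show "z \<notin> inner1 \<Longrightarrow> Re (linking_map (z, t)) \<le> 0"
    using inner1_infdist(3)[of z] infdist_nonneg[of z inner1] unfolding Re_linking fst_conv by linarith
  assume z: "z \<notin> closure inner1"
  then have "z \<notin> inner1" using closure_subset by blast
  then show "Re (linking_map (z, t)) < 0"
    using inner1_infdist(3)[of z] inner1_infdist(4)[OF z] unfolding Re_linking fst_conv by linarith
qed

text \<open>A vanishing imaginary part forces a height in [0, 1]; a vanishing real part then puts
  the projection on the boundary of \<open>inner1\<close>, and there \<open>height_map\<close>
  vanishes only on the component.\<close>

lemma linking_map_nonzero:
  assumes "y \<notin> link_component1"
  shows "linking_map y \<noteq> 0"
proof
  assume 0: "linking_map y = 0"
  obtain z t where y: "y = (z, t)" by (cases y)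
  have h: "height_map (z, t) = 0" using Im_linking_sign(3)[of y] 0 by (simp add: y)
  then have t: "0 \<le> t" "t \<le> 1" using height_map_sign[of "(z, t)"] by (auto simp: not_less[symmetric])
  have R0: "Re (linking_map (z, t)) = 0" using 0 by (simp add: y)
  then have "z \<notin> inner1" "z \<in> closure inner1"
    using Re_linking_inner[of z t] Re_linking_outer(2)[of z t] t by auto
  then have VH: "z \<in> V1 \<union> H1" using closure_inner1 by blast
  have h': "infdist z H1 * (t - 1) + infdist z V1 * t = 0" using h t by (simp add: height_map_def)
  have dV: "infdist z V1 = 0 \<longleftrightarrow> z \<in> V1" and dH: "infdist z H1 = 0 \<longleftrightarrow> z \<in> H1"
    using in_closed_iff_infdist_zero V1_H1 by blast+
  have "z \<in> V1 \<and> t = 1 \<or> z \<in> H1 \<and> t = 0 \<or> z \<in> C1"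
  proof (cases "z \<in> V1")
    case True
    then have "infdist z H1 * (t - 1) = 0" using dV h' by simp
    then show ?thesis using dH True V1_H1(5) by auto
  next
    case False
    then have "z \<in> H1" using VH by blast
    then have "infdist z V1 * t = 0" using dH h' by simp
    then show ?thesis using dV False \<open>z \<in> H1\<close> by auto
  qed
  then show False using assms t unfolding y link_component1_eq by blast
qed

lemma continuous_linking_map: "continuous_on A linking_map"
  unfolding linking_map_def height_map_def by (intro continuous_intros)

text \<open>The constants are crude: \<open>inner1\<close> lies in [0, 6]^2, so its points have
  modulus at most 12 and distance at most 14 from the outside point (7, 7). A large norm makes |z|
  or |t| exceed b + 26.\<close>

lemma linking_map_far: "norm y > 2 * (b + 26) \<Longrightarrow> Re (linking_map y) < - b"
proof -
  obtain z t where y: "y = (z, t)" by (cases y)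
  assume n: "norm y > 2 * (b + 26)"
  have "norm y \<le> cmod z + \<bar>t\<bar>" unfolding y norm_Pair using sqrt_sum_squares_le_sum_abs[of "cmod z" t] by simp
  then have "cmod z > b + 26 \<or> \<bar>t\<bar> > b + 26" using n by (smt (verit))
  moreover have in12: "cmod x \<le> 12" if "x \<in> inner1" for x
    using that cmod_le[of x] by (auto simp: inner1_def R_def)
  have "infdist z (- inner1) \<le> 26"
  proof (cases "z \<in> inner1")
    case True
    have "infdist z (- inner1) \<le> dist z (Complex 7 7)" by (rule infdist_le) (auto simp: inner1_def R_def)
    also have "\<dots> \<le> cmod z + cmod (Complex 7 7)" by (simp add: dist_norm norm_triangle_ineq4)
    also have "cmod (Complex 7 7) \<le> 14" using cmod_le[of "Complex 7 7"] by simp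
    finally show ?thesis using in12[OF True] by simp
  qed (simp add: inner1_infdist)
  moreover have "cmod z - 12 \<le> infdist z inner1"
    unfolding infdist_notempty[OF inner1_ne(1)]
  proof (rule cINF_greatest[OF inner1_ne(1)])
    fix x assume "x \<in> inner1"
    then show "cmod z - 12 \<le> dist z x" using in12 norm_triangle_ineq2[of z x] by (force simp: dist_norm)
  qed
  moreover have "infdist z (- inner1) \<le> 14"
  proof (cases "z \<in> inner1")
    case True
    have "infdist z (- inner1) \<le> dist z (Complex 7 7)" by (rule infdist_le) (auto simp: inner1_def R_def)
    also have "\<dots> \<le> \<bar>Re z - 7\<bar> + \<bar>Im z - 7\<bar>" using cmod_le[of "z - Complex 7 7"] by (simp add: dist_norm)
    also have "\<dots> \<le> 14" using True by (auto simp: inner1_def R_def)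
    finally show ?thesis .
  qed (simp add: inner1_infdist)
  moreover have "\<bar>t - max 0 (min 1 t)\<bar> \<ge> \<bar>t\<bar> - 1" by (auto simp: max_def min_def)
  ultimately show "Re (linking_map y) < - b"
    using infdist_nonneg[of z inner1] unfolding y Re_linking fst_conv snd_conv by linarith
qed

lemma sgn_near_minus_one:
  assumes "Re w < - b" "b > 0" "\<bar>Im w\<bar> \<le> 1"
  shows "dist (sgn w) (- 1) \<le> 2 / b"
proof -
  have b: "cmod w > b" using abs_Re_le_cmod[of w] assms by linarith
  then have w: "w \<noteq> 0" using assms(2) by auto
  have "sgn w - (- 1) = (w + of_real (cmod w)) / of_real (cmod w)"
    using w by (simp add: sgn_div_norm scaleR_conv_of_real field_simps)
  then have "dist (sgn w) (- 1) = cmod (w + of_real (cmod w)) / cmod w"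
    by (simp add: dist_norm norm_divide)
  also have "\<dots> \<le> 2 / cmod w"
  proof (rule divide_right_mono)
    have "cmod (w + of_real (cmod w)) \<le> \<bar>Re w + cmod w\<bar> + \<bar>Im w\<bar>"
      using cmod_le[of "w + of_real (cmod w)"] by simp
    moreover have "\<bar>Re w + cmod w\<bar> \<le> \<bar>Im w\<bar>"
      using cmod_le[of w] complex_Re_le_cmod[of "- w"] assms by simp
    ultimately show "cmod (w + of_real (cmod w)) \<le> 2" using assms(3) by linarith
  qed simp
  also have "\<dots> \<le> 2 / b" using b assms(2) by (intro divide_left_mono mult_pos_pos) auto
  finally show ?thesis .
qed

text \<open>The value -1 at infinity makes it continuous: the real part of
  \<open>linking_map\<close> tends to minus infinity there, while its imaginary part is truncated to
  [-1, 1].\<close>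

definition linking_circle :: "point option \<Rightarrow> complex" where
  "linking_circle x = (case x of None \<Rightarrow> - 1 | Some y \<Rightarrow> sgn (linking_map y))"

lemma linking_circle_unit: "x \<in> - Some ` link_component1 \<Longrightarrow> cmod (linking_circle x) = 1"
  using linking_map_nonzero by (auto simp: linking_circle_def norm_sgn split: option.split)

lemma continuous_linking_circle:
  "continuous_map (subtopology S3 (- Some ` link_component1)) euclidean linking_circle"
  unfolding continuous_map_def
proof (intro conjI allI impI)
  let ?K = "link_component1"
  have cK: "closed ?K" using compact_link(1) compact_imp_closed by blast
  fix U :: "complex set" assume "openin euclidean U"
  then have U: "open U" by simp
  define V where "V = {y \<in> - ?K. sgn (linking_map y) \<in> U}"
  have "continuous_on (- ?K) (\<lambda>y. sgn (linking_map y))"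
    using linking_map_nonzero by (intro continuous_on_sgn continuous_linking_map) blast
  then have oV: "open V"
    using continuous_open_preimage[OF _ open_Compl[OF cK] U] by (auto simp: V_def vimage_def Int_def)
  have "openin S3 {x \<in> - Some ` ?K. linking_circle x \<in> U}"
  proof (cases "- 1 \<in> U")
    case False
    have "{x \<in> - Some ` ?K. linking_circle x \<in> U} = Some ` V"
      using False by (auto simp: linking_circle_def V_def split: option.splits)
    then show ?thesis using openin_S3_Some[OF oV] by simp
  next
    case True
    then obtain \<eta> where \<eta>: "\<eta> > 0" "ball (- 1) \<eta> \<subseteq> U" using U open_contains_ball by metis
    have "- V \<subseteq> ?K \<union> cball 0 (2 * (4 / \<eta> + 26))"
    proof (intro subsetI, rule ccontr)
      fix y assume y: "y \<in> - V" "y \<notin> ?K \<union> cball 0 (2 * (4 / \<eta> + 26))"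
      then have "norm y > 2 * (4 / \<eta> + 26)" by simp
      then have "Re (linking_map y) < - (4 / \<eta>)" by (rule linking_map_far)
      then have "dist (sgn (linking_map y)) (- 1) \<le> 2 / (4 / \<eta>)"
        using \<eta>(1) by (intro sgn_near_minus_one) (auto simp: Im_linking)
      also have "\<dots> < \<eta>" using \<eta>(1) by simp
      finally have "sgn (linking_map y) \<in> U" using \<eta>(2) by (metis dist_commute mem_ball subsetD)
      then show False using y by (simp add: V_def)
    qed
    then have "bounded (- V)" using bounded_subset compact_imp_bounded[OF compact_link(1)] bounded_cball by (metis bounded_Un)
    then have "compact (- V)" using oV by (simp add: compact_eq_bounded_closed closed_Compl)
    moreover have "{x \<in> - Some ` ?K. linking_circle x \<in> U} = - Some ` (- V)"
    proof (rule Set.set_eqI)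
      fix x show "x \<in> {x \<in> - Some ` ?K. linking_circle x \<in> U} \<longleftrightarrow> x \<in> - Some ` (- V)"
        using True by (cases x) (auto simp: linking_circle_def V_def)
    qed
    ultimately show ?thesis using openin_S3_compl by simp
  qed
  moreover have "{x \<in> topspace (subtopology S3 (- Some ` ?K)). linking_circle x \<in> U} = {x \<in> - Some ` ?K. linking_circle x \<in> U}"
    by auto
  ultimately show "openin (subtopology S3 (- Some ` ?K)) {x \<in> topspace (subtopology S3 (- Some ` ?K)). linking_circle x \<in> U}"
    using openin_open_subtopology[OF openin_S3_compl[OF compact_link(1)]] by auto
qed auto

lemma Arg_uminus_upper: "Im w > 0 \<Longrightarrow> Arg (- w) = Arg w - pi"
proof -
  assume w: "Im w > 0"
  then have "0 < Arg w" "Arg w < pi" "w \<noteq> 0" using Arg_lt_pi by auto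
  then show "Arg (- w) = Arg w - pi"
    by (intro cis_Arg_unique) (auto simp: cis_Arg sgn_minus simp flip: cis_divide)
qed

text \<open>The winding angle in full turns. Outside \<open>inner1\<close> the real part is at most
  0, where \<open>Arg\<close> has its cut, so the argument of the negative is used. Adding pi fits
  the principal branch above the diagram, where the imaginary part is positive over the boundary of
  \<open>inner1\<close>; subtracting pi in \<open>lower_angle\<close> fits it below.\<close>

definition upper_angle :: "point \<Rightarrow> real" where
  "upper_angle y = (if fst y \<in> inner1 then Arg (linking_map y) else Arg (- linking_map y) + pi) / (2 * pi)"

definition lower_angle :: "point \<Rightarrow> real" where
  "lower_angle y = (if fst y \<in> inner1 then Arg (linking_map y) else Arg (- linking_map y) - pi) / (2 * pi)"

lemma angle_difference: "upper_angle (z, t) = lower_angle (z, t) + (if z \<in> inner1 then 0 else 1)"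
  by (simp add: upper_angle_def lower_angle_def field_simps)

lemma cis_angle: "y \<notin> link_component1 \<Longrightarrow> sgn (linking_map y) = cis (2 * pi * upper_angle y)"
  "y \<notin> link_component1 \<Longrightarrow> sgn (linking_map y) = cis (2 * pi * lower_angle y)"
  using linking_map_nonzero[of y]
  by (auto simp: upper_angle_def lower_angle_def cis_Arg sgn_minus simp flip: cis_mult cis_divide)

text \<open>Each of the two open sets carries one continuous formula: on A the principal argument,
  by the sign condition outside \<open>inner1\<close>, and on the exterior the shifted argument of
  the negative, whose real part is positive there.\<close>

lemma continuous_angle:
  assumes \<sigma>: "\<sigma> = pi \<or> \<sigma> = - pi"
    and A: "open A" "\<And>y. y \<in> A \<Longrightarrow> fst y \<in> inner1 \<or> Im (linking_map y) \<noteq> 0"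
      "\<And>y. y \<in> A \<Longrightarrow> fst y \<notin> inner1 \<Longrightarrow> Im (linking_map y) * \<sigma> > 0"
  shows "continuous_on (A \<union> (- closure inner1) \<times> UNIV)
    (\<lambda>y. (if fst y \<in> inner1 then Arg (linking_map y) else Arg (- linking_map y) + \<sigma>) / (2 * pi))" (is "continuous_on _ ?h")
proof (rule continuous_on_open_Un)
  have Arg: "continuous_on S (\<lambda>y. Arg (l y))" if "\<And>y. y \<in> S \<Longrightarrow> l y \<notin> \<real>\<^sub>\<le>\<^sub>0" "continuous_on S l"
    for S and l :: "point \<Rightarrow> complex"
    by (rule continuous_on_compose2[OF continuous_at_imp_continuous_on[of "- \<real>\<^sub>\<le>\<^sub>0" Arg] that(2)])
       (use that(1) continuous_at_Arg in auto)
  have 1: "?h y = Arg (linking_map y) / (2 * pi)" if y: "y \<in> A" for y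
  proof (cases "fst y \<in> inner1")
    case False
    have "Arg (- linking_map y) + \<sigma> = Arg (linking_map y)"
      using \<sigma>
    proof
      assume s: "\<sigma> = pi"
      then have "Im (linking_map y) > 0" using A(3)[OF y False] by (simp add: zero_less_mult_iff)
      then show ?thesis using Arg_uminus_upper s by simp
    next
      assume s: "\<sigma> = - pi"
      then have "Im (- linking_map y) > 0" using A(3)[OF y False] by (simp add: mult_less_0_iff)
      then show ?thesis using Arg_uminus_upper[of "- linking_map y"] s by simp
    qed
    then show ?thesis using False by simp
  qed simp
  have "linking_map y \<notin> \<real>\<^sub>\<le>\<^sub>0" if y: "y \<in> A" for y
  proof
    assume n: "linking_map y \<in> \<real>\<^sub>\<le>\<^sub>0"
    then have i: "Im (linking_map y) = 0" "Re (linking_map y) \<le> 0" by (auto simp: complex_nonpos_Reals_iff)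
    then have "fst y \<in> inner1" using A(2)[OF y] by blast
    moreover have "height_map y = 0" using i Im_linking_sign(3) by blast
    then have "0 \<le> snd y" "snd y \<le> 1" using height_map_sign[of y] by (auto simp: not_less[symmetric])
    ultimately show False using Re_linking_inner[of "fst y" "snd y"] i by simp
  qed
  then have "continuous_on A (\<lambda>y. Arg (linking_map y) / (2 * pi))"
    by (intro continuous_intros Arg continuous_linking_map) auto
  then show "continuous_on A ?h" by (subst continuous_on_cong[OF refl 1])
  have "- linking_map y \<notin> \<real>\<^sub>\<le>\<^sub>0" if y: "y \<in> (- closure inner1) \<times> UNIV" for y
    using Re_linking_outer(2)[of "fst y" "snd y"] y by (auto simp: complex_nonpos_Reals_iff)
  then have "continuous_on ((- closure inner1) \<times> UNIV) (\<lambda>y. (Arg (- linking_map y) + \<sigma>) / (2 * pi))"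
    by (intro continuous_intros Arg continuous_linking_map) auto
  moreover have "?h y = (Arg (- linking_map y) + \<sigma>) / (2 * pi)" if "y \<in> (- closure inner1) \<times> UNIV" for y
    using that closure_subset[of inner1] by auto
  ultimately show "continuous_on ((- closure inner1) \<times> UNIV) ?h" by (subst continuous_on_cong[OF refl])
qed (use A(1) in \<open>auto intro!: open_Times\<close>)

lemma open_height: "open {y. height_map y > 0}" "open {y. height_map y < 0}"
  unfolding height_map_def by (intro open_Collect_less continuous_intros)+

lemma Up_Dn_height: "(z, t) \<in> Up \<Longrightarrow> z \<in> V1 \<union> H1 \<Longrightarrow> height_map (z, t) > 0"
  "(z, t) \<in> Dn \<Longrightarrow> z \<in> V1 \<union> H1 \<Longrightarrow> height_map (z, t) < 0"
proof -
  have dV: "infdist z V1 > 0" if "z \<notin> V1" using that V1_H1 infdist_pos_not_in_closed by blast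
  have dH: "infdist z H1 > 0" if "z \<notin> H1" using that V1_H1 infdist_pos_not_in_closed by blast
  assume VH: "z \<in> V1 \<union> H1"
  show "height_map (z, t) > 0" if "(z, t) \<in> Up"
  proof (cases "t > 1")
    case False
    then have "z \<notin> V1" using that by (auto simp: Up_def Vl_def)
    then have "z \<in> H1" "t > 0" using VH that by (auto simp: Up_def Hl_def)
    then show ?thesis using dV[OF \<open>z \<notin> V1\<close>] False by (simp add: height_map_def)
  qed (simp add: height_map_sign)
  show "height_map (z, t) < 0" if "(z, t) \<in> Dn"
  proof (cases "t < 0")
    case False
    then have nH: "z \<notin> H1" using that by (auto simp: Dn_def Hl_def)
    then have "z \<in> V1" "t < 1" using VH that by (auto simp: Dn_def Vl_def)
    then show ?thesis using dH[OF nH] False by (simp add: height_map_def mult_less_0_iff)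
  qed (simp add: height_map_sign)
qed

lemma continuous_upper_angle: "continuous_on Up upper_angle"
proof -
  let ?A = "{y. height_map y > 0} \<union> inner1 \<times> UNIV"
  have "continuous_on (?A \<union> (- closure inner1) \<times> UNIV) upper_angle"
    unfolding upper_angle_def
    by (rule continuous_angle) (use Im_linking_sign open_height open_inner1 in \<open>auto intro!: open_Times\<close>)
  moreover have "Up \<subseteq> ?A \<union> (- closure inner1) \<times> UNIV"
  proof
    fix y assume y: "y \<in> Up"
    obtain z t where zt: "y = (z, t)" by (cases y)
    have "z \<in> V1 \<union> H1" if "z \<notin> inner1" "z \<in> closure inner1" using that closure_inner1 by blast
    then show "y \<in> ?A \<union> (- closure inner1) \<times> UNIV" using Up_Dn_height(1)[of z t] y unfolding zt by blast
  qed
  ultimately show ?thesis using continuous_on_subset by blast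
qed

lemma continuous_lower_angle: "continuous_on Dn lower_angle"
proof -
  let ?A = "{y. height_map y < 0} \<union> inner1 \<times> UNIV"
  have "continuous_on (?A \<union> (- closure inner1) \<times> UNIV)
      (\<lambda>y. (if fst y \<in> inner1 then Arg (linking_map y) else Arg (- linking_map y) + (- pi)) / (2 * pi))"
    by (rule continuous_angle) (use Im_linking_sign open_height open_inner1 in \<open>auto intro!: open_Times simp: mult_less_0_iff\<close>)
  moreover have "lower_angle = (\<lambda>y. (if fst y \<in> inner1 then Arg (linking_map y) else Arg (- linking_map y) + (- pi)) / (2 * pi))"
    by (simp add: lower_angle_def fun_eq_iff)
  ultimately have "continuous_on (?A \<union> (- closure inner1) \<times> UNIV) lower_angle" by (simp only:)
  moreover have "Dn \<subseteq> ?A \<union> (- closure inner1) \<times> UNIV"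
  proof
    fix y assume y: "y \<in> Dn"
    obtain z t where zt: "y = (z, t)" by (cases y)
    have "z \<in> V1 \<union> H1" if "z \<notin> inner1" "z \<in> closure inner1" using that closure_inner1 by blast
    then show "y \<in> ?A \<union> (- closure inner1) \<times> UNIV" using Up_Dn_height(2)[of z t] y unfolding zt by blast
  qed
  ultimately show ?thesis using continuous_on_subset by blast
qed

section \<open>Holonomy of the filled cusp and the relation imposed by the slope\<close>

section \<open>The filled end\<close>

text \<open>Points w of the unit circle within distance 1 of u satisfy Re (w/u) > 0, so the
  principal logarithm of w/u follows the path and returns to its initial value.\<close>

lemma arc_no_turn:
  fixes \<theta> :: "real \<Rightarrow> real"
  assumes \<theta>: "continuous_on {0..1} \<theta>" and u: "cmod u = 1" "\<And>t. t \<in> {0..1} \<Longrightarrow> cis (\<theta> t) \<in> ball u 1"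
    and ends: "cis (\<theta> 1) = cis (\<theta> 0)"
  shows "\<theta> 1 = \<theta> 0"
proof -
  have pos: "cis (\<theta> t) / u \<notin> \<real>\<^sub>\<le>\<^sub>0" "cis (\<theta> t) / u \<noteq> 0" if "t \<in> {0..1}" for t
  proof -
    have u0: "u \<noteq> 0" using u(1) by auto
    have "1 - cis (\<theta> t) / u = (u - cis (\<theta> t)) / u" using u0 by (simp add: diff_divide_distrib)
    then have "cmod (1 - cis (\<theta> t) / u) < 1" using u(2)[OF that] u(1) by (simp add: norm_divide dist_norm)
    then have "Re (cis (\<theta> t) / u) > 0" using complex_Re_le_cmod[of "1 - cis (\<theta> t) / u"] by simp
    then show "cis (\<theta> t) / u \<notin> \<real>\<^sub>\<le>\<^sub>0" "cis (\<theta> t) / u \<noteq> 0" by (auto simp: complex_nonpos_Reals_iff)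
  qed
  have u0: "u \<noteq> 0" using u(1) by auto
  have "\<i> * of_real (\<theta> 1) - \<i> * of_real (\<theta> 0) = (Ln (cis (\<theta> 1) / u) + Ln u) - (Ln (cis (\<theta> 0) / u) + Ln u)"
  proof (rule exp_lifts_differ)
    show "continuous_on {0..1} (\<lambda>t. \<i> * complex_of_real (\<theta> t))" by (intro continuous_intros \<theta>)
    have "continuous_on {0..1} (\<lambda>t. cis (\<theta> t) / u)" using u0 by (intro continuous_intros \<theta>) auto
    then show "continuous_on {0..1} (\<lambda>t. Ln (cis (\<theta> t) / u) + Ln u)"
      by (intro continuous_on_add continuous_on_Ln' continuous_on_const pos(1))
    show "exp (\<i> * of_real (\<theta> t)) = exp (Ln (cis (\<theta> t) / u) + Ln u)" if "t \<in> {0..1}" for t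
      using pos(2)[OF that] u0 by (simp add: exp_add cis_conv_exp)
  qed
  then have "\<i> * of_real (\<theta> 1) = \<i> * complex_of_real (\<theta> 0)" by (simp add: ends)
  then show ?thesis by simp
qed

context dehn_orbifold
begin

text \<open>The tube around K may contain the point at infinity. It is the image of a single (u, w),
  and w \<noteq> 0 since K is finite, so a smaller radius avoids it.\<close>

lemma radius_exists: "\<exists>\<rho>>0. \<forall>u\<in>circle. \<forall>w. cmod w < \<rho> \<longrightarrow> e (u, w) \<noteq> None"
proof (cases "\<exists>u\<in>circle. \<exists>w. e (u, w) = None")
  case True
  then obtain u w where uw: "u \<in> circle" "e (u, w) = None" by blast
  have w0: "w \<noteq> 0"
  proof
    assume "w = 0"
    then have "e (u, w) \<in> e ` (circle \<times> {0})" using uw by blast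
    then show False using uw(2) unfolding e_facts(3) by auto
  qed
  have "e (u', w') \<noteq> None" if "u' \<in> circle" "cmod w' < cmod w" for u' w'
  proof
    assume "e (u', w') = None"
    then have "(u', w') = (u, w)" using inj_onD[OF e_inj, of "(u', w')" "(u, w)"] uw that by simp
    then show False using that(2) by simp
  qed
  then show ?thesis using w0 by (intro exI[of _ "cmod w"]) auto
qed (auto intro!: exI[of _ 1])

definition \<rho>0 :: real where "\<rho>0 = (SOME \<rho>. \<rho> > 0 \<and> (\<forall>u\<in>circle. \<forall>w. cmod w < \<rho> \<longrightarrow> e (u, w) \<noteq> None))"

lemma \<rho>0: "\<rho>0 > 0" "u \<in> circle \<Longrightarrow> cmod w < \<rho>0 \<Longrightarrow> e (u, w) \<noteq> None"
  using someI_ex[OF radius_exists] unfolding \<rho>0_def by blast+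

text \<open>Universal covering of the punctured tube: the angle along K and the logarithm of the
  normal coordinate. \<open>dom_end\<close> is the half-space over radius less than \<rho>0, convex
  and hence simply connected, and \<open>shift m n\<close> is the deck transformation for m
  longitudes and n meridians.\<close>

definition chart :: "real \<times> complex \<Rightarrow> complex \<times> complex" where "chart d = (cis (fst d), exp (snd d))"

definition dom_end :: "(real \<times> complex) set" where "dom_end = {d. Re (snd d) < ln \<rho>0}"

definition to_end :: "real \<times> complex \<Rightarrow> point" where "to_end d = the (e (chart d))"

definition shift :: "int \<Rightarrow> int \<Rightarrow> real \<times> complex \<Rightarrow> real \<times> complex" where
  "shift m n d = (fst d + 2 * pi * of_int m, snd d + of_real (of_int (2 * n) * pi) * \<i>)"

lemma chart_in: "chart d \<in> circle \<times> UNIV" "snd (chart d) \<noteq> 0" "fst (chart d) \<in> circle"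
  by (auto simp: chart_def)

lemma e_chart_XL: "e (chart d) \<in> XL"
  using e_in_XL[of "fst (chart d)" "snd (chart d)"] chart_in[of d] by simp

lemma dom_end_small: "d \<in> dom_end \<Longrightarrow> cmod (snd (chart d)) < \<rho>0"
proof -
  assume "d \<in> dom_end"
  then have "exp (Re (snd d)) < exp (ln \<rho>0)" by (simp add: dom_end_def)
  then show "cmod (snd (chart d)) < \<rho>0" using \<rho>0(1) by (simp add: chart_def)
qed

lemma Some_to_end: "d \<in> dom_end \<Longrightarrow> Some (to_end d) = e (chart d)"
  using \<rho>0(2)[OF chart_in(3) dom_end_small, of d d] by (simp add: to_end_def)

lemma to_end_notin: "d \<in> dom_end \<Longrightarrow> to_end d \<notin> L"
  using Some_to_end e_chart_XL Some_in_XL by metis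

lemma chart_shift [simp]: "chart (shift m n d) = chart d"
proof -
  have "exp (snd d + of_real (of_int (2 * n) * pi) * \<i>) = exp (snd d)" unfolding exp_eq by blast
  moreover have "cis (fst d + 2 * pi * of_int m) = cis (fst d)" by (simp flip: cis_mult)
  ultimately show ?thesis by (simp add: chart_def shift_def)
qed

lemma shift_dom_end [simp]: "shift m n d \<in> dom_end \<longleftrightarrow> d \<in> dom_end"
  by (simp add: dom_end_def shift_def)

lemma to_end_shift [simp]: "to_end (shift m n d) = to_end d"
  by (simp add: to_end_def)

lemma shift_add: "shift m n (shift m' n' d) = shift (m + m') (n + n') d"
  by (simp add: shift_def algebra_simps)

lemma chart_eq: "chart d = chart d' \<Longrightarrow> \<exists>m n. d = shift m n d'"
proof -
  assume c: "chart d = chart d'"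
  then obtain n :: int where n: "snd d = snd d' + of_real (of_int (2 * n) * pi) * \<i>"
    unfolding chart_def prod.inject exp_eq by blast
  have "exp (\<i> * of_real (fst d)) = exp (\<i> * of_real (fst d'))" using c by (simp add: chart_def cis_conv_exp)
  then obtain m :: int where "\<i> * of_real (fst d) = \<i> * of_real (fst d') + of_real (of_int (2 * m) * pi) * \<i>"
    unfolding exp_eq by blast
  then have "Im (\<i> * of_real (fst d)) = Im (\<i> * of_real (fst d') + of_real (of_int (2 * m) * pi) * \<i>)" by simp
  then have "fst d = fst d' + 2 * pi * of_int m" by simp
  then show "\<exists>m n. d = shift m n d'" using n by (intro exI[of _ m] exI[of _ n]) (simp add: shift_def prod_eq_iff)
qed

lemma to_end_eq: "d \<in> dom_end \<Longrightarrow> d' \<in> dom_end \<Longrightarrow> to_end d = to_end d' \<Longrightarrow> \<exists>m n. d = shift m n d'"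
proof -
  assume d: "d \<in> dom_end" "d' \<in> dom_end" "to_end d = to_end d'"
  then have "e (chart d) = e (chart d')" using Some_to_end by metis
  then have "chart d = chart d'" using inj_onD[OF e_inj _ chart_in(1) chart_in(1)] by blast
  then show "\<exists>m n. d = shift m n d'" by (rule chart_eq)
qed

lemma convex_dom_end: "convex dom_end" and open_dom_end: "open dom_end" and dom_end_ne: "dom_end \<noteq> {}"
proof -
  have "dom_end = UNIV \<times> {z. Re z < ln \<rho>0}" by (auto simp: dom_end_def)
  then show "convex dom_end" "open dom_end"
    by (auto intro!: convex_Times convex_halfspace_Re_lt open_Times open_Collect_less continuous_intros)
  have "(0, of_real (ln \<rho>0 - 1)) \<in> dom_end" by (simp add: dom_end_def)
  then show "dom_end \<noteq> {}" by blast
qed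

lemma continuous_chart: "continuous_on A chart"
  unfolding chart_def by (intro continuous_intros)

lemma e_vimage_open:
  assumes "openin S3 U"
  shows "\<exists>T. open T \<and> (\<forall>x\<in>circle \<times> UNIV. e x \<in> U \<longleftrightarrow> x \<in> T)"
proof -
  have "openin (top_of_set (circle \<times> UNIV)) {x \<in> circle \<times> UNIV. e x \<in> U}"
    using open_embedding(2)[OF e_facts(1), of U] e_facts(2) assms by simp
  then obtain T where "open T" "{x \<in> circle \<times> UNIV. e x \<in> U} = (circle \<times> UNIV) \<inter> T"
    by (auto simp: openin_open)
  then show ?thesis by (intro exI[of _ T]) blast
qed

lemma continuous_to_end: "continuous_on dom_end to_end"
  unfolding continuous_on_open_vimage[OF open_dom_end]
proof (intro allI impI)
  fix U :: "point set" assume "open U"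
  then obtain T where T: "open T" "\<And>x. x \<in> circle \<times> UNIV \<Longrightarrow> e x \<in> Some ` U \<longleftrightarrow> x \<in> T"
    using e_vimage_open[OF openin_S3_Some] by metis
  have *: "to_end d \<in> U \<longleftrightarrow> chart d \<in> T" if "d \<in> dom_end" for d
    using T(2)[OF chart_in(1), of d] unfolding Some_to_end[OF that, symmetric] by blast
  have "to_end -` U \<inter> dom_end = chart -` T \<inter> dom_end" using * by blast
  moreover have "open (chart -` T \<inter> dom_end)"
    using continuous_chart T(1) continuous_on_open_vimage[OF open_dom_end] by blast
  ultimately show "open (to_end -` U \<inter> dom_end)" by simp
qed

lemma end_lift_exists: "\<exists>F. continuous_on dom_end F \<and> (\<forall>d\<in>dom_end. F d \<in> Hcov \<and> proj (F d) = to_end d)"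
proof -
  have "to_end \<in> dom_end \<rightarrow> - L" using to_end_notin by blast
  from covering_space_lift[OF covering_proj convex_imp_simply_connected[OF convex_dom_end]
      open_imp_locally_path_connected[OF open_dom_end] continuous_to_end this]
  obtain F where "continuous_on dom_end F" "F \<in> dom_end \<rightarrow> Hcov" "\<And>d. d \<in> dom_end \<Longrightarrow> proj (F d) = to_end d" by metis
  then show ?thesis by (intro exI[of _ F]) (simp add: Pi_iff)
qed

text \<open>A lift of the universal covering of the end to upper half-space: a developing map of the
  filled end.\<close>

definition FL :: "real \<times> complex \<Rightarrow> point" where
  "FL = (SOME F. continuous_on dom_end F \<and> (\<forall>d\<in>dom_end. F d \<in> Hcov \<and> proj (F d) = to_end d))"

lemma FL: "continuous_on dom_end FL" "d \<in> dom_end \<Longrightarrow> FL d \<in> Hcov" "d \<in> dom_end \<Longrightarrow> proj (FL d) = to_end d"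
  using someI_ex[OF end_lift_exists] unfolding FL_def by blast+

lemma holonomy_exists: "\<exists>A\<in>\<Gamma>. \<forall>d\<in>dom_end. FL (shift m n d) = act A (FL d)"
proof -
  obtain d0 where d0: "d0 \<in> dom_end" using dom_end_ne by blast
  have "proj (FL d0) = proj (FL (shift m n d0))" "FL d0 \<in> Hcov" "FL (shift m n d0) \<in> Hcov"
    using FL d0 by simp_all
  then obtain A where A: "A \<in> \<Gamma>" "FL (shift m n d0) = act A (FL d0)" using proj_eq_iff by blast
  have "continuous_on dom_end (shift m n)" unfolding shift_def by (intro continuous_intros)
  then have c: "continuous_on dom_end (\<lambda>d. FL (shift m n d))"
    by (rule continuous_on_compose2[OF FL(1)]) auto
  have "FL (shift m n d) = act A (FL d)" if "d \<in> dom_end" for d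
    by (rule lift_transition[OF c FL(1) _ _ _ convex_connected[OF convex_dom_end] d0 that A]) (use FL in auto)
  then show ?thesis using A(1) by blast
qed

text \<open>The holonomy of m longitudes and n meridians. It is determined up to sign, and
  \<open>hol_add\<close> makes it a homomorphism to PSL2.\<close>

definition hol :: "int \<Rightarrow> int \<Rightarrow> complex^2^2" where
  "hol m n = (SOME A. A \<in> \<Gamma> \<and> (\<forall>d\<in>dom_end. FL (shift m n d) = act A (FL d)))"

lemma hol: "hol m n \<in> \<Gamma>" "d \<in> dom_end \<Longrightarrow> FL (shift m n d) = act (hol m n) (FL d)"
proof -
  have "\<exists>A. A \<in> \<Gamma> \<and> (\<forall>d\<in>dom_end. FL (shift m n d) = act A (FL d))" using holonomy_exists by blast
  from someI_ex[OF this] show "hol m n \<in> \<Gamma>" "d \<in> dom_end \<Longrightarrow> FL (shift m n d) = act (hol m n) (FL d)"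
    unfolding hol_def by blast+
qed

lemma hol_peqI: "A \<in> \<Gamma> \<Longrightarrow> d \<in> dom_end \<Longrightarrow> FL (shift m n d) = act A (FL d) \<Longrightarrow> A \<doteq> hol m n"
  using Hcov_peq[OF FL(2) _ hol(1), of d A m n] hol(2)[of d m n] by simp

lemma hol_add: "hol m n ** hol m' n' \<doteq> hol (m + m') (n + n')"
proof -
  obtain d where d: "d \<in> dom_end" using dom_end_ne by blast
  have "FL (shift (m + m') (n + n') d) = act (hol m n) (act (hol m' n') (FL d))"
    using hol(2)[of "shift m' n' d" m n] hol(2)[OF d, of m' n'] d by (simp add: shift_add)
  also have "\<dots> = act (hol m n ** hol m' n') (FL d)"
    using act_mult_Hcov[OF FL(2)[OF d] hol(1) hol(1)] by simp
  finally show ?thesis by (rule hol_peqI[OF \<Gamma>(5)[OF hol(1) hol(1)] d])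
qed

lemma hol_0: "hol 0 0 \<doteq> mat 1"
proof -
  obtain d where d: "d \<in> dom_end" using dom_end_ne by blast
  have "mat 1 \<doteq> hol 0 0" by (rule hol_peqI[OF \<Gamma>(3) d]) (simp add: shift_def)
  then show ?thesis by (rule peq_sym)
qed

lemma hol_minv: "minv (hol m n) \<doteq> hol (- m) (- n)"
proof -
  have d: "det (hol m n) = 1" using \<Gamma>(4) hol(1) by blast
  have "hol (- m) (- n) ** hol m n \<doteq> mat 1"
    using peq_trans[OF hol_add[of "- m" "- n" m n]] hol_0 by simp
  then have "hol (- m) (- n) ** hol m n ** minv (hol m n) \<doteq> mat 1 ** minv (hol m n)"
    by (rule peq_mult[OF _ peq_refl])
  then show ?thesis
    using peq_sym by (simp add: matrix_mul_assoc[symmetric] minv_right d)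
qed

lemma hol_mpow: "mpow (hol m n) j \<doteq> hol (j * m) (j * n)"
proof -
  have nat: "mpow_nat A i \<doteq> hol (int i * a) (int i * b)" if "A \<doteq> hol a b" for A a b i
  proof (induction i)
    case (Suc i)
    have "mpow_nat A (Suc i) \<doteq> hol a b ** hol (int i * a) (int i * b)"
      using peq_mult[OF that Suc] by simp
    also have "\<dots> \<doteq> hol (a + int i * a) (b + int i * b)" by (rule hol_add)
    finally show ?case by (simp add: algebra_simps)
  qed (simp add: peq_sym[OF hol_0])
  show ?thesis
  proof (cases "j \<ge> 0")
    case True
    then show ?thesis using nat[OF peq_refl, of m n "nat j"] by (simp add: mpow_def)
  next
    case False
    then show ?thesis using nat[OF hol_minv, of m n "nat (- j)"] by (simp add: mpow_def)
  qed
qed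

text \<open>Both coordinates of the projected path in the tube have continuous logarithms, which
  lift the path to \<open>dom_end\<close> up to a shift. The starting point fixes the shift, and
  uniqueness of lifts identifies the path with the translate of \<open>FL\<close>.\<close>

lemma end_path:
  fixes \<gamma> :: "real \<Rightarrow> point"
  assumes \<gamma>: "continuous_on {0..1} \<gamma>" "\<And>t. t \<in> {0..1} \<Longrightarrow> \<gamma> t \<in> Hcov"
      "\<And>t. t \<in> {0..1} \<Longrightarrow> Some (proj (\<gamma> t)) \<in> e ` (circle \<times> ball 0 \<rho>0)"
    and B: "B \<in> \<Gamma>" "d \<in> dom_end" "\<gamma> 0 = act B (FL d)"
  shows "\<exists>\<delta>. continuous_on {0..1} \<delta> \<and> \<delta> 0 = d \<and>
    (\<forall>t\<in>{0..1}. \<delta> t \<in> dom_end \<and> to_end (\<delta> t) = proj (\<gamma> t) \<and> \<gamma> t = act B (FL (\<delta> t)))"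
proof -
  define c where "c t = inv_into (circle \<times> UNIV) e (Some (proj (\<gamma> t)))" for t
  have c: "c t \<in> circle \<times> ball 0 \<rho>0" "e (c t) = Some (proj (\<gamma> t))" if t: "t \<in> {0..1}" for t
  proof -
    obtain x where x: "x \<in> circle \<times> ball 0 \<rho>0" "e x = Some (proj (\<gamma> t))" using \<gamma>(3)[OF t] by (metis imageE)
    then have "x \<in> circle \<times> UNIV" by auto
    then have "c t = x" unfolding c_def x(2)[symmetric] by (rule inv_into_f_f[OF e_inj])
    then show "c t \<in> circle \<times> ball 0 \<rho>0" "e (c t) = Some (proj (\<gamma> t))" using x by auto
  qed
  have cont_p: "continuous_on {0..1} (\<lambda>t. proj (\<gamma> t))"
    by (rule continuous_on_compose2[OF continuous_on_proj \<gamma>(1)]) (use \<gamma>(2) in auto)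
  have cont: "continuous_on {0..1} c"
  proof (subst continuous_openin_preimage_eq, intro allI impI)
    fix U :: "(complex \<times> complex) set" assume U: "open U"
    have "openin (top_of_set (circle \<times> UNIV)) ((circle \<times> UNIV) \<inter> U)" using U by (rule openin_open_Int)
    then have "openin S3 (e ` ((circle \<times> UNIV) \<inter> U))"
      using open_embedding(1)[OF e_facts(1)] e_facts(2) by simp
    then have V: "open {y. Some y \<in> e ` ((circle \<times> UNIV) \<inter> U)}" (is "open ?V") by (rule open_vimage_Some)
    have "c t \<in> U \<longleftrightarrow> proj (\<gamma> t) \<in> ?V" if t: "t \<in> {0..1}" for t
    proof
      assume "c t \<in> U"
      then have "c t \<in> (circle \<times> UNIV) \<inter> U" using c(1)[OF t] by auto
      then have "e (c t) \<in> e ` ((circle \<times> UNIV) \<inter> U)" by (rule imageI)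
      then show "proj (\<gamma> t) \<in> ?V" using c(2)[OF t] by simp
    next
      assume "proj (\<gamma> t) \<in> ?V"
      then obtain x where x: "x \<in> circle \<times> UNIV" "x \<in> U" "e x = e (c t)" using c(2)[OF t] by auto
      moreover have "c t \<in> circle \<times> UNIV" using c(1)[OF t] by auto
      ultimately have "x = c t" using inj_onD[OF e_inj x(3) x(1)] by simp
      then show "c t \<in> U" using x(2) by simp
    qed
    then have "{0..1} \<inter> c -` U = {0..1} \<inter> (\<lambda>t. proj (\<gamma> t)) -` ?V" by blast
    then show "openin (top_of_set {0..1}) ({0..1} \<inter> c -` U)"
      using continuous_openin_preimage_eq[of "{0..1}" "\<lambda>t. proj (\<gamma> t)"] cont_p V by metis
  qed
  have nz: "fst (c t) \<noteq> 0" "snd (c t) \<noteq> 0" if t: "t \<in> {0..1}" for t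
  proof -
    show "fst (c t) \<noteq> 0" using c(1)[OF t] by (cases "c t") auto
    show "snd (c t) \<noteq> 0"
    proof
      assume "snd (c t) = 0"
      then have "c t \<in> circle \<times> {0}" using c(1)[OF t] by (cases "c t") auto
      then have "e (c t) \<in> Some ` K" unfolding e_facts(3)[symmetric] by (rule imageI)
      then show False using c(2)[OF t] proj(1)[OF \<gamma>(2)[OF t]] by (auto simp: L_def)
    qed
  qed
  have ctr: "contractible {0..1::real}" by (simp add: convex_imp_contractible)
  obtain l1 where l1: "continuous_on {0..1} l1" "\<And>t. t \<in> {0..1} \<Longrightarrow> fst (c t) = exp (l1 t)"
    using continuous_logarithm_on_contractible[OF continuous_on_fst[OF cont] ctr] nz(1) by metis
  obtain l2 where l2: "continuous_on {0..1} l2" "\<And>t. t \<in> {0..1} \<Longrightarrow> snd (c t) = exp (l2 t)"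
    using continuous_logarithm_on_contractible[OF continuous_on_snd[OF cont] ctr] nz(2) by metis
  define \<delta>' where "\<delta>' t = (Im (l1 t), l2 t)" for t
  have \<delta>': "chart (\<delta>' t) = c t" "\<delta>' t \<in> dom_end" "to_end (\<delta>' t) = proj (\<gamma> t)" if t: "t \<in> {0..1}" for t
  proof -
    have m: "cmod (fst (c t)) = 1" "cmod (snd (c t)) < \<rho>0" using c(1)[OF t] by (cases "c t", auto)+
    then have "exp (Re (l1 t)) = 1" using l1(2)[OF t] by simp
    then have "fst (c t) = cis (Im (l1 t))" using l1(2)[OF t] by (simp add: exp_eq_polar)
    then show 1: "chart (\<delta>' t) = c t" using l2(2)[OF t] by (simp add: chart_def \<delta>'_def prod_eq_iff)
    have "exp (Re (l2 t)) < \<rho>0" using m(2) l2(2)[OF t] by simp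
    then have "ln (exp (Re (l2 t))) < ln \<rho>0" by (subst ln_less_cancel_iff) (use \<rho>0(1) in auto)
    then show 2: "\<delta>' t \<in> dom_end" by (simp add: dom_end_def \<delta>'_def)
    show "to_end (\<delta>' t) = proj (\<gamma> t)" using Some_to_end[OF 2] 1 c(2)[OF t] by simp
  qed
  have "to_end d = to_end (\<delta>' 0)"
    using \<delta>'(3)[of 0] FL(2,3)[OF B(2)] proj_act[OF B(1)] B(3) by simp
  then obtain m n where mn: "d = shift m n (\<delta>' 0)" using to_end_eq[OF B(2) \<delta>'(2)[of 0]] by auto
  define \<delta> where "\<delta> t = shift m n (\<delta>' t)" for t
  have \<delta>: "\<delta> t \<in> dom_end" "to_end (\<delta> t) = proj (\<gamma> t)" if "t \<in> {0..1}" for t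
    using \<delta>'[OF that] by (simp_all add: \<delta>_def)
  have c\<delta>: "continuous_on {0..1} \<delta>"
    unfolding \<delta>_def \<delta>'_def shift_def by (intro continuous_intros l1 l2)
  have cF: "continuous_on {0..1} (\<lambda>t. FL (\<delta> t))"
    by (rule continuous_on_compose2[OF FL(1) c\<delta>]) (use \<delta>(1) in auto)
  have "\<gamma> t = act B (FL (\<delta> t))" if "t \<in> {0..1}" for t
    by (rule lift_transition[OF \<gamma>(1) cF, of 0 t B]) (use that \<gamma>(2) FL \<delta> B mn in \<open>auto simp: \<delta>_def\<close>)
  then show ?thesis using c\<delta> \<delta> mn by (intro exI[of _ \<delta>]) (simp add: \<delta>_def)
qed

text \<open>A small loop around the core, which represents the slope, lifts into the translates of a
  neighbourhood with finite stabilizer.\<close>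

lemma core_power: "\<exists>n>0. hol (int n * q) (int n * p) \<doteq> mat 1"
proof -
  have "g (0, 1) \<in> topspace M" using filling(3) by force
  then obtain x where x: "x \<in> H3" "P x = g (0, 1)" using P(4) by (metis imageE)
  obtain N where N: "open N" "x \<in> N" "N \<subseteq> H3" "\<And>A. A \<in> \<Gamma> \<Longrightarrow> act A ` N \<inter> N \<noteq> {} \<Longrightarrow> act A x = x"
    using free_neighbourhood[OF x(1)] by metis
  have "openin (top_of_set (UNIV \<times> circle)) {w \<in> UNIV \<times> circle. g w \<in> P ` N}"
    using g_cont P(2) N by blast
  then obtain T where T: "open T" "{w \<in> UNIV \<times> circle. g w \<in> P ` N} = (UNIV \<times> circle) \<inter> T"
    by (auto simp: openin_open)
  have "(0, 1) \<in> {w \<in> UNIV \<times> circle. g w \<in> P ` N}" using x N(2) by force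
  then have "(0, 1) \<in> T" unfolding T(2) by blast
  then obtain d where d: "d > 0" "ball (0, 1) d \<subseteq> T" using T(1) open_contains_ball by metis
  define \<epsilon> where "\<epsilon> = min d \<rho>0 / 2"
  have \<epsilon>: "0 < \<epsilon>" "\<epsilon> < d" "\<epsilon> < \<rho>0" using d(1) \<rho>0(1) by (auto simp: \<epsilon>_def min_def)
  \<comment> \<open>The circle z = \<epsilon> exp (\<i> t), v = 1 around the core, in the
    logarithmic coordinates of the end. Its period 2 pi is \<open>shift q p\<close>, one turn along
    the slope.\<close>
  define \<delta> where "\<delta> t = (of_int q * t, of_real (ln \<epsilon>) + of_real (of_int p * t) * \<i>)" for t :: real
  have \<delta>: "\<delta> t \<in> dom_end" for t using \<epsilon> by (simp add: dom_end_def \<delta>_def)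
  have gN: "P (FL (\<delta> t)) \<in> P ` N" for t
  proof -
    let ?z = "of_real \<epsilon> * cis t"
    have z: "?z \<noteq> 0" "sgn ?z = cis t" "cmod ?z = \<epsilon>" using \<epsilon>(1) by (simp_all add: sgn_mult norm_mult sgn_of_real)
    have "exp (snd (\<delta> t)) = of_real \<epsilon> * cis (of_int p * t)"
      using \<epsilon>(1) exp_of_real[of "ln \<epsilon>", where ?'a = complex]
      by (simp add: \<delta>_def exp_add cis_conv_exp mult.commute)
    then have "chart (\<delta> t) = (sgn ?z powi q * 1 powi s, of_real (cmod ?z) * sgn ?z powi p * 1 powi r)"
      unfolding z(2,3) by (simp add: chart_def \<delta>_def cis_power_int)
    then have "g (?z, 1) = f (e (chart (\<delta> t)))" using glue[OF z(1), of 1] by simp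
    also have "\<dots> = \<phi> (to_end (\<delta> t))" unfolding \<phi>_def Some_to_end[OF \<delta>] ..
    also have "\<dots> = P (FL (\<delta> t))" using FL(2,3)[OF \<delta>] proj(2) by metis
    finally have "g (?z, 1) = P (FL (\<delta> t))" .
    moreover have "(?z, 1) \<in> (UNIV \<times> circle) \<inter> T"
      using z(3) \<epsilon>(2) by (intro IntI subsetD[OF d(2)]) (auto simp: dist_Pair_Pair dist_norm)
    ultimately show ?thesis unfolding T(2)[symmetric] by auto
  qed
  \<comment> \<open>The translates of N grouped by the image of the centre x. Groups belonging to
    different points are disjoint, so the connected lift of the loop stays in one of them.\<close>
  define O' where "O' y = (\<Union>A\<in>{A\<in>\<Gamma>. act A x = y}. act A ` N)" for y
  have oO: "open (O' y)" for y unfolding O'_def using open_act_image N(1,3) \<Gamma>(4) by blast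
  have disj: "y = y'" if yy: "O' y \<inter> O' y' \<noteq> {}" for y y'
  proof -
    obtain A A' n n' where A: "A \<in> \<Gamma>" "act A x = y" "A' \<in> \<Gamma>" "act A' x = y'" "n \<in> N" "n' \<in> N" "act A n = act A' n'"
      using yy unfolding O'_def by blast
    have H: "n \<in> H3" "n' \<in> H3" using A N by auto
    have "act (minv A' ** A) n = n'"
      using act_mult[of "minv A'" A n] act_minv(1)[of A' n'] \<Gamma>(4)[OF A(1)] \<Gamma>(4)[OF A(3)] A(7) H by simp
    then have "act (minv A' ** A) x = x" using N(4)[OF \<Gamma>(5)[OF \<Gamma>(6)[OF A(3)] A(1)]] A(5,6) by blast
    then have "act A' (act (minv A') (act A x)) = act A' x"
      using act_mult[of "minv A'" A x] \<Gamma>(4)[OF A(1)] \<Gamma>(4)[OF A(3)] x(1) by simp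
    then show "y = y'"
      using act_minv(2)[OF \<Gamma>(4)[OF A(3)] act_in_H3[OF \<Gamma>(4)[OF A(1)] x(1)]] A(2,4) by simp
  qed
  have cov: "\<exists>A\<in>\<Gamma>. FL (\<delta> t) \<in> O' (act A x)" for t
  proof -
    obtain n where n: "n \<in> N" "P n = P (FL (\<delta> t))" using gN by (metis imageE)
    have "n \<in> H3" "FL (\<delta> t) \<in> H3" using n N(3) FL(2)[OF \<delta>] open_Hcov(2) by auto
    then obtain A where "A \<in> \<Gamma>" "FL (\<delta> t) = act A n" using P(5) n(2) by blast
    then show ?thesis unfolding O'_def using n(1) by blast
  qed
  have "continuous_on UNIV \<delta>" unfolding \<delta>_def by (intro continuous_intros)
  then have "continuous_on UNIV (\<lambda>t. FL (\<delta> t))" by (rule continuous_on_compose2[OF FL(1)]) (use \<delta> in auto)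
  then have con: "connected (range (\<lambda>t. FL (\<delta> t)))" by (rule connected_continuous_image) simp
  obtain A where A: "A \<in> \<Gamma>" "FL (\<delta> 0) \<in> O' (act A x)" using cov by blast
  define Y where "Y = (\<Union>y\<in>-{act A x}. O' y)"
  have "O' (act A x) \<inter> range (\<lambda>t. FL (\<delta> t)) = {} \<or> Y \<inter> range (\<lambda>t. FL (\<delta> t)) = {}"
  proof (rule connectedD[OF con oO])
    show "open Y" unfolding Y_def using oO by blast
    show "O' (act A x) \<inter> Y \<inter> range (\<lambda>t. FL (\<delta> t)) = {}" 
    proof (rule equals0I)
      fix z assume "z \<in> O' (act A x) \<inter> Y \<inter> range (\<lambda>t. FL (\<delta> t))"
      then obtain y where "y \<noteq> act A x" "z \<in> O' y" "z \<in> O' (act A x)" unfolding Y_def by auto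
      then show False using disj[of y "act A x"] by blast
    qed
    show "range (\<lambda>t. FL (\<delta> t)) \<subseteq> O' (act A x) \<union> Y" 
    proof
      fix z assume "z \<in> range (\<lambda>t. FL (\<delta> t))"
      then obtain t where "z = FL (\<delta> t)" by blast
      then obtain y where "z \<in> O' y" using cov[of t] by blast
      then show "z \<in> O' (act A x) \<union> Y" unfolding Y_def by (cases "y = act A x") auto
    qed
  qed
  then have Y: "Y \<inter> range (\<lambda>t. FL (\<delta> t)) = {}" using A(2) by blast
  obtain B where B: "FL (\<delta> (2 * pi)) \<in> O' (act B x)" using cov[of "2 * pi"] by blast
  have "act B x = act A x"
  proof (rule ccontr)
    assume "act B x \<noteq> act A x"
    then have "FL (\<delta> (2 * pi)) \<in> Y" using B unfolding Y_def by blast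
    then show False using Y by blast
  qed
  then have "FL (\<delta> (2 * pi)) \<in> O' (act A x)" using B by simp
  moreover have "\<delta> (2 * pi) = shift q p (\<delta> 0)" by (simp add: \<delta>_def shift_def)
  ultimately have "act (hol q p) (FL (\<delta> 0)) \<in> O' (act A x)" using hol(2)[OF \<delta>] by simp
  then obtain C n where C: "C \<in> \<Gamma>" "act C x = act A x" "n \<in> N" "act (hol q p) (FL (\<delta> 0)) = act C n"
    unfolding O'_def by blast
  obtain D n' where D: "D \<in> \<Gamma>" "act D x = act A x" "n' \<in> N" "FL (\<delta> 0) = act D n'"
    using A(2) unfolding O'_def by blast
  have H: "n' \<in> H3" using D N by auto
  have "act (hol q p ** D) n' = act C n"
    using C(4) D(4) act_mult[OF _ _ H, of "hol q p" D] \<Gamma>(4)[OF hol(1)] \<Gamma>(4)[OF D(1)] by simp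
  then have "act (hol q p ** D) n' \<in> O' (act (hol q p ** D) x) \<inter> O' (act A x)"
    using C D(3) \<Gamma>(5)[OF hol(1) D(1)] unfolding O'_def by blast
  then have "act (hol q p ** D) x = act A x" using disj by blast
  then have fixed: "act (hol q p) (act A x) = act A x"
    using act_mult[OF _ _ x(1), of "hol q p" D] \<Gamma>(4)[OF hol(1)] \<Gamma>(4)[OF D(1)] D(2) by simp
  define y where "y = act A x"
  have y: "y \<in> H3" "act (hol q p) y = y" using fixed act_in_H3[OF \<Gamma>(4)[OF A(1)] x(1)] by (auto simp: y_def)
  have "P y = g (0, 1)" using orbit_map_act[OF om dg A(1) x(1)] x(2) by (simp add: y_def)
  then have "P y \<in> core" using core(1) by auto
  then have "card (isotropy \<Gamma> y) = 2 * k" by (rule isotropy_core(1)[OF y(1)])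
  then have fin: "finite (isotropy \<Gamma> y)" using isotropy_core(2) card.infinite by force
  \<comment> \<open>All powers of the slope holonomy fix one point over the core, whose isotropy is
    finite; two powers must therefore coincide.\<close>
  have pow: "mpow_nat (hol q p) i \<in> isotropy \<Gamma> y" for i
  proof (induction i)
    case (Suc i)
    then have i: "mpow_nat (hol q p) i \<in> \<Gamma>" "act (mpow_nat (hol q p) i) y = y" by (auto simp: isotropy_def)
    show ?case using \<Gamma>(5)[OF hol(1) i(1)] act_mult[OF \<Gamma>(4)[OF hol(1)] \<Gamma>(4)[OF i(1)] y(1)] i(2) y(2)
      by (simp add: isotropy_def)
  qed (simp add: isotropy_def \<Gamma>(3))
  then have "\<not> inj_on (\<lambda>i. mpow_nat (hol q p) i) UNIV"
    using finite_subset[OF _ fin, of "range (mpow_nat (hol q p))"] finite_imageD[of "mpow_nat (hol q p)" UNIV] by blast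
  then obtain i j where "mpow_nat (hol q p) i = mpow_nat (hol q p) j" "i \<noteq> j" by (auto simp: inj_on_def)
  then obtain i j where ij: "mpow_nat (hol q p) i = mpow_nat (hol q p) j" "i < j" by (metis linorder_neqE_nat)
  have m: "mpow_nat (hol q p) i \<doteq> hol (int i * q) (int i * p)" for i
    using hol_mpow[of q p "int i"] by (simp add: mpow_def)
  have "hol (int i * q) (int i * p) \<doteq> hol (int j * q) (int j * p)"
    using peq_trans[OF peq_sym[OF m[of i]]] m[of j] ij(1) by simp
  then have "hol (int j * q) (int j * p) ** hol (- (int i * q)) (- (int i * p)) \<doteq>
      hol (int i * q) (int i * p) ** hol (- (int i * q)) (- (int i * p))"
    by (rule peq_mult[OF peq_sym peq_refl])
  from peq_trans[OF peq_trans[OF peq_sym[OF hol_add] this] hol_add]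
  have "hol (int (j - i) * q) (int (j - i) * p) \<doteq> hol 0 0"
    using ij(2) by (simp add: of_nat_diff algebra_simps)
  then show ?thesis using ij(2) hol_0 peq_trans by (intro exI[of _ "j - i"]) auto
qed

end

lemma additive_int:
  fixes h :: "int \<Rightarrow> int \<Rightarrow> real"
  assumes add: "\<And>m n m' n'. h (m + m') (n + n') = h m n + h m' n'"
  shows "h m n = of_int m * h 1 0 + of_int n * h 0 1"
proof -
  have lin: "\<phi> m = of_int m * \<phi> 1" if a: "\<And>m n. \<phi> (m + n) = \<phi> m + \<phi> n" for \<phi> :: "int \<Rightarrow> real" and m
  proof (induction m rule: int_induct[where k = 0])
    case base
    show ?case using a[of 0 0] by simp
  next
    case (step1 i)
    then show ?case using a[of i 1] by (simp add: algebra_simps)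
  next
    case (step2 i)
    then show ?case using a[of "i - 1" 1] by (simp add: algebra_simps)
  qed
  have "h m 0 = of_int m * h 1 0" by (rule lin) (use add[of _ _ 0 0] in simp)
  moreover have "h 0 n = of_int n * h 0 1" by (rule lin) (use add[of 0 0] in simp)
  ultimately show ?thesis using add[of m 0 0 n] by simp
qed

context link_orbifold
begin

lemma linking_circle_chart: "cmod (linking_circle (e (chart d))) = 1"
  using linking_circle_unit[of "e (chart d)"] e_chart_XL[of d] by (auto simp: XL_def)

lemma continuous_linking_chart: "continuous_on UNIV (\<lambda>d. linking_circle (e (chart d)))"
proof (subst continuous_on_open_vimage[OF open_UNIV], intro allI impI)
  fix U :: "complex set" assume "open U"
  have cK: "openin S3 (- Some ` link_component1)" using openin_S3_compl[OF compact_link(1)] .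
  let ?V = "{x \<in> - Some ` link_component1. linking_circle x \<in> U}"
  have "openin (subtopology S3 (- Some ` link_component1)) {x \<in> topspace (subtopology S3 (- Some ` link_component1)). linking_circle x \<in> U}"
    by (rule openin_continuous_map_preimage[OF continuous_linking_circle]) (use \<open>open U\<close> in simp)
  then have "openin (subtopology S3 (- Some ` link_component1)) ?V"
    unfolding topspace_subtopology topspace_S3 Int_UNIV_left .
  then have "openin S3 ?V" unfolding openin_open_subtopology[OF cK] by (rule conjunct1)
  from e_vimage_open[OF this] obtain T where T: "open T" "\<forall>x\<in>circle \<times> UNIV. e x \<in> ?V \<longleftrightarrow> x \<in> T" by (elim exE conjE)
  have "e (chart d) \<in> - Some ` link_component1" for d using e_chart_XL[of d] by (auto simp: XL_def)
  then have "linking_circle (e (chart d)) \<in> U \<longleftrightarrow> chart d \<in> T" for d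
    using bspec[OF T(2) chart_in(1), of d] by simp
  then have "(\<lambda>d. linking_circle (e (chart d))) -` U = chart -` T" by blast
  then show "open ((\<lambda>d. linking_circle (e (chart d))) -` U \<inter> UNIV)"
    using open_vimage[OF T(1) continuous_chart] by simp
qed

lemma linking_log_exists: "\<exists>G. continuous_on UNIV G \<and> (\<forall>d. linking_circle (e (chart d)) = exp (G d))"
proof -
  have nz: "linking_circle (e (chart d)) \<noteq> 0" for d using linking_circle_chart[of d] by auto
  show ?thesis
    using continuous_logarithm_on_contractible[OF continuous_linking_chart convex_imp_contractible[OF convex_UNIV]] nz
    by (metis UNIV_I)
qed

definition LG :: "real \<times> complex \<Rightarrow> complex" where
  "LG = (SOME G. continuous_on UNIV G \<and> (\<forall>d. linking_circle (e (chart d)) = exp (G d)))"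

lemma LG: "continuous_on UNIV LG" "linking_circle (e (chart d)) = exp (LG d)"
  using someI_ex[OF linking_log_exists] unfolding LG_def by blast+

definition wnd :: "int \<Rightarrow> int \<Rightarrow> real" where
  "wnd m n = (Im (LG (shift m n (0, 0))) - Im (LG (0, 0))) / (2 * pi)"

lemma wnd: "Im (LG (shift m n d)) - Im (LG d) = 2 * pi * wnd m n" and wnd_integer: "wnd m n \<in> \<int>"
proof -
  define h where "h d = (Im (LG (shift m n d)) - Im (LG d)) / (2 * pi)" for d
  have "continuous_on UNIV (shift m n)" unfolding shift_def by (intro continuous_intros)
  then have "continuous_on UNIV (\<lambda>d. LG (shift m n d))" by (rule continuous_on_compose2[OF LG(1)]) auto
  then have c: "continuous_on UNIV h" unfolding h_def by (intro continuous_intros LG(1)) auto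
  have int: "h d \<in> \<int>" for d
  proof -
    have "exp (LG (shift m n d)) = exp (LG d)" using LG(2)[of d] LG(2)[of "shift m n d"] by simp
    then obtain i :: int where "LG (shift m n d) = LG d + of_real (of_int (2 * i) * pi) * \<i>"
      unfolding exp_eq by blast
    then have "h d = of_int i" by (simp add: h_def)
    then show ?thesis by simp
  qed
  have "h d = h (0, 0)" by (rule continuous_integer_constant[OF c _ int]) auto
  then show "Im (LG (shift m n d)) - Im (LG d) = 2 * pi * wnd m n" by (simp add: h_def wnd_def)
  show "wnd m n \<in> \<int>" using int[of "(0, 0)"] by (simp add: h_def wnd_def)
qed

text \<open>By additivity the two basis loops decide, and the longitude contributes 0 because it
  bounds in the complement of the component. This is where the homological framing enters.\<close>

lemma wnd_linear: "wnd m n = of_int n * wnd 0 1"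
proof -
  have "wnd (m + m') (n + n') = wnd m n + wnd m' n'" for m m' n n'
  proof -
    have "2 * pi * wnd (m + m') (n + n') = 2 * pi * wnd m n + 2 * pi * wnd m' n'"
      using wnd[of m n "shift m' n' (0, 0)"] wnd[of m' n' "(0, 0)"] wnd[of "m + m'" "n + n'" "(0, 0)"]
      by (simp add: shift_add)
    then have "2 * pi * wnd (m + m') (n + n') = 2 * pi * (wnd m n + wnd m' n')" by (simp add: distrib_left)
    then show ?thesis by simp
  qed
  then have "wnd m n = of_int m * wnd 1 0 + of_int n * wnd 0 1" by (rule additive_int)
  moreover have "wnd 1 0 = 0"
  proof -
    let ?l = "\<lambda>t. e (cis (2 * pi * t), 1)"
    have bd: "singular_relboundary 1 (subtopology S3 (- Some ` link_component1)) {}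
        (frag_of (restrict (\<lambda>x. ?l (x 0)) (standard_simplex 1)))"
      using nbhd by (simp add: homologically_framed_nbhd_def)
    have ch: "chart (2 * pi * t, 0) = (cis (2 * pi * t), 1)" for t by (simp add: chart_def)
    have "Im (LG (2 * pi * 1, 0)) = Im (LG (2 * pi * 0, 0))"
    proof (rule null_homologous_log[OF continuous_linking_circle _ bd, of "\<lambda>t. LG (2 * pi * t, 0)"])
      show "linking_circle x \<noteq> 0" if "x \<in> topspace (subtopology S3 (- Some ` link_component1))" for x
        using linking_circle_unit[of x] that by auto
      show "continuous_on {0..1} (\<lambda>t. LG (2 * pi * t, 0))"
        by (rule continuous_on_compose2[OF LG(1)]) (auto intro!: continuous_intros)
      show "linking_circle (?l t) = exp (LG (2 * pi * t, 0))" for t using LG(2)[of "(2 * pi * t, 0)"] by (simp add: ch)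
    qed simp
    moreover have "shift 1 0 (0, 0) = (2 * pi * 1, 0)" by (simp add: shift_def)
    ultimately show ?thesis by (simp add: wnd_def)
  qed
  ultimately show ?thesis by simp
qed

text \<open>Lifting a loop of the tube to \<open>dom_end\<close> determines its class (m, n), and
  with it both its deck transformation and its winding number. The last clause recognises powers of
  the meridian: a loop whose position along K stays in an arc has no longitudinal part.\<close>

lemma loop_holonomy:
  fixes Q :: "real \<Rightarrow> point \<times> real"
  assumes Q: "continuous_on {0..1} Q" "\<And>t. t \<in> {0..1} \<Longrightarrow> fst (Q t) \<in> Hcov"
      "\<And>t. t \<in> {0..1} \<Longrightarrow> Some (proj (fst (Q t))) \<in> e ` (circle \<times> ball 0 \<rho>0)"
      "\<And>t. t \<in> {0..1} \<Longrightarrow> linking_circle (Some (proj (fst (Q t)))) = cis (2 * pi * snd (Q t))"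
    and W: "W \<in> \<Gamma>" "fst (Q 1) = act W (fst (Q 0))" and B: "B \<in> \<Gamma>" "d \<in> dom_end" "fst (Q 0) = act B (FL d)"
  shows "\<exists>m n. W \<doteq> conj_by B (hol m n) \<and> snd (Q 1) - snd (Q 0) = wnd m n \<and>
    (\<forall>u. cmod u = 1 \<longrightarrow> (\<forall>t\<in>{0..1}. Some (proj (fst (Q t))) \<in> e ` ((circle \<inter> ball u 1) \<times> ball 0 \<rho>0)) \<longrightarrow> m = 0)"
proof -
  obtain \<delta> where \<delta>: "continuous_on {0..1} \<delta>" "\<delta> 0 = d"
    "\<And>t. t \<in> {0..1} \<Longrightarrow> \<delta> t \<in> dom_end \<and> to_end (\<delta> t) = proj (fst (Q t)) \<and> fst (Q t) = act B (FL (\<delta> t))"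
    using end_path[OF continuous_on_fst[OF Q(1)] Q(2,3) B] by blast
  have "proj (fst (Q 1)) = proj (fst (Q 0))" using W Q(2)[of 0] proj_act by simp
  then have "to_end (\<delta> 1) = to_end d" using \<delta>(3)[of 1] \<delta>(3)[of 0] \<delta>(2) by simp
  then obtain m n where mn: "\<delta> 1 = shift m n d" using to_end_eq[of "\<delta> 1" d] \<delta>(3)[of 1] B(2) by auto
  have dB: "det B = 1" "det W = 1" using B W \<Gamma>(4) by blast+
  have "act (W ** B) (FL d) = act W (fst (Q 0))" using act_mult_Hcov[OF FL(2)[OF B(2)] W(1) B(1)] B(3) by simp
  also have "\<dots> = act B (FL (shift m n d))" using \<delta>(3)[of 1] W(2) mn by simp
  also have "\<dots> = act (B ** hol m n) (FL d)" using hol(2)[OF B(2)] act_mult_Hcov[OF FL(2)[OF B(2)] B(1) hol(1)] by simp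
  finally have "W ** B \<doteq> B ** hol m n"
    by (rule Hcov_peq[OF FL(2)[OF B(2)] \<Gamma>(5)[OF W(1) B(1)] \<Gamma>(5)[OF B(1) hol(1)]])
  then have "W ** B ** minv B \<doteq> B ** hol m n ** minv B" by (rule peq_mult[OF _ peq_refl])
  then have 1: "W \<doteq> conj_by B (hol m n)" by (simp add: conj_by_def matrix_mul_assoc[symmetric] minv_right dB)
  have "of_real (2 * pi * snd (Q 1)) * \<i> - of_real (2 * pi * snd (Q 0)) * \<i> = LG (\<delta> 1) - LG (\<delta> 0)"
  proof (rule exp_lifts_differ)
    show "continuous_on {0..1} (\<lambda>t. complex_of_real (2 * pi * snd (Q t)) * \<i>)" by (intro continuous_intros Q(1))
    show "continuous_on {0..1} (\<lambda>t. LG (\<delta> t))" by (rule continuous_on_compose2[OF LG(1) \<delta>(1)]) auto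
    fix t :: real assume t: "t \<in> {0..1}"
    have "exp (LG (\<delta> t)) = cis (2 * pi * snd (Q t))"
      using LG(2)[of "\<delta> t"] Q(4)[OF t] \<delta>(3)[OF t] Some_to_end[of "\<delta> t"] by simp
    then show "exp (complex_of_real (2 * pi * snd (Q t)) * \<i>) = exp (LG (\<delta> t))" by (simp add: cis_conv_exp mult.commute)
  qed
  then have "Im (of_real (2 * pi * snd (Q 1)) * \<i> - of_real (2 * pi * snd (Q 0)) * \<i>) = Im (LG (\<delta> 1) - LG (\<delta> 0))" by simp
  then have "2 * pi * snd (Q 1) - 2 * pi * snd (Q 0) = 2 * pi * wnd m n" using wnd[of m n d] mn \<delta>(2) by simp
  then have "2 * pi * (snd (Q 1) - snd (Q 0)) = 2 * pi * wnd m n" by (simp add: right_diff_distrib)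
  then have 2: "snd (Q 1) - snd (Q 0) = wnd m n" by simp
  have 3: "m = 0" if u: "cmod u = 1" "\<forall>t\<in>{0..1}. Some (proj (fst (Q t))) \<in> e ` ((circle \<inter> ball u 1) \<times> ball 0 \<rho>0)" for u
  proof -
    have "fst (\<delta> 1) = fst (\<delta> 0)"
    proof (rule arc_no_turn[OF continuous_on_fst[OF \<delta>(1)] u(1)])
      fix t :: real assume t: "t \<in> {0..1}"
      obtain x where x: "x \<in> (circle \<inter> ball u 1) \<times> ball 0 \<rho>0" "Some (proj (fst (Q t))) = e x" using u(2) t by blast
      have "e (chart (\<delta> t)) = e x" using x(2) \<delta>(3)[OF t] Some_to_end[of "\<delta> t"] by simp
      moreover have "x \<in> circle \<times> UNIV" using x(1) by auto
      ultimately have "chart (\<delta> t) = x" using inj_onD[OF e_inj _ chart_in(1)] by blast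
      then show "cis (fst (\<delta> t)) \<in> ball u 1" using x(1) by (auto simp: chart_def)
    next
      have "chart (\<delta> 1) = chart (\<delta> 0)" using mn \<delta>(2) by simp
      then show "cis (fst (\<delta> 1)) = cis (fst (\<delta> 0))" by (simp add: chart_def)
    qed
    then show "m = 0" using mn \<delta>(2) by (simp add: shift_def)
  qed
  show ?thesis using 1 2 3 by blast
qed

text \<open>Winding numbers settle the meridional parts. The meridian has -1 and the pushed-off
  parallel 2, both integer multiples of \<open>wnd 0 1\<close>, so i is 1 or -1 and l = -2 i; the
  longitude word, with one more meridian on each side, has none left. The integer \<open>j\<close>
  stays undetermined and is absorbed by a power in \<open>filled_relation\<close>.\<close>

lemma peripheral_words:
  "\<exists>B\<in>\<Gamma>. \<exists>i j. (i = 1 \<or> i = - 1) \<and> mu \<doteq> conj_by B (hol 0 i) \<and> longitude mu mv \<doteq> conj_by B (hol j 0)"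
proof -
  interpret lk: loops \<Gamma> M P e f g p q r s core k "\<lambda>y. linking_circle (Some y)" upper_angle lower_angle
    "\<lambda>z. if z \<in> inner1 then 0 else 1"
  proof unfold_locales
    show "linking_circle (Some y) = cis (2 * pi * upper_angle y)" if "y \<in> Up" for y
      using cis_angle(1)[of y] that Up_disjoint by (auto simp: linking_circle_def Lk_def)
    show "linking_circle (Some y) = cis (2 * pi * lower_angle y)" if "y \<in> Dn" for y
      using cis_angle(2)[of y] that Dn_disjoint by (auto simp: linking_circle_def Lk_def)
  qed (use continuous_upper_angle continuous_lower_angle angle_difference in auto)
  have oimg: "openin S3 (e ` ((circle \<inter> U) \<times> V))" if "open U" "open V" for U V
  proof -
    have "openin (top_of_set (circle \<times> UNIV)) ((circle \<inter> U) \<times> V)"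
      using that by (intro openin_Times) (auto simp: openin_open_Int openin_open_eq)
    then show ?thesis using open_embedding(1)[OF e_facts(1)] e_facts(2) by simp
  qed
  have "Some (Complex 0 1, 1) \<in> e ` (circle \<times> {0})"
    unfolding e_facts(3) by (auto simp: link_component1_eq diagram_defs)
  then obtain u where u: "cmod u = 1" "e (u, 0) = Some (Complex 0 1, 1)" by auto
  \<comment> \<open>\<open>N1\<close> is the tube and hosts the parallel. \<open>N2\<close> is its
    part over an arc around the base point, which leaves the meridian no room to travel along
    K.\<close>
  define N1 N2 where "N1 = {y. Some y \<in> e ` ((circle \<inter> UNIV) \<times> ball 0 \<rho>0)}"
    and "N2 = {y. Some y \<in> e ` ((circle \<inter> ball u 1) \<times> ball 0 \<rho>0)}"
  have o: "open N1" "open N2" unfolding N1_def N2_def by (intro open_vimage_Some oimg; simp)+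
  have "link_component1 \<subseteq> N1"
  proof
    fix y assume "y \<in> link_component1"
    then have "Some y \<in> e ` (circle \<times> {0})" unfolding e_facts(3) by blast
    then show "y \<in> N1" using \<rho>0(1) by (auto simp: N1_def)
  qed
  then obtain \<epsilon>1 where \<epsilon>1: "lk.near link_component1 \<epsilon>1 N1" using lk.near_exists[OF compact_link(1) o(1)] by blast
  have "(u, 0) \<in> (circle \<inter> ball u 1) \<times> ball 0 \<rho>0" using u(1) \<rho>0(1) by simp
  then have "{(Complex 0 1, 1)} \<subseteq> N2" unfolding N2_def using u(2) by (auto intro!: image_eqI[of _ e "(u, 0)"])
  moreover have "compact {(Complex 0 1, 1 :: real)}" by simp
  ultimately obtain \<epsilon>2 where \<epsilon>2: "lk.near {(Complex 0 1, 1)} \<epsilon>2 N2"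
    using lk.near_exists[of "{(Complex 0 1, 1)}" N2] o(2) by blast
  define \<epsilon> where "\<epsilon> = min \<epsilon>1 \<epsilon>2"
  have e0: "0 < \<epsilon>1" "0 < \<epsilon>2" "\<epsilon>1 < 1" using \<epsilon>1 \<epsilon>2 by (auto simp: lk.near_def)
  have n: "lk.near link_component1 \<epsilon> N1" "lk.near {(Complex 0 1, 1)} \<epsilon> N2"
    by (rule lk.near_subset[OF \<epsilon>1] lk.near_subset[OF \<epsilon>2]; use e0 in \<open>simp add: \<epsilon>_def\<close>)+
  note loop1 = lk.component1_loops(1)[OF refl n(1)] and loop2 = lk.component1_loops(2)[OF refl n(2)]
  let ?y0 = "(lk.sh \<epsilon> 0 1, 1 :: real)"
  let ?W = "minv mu ** longitude mu mv ** minv mu"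
  have "longitude mu mv \<in> \<Gamma>" unfolding longitude_def by (intro \<Gamma>(5) \<Gamma>(6) mu_mv_in)
  then have W: "?W \<in> \<Gamma>" by (intro \<Gamma>(5) \<Gamma>(6) mu_mv_in)
  have N21: "N2 \<subseteq> N1" unfolding N1_def N2_def by auto
  have st: "lk.up (mat 1) 0 ?y0 \<in> lk.tube N1" using path_component_mem(1)[OF loop1] .
  let ?x = "sp ?y0"
  have x: "?x \<in> Hcov" "proj ?x \<in> N1" using st by (auto simp: lk.up_def lk.tube_def)
  obtain d B where dB: "d \<in> dom_end" "B \<in> \<Gamma>" "?x = act B (FL d)"
  proof -
    obtain c where c: "c \<in> circle \<times> ball 0 \<rho>0" "Some (proj ?x) = e c" using x(2) by (auto simp: N1_def)
    have w0: "snd c \<noteq> 0"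
    proof
      assume "snd c = 0"
      then have "c \<in> circle \<times> {0}" using c(1) by (cases c) auto
      then have "e c \<in> Some ` link_component1" unfolding e_facts(3)[symmetric] by (rule imageI)
      then show False using c(2) proj(1)[OF x(1)] by (auto simp: L_def)
    qed
    have m: "cmod (fst c) = 1" "cmod (snd c) < \<rho>0" using c(1) by (cases c, auto)+
    define d where "d = (Arg (fst c), Ln (snd c))"
    have "fst c \<noteq> 0" using m(1) by (metis norm_zero zero_neq_one)
    then have "cis (Arg (fst c)) = fst c" using m(1) cis_Arg[of "fst c"] by (auto simp: sgn_div_norm)
    then have ch: "chart d = c" using w0 by (simp add: chart_def d_def prod_eq_iff)
    have "Re (Ln (snd c)) < ln \<rho>0" using w0 m(2) \<rho>0(1) by simp
    then have d: "d \<in> dom_end" by (simp add: dom_end_def d_def)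
    have "Some (to_end d) = Some (proj ?x)" using Some_to_end[OF d] ch c(2) by simp
    then have "proj (FL d) = proj ?x" using FL(3)[OF d] by simp
    then obtain B where "B \<in> \<Gamma>" "?x = act B (FL d)" using proj_eq_iff[OF FL(2)[OF d] x(1)] by blast
    then show ?thesis using that d by blast
  qed
  have H: "\<exists>m n. V \<doteq> conj_by B (hol m n) \<and> of_int j = wnd m n \<and> (N = N2 \<longrightarrow> m = 0)"
    if pc: "path_component (lk.tube N) (lk.up (mat 1) 0 ?y0) (lk.up V j ?y0)" and V: "V \<in> \<Gamma>" and N: "N \<subseteq> N1" for V j N
  proof -
    obtain Q where Q: "path Q" "path_image Q \<subseteq> lk.tube N" "pathstart Q = lk.up (mat 1) 0 ?y0" "pathfinish Q = lk.up V j ?y0"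
      using pc by (auto simp: path_component_def)
    have Qt: "fst (Q t) \<in> Hcov" "proj (fst (Q t)) \<in> N" "linking_circle (Some (proj (fst (Q t)))) = cis (2 * pi * snd (Q t))"
      if "t \<in> {0..1}" for t
    proof -
      have "Q t \<in> lk.tube N" using Q(2) that by (auto simp: path_image_def)
      then show "fst (Q t) \<in> Hcov" "proj (fst (Q t)) \<in> N" "linking_circle (Some (proj (fst (Q t)))) = cis (2 * pi * snd (Q t))"
        by (auto simp: lk.tube_def)
    qed
    have ends: "fst (Q 0) = ?x" "fst (Q 1) = act V ?x" "snd (Q 1) - snd (Q 0) = of_int j"
      using Q(3,4) by (simp_all add: pathstart_def pathfinish_def lk.up_def)
    have "\<exists>m n. V \<doteq> conj_by B (hol m n) \<and> snd (Q 1) - snd (Q 0) = wnd m n \<and>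
      (\<forall>u. cmod u = 1 \<longrightarrow> (\<forall>t\<in>{0..1}. Some (proj (fst (Q t))) \<in> e ` ((circle \<inter> ball u 1) \<times> ball 0 \<rho>0)) \<longrightarrow> m = 0)"
    proof (rule loop_holonomy)
      show "continuous_on {0..1} Q" using Q(1) by (simp add: path_def)
      show "Some (proj (fst (Q t))) \<in> e ` (circle \<times> ball 0 \<rho>0)" if "t \<in> {0..1}" for t
        using Qt(2)[OF that] N unfolding N1_def by auto
    qed (use Qt ends V dB in simp_all)
    then obtain m n where mn: "V \<doteq> conj_by B (hol m n)" "snd (Q 1) - snd (Q 0) = wnd m n"
      "\<forall>t\<in>{0..1}. Some (proj (fst (Q t))) \<in> e ` ((circle \<inter> ball u 1) \<times> ball 0 \<rho>0) \<Longrightarrow> m = 0"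
      using u(1) by blast
    have "m = 0" if "N = N2" using mn(3) Qt(2) that unfolding N2_def by blast
    then show ?thesis using mn(1,2) ends(3) by auto
  qed
  obtain i where i: "mu \<doteq> conj_by B (hol 0 i)" "- 1 = wnd 0 i" using H[OF loop2 mu_mv_in(1) N21] by auto
  obtain j l where jl: "?W \<doteq> conj_by B (hol j l)" "2 = wnd j l" using H[OF loop1 W] by auto
  have w: "of_int i * wnd 0 1 = - 1" "of_int l * wnd 0 1 = 2" using i(2) jl(2) wnd_linear by metis+
  obtain b where b: "wnd 0 1 = of_int b" using wnd_integer[of 0 1] by (auto elim: Ints_cases)
  have "of_int (i * b) = (of_int (- 1) :: real)" "of_int (l * b) = (of_int 2 :: real)" using w by (simp_all add: b)
  then have ib: "i * b = - 1" "l * b = 2" by (simp_all only: of_int_eq_iff)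
  have "\<bar>i * b\<bar> = 1" using ib(1) by simp
  then have i1: "\<bar>i\<bar> = 1" by (simp add: abs_zmult_eq_1)
  have "(l + 2 * i) * b = 0" "b \<noteq> 0" using ib by (auto simp: algebra_simps)
  then have l: "l + 2 * i = 0" by simp
  have dBd: "det B = 1" using \<Gamma>(4)[OF dB(2)] .
  have "longitude mu mv = mu ** ?W ** mu" by (simp add: cancel)
  also have "\<dots> \<doteq> conj_by B (hol 0 i) ** conj_by B (hol j l) ** conj_by B (hol 0 i)"
    by (rule peq_mult[OF peq_mult[OF i(1) jl(1)] i(1)])
  also have "\<dots> = conj_by B (hol 0 i ** hol j l ** hol 0 i)" by (simp add: conj_by_mult[OF dBd])
  also have "\<dots> \<doteq> conj_by B (hol (0 + j + 0) (i + l + i))"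
    by (rule peq_conj_by, rule peq_trans[OF peq_mult[OF hol_add peq_refl] hol_add])
  also have "(0 + j + 0) = j" by simp
  also have "i + l + i = 0" using l by simp
  finally have "longitude mu mv \<doteq> conj_by B (hol j 0)" .
  moreover have "i = 1 \<or> i = - 1" using i1 by linarith
  ultimately show ?thesis using dB(2) i(1) by blast
qed

text \<open>The exponents are chosen so that, by i^2 = 1, the product is the holonomy of (j n q, j n
  p). This is the j-th power of the slope power that \<open>core_power\<close> makes
  trivial.\<close>

theorem filled_relation:
  assumes "q \<noteq> 0"
  shows "\<exists>a b. b \<noteq> 0 \<and> mpow mu a ** mpow (longitude mu mv) b \<doteq> mat 1"
proof -
  obtain B i j where B: "B \<in> \<Gamma>" "i = 1 \<or> i = - 1" "mu \<doteq> conj_by B (hol 0 i)" "longitude mu mv \<doteq> conj_by B (hol j 0)"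
    using peripheral_words by blast
  obtain n where n: "n > 0" "hol (int n * q) (int n * p) \<doteq> mat 1" using core_power by blast
  have d: "det B = 1" using \<Gamma>(4)[OF B(1)] .
  let ?a = "i * (p * j * int n)" and ?b = "q * int n"
  have pw: "mpow V c \<doteq> conj_by B (hol (c * x) (c * y))" if "V \<doteq> conj_by B (hol x y)" for V c x y
  proof -
    have "mpow V c \<doteq> mpow (conj_by B (hol x y)) c" by (rule peq_mpow[OF that])
    also have "\<dots> = conj_by B (mpow (hol x y) c)" by (simp add: conj_by_mpow[OF d])
    also have "\<dots> \<doteq> conj_by B (hol (c * x) (c * y))" by (rule peq_conj_by[OF hol_mpow])
    finally show ?thesis .
  qed
  have "mpow mu ?a ** mpow (longitude mu mv) ?b \<doteq> conj_by B (hol (?a * 0) (?a * i)) ** conj_by B (hol (?b * j) (?b * 0))"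
    by (rule peq_mult[OF pw[OF B(3)] pw[OF B(4)]])
  also have "\<dots> = conj_by B (hol (?a * 0) (?a * i) ** hol (?b * j) (?b * 0))" by (simp add: conj_by_mult[OF d])
  also have "\<dots> \<doteq> conj_by B (hol (?a * 0 + ?b * j) (?a * i + ?b * 0))" by (rule peq_conj_by[OF hol_add])
  also have "\<dots> = conj_by B (hol (j * (int n * q)) (j * (int n * p)))"
    using B(2) by (auto simp: mult_ac)
  also have "\<dots> \<doteq> conj_by B (mpow (hol (int n * q) (int n * p)) j)" by (rule peq_conj_by[OF peq_sym[OF hol_mpow]])
  also have "\<dots> \<doteq> conj_by B (mpow (mat 1) j)" by (rule peq_conj_by[OF peq_mpow[OF n(2)]])
  also have "mpow (mat 1) j = mat 1"
  proof -
    have "mpow_nat (mat 1) m = mat 1" for m by (induction m) auto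
    then show ?thesis by (simp add: mpow_def)
  qed
  also have "conj_by B (mat 1) = mat 1" by (rule conj_by_mat1[OF d])
  finally have "mpow mu ?a ** mpow (longitude mu mv) ?b \<doteq> mat 1" .
  moreover have "?b \<noteq> 0" using assms n(1) by simp
  ultimately show ?thesis by blast
qed

end

section \<open>Invariance under conjugation, and the theorem for the first component\<close>

section \<open>Conjugation\<close>

lemma conj_by_cancel:
  assumes "det C = 1"
  shows "conj_by (minv C) (conj_by C A) = A" "conj_by C (conj_by (minv C) A) = A"
  by (simp_all add: conj_by_def matrix_mul_assoc[symmetric] minv_cancel minv_left minv_right assms)

lemma conj_generate:
  assumes C: "det C = 1" and S: "S \<subseteq> carrier SL2C" and A: "A \<in> generate SL2C S"
  shows "conj_by C A \<in> generate SL2C (conj_by C ` S)"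
proof -
  have S': "conj_by C ` S \<subseteq> carrier SL2C" using S by (auto simp: det_conj_by C)
  note sg = subgroup_SL2C_D[OF group.generate_is_subgroup[OF group_SL2C S']]
  have i: "conj_by C B \<in> generate SL2C (conj_by C ` S)" if "B \<in> S" for B
    using that by (intro generate.incl) blast
  show ?thesis
    using A S
    by (induction rule: generate_SL2C_induct)
       (use i sg(2-4) in \<open>auto simp: conj_by_minv conj_by_mult conj_by_mat1 C\<close>)
qed

lemma discrete_group_conj:
  assumes \<Gamma>: "discrete_group \<Gamma>" and C: "det C = 1"
  shows "discrete_group (conj_by C ` \<Gamma>)"
  unfolding discrete_group_def
proof (intro conjI allI impI)
  note g = discrete_groupD[OF \<Gamma>]
  show "subgroup (conj_by C ` \<Gamma>) SL2C"
  proof (rule subgroup.intro)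
    show "conj_by C ` \<Gamma> \<subseteq> carrier SL2C" using g(4) by (auto simp: det_conj_by C)
    show "x \<otimes>\<^bsub>SL2C\<^esub> y \<in> conj_by C ` \<Gamma>" if "x \<in> conj_by C ` \<Gamma>" "y \<in> conj_by C ` \<Gamma>" for x y
      using that g(5) by (auto simp: C simp flip: conj_by_mult)
    show "\<one>\<^bsub>SL2C\<^esub> \<in> conj_by C ` \<Gamma>" using g(3) conj_by_mat1[OF C] by (metis imageI one_SL2C)
    show "inv\<^bsub>SL2C\<^esub> x \<in> conj_by C ` \<Gamma>" if x: "x \<in> conj_by C ` \<Gamma>" for x
    proof -
      obtain A where A: "A \<in> \<Gamma>" "x = conj_by C A" using x by blast
      then have "inv\<^bsub>SL2C\<^esub> x = conj_by C (minv A)" using g(4) by (simp add: inv_SL2C det_conj_by C conj_by_minv)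
      then show ?thesis using g(6)[OF A(1)] by blast
    qed
  qed
  have "conj_by C (- mat 1) = - mat 1" by (simp add: conj_by_uminus conj_by_mat1 C)
  then show "- mat 1 \<in> conj_by C ` \<Gamma>" using g(2) by (metis imageI)
  fix h A assume h: "range h \<subseteq> conj_by C ` \<Gamma>" "A \<in> conj_by C ` \<Gamma>" "h \<longlonglongrightarrow> A"
  have undo: "conj_by (minv C) B \<in> \<Gamma>" if "B \<in> conj_by C ` \<Gamma>" for B
    using that by (auto simp: conj_by_cancel C)
  have "(\<lambda>n. conj_by (minv C) (h n)) \<longlonglongrightarrow> conj_by (minv C) A"
    unfolding conj_by_def by (intro tendsto_matrix_mult tendsto_const h(3))
  then have "\<forall>\<^sub>F n in sequentially. conj_by (minv C) (h n) = conj_by (minv C) A"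
    by (intro discrete_group_lim[OF \<Gamma>]) (use h undo in auto)
  then show "\<forall>\<^sub>F n in sequentially. h n = A"
    by (rule eventually_mono) (metis conj_by_cancel(2)[OF C])
qed

lemma act_conj_by:
  assumes "det C = 1" "det A = 1" "x \<in> H3"
  shows "act (minv C) (act (conj_by C A) x) = act A (act (minv C) x)"
proof -
  have x': "act (minv C) x \<in> H3" using act_in_H3[of "minv C"] assms by simp
  have "act (conj_by C A) x = act C (act A (act (minv C) x))"
    unfolding conj_by_def
    using act_mult[of "C ** A" "minv C" x] act_mult[OF assms(1,2) x'] assms by (simp add: det_mul)
  then show ?thesis using act_minv(1)[OF assms(1) act_in_H3[OF assms(2) x']] by simp
qed

lemma orbit_map_conj:
  assumes om: "orbit_map \<Gamma> M P" and \<Gamma>: "discrete_group \<Gamma>" and C: "det C = 1"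
  shows "orbit_map (conj_by C ` \<Gamma>) M (\<lambda>x. P (act (minv C) x))"
  unfolding orbit_map_def
proof (intro conjI ballI)
  note g = discrete_groupD[OF \<Gamma>] and P = orbit_mapD[OF om]
  have C': "det (minv C) = 1" using C by simp
  have hom: "homeomorphic_map (top_of_set H3) (top_of_set H3) (act (minv C))"
  proof -
    have "homeomorphic_maps (top_of_set H3) (top_of_set H3) (act (minv C)) (act C)"
      using act_minv[OF C] act_in_H3[OF C] act_in_H3[OF C'] continuous_on_act[OF C] continuous_on_act[OF C']
      unfolding homeomorphic_maps_def by simp
    then show ?thesis by (metis homeomorphic_map_maps)
  qed
  have P': "continuous_map (top_of_set H3) M P" "open_map (top_of_set H3) M P" using om by (auto simp: orbit_map_def)
  show "continuous_map (top_of_set H3) M (\<lambda>x. P (act (minv C) x))"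
    using continuous_map_compose[OF homeomorphic_imp_continuous_map[OF hom] P'(1)] by (simp add: comp_def)
  show "open_map (top_of_set H3) M (\<lambda>x. P (act (minv C) x))"
    using open_map_compose[OF homeomorphic_imp_open_map[OF hom] P'(2)] by (simp add: comp_def)
  have im: "act (minv C) ` H3 = H3" using homeomorphism_image1[OF homeomorphism_act[OF C']] .
  have "(\<lambda>x. P (act (minv C) x)) ` H3 = P ` act (minv C) ` H3" by (simp add: image_image)
  then show "(\<lambda>x. P (act (minv C) x)) ` H3 = topspace M" using im P(4) by simp
  fix x y assume xy: "x \<in> H3" "y \<in> H3"
  have H: "act (minv C) x \<in> H3" "act (minv C) y \<in> H3" using act_in_H3[OF C'] xy by blast+
  have "act (minv C) y = act A (act (minv C) x) \<longleftrightarrow> y = act (conj_by C A) x" if "A \<in> \<Gamma>" for A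
  proof
    assume "act (minv C) y = act A (act (minv C) x)"
    then have "act (minv C) y = act (minv C) (act (conj_by C A) x)" using act_conj_by[OF C g(4)[OF that] xy(1)] by simp
    then have "act C (act (minv C) y) = act C (act (minv C) (act (conj_by C A) x))" by simp
    moreover have "act (conj_by C A) x \<in> H3" using act_in_H3 xy(1) g(4)[OF that] by (simp add: det_conj_by C)
    ultimately show "y = act (conj_by C A) x" using act_minv(2)[OF C] xy(2) by simp
  qed (use act_conj_by[OF C g(4)[OF that] xy(1)] in simp)
  then show "P (act (minv C) x) = P (act (minv C) y) \<longleftrightarrow> (\<exists>A\<in>conj_by C ` \<Gamma>. y = act A x)"
    using P(5)[OF H] by auto
qed

lemma isotropy_conj:
  assumes \<Gamma>: "discrete_group \<Gamma>" and C: "det C = 1" and x: "x \<in> H3"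
  shows "isotropy (conj_by C ` \<Gamma>) x = conj_by C ` isotropy \<Gamma> (act (minv C) x)"
proof -
  note g = discrete_groupD[OF \<Gamma>]
  have C': "det (minv C) = 1" using C by simp
  have "act (conj_by C A) x = x \<longleftrightarrow> act A (act (minv C) x) = act (minv C) x" if "A \<in> \<Gamma>" for A
  proof
    assume a: "act A (act (minv C) x) = act (minv C) x"
    then have "act C (act (minv C) (act (conj_by C A) x)) = act C (act (minv C) x)"
      using act_conj_by[OF C g(4)[OF that] x] by simp
    moreover have "act (conj_by C A) x \<in> H3" using act_in_H3 x g(4)[OF that] by (simp add: det_conj_by C)
    ultimately show "act (conj_by C A) x = x" using act_minv(2)[OF C] x by simp
  qed (use act_conj_by[OF C g(4)[OF that] x] in simp)
  then show ?thesis unfolding isotropy_def by auto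
qed

lemma trace_generate_conj:
  assumes C: "det C = 1" and S: "S \<subseteq> carrier SL2C"
  shows "trace ` generate SL2C (conj_by C ` S) = trace ` generate SL2C S"
proof (intro equalityI image_subsetI)
  fix A assume "A \<in> generate SL2C S"
  from imageI[OF conj_generate[OF C S this], of trace]
  show "trace A \<in> trace ` generate SL2C (conj_by C ` S)" by (simp add: trace_conj_by C)
next
  fix A assume A: "A \<in> generate SL2C (conj_by C ` S)"
  have "conj_by C ` S \<subseteq> carrier SL2C" using S by (auto simp: det_conj_by C)
  from imageI[OF conj_generate[OF _ this A, of "minv C"], of trace]
  show "trace A \<in> trace ` generate SL2C S" by (simp add: trace_conj_by image_image conj_by_cancel C)
qed

lemma invariant_trace_field_conj:
  assumes \<Gamma>: "discrete_group \<Gamma>" and C: "det C = 1"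
  shows "invariant_trace_field (conj_by C ` \<Gamma>) = invariant_trace_field \<Gamma>"
proof -
  note g = discrete_groupD[OF \<Gamma>]
  let ?S = "{A ** A | A. A \<in> \<Gamma>}" and ?S' = "{A ** A | A. A \<in> conj_by C ` \<Gamma>}"
  have S': "?S' = conj_by C ` ?S" by (force simp: conj_by_mult[OF C])
  have S: "?S \<subseteq> carrier SL2C" using g(4) by (auto simp: det_mul)
  have "trace ` generate SL2C ?S' = trace ` generate SL2C ?S"
    unfolding S' by (rule trace_generate_conj[OF C S])
  then show ?thesis by (simp add: invariant_trace_field_def)
qed

text \<open>The element A that moves the peripheral words to infinity belongs to \<Gamma>, so
  conjugating the generators by it changes neither the group nor its lattice at infinity.\<close>

theorem (in cusped_link) invariant_trace_field_link:
  assumes "q \<noteq> 0"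
  shows "invariant_trace_field \<Gamma> = cusp_field (w2 / w1)"
proof -
  obtain A where A: "A \<in> \<Gamma>" "conj_by A mv $ 2 $ 1 = 0" "conj_by A (longitude mv mu) $ 2 $ 1 = 0"
    using peripheral_triangular by blast
  have d: "det A = 1" "det (minv A) = 1" using \<Gamma>(4)[OF A(1)] by simp_all
  obtain a b where ab: "b \<noteq> 0" "mpow mu a ** mpow (longitude mu mv) b \<doteq> mat 1" using filled_relation[OF assms] by blast
  have inG: "conj_by A B \<in> \<Gamma>" if "B \<in> \<Gamma>" for B unfolding conj_by_def by (intro \<Gamma>(5) \<Gamma>(6) A(1) that)
  have gens: "\<Gamma> \<subseteq> generate SL2C {conj_by A mu, conj_by A mv, - mat 1}"
  proof
    fix B assume "B \<in> \<Gamma>"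
    have "conj_by (minv A) B \<in> \<Gamma>" unfolding conj_by_def minv_minv by (intro \<Gamma>(5) \<Gamma>(6) A(1) \<open>B \<in> \<Gamma>\<close>)
    then have "conj_by (minv A) B \<in> generate SL2C {mu, mv, - mat 1}" using generators unfolding \<Gamma>0_def by blast
    then have "conj_by A (conj_by (minv A) B) \<in> generate SL2C (conj_by A ` {mu, mv, - mat 1})"
      by (rule conj_generate[OF d(1), rotated]) (use mu_mv_det in simp)
    then show "B \<in> generate SL2C {conj_by A mu, conj_by A mv, - mat 1}"
      by (simp add: conj_by_cancel d conj_by_uminus conj_by_mat1)
  qed
  have rel: "mpow (conj_by A mu) a ** mpow (longitude (conj_by A mu) (conj_by A mv)) b \<doteq> mat 1"
    using peq_conj_by[OF ab(2), of A] by (simp add: conj_by_mult conj_by_mpow conj_by_longitude conj_by_mat1 d)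
  show ?thesis
    by (rule invariant_trace_field_eq_cusp_field[OF \<Gamma>(1) inG[OF mu_mv_in(1)] inG[OF mu_mv_in(2)] gens lattice w12 A(2) _ rel ab(1)
          not_all_triangular])
       (use A(3) in \<open>simp add: conj_by_longitude d\<close>)
qed

section \<open>The symmetry of the link and the general case\<close>

section \<open>Exchanging the components\<close>

text \<open>The rotation by pi about the line x + y = 7 at height 1/2. It turns vertical strands at
  height 1 into horizontal ones at height 0, so the convention that vertical edges pass over is
  respected.\<close>

definition half_turn :: "point \<Rightarrow> point" where
  "half_turn x = (Complex (7 - Im (fst x)) (7 - Re (fst x)), 1 - snd x)"

lemma half_turn_involution [simp]: "half_turn (half_turn x) = x"
  by (simp add: half_turn_def complex_eq_iff prod_eq_iff)

lemma half_turn_link: "half_turn ` link_component2 = link_component1" "half_turn ` link_component1 = link_component2"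
proof -
  have V: "Complex (7 - Im z) (7 - Re z) \<in> V1 \<longleftrightarrow> z \<in> H2" "Complex (7 - Im z) (7 - Re z) \<in> H1 \<longleftrightarrow> z \<in> V2" for z
    by (auto simp: diagram_defs)
  have C: "Complex (7 - Im z) (7 - Re z) \<in> C1 \<longleftrightarrow> z \<in> C2" for z
    by (auto simp: diagram_defs complex_eq_iff)
  have *: "half_turn x \<in> link_component1 \<longleftrightarrow> x \<in> link_component2" for x
  proof -
    obtain z t where x: "x = (z, t)" by (cases x)
    show ?thesis unfolding x half_turn_def link_component1_eq link_component2_eq by (auto simp: V C)
  qed
  show "half_turn ` link_component2 = link_component1"
  proof (intro equalityI subsetI)
    fix x assume "x \<in> link_component1"
    then have "half_turn x \<in> link_component2" using *[of "half_turn x"] by simp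
    then show "x \<in> half_turn ` link_component2" by (metis half_turn_involution imageI)
  qed (use * in blast)
  then have "half_turn ` half_turn ` link_component2 = half_turn ` link_component1" by simp
  then show "half_turn ` link_component1 = link_component2" by (simp add: image_image)
qed

definition turn_S3 :: "point option \<Rightarrow> point option" where
  "turn_S3 = map_option half_turn"

lemma turn_S3_involution [simp]: "turn_S3 (turn_S3 x) = x"
  by (cases x) (simp_all add: turn_S3_def)

lemma turn_S3_Some: "turn_S3 ` Some ` U = Some ` half_turn ` U"
  by (auto simp: turn_S3_def image_image)

lemma bij_turn_S3: "bij turn_S3"
  by (rule o_bij[of turn_S3]) (simp_all add: fun_eq_iff)

lemma turn_S3_Compl: "turn_S3 ` (- U) = - turn_S3 ` U"
  by (rule bij_image_Compl_eq[OF bij_turn_S3])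

lemma continuous_half_turn: "continuous_on A half_turn"
proof -
  have *: "half_turn = (\<lambda>x. (of_real (7 - Im (fst x)) + \<i> * of_real (7 - Re (fst x)), 1 - snd x))"
    by (simp add: half_turn_def fun_eq_iff complex_eq_iff)
  show ?thesis unfolding * by (intro continuous_intros)
qed

lemma open_map_turn_S3: "openin S3 U \<Longrightarrow> openin S3 (turn_S3 ` U)"
proof -
  assume "openin S3 U"
  then consider V where "open V" "U = Some ` V" | K where "compact K" "U = insert None (Some ` (- K))"
    unfolding S3_def openin_Alexandroff_compactification by (auto simp: Compl_eq_Diff_UNIV)
  then show "openin S3 (turn_S3 ` U)"
  proof cases
    case 1
    have "half_turn ` V = half_turn -` V"
      by (auto simp: image_iff) (metis half_turn_involution)
    then have "open (half_turn ` V)" using open_vimage[OF 1(1) continuous_half_turn] by simp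
    then show ?thesis using 1(2) openin_S3_Some by (simp add: turn_S3_Some)
  next
    case 2
    have "U = - Some ` K"
    proof (rule Set.set_eqI)
      fix x show "x \<in> U \<longleftrightarrow> x \<in> - Some ` K" unfolding 2(2) by (cases x) auto
    qed
    then have "turn_S3 ` U = - Some ` half_turn ` K" by (simp add: turn_S3_Compl turn_S3_Some)
    moreover have "compact (half_turn ` K)" by (rule compact_continuous_image[OF continuous_half_turn 2(1)])
    ultimately show ?thesis using openin_S3_compl by simp
  qed
qed

lemma homeomorphic_turn_S3: "homeomorphic_map S3 S3 turn_S3"
proof -
  have "continuous_map S3 S3 turn_S3"
    unfolding continuous_map_def
  proof (intro conjI allI impI)
    fix U assume "openin S3 U"
    moreover have "{x \<in> topspace S3. turn_S3 x \<in> U} = turn_S3 ` U"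
      by (auto simp: image_iff) (metis turn_S3_involution)
    ultimately show "openin S3 {x \<in> topspace S3. turn_S3 x \<in> U}" using open_map_turn_S3 by simp
  qed simp
  then have "homeomorphic_maps S3 S3 turn_S3 turn_S3" by (simp add: homeomorphic_maps_def)
  then show ?thesis by (metis homeomorphic_map_maps)
qed

locale filling_data =
  fixes K K' :: "point set" and p q :: int and M :: "'a topology" and core :: "'a set"
    and e :: "complex \<times> complex \<Rightarrow> point option" and f :: "point option \<Rightarrow> 'a"
    and g :: "complex \<times> complex \<Rightarrow> 'a" and r s :: int
  assumes data: "homologically_framed_nbhd K K' e"
    "embedding_map (subtopology S3 (- (Some ` K \<union> Some ` K'))) M f"
    "openin M (f ` (- (Some ` K \<union> Some ` K')))"
    "embedding_map (top_of_set (UNIV \<times> circle)) M g" "openin M (g ` (UNIV \<times> circle))"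
    "topspace M = f ` (- (Some ` K \<union> Some ` K')) \<union> g ` (UNIV \<times> circle)"
    "core = g ` ({0} \<times> circle)" "core \<inter> f ` (- (Some ` K \<union> Some ` K')) = {}"
    "(p div gcd p q) * s - (q div gcd p q) * r = 1"
    "\<forall>z v. z \<noteq> 0 \<longrightarrow> v \<in> circle \<longrightarrow> g (z, v) =
       f (e (sgn z powi (q div gcd p q) * v powi s, of_real (cmod z) * sgn z powi (p div gcd p q) * v powi r))"

lemma dehn_filling_iff: "dehn_filling K K' p q M core \<longleftrightarrow> (\<exists>e f g r s. filling_data K K' p q M core e f g r s)"
  unfolding dehn_filling_def filling_data_def conj_assoc ..

text \<open>The symmetry is absorbed into the charts: \<open>e\<close> is followed and
  \<open>f\<close> preceded by it, while the orbifold, the solid torus and the gluing matrix stay.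
  The induced chain map carries the bounding chain of the longitude along.\<close>

lemma dehn_filling_exchange:
  assumes "dehn_filling link_component2 link_component1 p q M core"
  shows "dehn_filling link_component1 link_component2 p q M core"
proof -
  obtain e f g r s where "filling_data link_component2 link_component1 p q M core e f g r s"
    using assms unfolding dehn_filling_iff by blast
  note D = filling_data.data[OF this]
  define e' f' where "e' = turn_S3 \<circ> e" and "f' = f \<circ> turn_S3"
  let ?L = "- (Some ` link_component2 \<union> Some ` link_component1)" and ?L' = "- (Some ` link_component1 \<union> Some ` link_component2)"
  have L: "turn_S3 ` ?L' = ?L"
    unfolding turn_S3_Compl image_Un turn_S3_Some half_turn_link ..
  have fim: "f' ` ?L' = f ` ?L" unfolding f'_def image_comp[symmetric] L ..
  have nb: "embedding_map (top_of_set (circle \<times> UNIV)) S3 e" "openin S3 (e ` (circle \<times> UNIV))"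
     "e ` (circle \<times> {0}) = Some ` link_component2" "e ` (circle \<times> UNIV) \<inter> Some ` link_component1 = {}"
     "singular_relboundary 1 (subtopology S3 (- Some ` link_component2)) {}
       (frag_of (restrict (\<lambda>x. e (cis (2 * pi * x 0), 1)) (standard_simplex 1)))"
    using D(1) by (auto simp: homologically_framed_nbhd_def)
  have emb: "embedding_map S3 S3 turn_S3"
    using homeomorphic_turn_S3 homeomorphic_imp_surjective_map[OF homeomorphic_turn_S3]
    by (simp add: embedding_map_def flip: topspace_S3)
  have "homologically_framed_nbhd link_component1 link_component2 e'"
    unfolding homologically_framed_nbhd_def
  proof (intro conjI)
    show "embedding_map (top_of_set (circle \<times> UNIV)) S3 e'"
      unfolding e'_def by (rule embedding_map_compose[OF nb(1) emb])
    show "openin S3 (e' ` (circle \<times> UNIV))"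
      unfolding e'_def image_comp[symmetric] by (rule open_map_turn_S3[OF nb(2)])
    show "e' ` (circle \<times> {0}) = Some ` link_component1"
      unfolding e'_def image_comp[symmetric] nb(3) turn_S3_Some half_turn_link ..
    have "turn_S3 ` (e ` (circle \<times> UNIV) \<inter> Some ` link_component1) = {}" using nb(4) by simp
    then show "e' ` (circle \<times> UNIV) \<inter> Some ` link_component2 = {}"
      unfolding e'_def image_comp[symmetric] image_Int[OF bij_is_inj[OF bij_turn_S3]] turn_S3_Some half_turn_link .
    have "turn_S3 ` (topspace S3 \<inter> - Some ` link_component2) = topspace S3 \<inter> - Some ` link_component1"
      by (simp add: turn_S3_Compl turn_S3_Some half_turn_link)
    then have "continuous_map (subtopology S3 (- Some ` link_component2)) (subtopology S3 (- Some ` link_component1)) turn_S3"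
      using homeomorphic_map_subtopologies[OF homeomorphic_turn_S3] homeomorphic_imp_continuous_map by blast
    then have "singular_relboundary 1 (subtopology S3 (- Some ` link_component1)) {}
        (chain_map 1 turn_S3 (frag_of (restrict (\<lambda>x. e (cis (2 * pi * x 0), 1)) (standard_simplex 1))))"
      by (rule singular_relboundary_chain_map[OF nb(5)]) simp
    moreover have "simplex_map 1 turn_S3 (restrict (\<lambda>x. e (cis (2 * pi * x 0), 1)) (standard_simplex 1)) =
        restrict (\<lambda>x. e' (cis (2 * pi * x 0), 1)) (standard_simplex 1)"
      by (auto simp: simplex_map_def e'_def fun_eq_iff restrict_def)
    ultimately show "singular_relboundary 1 (subtopology S3 (- Some ` link_component1)) {}
        (frag_of (restrict (\<lambda>x. e' (cis (2 * pi * x 0), 1)) (standard_simplex 1)))" by simp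
  qed
  moreover have "embedding_map (subtopology S3 ?L') M f'"
  proof -
    have "turn_S3 ` (topspace S3 \<inter> ?L') = topspace S3 \<inter> ?L" using L by simp
    then have h: "homeomorphic_map (subtopology S3 ?L') (subtopology S3 ?L) turn_S3"
      by (rule homeomorphic_map_subtopologies[OF homeomorphic_turn_S3])
    have "embedding_map (subtopology S3 ?L') (subtopology S3 ?L) turn_S3"
      using h homeomorphic_imp_surjective_map[OF h] unfolding embedding_map_def by (metis subtopology_topspace)
    then show ?thesis unfolding f'_def by (rule embedding_map_compose[OF _ D(2)])
  qed
  moreover have "f' (e' x) = f (e x)" for x by (simp add: e'_def f'_def)
  ultimately show ?thesis
    unfolding dehn_filling_def fim[symmetric]
    using D(3-10) unfolding fim[symmetric] by (intro exI[of _ e'] exI[of _ f'] exI[of _ g] exI[of _ r] exI[of _ s]) simp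
qed

theorem corollary6p17:
  fixes p q :: int
    and K K' :: "(complex \<times> real) set"
    and \<Gamma> :: "(complex^2^2) set"
    and \<tau> :: complex
  assumes "q \<noteq> 0"
    and "(K, K') \<in> {(link_component1, link_component2), (link_component2, link_component1)}"
    and "hyperbolic_filling K K' p q \<Gamma>"
    and "cusp_parameter \<Gamma> \<tau>"
  shows "invariant_trace_field \<Gamma> = cusp_field \<tau>"
proof -
  obtain core where core: "dehn_filling K K' p q (orbit_space \<Gamma>) core"
    "\<And>x. x \<in> H3 \<Longrightarrow> cyclic_isotropy \<Gamma> x (if orbit \<Gamma> x \<in> core then nat (gcd p q) else 1)"
    and hyp: "hyperbolic_orbifold_group \<Gamma>"
    using assms(3) unfolding hyperbolic_filling_def by blast
  have dg: "discrete_group \<Gamma>" using hyp by (simp add: discrete_group_iff hyperbolic_orbifold_group_def)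
  note g = discrete_groupD[OF dg]
  obtain C w1 w2 where C: "det C = 1" "w1 \<noteq> 0" "Im (w2 / w1) \<noteq> 0" "\<tau> = w2 / w1"
    "{B. (\<exists>A\<in>\<Gamma>. B = C ** A ** matrix_inv C) \<and> B$2$1 = 0} =
          (\<Union>m n :: int. {translation (of_int m * w1 + of_int n * w2),
                          - translation (of_int m * w1 + of_int n * w2)})"
    using assms(4) unfolding cusp_parameter_def by auto
  define \<Gamma>' where "\<Gamma>' = conj_by C ` \<Gamma>"
  \<comment> \<open>The orbit space is kept; only the quotient map changes, by the inverse of C. The
    embeddings of the filling thus serve the conjugated group as they stand.\<close>
  define P where "P x = orbit \<Gamma> (act (minv C) x)" for x
  have dg': "discrete_group \<Gamma>'" unfolding \<Gamma>'_def by (rule discrete_group_conj[OF dg C(1)])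
  have om: "orbit_map \<Gamma>' (orbit_space \<Gamma>) P"
    unfolding \<Gamma>'_def P_def by (rule orbit_map_conj[OF orbit_map_orbit_space[OF dg] dg C(1)])
  have lat: "{A \<in> \<Gamma>'. A$2$1 = 0} = (\<Union>m n :: int. {translation (of_int m * w1 + of_int n * w2),
                          - translation (of_int m * w1 + of_int n * w2)})"
    unfolding C(5)[symmetric] \<Gamma>'_def matrix_inv_minv[OF C(1)] conj_by_def by blast
  have card: "card (isotropy \<Gamma>' x) = 2 * (if P x \<in> core then nat (gcd p q) else 1)" if x: "x \<in> H3" for x
  proof -
    have "act (minv C) x \<in> H3" using act_in_H3[of "minv C"] C(1) x by simp
    then have "card (isotropy \<Gamma> (act (minv C) x)) = 2 * (if P x \<in> core then nat (gcd p q) else 1)"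
      using core(2) by (simp add: cyclic_isotropy_def P_def)
    moreover have "inj (conj_by C)" by (metis injI conj_by_cancel(1)[OF C(1)])
    ultimately show ?thesis
      unfolding \<Gamma>'_def isotropy_conj[OF dg C(1) x] by (simp add: card_image inj_on_subset)
  qed
  have free: "free_at \<Gamma>' x" if x: "x \<in> H3" "P x \<notin> core" for x
    unfolding free_at_def
  proof (intro ballI impI)
    note g' = discrete_groupD[OF dg']
    fix A assume A: "A \<in> \<Gamma>'" "act A x = x"
    \<comment> \<open>Off the core the isotropy has two elements, so it consists of 1 and
      -1.\<close>
    have c: "card (isotropy \<Gamma>' x) = 2" using card[OF x(1)] x(2) by simp
    have "{mat 1, - mat 1} \<subseteq> isotropy \<Gamma>' x" using g'(2,3) by (simp add: isotropy_def)
    moreover have "mat 1 \<noteq> - (mat 1 :: complex^2^2)" by (simp add: mat_eq_iff)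
    then have "card {mat 1, - mat 1 :: complex^2^2} = 2" by simp
    ultimately have "{mat 1, - mat 1} = isotropy \<Gamma>' x"
      using c by (metis card.infinite card_subset_eq zero_neq_numeral)
    moreover have "A \<in> isotropy \<Gamma>' x" using A by (simp add: isotropy_def)
    ultimately show "A \<doteq> mat 1" by (auto simp: peq_def)
  qed
  \<comment> \<open>By the half turn it may be assumed that the first component is the filled
    one.\<close>
  have "dehn_filling link_component1 link_component2 p q (orbit_space \<Gamma>) core"
    using core(1) assms(2) dehn_filling_exchange by blast
  then obtain e f g r s where "filling_data link_component1 link_component2 p q (orbit_space \<Gamma>) core e f g r s"
    unfolding dehn_filling_iff by blast
  note D = filling_data.data[OF this]
  have itf: "invariant_trace_field \<Gamma>' = invariant_trace_field \<Gamma>"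
    unfolding \<Gamma>'_def by (rule invariant_trace_field_conj[OF dg C(1)])
  have gcd0: "gcd p q > 0" using assms(1) by simp
  interpret cusped_link \<Gamma>' "orbit_space \<Gamma>" P e f g "p div gcd p q" "q div gcd p q" r s core "nat (gcd p q)" w1 w2
  proof unfold_locales
    show "nat (gcd p q) > 0" using gcd0 by simp
    show "card (isotropy \<Gamma>' x) = 2 * nat (gcd p q)" if "x \<in> H3" "P x \<in> core" for x
      using card[OF that(1)] that(2) by simp
  qed (rule dg' om compact_link D(1-9) lat C(2,3) | rule free D(10)[rule_format], assumption+)+
  have "q div gcd p q \<noteq> 0" using assms(1) by (metis dvd_div_eq_0_iff gcd_dvd2)
  from invariant_trace_field_link[OF this] show ?thesis by (simp add: itf C(4))
qed

end
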